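(* Consider the control affine system $\dot x = g(x,u) = f_0(x)+\sum_{j=1}^{n-1}u_jf_j(x)$ on an $n$-dimensional manifold $X$, and let $\tilde\Omega_0,\tilde\Omega\subset\mathfrak X$ be the sets defined in the context. For each point $(x_0,\overline u_0)\in\tilde\Omega_0$ (so that there is $k\in\{1,\dots,n-1\}$ with $\dim(\mathrm{Span}\{f_1,\dots,f_{n-1},[g,f_k]\})=n$ in an open neighborhood of $(x_0,u_0)$), there exist an open neighborhood $U_{(x_0,u_0)}\subset\tilde\Omega_0$ of $(x_0,\overline u_0)$ and a well-defined flat output $z=\Phi_{(x_0,u_0)}(x,u,\dot u)$ in $U_{(x_0,u_0)}$, made of $n-1$ independent first integrals of such an $f_k$. Moreover, $(U_{(x_0,u_0)},\Phi_{(x_0,u_0)})$ constitutes a Lie-Bäcklund chart, and the collection of these charts defines a Lie-Bäcklund atlas. Moreover, the set of intrinsic flatness singularities of the system is contained in $\mathfrak X\setminus\tilde\Omega_0$ and contains $\mathfrak X\setminus\tilde\Omega$.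
   Context: **System.** $X$ is a smooth manifold of dimension $n\ge 2$. The system is given, in a local chart, by $\dot x=g(x,u)\triangleq f_0(x)+\sum_{j=1}^{n-1}u_jf_j(x)$, with state $x\in X$, control $u=(u_1,\dots,u_{n-1})\in\mathbb R^{n-1}$, and $C^\infty$ vector fields. The vector fields $f_1,\dots,f_{n-1}$ are linearly independent on a dense open subset of $X$. Lie bracket convention: $[\eta,\gamma]=\frac{\partial\gamma}{\partial x}\eta-\frac{\partial\eta}{\partial x}\gamma$, $\mathrm{ad}_\eta\gamma=[\eta,\gamma]$. In $[g,f_k]$ the control $u$ is a constant parameter. **Infinite jets.** $\mathbb R^{m}_\infty=\mathbb R^m\times\mathbb R^m\times\cdots$ with the product topology. $\mathfrak X=X\times\mathbb R^{n-1}_\infty$ has coordinates $(x,\overline u)=(x,u^{(0)},u^{(1)},\dots)$, with $u^{(0)}=u$. Smooth functions depend (locally) on finitely many coordinates and are smooth in them. $\mathfrak X$ is endowed with the Cartan field $C_g=g(x,u)\frac{\partial}{\partial x}+\sum_{j\ge0}u^{(j+1)}\frac{\partial}{\partial u^{(j)}}$. **Flat outputs.** A $\mathbb R^{n-1}$-valued smooth function $z$ on an open set of $\mathfrak X$ is a local flat output if the map $(x,\overline u)\mapsto(z,C_gz,C_g^2z,\dots)\in\mathbb R^{n-1}_\infty$ is a $C^\infty$ isomorphism onto an open set of $\mathbb R^{n-1}_\infty$, with $C^\infty$ inverse (a Lie-Bäcklund isomorphism). It then carries $C_g$ to the trivial Cartan field $\tau=\sum_{j\ge0}\sum_{i}z_i^{(j+1)}\frac{\partial}{\partial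 z_i^{(j)}}$. The system is flat at a point if a local flat output exists near it. **First integrals.** A first integral of $f_k$ is a smooth function $\psi$ of $x$, defined on an open set, with $L_{f_k}\psi=0$. First integrals are independent if their differentials are linearly independent. **Charts, atlas, singularities.** A Lie-Bäcklund chart is a pair $(\mathfrak U,\psi)$ with $\mathfrak U\subset\mathfrak X$ open and $\psi:\mathfrak U\to\mathbb R^{n-1}_\infty$ (the map induced by) a local flat output, with local inverse $\varphi:\psi(\mathfrak U)\to\mathfrak U$. Two charts $(\mathfrak U_1,\psi_1),(\mathfrak U_2,\psi_2)$ are compatible if, whenever $\mathfrak U_1\cap\mathfrak U_2\ne\emptyset$, $\psi_1\circ\varphi_2:\psi_2(\mathfrak U_1\cap\mathfrak U_2)\to\psi_1(\mathfrak U_1\cap\mathfrak U_2)$ is a local Lie-Bäcklund isomorphism (for $\tau$ on both sides) with local inverse $\psi_2\circ\varphi_1$. A Lie-Bäcklund atlas is a collection of compatible charts (not required to cover $\mathfrak X$). A point of $\mathfrak X$ is an intrinsic flatness singularity if it is excluded from all charts of every Lie-Bäcklund atlas. **The sets.** $\Omega_0=\{(x,u)\in X\times\mathbb R^{n-1}\mid\exists k\in\{1,\dots,n-1\}:\ \mathrm{Span}\{f_1,\dots,f_{n-1},[f,f_k]\}=T_xX\}$, where $f=f_0+\sum_{i\ne k}u_if_i$ (so $[f,f_k]=[g,f_k]$). $\Omega=\{(x,u)\in X\times\mathbb R^{n-1}\mid\exists k^\star\in\mathbb N:\ \mathrm{rank}\,\mathcal D_{k^\star}=n \text{ at }(x,u)\}$,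 where $\mathcal D_0=\mathrm{Span}\{f_1,\dots,f_{n-1}\}$, $\mathcal D_{k+1}=\overline{\mathcal D}_k+\mathrm{ad}_{f_0}\overline{\mathcal D}_k$, and $\overline{\mathcal D}_k$ is the involutive closure of $\mathcal D_k$ (the $\mathcal D_k$ do not depend on $u$). $\tilde\Omega_0$ (resp. $\tilde\Omega$) is the set of points $(x,\overline u)\in\mathfrak X$ whose projection $(x,u^{(0)})\in X\times\mathbb R^{n-1}$ belongs to $\Omega_0$ (resp. $\Omega$). *)

theory Defs
  imports "HOL-Analysis.Analysis"
begin

section \<open>Smoothness in finitely or infinitely many real coordinates\<close>

text \<open>
  For a finite index type \<open>'i\<close>, \<open>smooth_coord S F\<close> is the usual notion of a smooth function on an
  open set \<open>S\<close>: all iterated partial derivatives exist and are continuous.  For an infinite index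
  type, \<open>'i \<Rightarrow> real\<close> carries the product topology, and the function has in addition to depend,
  locally, on finitely many coordinates only.
\<close>

definition partial :: "'i \<Rightarrow> (('i \<Rightarrow> real) \<Rightarrow> real) \<Rightarrow> ('i \<Rightarrow> real) \<Rightarrow> real" where
  "partial i F p = deriv (\<lambda>t. F (p(i := t))) (p i)"

definition smooth_coord :: "('i \<Rightarrow> real) set \<Rightarrow> (('i \<Rightarrow> real) \<Rightarrow> real) \<Rightarrow> bool" where
  "smooth_coord S F \<longleftrightarrow>
     open S \<and>
     (\<forall>p\<in>S. \<exists>V J. open V \<and> p \<in> V \<and> V \<subseteq> S \<and> finite J \<and>
        (\<forall>q\<in>V. \<forall>r\<in>V. (\<forall>i\<in>J. q i = r i) \<longrightarrow> F q = F r)) \<and>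
     (\<forall>is. continuous_on S (foldr partial is F) \<and>
        (\<forall>i. \<forall>p\<in>S. (\<lambda>t. foldr partial is F (p(i := t))) differentiable (at (p i))))"

text \<open>Smoothness of a real function on \<open>S\<close>, read in coordinates \<open>\<kappa>\<close> that are injective on \<open>S\<close>.\<close>

definition smooth_in :: "('a \<Rightarrow> 'i \<Rightarrow> real) \<Rightarrow> 'a set \<Rightarrow> ('a \<Rightarrow> real) \<Rightarrow> bool" where
  "smooth_in \<kappa> S F \<longleftrightarrow> smooth_coord (\<kappa> ` S) (F \<circ> inv_into S \<kappa>)"


section \<open>Smooth manifolds, functions and vector fields\<close>

type_synonym ('x, 'n) chart = "'x set \<times> ('x \<Rightarrow> real ^ 'n)"

abbreviation chart_inv :: "('x, 'n) chart \<Rightarrow> real ^ 'n \<Rightarrow> 'x" where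
  "chart_inv c \<equiv> inv_into (fst c) (snd c)"

text \<open>The manifold is the whole type \<open>'x\<close>.\<close>

definition smooth_manifold ::
    "('x::{t2_space,second_countable_topology}, 'n::finite) chart set \<Rightarrow> bool" where
  "smooth_manifold A \<longleftrightarrow>
     (\<Union>c\<in>A. fst c) = UNIV \<and>
     (\<forall>c\<in>A. open (fst c) \<and> open (snd c ` fst c) \<and>
        homeomorphism (fst c) (snd c ` fst c) (snd c) (chart_inv c)) \<and>
     (\<forall>c\<in>A. \<forall>d\<in>A. \<forall>i.
        smooth_in vec_nth (snd c ` (fst c \<inter> fst d)) (\<lambda>y. snd d (chart_inv c y) $ i))"

definition chart_at :: "('x, 'n::finite) chart set \<Rightarrow> 'x \<Rightarrow> ('x, 'n) chart" where
  "chart_at A x = (SOME c. c \<in> A \<and> x \<in> fst c)"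

definition smooth_fun :: "('x, 'n::finite) chart set \<Rightarrow> 'x set \<Rightarrow> ('x \<Rightarrow> real) \<Rightarrow> bool" where
  "smooth_fun A S h \<longleftrightarrow> (\<forall>c\<in>A. smooth_in (\<lambda>x. vec_nth (snd c x)) (S \<inter> fst c) h)"

text \<open>
  A vector field is the family of its coordinate expressions, one for each chart of the atlas, which
  are related by the Jacobians of the transition maps: \<open>v c y\<close> is the component vector, in the
  chart \<open>c\<close>, of the field at the point with coordinates \<open>y\<close>.  Only charts \<open>c\<close> in the atlas and points
  \<open>y\<close> in the range of \<open>c\<close> are relevant.
\<close>

type_synonym ('x, 'n) vfield = "('x, 'n) chart \<Rightarrow> real ^ 'n \<Rightarrow> real ^ 'n"

definition smooth_vfield :: "('x, 'n::finite) chart set \<Rightarrow> ('x, 'n) vfield \<Rightarrow> bool" where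
  "smooth_vfield A v \<longleftrightarrow>
     (\<forall>c\<in>A. \<forall>i. smooth_in vec_nth (snd c ` fst c) (\<lambda>y. v c y $ i)) \<and>
     (\<forall>c\<in>A. \<forall>d\<in>A. \<forall>x \<in> fst c \<inter> fst d.
        v d (snd d x) = frechet_derivative (snd d \<circ> chart_inv c) (at (snd c x)) (v c (snd c x)))"

text \<open>
  The value of a field at \<open>x\<close> as an element of the tangent space at \<open>x\<close>, which is identified with
  \<open>real ^ 'n\<close> by means of one fixed chart around \<open>x\<close>.
\<close>

definition vf_at :: "('x, 'n::finite) chart set \<Rightarrow> ('x, 'n) vfield \<Rightarrow> 'x \<Rightarrow> real ^ 'n" where
  "vf_at A v x = (let c = chart_at A x in v c (snd c x))"

definition lie_bracket :: "('x, 'n::finite) vfield \<Rightarrow> ('x, 'n) vfield \<Rightarrow> ('x, 'n) vfield" where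
  "lie_bracket v w c y =
     frechet_derivative (w c) (at y) (v c y) - frechet_derivative (v c) (at y) (w c y)"

definition differential ::
    "('x, 'n::finite) chart set \<Rightarrow> ('x \<Rightarrow> real) \<Rightarrow> 'x \<Rightarrow> real ^ 'n \<Rightarrow> real" where
  "differential A h x =
     (let c = chart_at A x in frechet_derivative (h \<circ> chart_inv c) (at (snd c x)))"

definition first_integral ::
    "('x::topological_space, 'n::finite) chart set \<Rightarrow> 'x set \<Rightarrow> ('x, 'n) vfield \<Rightarrow> ('x \<Rightarrow> real) \<Rightarrow> bool"
  where
  "first_integral A V v h \<longleftrightarrow>
     open V \<and> smooth_fun A V h \<and> (\<forall>x\<in>V. differential A h x (vf_at A v x) = 0)"

definition indep_differentials ::
    "('x, 'n::finite) chart set \<Rightarrow> 'x set \<Rightarrow> ('m::finite \<Rightarrow> 'x \<Rightarrow> real) \<Rightarrow> bool" where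
  "indep_differentials A V h \<longleftrightarrow>
     (\<forall>x\<in>V. \<forall>a :: 'm \<Rightarrow> real.
        (\<forall>v. (\<Sum>i\<in>UNIV. a i * differential A (h i) x v) = 0) \<longrightarrow> (\<forall>i. a i = 0))"

definition indep_fields_at ::
    "('x, 'n::finite) chart set \<Rightarrow> ('m::finite \<Rightarrow> ('x, 'n) vfield) \<Rightarrow> 'x \<Rightarrow> bool" where
  "indep_fields_at A f x \<longleftrightarrow>
     (\<forall>a :: 'm \<Rightarrow> real. (\<Sum>j\<in>UNIV. a j *\<^sub>R vf_at A (f j) x) = 0 \<longrightarrow> (\<forall>j. a j = 0))"


section \<open>Distributions\<close>

text \<open>
  A distribution is a module of vector fields over the ring of smooth functions on the manifold;
  its rank at a point is the dimension of the space of the values of its members at that point.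
\<close>

inductive_set involutive_closure ::
    "('x, 'n::finite) chart set \<Rightarrow> ('x, 'n) vfield set \<Rightarrow> ('x, 'n) vfield set"
  for A :: "('x, 'n) chart set" and D :: "('x, 'n) vfield set" where
  base: "v \<in> D \<Longrightarrow> v \<in> involutive_closure A D"
| add: "v \<in> involutive_closure A D \<Longrightarrow> w \<in> involutive_closure A D \<Longrightarrow>
    (\<lambda>c y. v c y + w c y) \<in> involutive_closure A D"
| scale: "smooth_fun A UNIV a \<Longrightarrow> v \<in> involutive_closure A D \<Longrightarrow>
    (\<lambda>c y. a (chart_inv c y) *\<^sub>R v c y) \<in> involutive_closure A D"
| bracket: "v \<in> involutive_closure A D \<Longrightarrow> w \<in> involutive_closure A D \<Longrightarrow>
    lie_bracket v w \<in> involutive_closure A D"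

primrec distr ::
    "('x, 'n::finite) chart set \<Rightarrow> ('x, 'n) vfield \<Rightarrow> ('m::finite \<Rightarrow> ('x, 'n) vfield) \<Rightarrow>
     nat \<Rightarrow> ('x, 'n) vfield set" where
  "distr A f0 f 0 =
     {(\<lambda>c y. \<Sum>j\<in>UNIV. a j (chart_inv c y) *\<^sub>R f j c y) | a. \<forall>j. smooth_fun A UNIV (a j)}"
| "distr A f0 f (Suc k) =
     {(\<lambda>c y. v c y + lie_bracket f0 w c y) | v w.
        v \<in> involutive_closure A (distr A f0 f k) \<and> w \<in> involutive_closure A (distr A f0 f k)}"

definition rank_at :: "('x, 'n::finite) chart set \<Rightarrow> ('x, 'n) vfield set \<Rightarrow> 'x \<Rightarrow> nat" where
  "rank_at A D x = dim ((\<lambda>v. vf_at A v x) ` D)"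


section \<open>The system and its infinite prolongation\<close>

text \<open>
  The space of infinite jets is \<open>'x \<times> (nat \<Rightarrow> real ^ 'm)\<close> with the product topology; in a point
  \<open>(x, w)\<close>, the component \<open>w j\<close> is the \<open>j\<close>-th derivative of the control.
\<close>

type_synonym 'm jet = "nat \<Rightarrow> real ^ 'm"

definition affine_field ::
    "('x, 'n::finite) vfield \<Rightarrow> ('m::finite \<Rightarrow> ('x, 'n) vfield) \<Rightarrow> real ^ 'm \<Rightarrow> ('x, 'n) vfield" where
  "affine_field f0 f u c y = f0 c y + (\<Sum>j\<in>UNIV. (u $ j) *\<^sub>R f j c y)"

definition jet_coords :: "'m jet \<Rightarrow> nat \<times> 'm::finite \<Rightarrow> real" where
  "jet_coords w = (\<lambda>(j, i). w j $ i)"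

definition ext_coords ::
    "('x, 'n::finite) chart \<Rightarrow> 'x \<times> 'm::finite jet \<Rightarrow> 'n + nat \<times> 'm \<Rightarrow> real" where
  "ext_coords c p = case_sum (vec_nth (snd c (fst p))) (jet_coords (snd p))"

definition smooth_ext ::
    "('x, 'n::finite) chart set \<Rightarrow> ('x \<times> 'm::finite jet) set \<Rightarrow> ('x \<times> 'm jet \<Rightarrow> real) \<Rightarrow> bool" where
  "smooth_ext A W F \<longleftrightarrow> (\<forall>c\<in>A. smooth_in (ext_coords c) (W \<inter> fst c \<times> UNIV) F)"

definition smooth_into_ext ::
    "('x::topological_space, 'n::finite) chart set \<Rightarrow> 'm::finite jet set \<Rightarrow>
     ('m jet \<Rightarrow> 'x \<times> 'm jet) \<Rightarrow> bool" where
  "smooth_into_ext A V \<eta> \<longleftrightarrow>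
     continuous_on V \<eta> \<and>
     (\<forall>c\<in>A. \<forall>a. smooth_in jet_coords (V \<inter> \<eta> -` (fst c \<times> UNIV)) (\<lambda>w. ext_coords c (\<eta> w) a))"

text \<open>
  The derivations given by the Cartan field of the system and by the trivial Cartan field.  The
  series have only finitely many nonzero terms for smooth functions, and the choice of the chart
  does not matter for them.
\<close>

definition cartan ::
    "('x, 'n::finite) chart set \<Rightarrow> ('x, 'n) vfield \<Rightarrow> ('m::finite \<Rightarrow> ('x, 'n) vfield) \<Rightarrow>
     ('x \<times> 'm jet \<Rightarrow> real) \<Rightarrow> 'x \<times> 'm jet \<Rightarrow> real" where
  "cartan A f0 f F p =
     (let x = fst p; w = snd p; c = chart_at A x;
          G = F \<circ> inv_into (fst c \<times> UNIV) (ext_coords c); q = ext_coords c p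
      in (\<Sum>i\<in>UNIV. affine_field f0 f (w 0) c (snd c x) $ i * partial (Inl i) G q)
         + (\<Sum>j. \<Sum>i\<in>UNIV. w (Suc j) $ i * partial (Inr (j, i)) G q))"

definition trivial_cartan :: "('m::finite jet \<Rightarrow> real) \<Rightarrow> 'm jet \<Rightarrow> real" where
  "trivial_cartan F w =
     (\<Sum>j. \<Sum>i\<in>UNIV. w (Suc j) $ i * partial (j, i) (F \<circ> inv jet_coords) (jet_coords w))"

definition prolong ::
    "('x, 'n::finite) chart set \<Rightarrow> ('x, 'n) vfield \<Rightarrow> ('m::finite \<Rightarrow> ('x, 'n) vfield) \<Rightarrow>
     ('x \<times> 'm jet \<Rightarrow> real ^ 'm) \<Rightarrow> 'x \<times> 'm jet \<Rightarrow> 'm jet" where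
  "prolong A f0 f z p j = (\<chi> i. (cartan A f0 f ^^ j) (\<lambda>q. z q $ i) p)"

definition flat_output ::
    "('x::topological_space, 'n::finite) chart set \<Rightarrow> ('x, 'n) vfield \<Rightarrow>
     ('m::finite \<Rightarrow> ('x, 'n) vfield) \<Rightarrow> ('x \<times> 'm jet) set \<Rightarrow> ('x \<times> 'm jet \<Rightarrow> real ^ 'm) \<Rightarrow> bool" where
  "flat_output A f0 f W z \<longleftrightarrow>
     open W \<and> (\<forall>i. smooth_ext A W (\<lambda>p. z p $ i)) \<and>
     (let \<psi> = prolong A f0 f z in
        open (\<psi> ` W) \<and> inj_on \<psi> W \<and>
        (\<forall>j i. smooth_ext A W (\<lambda>p. \<psi> p j $ i)) \<and>
        smooth_into_ext A (\<psi> ` W) (inv_into W \<psi>))"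


section \<open>Lie-Baecklund charts and atlases\<close>

definition lb_chart ::
    "('x::topological_space, 'n::finite) chart set \<Rightarrow> ('x, 'n) vfield \<Rightarrow>
     ('m::finite \<Rightarrow> ('x, 'n) vfield) \<Rightarrow> ('x \<times> 'm jet) set \<times> ('x \<times> 'm jet \<Rightarrow> 'm jet) \<Rightarrow> bool" where
  "lb_chart A f0 f = (\<lambda>(W, \<psi>).
     \<exists>z. flat_output A f0 f W z \<and> (\<forall>p\<in>W. \<psi> p = prolong A f0 f z p))"

text \<open>
  The smooth map \<open>\<theta>\<close> carries the trivial Cartan field to itself iff applying the field to the
  component \<open>(j, i)\<close> of \<open>\<theta>\<close> gives the coefficient of the field at the image point for this
  coordinate, i.e. the component \<open>(j + 1, i)\<close> of \<open>\<theta>\<close>.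
\<close>

definition lb_map :: "'m::finite jet set \<Rightarrow> ('m jet \<Rightarrow> 'm jet) \<Rightarrow> bool" where
  "lb_map V \<theta> \<longleftrightarrow>
     (\<forall>j i. smooth_in jet_coords V (\<lambda>w. \<theta> w j $ i)) \<and>
     (\<forall>j i. \<forall>w\<in>V. trivial_cartan (\<lambda>w. \<theta> w j $ i) w = \<theta> w (Suc j) $ i)"

definition lb_isomorphism ::
    "'m::finite jet set \<Rightarrow> 'm jet set \<Rightarrow> ('m jet \<Rightarrow> 'm jet) \<Rightarrow> ('m jet \<Rightarrow> 'm jet) \<Rightarrow> bool" where
  "lb_isomorphism V V' \<theta> \<theta>' \<longleftrightarrow>
     open V \<and> open V' \<and> \<theta> ` V = V' \<and> \<theta>' ` V' = V \<and>
     (\<forall>w\<in>V. \<theta>' (\<theta> w) = w) \<and> (\<forall>w\<in>V'. \<theta> (\<theta>' w) = w) \<and>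
     lb_map V \<theta> \<and> lb_map V' \<theta>'"

definition lb_compatible ::
    "('x \<times> 'm::finite jet) set \<times> ('x \<times> 'm jet \<Rightarrow> 'm jet) \<Rightarrow>
     ('x \<times> 'm jet) set \<times> ('x \<times> 'm jet \<Rightarrow> 'm jet) \<Rightarrow> bool" where
  "lb_compatible = (\<lambda>(W1, \<psi>1) (W2, \<psi>2).
     W1 \<inter> W2 \<noteq> {} \<longrightarrow>
     lb_isomorphism (\<psi>2 ` (W1 \<inter> W2)) (\<psi>1 ` (W1 \<inter> W2))
       (\<psi>1 \<circ> inv_into W2 \<psi>2) (\<psi>2 \<circ> inv_into W1 \<psi>1))"

definition lb_atlas ::
    "('x::topological_space, 'n::finite) chart set \<Rightarrow> ('x, 'n) vfield \<Rightarrow>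
     ('m::finite \<Rightarrow> ('x, 'n) vfield) \<Rightarrow>
     (('x \<times> 'm jet) set \<times> ('x \<times> 'm jet \<Rightarrow> 'm jet)) set \<Rightarrow> bool" where
  "lb_atlas A f0 f \<C> \<longleftrightarrow>
     (\<forall>C\<in>\<C>. lb_chart A f0 f C) \<and> (\<forall>C\<in>\<C>. \<forall>C'\<in>\<C>. lb_compatible C C')"

definition intrinsic_singularities ::
    "('x::topological_space, 'n::finite) chart set \<Rightarrow> ('x, 'n) vfield \<Rightarrow>
     ('m::finite \<Rightarrow> ('x, 'n) vfield) \<Rightarrow> ('x \<times> 'm jet) set" where
  "intrinsic_singularities A f0 f =
     {p. \<forall>\<C>. lb_atlas A f0 f \<C> \<longrightarrow> (\<forall>C\<in>\<C>. p \<notin> fst C)}"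


section \<open>The sets \<open>\<Omega>\<^sub>0\<close> and \<open>\<Omega>\<close>\<close>

definition Omega0 ::
    "('x, 'n::finite) chart set \<Rightarrow> ('x, 'n) vfield \<Rightarrow> ('m::finite \<Rightarrow> ('x, 'n) vfield) \<Rightarrow>
     ('x \<times> (real ^ 'm)) set" where
  "Omega0 A f0 f =
     {(x, u). \<exists>k.
        let g' = (\<lambda>c y. f0 c y + (\<Sum>i\<in>UNIV - {k}. (u $ i) *\<^sub>R f i c y))
        in span (insert (vf_at A (lie_bracket g' (f k)) x) (range (\<lambda>j. vf_at A (f j) x))) = UNIV}"

definition Omega ::
    "('x, 'n::finite) chart set \<Rightarrow> ('x, 'n) vfield \<Rightarrow> ('m::finite \<Rightarrow> ('x, 'n) vfield) \<Rightarrow>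
     ('x \<times> (real ^ 'm)) set" where
  "Omega A f0 f = {(x, u). \<exists>k. rank_at A (distr A f0 f k) x = CARD('n)}"

definition lift_set :: "('x \<times> (real ^ 'm)) set \<Rightarrow> ('x \<times> 'm jet) set" where
  "lift_set S = {(x, w). (x, w 0) \<in> S}"

end

theory Submission
  imports Defs
begin

text \<open>
  Near a point of \<open>\<Omega>\<^sub>0\<close>, let \<open>h\<close> be \<open>n - 1\<close> independent first integrals of \<open>f\<^sub>k\<close>, obtained by following the
  flow of \<open>f\<^sub>k\<close> to a transversal slice.  Their time derivatives do not involve \<open>u\<^sub>k\<close>, and the spanning
  condition says precisely that \<open>(h, dh/dt)\<close> is a local diffeomorphism in \<open>x\<close> and the remaining
  \<open>n - 2\<close> controls.  The control \<open>u\<^sub>k\<close> is then recovered from the derivative of \<open>x\<close>, hence from two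
  derivatives of \<open>h\<close>, so \<open>h\<close> is a flat output.

  Conversely, a flat output expresses \<open>x\<close> and \<open>u\<close> as functions \<open>X\<close> and \<open>U\<close> of the jet of \<open>z\<close>.
  The partial derivatives of \<open>X\<close> vanish in the coordinates \<open>z\<^sup>(\<^sup>j\<^sup>)\<close> with \<open>j\<close> large.
  Differentiating the equation of the system with respect to \<open>z\<^sup>(\<^sup>j\<^sup>+\<^sup>1\<^sup>)\<close> expresses the derivative of \<open>X\<close> in \<open>z\<^sup>(\<^sup>j\<^sup>)\<close> by
  brackets of the preceding one with \<open>f\<^sub>0\<close> and the \<open>f\<^sub>i\<close>, so by descending induction on \<open>j\<close> all of them
  lie in some \<open>\<D>\<^sub>k\<close>.  They span the tangent space since \<open>X\<close> has a right inverse.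
\<close>

section \<open>Smooth functions of arbitrarily many coordinates\<close>

text \<open>The jet space carries only the product topology, so derivatives there are sums over the
  finitely many coordinates on which a function locally depends; chain rule, composition and
  commuting partials have to be obtained in this form.

  Why spanning amounts to a local diffeomorphism: the common kernel of the differentials of
  \<open>h\<close> is spanned by f_k, and L_{f_k} h = 0 gives L_{f_k} L_g h = - L_{[g,f_k]} h. A
  state vector l f_k, invisible to dh, is thus seen by the derivative of L_g h through - l [g,f_k],
  which is independent of all the f_i.

  Following the flow yields smooth integrals only if the flow is smooth in its initial point. This
  is the laborious part: the derivatives of the Picard iterates obey linear recursions with the same
  small coefficients at every order, so their uniform convergence follows by induction on the order.

  In the converse the brackets come from the commutator [d/dz^(j+1), tau] = d/dz^(j) with the
  trivial Cartan field tau. Compatibility of charts has nothing to do with first integrals: any two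
  prolongations carry the Cartan field of the system to tau.\<close>

definition depends_on :: "('i \<Rightarrow> real) set \<Rightarrow> 'i set \<Rightarrow> (('i \<Rightarrow> real) \<Rightarrow> real) \<Rightarrow> bool" where
  "depends_on V J F \<longleftrightarrow> (\<forall>q\<in>V. \<forall>r\<in>V. (\<forall>i\<in>J. q i = r i) \<longrightarrow> F q = F r)"

definition locfin :: "('i \<Rightarrow> real) set \<Rightarrow> (('i \<Rightarrow> real) \<Rightarrow> real) \<Rightarrow> bool" where
  "locfin S F \<longleftrightarrow> (\<forall>p\<in>S. \<exists>V J. open V \<and> p \<in> V \<and> V \<subseteq> S \<and> finite J \<and> depends_on V J F)"

text \<open>The class C^r in this setting. Grading \<open>smooth_coord\<close> by the order replaces
  its quantification over lists of partial derivatives, so that closure properties can be proved by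
  induction on \<open>r\<close> with the function arbitrary.\<close>

primrec ck :: "nat \<Rightarrow> ('i \<Rightarrow> real) set \<Rightarrow> (('i \<Rightarrow> real) \<Rightarrow> real) \<Rightarrow> bool" where
  "ck 0 S F \<longleftrightarrow> continuous_on S F \<and> locfin S F"
| "ck (Suc r) S F \<longleftrightarrow> continuous_on S F \<and> locfin S F \<and>
     (\<forall>i. (\<forall>p\<in>S. (\<lambda>t. F (p(i := t))) differentiable (at (p i))) \<and> ck r S (partial i F))"

section \<open>Boxes in the product topology and locality of partial derivatives\<close>

lemma open_contains_box:
  fixes S :: "('i \<Rightarrow> real) set"
  assumes "open S" "p \<in> S"
  obtains J d where "finite J" "d > 0" "{q. \<forall>i\<in>J. \<bar>q i - p i\<bar> < d} \<subseteq> S"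
proof -
  obtain X where X: "p \<in> PiE UNIV X" "\<forall>i. openin euclidean (X i)"
      "finite {i. X i \<noteq> topspace euclidean}" "PiE UNIV X \<subseteq> S"
    using product_topology_open_contains_basis[of "\<lambda>_. euclidean" UNIV S p] assms
    by (auto simp: open_fun_def)
  define J where "J = {i. X i \<noteq> UNIV}"
  have fJ: "finite J" using X(3) by (simp add: J_def)
  have "\<forall>i. \<exists>d>0. \<forall>t. \<bar>t - p i\<bar> < d \<longrightarrow> t \<in> X i"
  proof
    fix i
    have "open (X i)" "p i \<in> X i" using X by (auto simp: PiE_def)
    then show "\<exists>d>0. \<forall>t. \<bar>t - p i\<bar> < d \<longrightarrow> t \<in> X i"
      by (metis open_real)
  qed
  then obtain d where d: "\<And>i. d i > 0" "\<And>i t. \<bar>t - p i\<bar> < d i \<Longrightarrow> t \<in> X i" by metis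
  \<comment> \<open>The extra \<open>1\<close> keeps the minimum meaningful when no coordinate is
    restricted.\<close>
  define e where "e = Min (insert 1 (d ` J))"
  have "e > 0" unfolding e_def using fJ d(1) by (subst Min_gr_iff) auto
  have ed: "e \<le> d i" if "i \<in> J" for i
    unfolding e_def using fJ that by (intro Min_le) auto
  have "{q. \<forall>i\<in>J. \<bar>q i - p i\<bar> < e} \<subseteq> S"
  proof
    fix q assume q: "q \<in> {q. \<forall>i\<in>J. \<bar>q i - p i\<bar> < e}"
    have "q i \<in> X i" for i
      using q ed[of i] d(2)[of "q i" i] by (cases "i \<in> J") (force simp: J_def)+
    then show "q \<in> S" using X(4) by auto
  qed
  with that fJ \<open>e > 0\<close> show thesis by blast
qed

lemma open_box:
  fixes p :: "'i \<Rightarrow> real"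
  assumes "finite J"
  shows "open {q. \<forall>i\<in>J. \<bar>q i - p i\<bar> < d}"
proof -
  have "{q. \<forall>i\<in>J. \<bar>q i - p i\<bar> < d} = (\<Inter>i\<in>J. (\<lambda>q. q i) -` ball (p i) d)"
    by (auto simp: dist_real_def abs_minus_commute)
  also have "open \<dots>"
    using assms by (intro open_INT ballI open_vimage open_ball continuous_on_product_coordinates)
  finally show ?thesis .
qed

lemma eventually_in_open_coordinatewise:
  fixes \<gamma> :: "'a \<Rightarrow> 'i \<Rightarrow> real"
  assumes "open V" "p \<in> V" "\<And>i. ((\<lambda>t. \<gamma> t i) \<longlongrightarrow> p i) F"
  shows "\<forall>\<^sub>F t in F. \<gamma> t \<in> V"
proof -
  obtain J d where J: "finite J" "d > 0" "{q. \<forall>i\<in>J. \<bar>q i - p i\<bar> < d} \<subseteq> V"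
    using open_contains_box[OF assms(1,2)] .
  have "\<forall>\<^sub>F t in F. \<forall>i\<in>J. \<bar>\<gamma> t i - p i\<bar> < d"
    using J assms(3) by (auto simp: eventually_ball_finite_distrib tendsto_iff dist_real_def)
  then show ?thesis by eventually_elim (use J in auto)
qed

lemma eventually_upd_in_open:
  fixes V :: "('i \<Rightarrow> real) set"
  assumes "open V" "q \<in> V"
  shows "\<forall>\<^sub>F t in nhds (q i). q(i := t) \<in> V"
proof (rule eventually_in_open_coordinatewise[OF assms])
  show "((\<lambda>t. (q(i := t)) j) \<longlongrightarrow> q j) (nhds (q i))" for j
    by (cases "j = i") (auto simp: filterlim_ident)
qed

lemma partial_cong:
  assumes "open S" "p \<in> S" "\<And>q. q \<in> S \<Longrightarrow> F q = G q"
  shows "partial i F p = partial i G p"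
  unfolding partial_def
proof (rule deriv_cong_ev[OF _ refl])
  show "\<forall>\<^sub>F t in nhds (p i). F (p(i := t)) = G (p(i := t))"
    using eventually_upd_in_open[OF assms(1,2)] by eventually_elim (use assms(3) in auto)
qed

lemma differentiable_upd_cong:
  fixes F G :: "('i \<Rightarrow> real) \<Rightarrow> real"
  assumes "open S" "p \<in> S" "\<And>q. q \<in> S \<Longrightarrow> F q = G q"
    "(\<lambda>t. F (p(i := t))) differentiable (at (p i))"
  shows "(\<lambda>t. G (p(i := t))) differentiable (at (p i))"
proof -
  have "\<forall>\<^sub>F t in nhds (p i). F (p(i := t)) = G (p(i := t))"
    using eventually_upd_in_open[OF assms(1,2)] by eventually_elim (use assms(3) in auto)
  then have "\<forall>\<^sub>F t in at (p i). F (p(i := t)) = G (p(i := t))" "F (p(i := p i)) = G (p(i := p i))"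
    using assms by (auto simp: eventually_at_filter elim: eventually_mono)
  note ev = this
  obtain D where "((\<lambda>t. F (p(i := t))) has_derivative D) (at (p i))"
    using assms(4) unfolding differentiable_def ..
  then have "((\<lambda>t. G (p(i := t))) has_derivative D) (at (p i))"
    by (rule has_derivative_transform_eventually[OF _ ev]) auto
  then show ?thesis unfolding differentiable_def by blast
qed

lemma locfin_cong:
  assumes "\<And>q. q \<in> S \<Longrightarrow> F q = G q" "locfin S F"
  shows "locfin S G"
  unfolding locfin_def
proof
  fix p assume "p \<in> S"
  then obtain V J where V: "open V" "p \<in> V" "V \<subseteq> S" "finite J"
    "depends_on V J F"
    using assms(2) unfolding locfin_def by meson
  have "depends_on V J G"
    unfolding depends_on_def
  proof (intro ballI impI)
    fix q r assume "q \<in> V" "r \<in> V" "\<forall>i\<in>J. q i = r i"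
    moreover from this have "q \<in> S" "r \<in> S" using V(3) by auto
    ultimately show "G q = G r" using V(5) assms(1) unfolding depends_on_def by metis
  qed
  with V show "\<exists>V J. open V \<and> p \<in> V \<and> V \<subseteq> S \<and> finite J \<and>
     depends_on V J G" by blast
qed

lemma ck_cong:
  assumes "open S" "\<And>q. q \<in> S \<Longrightarrow> F q = G q" "ck r S F"
  shows "ck r S G"
  using assms(2,3)
proof (induction r arbitrary: F G)
  case 0
  have "continuous_on S G" using 0 continuous_on_cong[OF refl, of S F G] by simp
  moreover have "locfin S G" by (rule locfin_cong[of S F]) (use 0 in simp_all)
  ultimately show ?case by simp
next
  case (Suc r)
  have "continuous_on S G" using Suc.prems continuous_on_cong[OF refl, of S F G] by simp
  moreover have "locfin S G" by (rule locfin_cong[of S F]) (use Suc.prems in simp_all)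
  moreover have "ck r S (partial i G)" for i
  proof (rule Suc.IH)
    show "partial i F q = partial i G q" if "q \<in> S" for q
      by (rule partial_cong[OF assms(1) that Suc.prems(1)])
  qed (use Suc.prems in simp)
  moreover have "(\<lambda>t. G (p(i := t))) differentiable (at (p i))" if "p \<in> S" for p i
    by (rule differentiable_upd_cong[OF assms(1) that, of F]) (use Suc.prems that in simp_all)
  ultimately show ?case by simp
qed

text \<open>\<open>V\<close> is an arbitrary open set, so two of its points that agree on
  \<open>J\<close> need not be joined inside it. Only germs are compared: for \<open>i\<close> in
  \<open>J\<close> and \<open>t\<close> near the common value both points can be moved in coordinate
  \<open>i\<close> without leaving \<open>V\<close>, and the two one-variable functions coincide
  there. Outside \<open>J\<close> both derivatives vanish.\<close>

lemma partial_locally_determined: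
  fixes F :: "('i \<Rightarrow> real) \<Rightarrow> real"
  assumes oV: "open V" and dep: "depends_on V J F"
  shows partial_eq_0: "i \<notin> J \<Longrightarrow> q \<in> V \<Longrightarrow> partial i F q = 0"
    and depends_on_partial: "depends_on V J (partial i F)"
proof -
  note V = oV dep[unfolded depends_on_def, rule_format]
  show z: "partial i F q = 0" if "i \<notin> J" "q \<in> V" for q
  proof -
    have "\<forall>\<^sub>F t in nhds (q i). F (q(i := t)) = F q"
      using eventually_upd_in_open[OF V(1) that(2)]
      by eventually_elim (rule V(2), use that in auto)
    then have "deriv (\<lambda>t. F (q(i := t))) (q i) = deriv (\<lambda>t. F q) (q i)"
      by (intro deriv_cong_ev) auto
    then show ?thesis by (simp add: partial_def)
  qed
  have "partial i F q = partial i F r" if "q \<in> V" "r \<in> V" "\<forall>i\<in>J. q i = r i" for q r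
  proof (cases "i \<in> J")
    case True
    have "\<forall>\<^sub>F t in nhds (q i). q(i := t) \<in> V" "\<forall>\<^sub>F t in nhds (q i). r(i := t) \<in> V"
      using eventually_upd_in_open[OF V(1), of q i] eventually_upd_in_open[OF V(1), of r i] that True
    by auto
    then have "\<forall>\<^sub>F t in nhds (q i). F (q(i := t)) = F (r(i := t))"
      by eventually_elim (rule V(2), use that in auto)
    then show ?thesis unfolding partial_def using that True by (intro deriv_cong_ev) auto
  next
    case False
    then show ?thesis using z that by metis
  qed
  then show "depends_on V J (partial i F)" unfolding depends_on_def by blast
qed

lemma locfin_partial: "locfin S F \<Longrightarrow> locfin S (partial i F)"
  unfolding locfin_def by (meson depends_on_partial)

lemma ck_imp_continuous_on: "ck r S F \<Longrightarrow> continuous_on S F" and ck_imp_locfin: "ck r S F \<Longrightarrow> locfin S F"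
  by (cases r; simp)+

text \<open>\<open>foldr\<close> applies the head of the list last, so prepending an index
  differentiates once more, and the induction on \<open>r\<close> runs over all lists at once.
  \<open>smooth_coord\<close> asks for local finiteness of the function itself;
  \<open>locfin_partial\<close> passes it on to the derivatives.\<close>

lemma smooth_coord_iff_ck: "smooth_coord S F \<longleftrightarrow> open S \<and> (\<forall>r. ck r S F)"
proof safe
  assume F: "smooth_coord S F"
  then show "open S" by (simp add: smooth_coord_def)
  have lf: "locfin S (foldr partial is F)" for "is"
  proof (induction "is")
    case Nil
    show ?case using F unfolding smooth_coord_def locfin_def depends_on_def by simp
  qed (simp add: locfin_partial)
  have "ck r S (foldr partial is F)" for r "is"
  proof (induction r arbitrary: "is")
    case 0
    then show ?case using F lf by (simp add: smooth_coord_def)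
  next
    case (Suc r)
    have "ck r S (partial i (foldr partial is F))" for i using Suc[of "i # is"] by simp
    then show ?case using F lf by (simp add: smooth_coord_def)
  qed
  from this[of _ "[]"] show "ck r S F" for r by simp
next
  assume S: "open S" "\<forall>r. ck r S F"
  have ck: "ck r S (foldr partial is F)" for r "is"
  proof (induction "is" arbitrary: r)
    case (Cons i "is")
    from Cons[of "Suc r"] show ?case by simp
  qed (use S in simp)
  have "continuous_on S (foldr partial is F)" "locfin S F" for "is"
    using ck[of 0 "is"] S by (auto dest: ck_imp_locfin)
  moreover have "(\<lambda>t. foldr partial is F (p(i := t))) differentiable (at (p i))" if "p \<in> S" for "is" i p
    using ck[of 1 "is"] that by simp
  ultimately show "smooth_coord S F"
    using S unfolding smooth_coord_def locfin_def depends_on_def by simp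
qed

lemma smooth_coordD:
  assumes "smooth_coord S F"
  shows "open S" "continuous_on S F" "locfin S F" "smooth_coord S (partial i F)"
    "p \<in> S \<Longrightarrow> (\<lambda>t. F (p(i := t))) differentiable (at (p i))" "ck r S F"
proof -
  have c: "ck r S F" for r using assms smooth_coord_iff_ck by auto
  have o: "open S" using assms smooth_coord_iff_ck by auto
  show "open S" "continuous_on S F" "locfin S F" "ck r S F"
    using c[of 0] c[of r] o by auto
  show "smooth_coord S (partial i F)" using c[of "Suc _"] o by (simp add: smooth_coord_iff_ck)
  show "p \<in> S \<Longrightarrow> (\<lambda>t. F (p(i := t))) differentiable (at (p i))" using c[of "Suc 0"] by simp
qed

lemma smooth_coord_cong:
  assumes "smooth_coord S F" "\<And>q. q \<in> S \<Longrightarrow> F q = G q"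
  shows "smooth_coord S G"
  using assms ck_cong[of S F G] by (auto simp: smooth_coord_iff_ck)

lemma locfin_subset:
  fixes S :: "('i \<Rightarrow> real) set"
  assumes "locfin S F" "open T" "T \<subseteq> S"
  shows "locfin T F"
  unfolding locfin_def
proof
  fix p assume p: "p \<in> T"
  then obtain V J where "open V" "p \<in> V" "V \<subseteq> S" "finite J"
     "depends_on V J F"
    using assms unfolding locfin_def by (meson subsetD)
  then show "\<exists>V J. open V \<and> p \<in> V \<and> V \<subseteq> T \<and> finite J \<and>
     depends_on V J F"
    using p assms by (intro exI[of _ "V \<inter> T"] exI[of _ J]) (auto simp: depends_on_def)
qed

lemma ck_subset:
  fixes S :: "('i \<Rightarrow> real) set"
  assumes "ck r S F" "open T" "T \<subseteq> S"
  shows "ck r T F"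
  using assms(1)
proof (induction r arbitrary: F)
  case 0
  then show ?case using assms locfin_subset continuous_on_subset by auto
next
  case (Suc r)
  then show ?case using assms locfin_subset continuous_on_subset by (auto simp: subset_iff)
qed

lemma smooth_coord_subset:
  "smooth_coord S F \<Longrightarrow> open T \<Longrightarrow> T \<subseteq> S \<Longrightarrow> smooth_coord T F"
  by (meson ck_subset smooth_coord_iff_ck)

lemma continuous_on_locally_open:
  fixes F :: "'a::topological_space \<Rightarrow> 'b::topological_space"
  assumes "\<And>p. p \<in> S \<Longrightarrow> \<exists>T. open T \<and> p \<in> T \<and> T \<subseteq> S \<and> continuous_on T F"
  shows "continuous_on S F"
proof -
  have "S \<subseteq> \<Union>{T. open T \<and> T \<subseteq> S \<and> continuous_on T F}"
  proof
    fix p assume "p \<in> S"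
    from assms[OF this] show "p \<in> \<Union>{T. open T \<and> T \<subseteq> S \<and> continuous_on T F}" by auto
  qed
  then have "S = \<Union>{T. open T \<and> T \<subseteq> S \<and> continuous_on T F}" by auto
  moreover have "continuous_on (\<Union>{T. open T \<and> T \<subseteq> S \<and> continuous_on T F}) F"
    by (rule continuous_on_open_Union) auto
  ultimately show ?thesis by simp
qed

text \<open>For chain rule sums, whose finite index set changes from point to point.\<close>

lemma ck_locally:
  fixes S :: "('i \<Rightarrow> real) set"
  assumes "\<And>p. p \<in> S \<Longrightarrow> \<exists>T. open T \<and> p \<in> T \<and> T \<subseteq> S \<and> ck r T F"
  shows "ck r S F"
  using assms
proof (induction r arbitrary: F)
  case 0
  have "continuous_on S F"
  proof (rule continuous_on_locally_open)
    fix p assume "p \<in> S"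
    then obtain T where "open T" "p \<in> T" "T \<subseteq> S" "ck 0 T F" using 0 by blast
    then show "\<exists>T. open T \<and> p \<in> T \<and> T \<subseteq> S \<and> continuous_on T F" using ck_imp_continuous_on by blast
  qed
  moreover have "locfin S F"
    unfolding locfin_def
  proof
    fix p assume "p \<in> S"
    then obtain T where "open T" "p \<in> T" "T \<subseteq> S" "ck 0 T F" using 0 by blast
    then have "open T" "p \<in> T" "T \<subseteq> S" "locfin T F" using ck_imp_locfin by blast+
    then show "\<exists>V J. open V \<and> p \<in> V \<and> V \<subseteq> S \<and> finite J \<and>
     depends_on V J F" unfolding locfin_def by (meson order_trans)
  qed
  ultimately show ?case by simp
next
  case (Suc r)
  have "\<exists>T. open T \<and> p \<in> T \<and> T \<subseteq> S \<and> ck r T (partial i F)" if "p \<in> S" for i p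
    using Suc.prems[OF that] by auto
  then have "ck r S (partial i F)" for i by (rule Suc.IH)
  moreover have "continuous_on S F"
  proof (rule continuous_on_locally_open)
    fix p assume "p \<in> S"
    then obtain T where "open T" "p \<in> T" "T \<subseteq> S" "ck (Suc r) T F" using Suc.prems by blast
    then show "\<exists>T. open T \<and> p \<in> T \<and> T \<subseteq> S \<and> continuous_on T F" using ck_imp_continuous_on by blast
  qed
  moreover have "locfin S F"
    unfolding locfin_def
  proof
    fix p assume "p \<in> S"
    then obtain T where "open T" "p \<in> T" "T \<subseteq> S" "ck (Suc r) T F" using Suc.prems by blast
    then have "open T" "p \<in> T" "T \<subseteq> S" "locfin T F" using ck_imp_locfin by blast+
    then show "\<exists>V J. open V \<and> p \<in> V \<and> V \<subseteq> S \<and> finite J \<and>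
     depends_on V J F" unfolding locfin_def by (meson order_trans)
  qed
  moreover have "(\<lambda>t. F (p(i := t))) differentiable (at (p i))" if "p \<in> S" for i p
    using Suc.prems[OF that] by auto
  ultimately show ?case by simp
qed

lemma smooth_coord_locally:
  fixes S :: "('i \<Rightarrow> real) set"
  assumes "\<And>p. p \<in> S \<Longrightarrow> \<exists>T. p \<in> T \<and> T \<subseteq> S \<and> smooth_coord T F"
  shows "smooth_coord S F"
proof -
  have "open S"
  proof (subst open_subopen, rule ballI)
    fix p assume "p \<in> S"
    then obtain T where "p \<in> T" "T \<subseteq> S" "smooth_coord T F" using assms by blast
    then show "\<exists>T. open T \<and> p \<in> T \<and> T \<subseteq> S" by (blast dest: smooth_coordD(1))
  qed
  moreover have "ck r S F" for r
  proof (rule ck_locally)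
    fix p assume "p \<in> S"
    then obtain T where "p \<in> T" "T \<subseteq> S" "smooth_coord T F" using assms by blast
    then show "\<exists>T. open T \<and> p \<in> T \<and> T \<subseteq> S \<and> ck r T F"
      by (blast dest: smooth_coordD(1,6))
  qed
  ultimately show ?thesis by (simp add: smooth_coord_iff_ck)
qed

section \<open>Arithmetic of smooth functions\<close>

lemma has_partial:
  assumes "(\<lambda>t. F (p(i := t))) differentiable (at (p i))"
  shows "((\<lambda>t. F (p(i := t))) has_real_derivative partial i F p) (at (p i))"
  using assms unfolding partial_def by (simp add: DERIV_deriv_iff_real_differentiable)

lemma has_partial_at:
  assumes "\<And>p. p \<in> S \<Longrightarrow> (\<lambda>t. F (p(i := t))) differentiable (at (p i))"
    and "p(i := s) \<in> S"
  shows "((\<lambda>t. F (p(i := t))) has_real_derivative partial i F (p(i := s))) (at s)"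
  using has_partial[of F "p(i := s)" i] assms(1)[OF assms(2)] by simp

lemma partialI: "((\<lambda>t. F (p(i := t))) has_real_derivative D) (at (p i)) \<Longrightarrow> partial i F p = D"
  unfolding partial_def by (rule DERIV_imp_deriv)

lemma ck_mono: "ck r S F \<Longrightarrow> k \<le> r \<Longrightarrow> ck k S F"
proof (induction r arbitrary: F k)
  case (Suc r)
  then show ?case by (cases k) auto
qed simp

lemma locfin_binop:
  fixes S :: "('i \<Rightarrow> real) set"
  assumes "locfin S F" "locfin S G"
  shows "locfin S (\<lambda>q. h (F q) (G q))"
  unfolding locfin_def
proof
  fix p assume p: "p \<in> S"
  obtain V J where V: "open V" "p \<in> V" "V \<subseteq> S" "finite J"
     "depends_on V J F"
    using assms(1) p unfolding locfin_def by meson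
  obtain W K where W: "open W" "p \<in> W" "W \<subseteq> S" "finite K"
     "depends_on W K G"
    using assms(2) p unfolding locfin_def by meson
  have "depends_on (V \<inter> W) (J \<union> K) (\<lambda>q. h (F q) (G q))"
    unfolding depends_on_def
  proof (intro ballI impI)
    fix q r assume qr: "q \<in> V \<inter> W" "r \<in> V \<inter> W" "\<forall>i\<in>J \<union> K. q i = r i"
    then have "F q = F r" "G q = G r" using V(5) W(5) by (auto simp: depends_on_def)
    then show "h (F q) (G q) = h (F r) (G r)" by simp
  qed
  then show "\<exists>V J. open V \<and> p \<in> V \<and> V \<subseteq> S \<and> finite J \<and> depends_on V J (\<lambda>q. h (F q) (G q))"
    using V W by (intro exI[of _ "V \<inter> W"] exI[of _ "J \<union> K"]) auto
qed

lemma ck_const: "open S \<Longrightarrow> ck r S (\<lambda>q. c)"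
proof (induction r arbitrary: c)
  case 0
  then show ?case by (auto simp: locfin_def depends_on_def)
next
  case (Suc r)
  have "partial i (\<lambda>q. c) = (\<lambda>q. 0)" for i :: 'a by (auto simp: partial_def)
  with Suc show ?case by (auto simp: locfin_def depends_on_def)
qed

lemma ck_coord: "open S \<Longrightarrow> ck r S (\<lambda>q. q i)"
proof -
  assume o: "open S"
  have lf: "locfin S (\<lambda>q. q i)"
    unfolding locfin_def depends_on_def using o by (intro ballI exI[of _ S] exI[of _ "{i}"]) auto
  have p: "partial j (\<lambda>q. q i) = (\<lambda>q. if j = i then 1 else 0)" for j
  proof
    show "partial j (\<lambda>q. q i) q = (if j = i then 1 else 0)" for q
      by (rule partialI) (auto intro!: derivative_eq_intros)
  qed
  have "(\<lambda>t. (q(j := t)) i) differentiable at (q j)" for q :: "_ \<Rightarrow> real" and j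
    by (cases "j = i") auto
  with o lf show ?thesis
    by (cases r) (auto simp: p intro!: ck_const continuous_on_subset[OF continuous_on_product_coordinates])
qed

lemma ck_add:
  assumes "open S"
  shows "ck r S F \<Longrightarrow> ck r S G \<Longrightarrow> ck r S (\<lambda>q. F q + G q)"
proof (induction r arbitrary: F G)
  case 0
  then show ?case by (auto intro: continuous_on_add locfin_binop)
next
  case (Suc r)
  have "partial i (\<lambda>q. F q + G q) p = partial i F p + partial i G p" if "p \<in> S" for i p
  proof -
    have "((\<lambda>t. F (p(i := t))) has_real_derivative partial i F p) (at (p i))"
      "((\<lambda>t. G (p(i := t))) has_real_derivative partial i G p) (at (p i))"
      using Suc.prems that by (auto intro!: has_partial)
    from DERIV_add[OF this] show ?thesis by (rule partialI)
  qed
  note * = this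
  have "ck r S (\<lambda>p. partial i F p + partial i G p)" for i
    using Suc.prems by (intro Suc.IH) simp_all
  then have "ck r S (partial i (\<lambda>q. F q + G q))" for i
    by (rule ck_cong[OF assms(1), rotated]) (simp add: *)
  with Suc.prems show ?case by (auto intro: continuous_on_add locfin_binop)
qed

lemma ck_mult:
  assumes "open S"
  shows "ck r S F \<Longrightarrow> ck r S G \<Longrightarrow> ck r S (\<lambda>q. F q * G q)"
proof (induction r arbitrary: F G)
  case 0
  then show ?case by (auto intro: continuous_on_mult locfin_binop)
next
  case (Suc r)
  have "partial i (\<lambda>q. F q * G q) p = partial i F p * G p + F p * partial i G p" if "p \<in> S" for i p
  proof -
    have "((\<lambda>t. F (p(i := t))) has_real_derivative partial i F p) (at (p i))"
      "((\<lambda>t. G (p(i := t))) has_real_derivative partial i G p) (at (p i))"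
      using Suc.prems that by (auto intro!: has_partial)
    from DERIV_mult[OF this] show ?thesis by (intro partialI) (simp add: algebra_simps)
  qed
  note * = this
  have "ck r S (\<lambda>p. partial i F p * G p + F p * partial i G p)" for i
    using Suc.prems ck_mono[of "Suc r" S _ r] by (auto intro!: ck_add[OF assms] Suc.IH)
  then have "ck r S (partial i (\<lambda>q. F q * G q))" for i
    by (rule ck_cong[OF assms(1), rotated]) (simp add: *)
  with Suc.prems show ?case by (auto intro: continuous_on_mult locfin_binop)
qed

lemma ck_sum:
  assumes "open S" "\<And>a. a \<in> A \<Longrightarrow> ck r S (F a)"
  shows "ck r S (\<lambda>q. \<Sum>a\<in>A. F a q)"
  using assms(2)
  by (induction A rule: infinite_finite_induct) (auto intro!: ck_const ck_add assms(1))

lemma ck_prod: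
  assumes "open S" "\<And>a. a \<in> A \<Longrightarrow> ck r S (F a)"
  shows "ck r S (\<lambda>q. \<Prod>a\<in>A. F a q)"
  using assms(2)
  by (induction A rule: infinite_finite_induct) (auto intro!: ck_const ck_mult assms(1))

lemma smooth_coord_const [intro]: "open S \<Longrightarrow> smooth_coord S (\<lambda>q. c)"
  and smooth_coord_coord [intro]: "open S \<Longrightarrow> smooth_coord S (\<lambda>q. q i)"
  and smooth_coord_add [intro]: "smooth_coord S F \<Longrightarrow> smooth_coord S G \<Longrightarrow> smooth_coord S (\<lambda>q. F q + G q)"
  and smooth_coord_mult [intro]: "smooth_coord S F \<Longrightarrow> smooth_coord S G \<Longrightarrow> smooth_coord S (\<lambda>q. F q * G q)"
  by (auto simp: smooth_coord_iff_ck ck_const ck_coord ck_add ck_mult)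

lemma smooth_coord_sum [intro]:
  "open S \<Longrightarrow> (\<And>a. a \<in> A \<Longrightarrow> smooth_coord S (F a)) \<Longrightarrow> smooth_coord S (\<lambda>q. \<Sum>a\<in>A. F a q)"
  by (auto simp: smooth_coord_iff_ck ck_sum)

lemma smooth_coord_diff [intro]:
  assumes "smooth_coord S F" "smooth_coord S G" shows "smooth_coord S (\<lambda>q. F q - G q)"
proof -
  have "smooth_coord S (\<lambda>q. F q + (-1) * G q)"
    by (intro smooth_coord_add smooth_coord_mult smooth_coord_const assms smooth_coordD(1)[OF assms(1)])
  then show ?thesis by simp
qed

text \<open>The mean value theorem is applied along the finitely many relevant coordinates, one at a time.\<close>

lemma coordinate_increment:
  fixes F :: "('i \<Rightarrow> real) \<Rightarrow> real"
  assumes V0: "open V0" "p \<in> V0" "finite J"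
      "depends_on V0 J F"
    and diff: "\<And>i q. q \<in> V0 \<Longrightarrow> (\<lambda>t. F (q(i := t))) differentiable (at (q i))"
    and cont: "\<And>i. continuous_on V0 (partial i F)" and e: "e > 0"
  obtains V where "open V" "p \<in> V" "V \<subseteq> V0"
    "\<And>q. q \<in> V \<Longrightarrow> \<bar>F q - F p - (\<Sum>i\<in>J. partial i F p * (q i - p i))\<bar> \<le> e * (\<Sum>i\<in>J. \<bar>q i - p i\<bar>)"
proof -
  \<comment> \<open>On \<open>W\<close> every partial derivative with index in \<open>J\<close>
    differs from its value at \<open>p\<close> by less than \<open>e\<close>. The box
    \<open>V\<close> inside it may restrict further coordinates \<open>K\<close>; what counts is
    that a box around \<open>p\<close> contains all points mixed from coordinates of
    \<open>p\<close> and of one of its points \<open>q\<close>.\<close>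
  define W where "W = (\<Inter>i\<in>J. V0 \<inter> partial i F -` ball (partial i F p) e) \<inter> V0"
  have "open W"
    unfolding W_def using V0 cont
    by (intro open_Int open_INT ballI continuous_open_preimage) auto
  moreover have "p \<in> W" using V0 e by (auto simp: W_def)
  ultimately obtain K d where K: "finite K" "d > 0" "{q. \<forall>i\<in>K. \<bar>q i - p i\<bar> < d} \<subseteq> W"
    by (rule open_contains_box)
  define V where "V = {q. \<forall>i\<in>K. \<bar>q i - p i\<bar> < d}"
  have VW: "V \<subseteq> W" using K V_def by simp
  have est: "\<bar>F (\<lambda>i. if i \<in> L then q i else p i) - F p - (\<Sum>i\<in>L. partial i F p * (q i - p i))\<bar>
      \<le> e * (\<Sum>i\<in>L. \<bar>q i - p i\<bar>)" if q: "q \<in> V" and "finite L" "L \<subseteq> J" for q L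
    using that(2,3)
  proof (induction L rule: finite_induct)
    case (insert k L)
    define r where "r = (\<lambda>i. if i \<in> L then q i else p i)"
    have r': "(\<lambda>i. if i \<in> insert k L then q i else p i) = r(k := q k)" and rk: "r = r(k := p k)"
      using insert by (auto simp: r_def)
    have inV: "r(k := s) \<in> V" if "s \<in> closed_segment (p k) (q k)" for s
    proof -
      have "\<bar>s - p k\<bar> \<le> \<bar>q k - p k\<bar>" using that by (auto simp: closed_segment_eq_real_ivl split: if_splits)
      then show ?thesis using q K(2) by (fastforce simp: V_def r_def)
    qed
    \<comment> \<open>Subtracting the linear part \<open>partial k F p * s\<close> turns closeness
      of the derivatives into a bound \<open>e\<close> for the slope.\<close>
    have "norm ((F (r(k := q k)) - partial k F p * q k) - (F (r(k := p k)) - partial k F p * p k))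
        \<le> e * norm (q k - p k)"
    proof (rule field_differentiable_bound[where S="closed_segment (p k) (q k)" and
          f="\<lambda>s. F (r(k := s)) - partial k F p * s" and
          f'="\<lambda>s. partial k F (r(k := s)) - partial k F p"])
      fix s assume s: "s \<in> closed_segment (p k) (q k)"
      have "r(k := s) \<in> W" using inV[OF s] VW by auto
      then have "((\<lambda>t. F (r(k := t))) has_real_derivative partial k F (r(k := s))) (at s)"
        by (intro has_partial_at[where S=V0]) (auto simp: W_def intro: diff)
      from DERIV_diff[OF has_field_derivative_at_within[OF this] DERIV_cmult_Id]
      show "((\<lambda>s. F (r(k := s)) - partial k F p * s) has_real_derivative
          partial k F (r(k := s)) - partial k F p) (at s within closed_segment (p k) (q k))" .
      show "norm (partial k F (r(k := s)) - partial k F p) \<le> e"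
      proof -
        have "partial k F (r(k := s)) \<in> ball (partial k F p) e"
          using \<open>r(k := s) \<in> W\<close> insert.prems unfolding W_def by blast
        then show ?thesis by (simp add: dist_real_def abs_minus_commute)
      qed
    qed auto
    then have "\<bar>F (r(k := q k)) - F r - partial k F p * (q k - p k)\<bar> \<le> e * \<bar>q k - p k\<bar>"
      using rk by (simp add: algebra_simps)
    moreover have "\<bar>F r - F p - (\<Sum>i\<in>L. partial i F p * (q i - p i))\<bar> \<le> e * (\<Sum>i\<in>L. \<bar>q i - p i\<bar>)"
      using insert by (simp add: r_def)
    ultimately show ?case
      unfolding r' using insert.hyps by (simp add: distrib_left)
  qed simp
  show thesis
  proof (rule that[of V])
    show "open V" "p \<in> V" unfolding V_def using K open_box[OF K(1), of p d] by auto
    show "V \<subseteq> V0" using VW by (auto simp: W_def)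
    fix q assume q: "q \<in> V"
    \<comment> \<open>\<open>q\<close> is exchanged for the point that equals \<open>p\<close>
      outside \<open>J\<close>; both lie in \<open>V0\<close> and agree on \<open>J\<close>, so
      \<open>F\<close> does not see the exchange.\<close>
    have "(\<lambda>i. if i \<in> J then q i else p i) \<in> V" using q K(2) by (auto simp: V_def)
    then have "F (\<lambda>i. if i \<in> J then q i else p i) = F q"
      using q VW by (intro V0(4)[unfolded depends_on_def, rule_format]) (auto simp: W_def)
    with est[OF q V0(3)] show "\<bar>F q - F p - (\<Sum>i\<in>J. partial i F p * (q i - p i))\<bar> \<le> e * (\<Sum>i\<in>J. \<bar>q i - p i\<bar>)"
      by simp
  qed
qed

lemma tendsto_diff_quotient_sum:
  fixes \<gamma> :: "real \<Rightarrow> 'i \<Rightarrow> real"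
  assumes "finite J" "\<And>i. i \<in> J \<Longrightarrow> ((\<lambda>t. \<gamma> t i) has_real_derivative \<gamma>' i) (at t0)"
  shows "((\<lambda>t. \<Sum>i\<in>J. \<bar>(\<gamma> t i - \<gamma> t0 i) / (t - t0)\<bar>) \<longlongrightarrow> (\<Sum>i\<in>J. \<bar>\<gamma>' i\<bar>)) (at t0)"
  using assms(2) by (intro tendsto_sum tendsto_rabs) (simp add: has_field_derivative_iff)

text \<open>The remainder is at most \<open>e'\<close> times the sum of the increments of the
  coordinates in \<open>J\<close>; divided by \<open>t - t0\<close> this sum converges, and
  eventually stays below \<open>C\<close>. The infinitely many other coordinates only have to
  converge one by one, which brings \<open>\<gamma> t\<close> into \<open>V\<close>.\<close>

lemma has_derivative_along_curve:
  fixes F :: "('i \<Rightarrow> real) \<Rightarrow> real"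
  assumes V0: "open V0" "\<gamma> t0 \<in> V0" "finite J" "depends_on V0 J F"
    and diff: "\<And>i q. q \<in> V0 \<Longrightarrow> (\<lambda>t. F (q(i := t))) differentiable (at (q i))"
    and cont: "\<And>i. continuous_on V0 (partial i F)"
    and \<gamma>: "\<And>i. ((\<lambda>t. \<gamma> t i) has_real_derivative \<gamma>' i) (at t0)"
  shows "((\<lambda>t. F (\<gamma> t)) has_real_derivative (\<Sum>i\<in>J. partial i F (\<gamma> t0) * \<gamma>' i)) (at t0)"
proof -
  define p where "p = \<gamma> t0"
  define R where "R t = F (\<gamma> t) - F p - (\<Sum>i\<in>J. partial i F p * (\<gamma> t i - p i))" for t
  define C where "C = (\<Sum>i\<in>J. \<bar>\<gamma>' i\<bar>) + 1"
  have "C > 0" unfolding C_def by (intro add_nonneg_pos sum_nonneg) auto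
  have "((\<lambda>t. R t / (t - t0)) \<longlongrightarrow> 0) (at t0)"
  proof (rule tendstoI)
    fix e :: real assume "e > 0"
    define e' where "e' = e / (2 * C)"
    have "e' > 0" using \<open>e > 0\<close> \<open>C > 0\<close> by (simp add: e'_def)
    obtain V where V: "open V" "p \<in> V"
      "\<And>q. q \<in> V \<Longrightarrow> \<bar>F q - F p - (\<Sum>i\<in>J. partial i F p * (q i - p i))\<bar> \<le> e' * (\<Sum>i\<in>J. \<bar>q i - p i\<bar>)"
      by (rule coordinate_increment[OF V0(1) _ V0(3,4) diff cont \<open>e' > 0\<close>, of p])
        (use V0(2) p_def in auto)
    have "((\<lambda>t. \<gamma> t i) \<longlongrightarrow> p i) (at t0)" for i
      using DERIV_isCont[OF \<gamma>[of i]] by (simp add: isCont_def p_def)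
    then have ev1: "\<forall>\<^sub>F t in at t0. \<gamma> t \<in> V"
      by (rule eventually_in_open_coordinatewise[OF V(1,2)])
    have ev2: "\<forall>\<^sub>F t in at t0. (\<Sum>i\<in>J. \<bar>(\<gamma> t i - p i) / (t - t0)\<bar>) < C"
      unfolding p_def C_def
      by (rule order_tendstoD(2)[OF tendsto_diff_quotient_sum[OF V0(3) \<gamma>]]) simp
    show "\<forall>\<^sub>F t in at t0. dist (R t / (t - t0)) 0 < e"
      using ev1 ev2
    proof eventually_elim
      case (elim t)
      have "\<bar>R t\<bar> / \<bar>t - t0\<bar> \<le> e' * (\<Sum>i\<in>J. \<bar>\<gamma> t i - p i\<bar>) / \<bar>t - t0\<bar>"
        unfolding R_def using V(3)[OF elim(1)] by (intro divide_right_mono) auto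
      also have "\<dots> = e' * (\<Sum>i\<in>J. \<bar>(\<gamma> t i - p i) / (t - t0)\<bar>)"
        by (simp add: sum_divide_distrib abs_divide flip: times_divide_eq_right)
      also have "\<dots> \<le> e' * C" using elim(2) \<open>e' > 0\<close> by simp
      also have "\<dots> < e" using \<open>C > 0\<close> \<open>e > 0\<close> by (simp add: e'_def)
      finally show ?case by (simp add: abs_divide)
    qed
  qed
  then have "(R has_real_derivative 0) (at t0)"
    unfolding has_field_derivative_iff by (simp add: R_def p_def)
  moreover have "((\<lambda>t. F p + (\<Sum>i\<in>J. partial i F p * (\<gamma> t i - p i))) has_real_derivative
      (\<Sum>i\<in>J. partial i F p * \<gamma>' i)) (at t0)"
    by (auto intro!: derivative_eq_intros \<gamma> simp: mult.commute)
  ultimately have "((\<lambda>t. R t + (F p + (\<Sum>i\<in>J. partial i F p * (\<gamma> t i - p i)))) has_real_derivative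
      0 + (\<Sum>i\<in>J. partial i F p * \<gamma>' i)) (at t0)"
    by (rule DERIV_add)
  then show ?thesis by (simp add: R_def p_def)
qed

text \<open>A smooth function depends locally on finitely many coordinates, so the sum is finite at
  every point of its domain.\<close>

definition dder :: "('i \<Rightarrow> real) \<Rightarrow> (('i \<Rightarrow> real) \<Rightarrow> real) \<Rightarrow> ('i \<Rightarrow> real) \<Rightarrow> real" where
  "dder a F q = (\<Sum>i | partial i F q \<noteq> 0. a i * partial i F q)"

lemma dder_eq_sum:
  assumes "finite J" "\<And>i. i \<notin> J \<Longrightarrow> partial i F q = 0"
  shows "dder a F q = (\<Sum>i\<in>J. a i * partial i F q)"
  unfolding dder_def using assms by (intro sum.mono_neutral_left) auto

lemma dder_finite: "dder a F q = (\<Sum>i\<in>UNIV. a i * partial i F q)" for q :: "'i::finite \<Rightarrow> real"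
  by (rule dder_eq_sum) auto

lemma dder_cong:
  assumes "open S" "p \<in> S" "\<And>q. q \<in> S \<Longrightarrow> F q = G q"
  shows "dder a F p = dder a G p"
  using partial_cong[OF assms] by (simp add: dder_def)

lemma smooth_coord_local_support:
  assumes "smooth_coord S F" "p \<in> S"
  obtains V J where "open V" "p \<in> V" "V \<subseteq> S" "finite J" "depends_on V J F"
  using smooth_coordD(3)[OF assms(1)] assms(2) unfolding locfin_def by meson

lemma finite_partial_support:
  assumes "smooth_coord S F" "p \<in> S"
  shows "finite {i. partial i F p \<noteq> 0}"
proof -
  obtain V J where V: "open V" "p \<in> V" "V \<subseteq> S" "finite J" "depends_on V J F"
    using smooth_coord_local_support[OF assms] .
  then have "{i. partial i F p \<noteq> 0} \<subseteq> J" using partial_eq_0[OF V(1,5)] by blast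
  then show ?thesis using V(4) finite_subset by blast
qed

lemma chain_partial_aux:
  fixes F :: "('i \<Rightarrow> real) \<Rightarrow> real" and G :: "('k \<Rightarrow> real) \<Rightarrow> 'i \<Rightarrow> real"
  assumes F: "smooth_coord S F" and q: "G q \<in> S"
    and G: "\<And>i. (\<lambda>t. G (q(k := t)) i) differentiable (at (q k))"
  shows "((\<lambda>t. F (G (q(k := t)))) has_real_derivative
    dder (\<lambda>i. partial k (\<lambda>q. G q i) q) F (G q)) (at (q k))"
proof -
  obtain V J where V: "open V" "G q \<in> V" "V \<subseteq> S" "finite J" "depends_on V J F"
    using smooth_coord_local_support[OF F q] .
  have "((\<lambda>t. F (G (q(k := t)))) has_real_derivative
    (\<Sum>i\<in>J. partial i F (G (q(k := q k))) * partial k (\<lambda>q. G q i) q)) (at (q k))"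
  proof (rule has_derivative_along_curve[where \<gamma>="\<lambda>t. G (q(k := t))"])
    show "((\<lambda>t. G (q(k := t)) i) has_real_derivative partial k (\<lambda>q. G q i) q) (at (q k))" for i
      using has_partial[of "\<lambda>q. G q i", OF G] .
    show "(\<lambda>t. F (r(i := t))) differentiable at (r i)" if "r \<in> V" for i r
      using smooth_coordD(5)[OF F] that V(3) by blast
    show "continuous_on V (partial i F)" for i
      using smooth_coordD(2)[OF smooth_coordD(4)[OF F]] V(3) continuous_on_subset by blast
  qed (use V in auto)
  then show ?thesis
    using dder_eq_sum[of J F "G q"] V partial_eq_0[OF V(1,5)] by (simp add: mult.commute)
qed

lemma chain_partial:
  fixes F :: "('i \<Rightarrow> real) \<Rightarrow> real" and G :: "('k \<Rightarrow> real) \<Rightarrow> 'i \<Rightarrow> real"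
  assumes "smooth_coord S F" "G q \<in> S" "\<And>i. (\<lambda>t. G (q(k := t)) i) differentiable (at (q k))"
  shows "partial k (\<lambda>q. F (G q)) q = dder (\<lambda>i. partial k (\<lambda>q. G q i) q) F (G q)"
  by (rule partialI[OF chain_partial_aux[OF assms]])

lemma continuous_on_comp_coordinatewise:
  fixes G :: "('k \<Rightarrow> real) \<Rightarrow> 'i \<Rightarrow> real"
  assumes "continuous_on S F" "\<And>i. continuous_on T (\<lambda>q. G q i)" "G ` T \<subseteq> S"
  shows "continuous_on T (\<lambda>q. F (G q))"
  using continuous_on_compose2[OF assms(1) continuous_on_coordinatewise_then_product assms(3)] assms(2) by blast

lemma open_preimage_coordinatewise:
  fixes G :: "'a::topological_space \<Rightarrow> 'i \<Rightarrow> real"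
  assumes "open T" "open V" "\<And>i. continuous_on T (\<lambda>q. G q i)"
  shows "open {q \<in> T. G q \<in> V}"
proof -
  have "continuous_on T G" using assms(3) by (rule continuous_on_coordinatewise_then_product)
  from continuous_open_preimage[OF this assms(1,2)] show ?thesis
    by (simp add: vimage_def Int_def)
qed

lemma locfin_comp:
  fixes G :: "('k \<Rightarrow> real) \<Rightarrow> 'i \<Rightarrow> real"
  assumes F: "locfin S F" and T: "open T" and G: "\<And>i. continuous_on T (\<lambda>q. G q i)" "\<And>i. locfin T (\<lambda>q. G q i)"
    and "G ` T \<subseteq> S"
  shows "locfin T (\<lambda>q. F (G q))"
  unfolding locfin_def
proof
  fix p assume p: "p \<in> T"
  then have "G p \<in> S" using assms(5) by blast
  with F[unfolded locfin_def] have "\<exists>V J. open V \<and> G p \<in> V \<and> V \<subseteq> S \<and> finite J \<and> depends_on V J F" by (rule bspec)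
  then obtain V J where V: "open V" "G p \<in> V" "finite J" "depends_on V J F" by (elim exE conjE)
  have "\<forall>i. \<exists>W K. open W \<and> p \<in> W \<and> W \<subseteq> T \<and> finite K \<and> depends_on W K (\<lambda>q. G q i)"
  proof
    show "\<exists>W K. open W \<and> p \<in> W \<and> W \<subseteq> T \<and> finite K \<and> depends_on W K (\<lambda>q. G q i)" for i
      using G(2)[of i, unfolded locfin_def] p by (rule bspec)
  qed
  from choice[OF this] obtain W
    where "\<forall>i. \<exists>K. open (W i) \<and> p \<in> W i \<and> W i \<subseteq> T \<and> finite K \<and> depends_on (W i) K (\<lambda>q. G q i)" ..
  from choice[OF this] obtain K
    where "\<forall>i. open (W i) \<and> p \<in> W i \<and> W i \<subseteq> T \<and> finite (K i) \<and> depends_on (W i) (K i) (\<lambda>q. G q i)" ..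
  then have W: "\<And>i. open (W i) \<and> p \<in> W i \<and> W i \<subseteq> T \<and> finite (K i) \<and> depends_on (W i) (K i) (\<lambda>q. G q i)"
    by blast
  \<comment> \<open>Only the components of \<open>G\<close> with index in \<open>J\<close> matter
    near \<open>p\<close>, so finitely many neighbourhoods \<open>W i\<close> are intersected and
    finitely many index sets \<open>K i\<close> united.\<close>
  define U where "U = {q \<in> T. G q \<in> V} \<inter> (\<Inter>i\<in>J. W i)"
  have "open U" unfolding U_def
    using W V(3) open_preimage_coordinatewise[OF T V(1) G(1)] by (intro open_Int open_INT ballI) auto
  moreover have "depends_on U (\<Union>i\<in>J. K i) (\<lambda>q. F (G q))"
    unfolding depends_on_def
  proof (intro ballI impI)
    fix q r assume qr: "q \<in> U" "r \<in> U" "\<forall>i\<in>\<Union>(K ` J). q i = r i"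
    have "G q i = G r i" if "i \<in> J" for i
    proof -
      have "q \<in> W i" "r \<in> W i" "\<forall>j\<in>K i. q j = r j" using qr that by (auto simp: U_def)
      with W[of i] show ?thesis unfolding depends_on_def by blast
    qed
    moreover have "G q \<in> V" "G r \<in> V" using qr by (auto simp: U_def)
    ultimately show "F (G q) = F (G r)" using V(4) unfolding depends_on_def by blast
  qed
  ultimately show "\<exists>V J. open V \<and> p \<in> V \<and> V \<subseteq> T \<and> finite J \<and> depends_on V J (\<lambda>q. F (G q))"
    using p V W by (intro exI[of _ U] exI[of _ "\<Union>i\<in>J. K i"]) (auto simp: U_def)
qed

text \<open>The chain rule expresses a partial derivative of the composite by those of
  \<open>G\<close>, which have one order less, and by \<open>partial i F\<close> composed with
  \<open>G\<close>, to which the induction hypothesis applies because \<open>F\<close> is arbitrary.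
  The sum is finite only near each point; hence \<open>ck_locally\<close>.\<close>

lemma ck_comp:
  fixes F :: "('i \<Rightarrow> real) \<Rightarrow> real" and G :: "('k \<Rightarrow> real) \<Rightarrow> 'i \<Rightarrow> real"
  assumes "smooth_coord S F" "open T" "\<And>i. ck r T (\<lambda>q. G q i)" "G ` T \<subseteq> S"
  shows "ck r T (\<lambda>q. F (G q))"
  using assms
proof (induction r arbitrary: F T)
  case 0
  have "continuous_on T (\<lambda>q. F (G q))"
    by (rule continuous_on_comp_coordinatewise[OF smooth_coordD(2)[OF 0(1)] _ 0(4)]) (use 0(3) in auto)
  moreover have "locfin T (\<lambda>q. F (G q))"
    by (rule locfin_comp[OF smooth_coordD(3)[OF 0(1)] 0(2) _ _ 0(4)]) (use 0(3) in auto)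
  ultimately show ?case by simp
next
  case (Suc r)
  note F = Suc.prems(1)
  have cont: "continuous_on T (\<lambda>q. G q i)" for i using Suc.prems(3) by simp
  have lf: "locfin T (\<lambda>q. G q i)" for i using Suc.prems(3) by simp
  have dG: "(\<lambda>t. G (q(k := t)) i) differentiable (at (q k))" if "q \<in> T" for q k i
    using Suc.prems(3) that by simp
  have "continuous_on T (\<lambda>q. F (G q))"
    by (rule continuous_on_comp_coordinatewise[OF smooth_coordD(2)[OF F] cont Suc.prems(4)])
  moreover have "locfin T (\<lambda>q. F (G q))"
    by (rule locfin_comp[OF smooth_coordD(3)[OF F] Suc.prems(2) cont lf Suc.prems(4)])
  moreover have "(\<lambda>t. F (G (q(k := t)))) differentiable (at (q k))" if "q \<in> T" for q k
  proof -
    have "((\<lambda>t. F (G (q(k := t)))) has_real_derivative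
      dder (\<lambda>i. partial k (\<lambda>q. G q i) q) F (G q)) (at (q k))"
      by (rule chain_partial_aux[OF F]) (use that Suc.prems(4) dG[OF that] in \<open>auto simp del: fun_upd_apply\<close>)
    then show ?thesis using real_differentiable_def by blast
  qed
  moreover have "ck r T (partial k (\<lambda>q. F (G q)))" for k
  proof (rule ck_locally)
    fix p assume p: "p \<in> T"
    then have "G p \<in> S" using Suc.prems(4) by auto
    then obtain V J where V: "open V" "G p \<in> V" "V \<subseteq> S" "finite J" "depends_on V J F"
      using smooth_coord_local_support[OF F \<open>G p \<in> S\<close>] by metis
    define U where "U = {q \<in> T. G q \<in> V}"
    have oU: "open U" unfolding U_def using open_preimage_coordinatewise[OF Suc.prems(2) V(1) cont] .
    have UT: "U \<subseteq> T" by (auto simp: U_def)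
    have "ck r U (\<lambda>q. \<Sum>i\<in>J. partial k (\<lambda>q. G q i) q * partial i F (G q))"
    proof (intro ck_sum ck_mult oU)
      fix i
      show "ck r U (partial k (\<lambda>q. G q i))"
        using Suc.prems(3)[of i] ck_subset[OF _ oU UT] by simp
      have ckG: "ck r T (\<lambda>q. G q i)" for i by (rule ck_mono[OF Suc.prems(3)]) simp
      show "ck r U (\<lambda>q. partial i F (G q))"
      proof (rule Suc.IH[OF smooth_coordD(4)[OF F] oU])
        show "ck r U (\<lambda>q. G q i)" for i
          by (rule ck_subset[OF ckG oU UT])
      qed (use UT Suc.prems(4) in auto)
    qed
    then have "ck r U (partial k (\<lambda>q. F (G q)))"
    proof (rule ck_cong[OF oU, rotated])
      fix q assume q: "q \<in> U"
      then have "q \<in> T" "G q \<in> V" by (auto simp: U_def)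
      with V have "partial k (\<lambda>q. F (G q)) q = dder (\<lambda>i. partial k (\<lambda>q. G q i) q) F (G q)"
        by (intro chain_partial[OF F]) (use dG[OF \<open>q \<in> T\<close>] in \<open>auto simp del: fun_upd_apply\<close>)
      also have "\<dots> = (\<Sum>i\<in>J. partial k (\<lambda>q. G q i) q * partial i F (G q))"
        using V \<open>G q \<in> V\<close> partial_eq_0[OF V(1,5)] by (intro dder_eq_sum) auto
      finally show "(\<Sum>i\<in>J. partial k (\<lambda>q. G q i) q * partial i F (G q)) = partial k (\<lambda>q. F (G q)) q" by simp
    qed
    then show "\<exists>U. open U \<and> p \<in> U \<and> U \<subseteq> T \<and> ck r U (partial k (\<lambda>q. F (G q)))"
      using oU UT p V(2) by (intro exI[of _ U]) (auto simp: U_def)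
  qed
  ultimately show ?case by simp
qed

lemma smooth_coord_comp:
  fixes F :: "('i \<Rightarrow> real) \<Rightarrow> real" and G :: "('k \<Rightarrow> real) \<Rightarrow> 'i \<Rightarrow> real"
  assumes "smooth_coord S F" "open T" "\<And>i. smooth_coord T (\<lambda>q. G q i)" "G ` T \<subseteq> S"
  shows "smooth_coord T (\<lambda>q. F (G q))"
proof -
  have "ck r T (\<lambda>q. F (G q))" for r
    by (rule ck_comp[OF assms(1,2) smooth_coordD(6)[OF assms(3)] assms(4)])
  with assms(2) show ?thesis by (simp add: smooth_coord_iff_ck)
qed

text \<open>Both sides become finite sums before they are interchanged: \<open>J\<close> supports
  the derivatives of \<open>F\<close> at \<open>G q\<close>, and \<open>K\<close> collects the
  supports of the components of \<open>G\<close> with index in \<open>J\<close>. The direction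
  \<open>b\<close> may have infinitely many nonzero entries, as the Cartan fields do.\<close>

lemma chain_dder:
  fixes F :: "('i \<Rightarrow> real) \<Rightarrow> real" and G :: "('k \<Rightarrow> real) \<Rightarrow> 'i \<Rightarrow> real"
  assumes F: "smooth_coord S F" "G q \<in> S" and G: "\<And>i. smooth_coord T (\<lambda>q. G q i)" "q \<in> T"
  shows "dder b (\<lambda>q. F (G q)) q = dder (\<lambda>i. dder b (\<lambda>q. G q i) q) F (G q)"
proof -
  define J where "J = {i. partial i F (G q) \<noteq> 0}"
  have fJ: "finite J" unfolding J_def by (rule finite_partial_support[OF F])
  define K where "K = (\<Union>i\<in>J. {k. partial k (\<lambda>q. G q i) q \<noteq> 0})"
  have fK: "finite K" unfolding K_def
    using fJ by (intro finite_UN_I finite_partial_support[OF G]) auto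
  have ch: "partial k (\<lambda>q. F (G q)) q = (\<Sum>i\<in>J. partial k (\<lambda>q. G q i) q * partial i F (G q))" for k
  proof -
    have "partial k (\<lambda>q. F (G q)) q = dder (\<lambda>i. partial k (\<lambda>q. G q i) q) F (G q)"
      by (rule chain_partial[OF F(1)]) (use F(2) smooth_coordD(5)[OF G] in \<open>auto simp del: fun_upd_apply\<close>)
    then show ?thesis by (simp add: dder_def J_def)
  qed
  have "dder b (\<lambda>q. F (G q)) q = (\<Sum>k\<in>K. b k * partial k (\<lambda>q. F (G q)) q)"
  proof (rule dder_eq_sum[OF fK])
    fix k assume "k \<notin> K"
    then have "partial k (\<lambda>q. G q i) q = 0" if "i \<in> J" for i using that by (auto simp: K_def)
    then show "partial k (\<lambda>q. F (G q)) q = 0" unfolding ch by simp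
  qed
  also have "\<dots> = (\<Sum>i\<in>J. (\<Sum>k\<in>K. b k * partial k (\<lambda>q. G q i) q) * partial i F (G q))"
    unfolding ch sum_distrib_left sum_distrib_right
    by (subst sum.swap) (simp add: mult.assoc)
  also have "\<dots> = (\<Sum>i\<in>J. dder b (\<lambda>q. G q i) q * partial i F (G q))"
  proof (rule sum.cong[OF refl])
    fix i assume "i \<in> J"
    then have "dder b (\<lambda>q. G q i) q = (\<Sum>k\<in>K. b k * partial k (\<lambda>q. G q i) q)"
      by (intro dder_eq_sum fK) (auto simp: K_def)
    then show "(\<Sum>k\<in>K. b k * partial k (\<lambda>q. G q i) q) * partial i F (G q) = dder b (\<lambda>q. G q i) q * partial i F (G q)"
      by simp
  qed
  also have "\<dots> = dder (\<lambda>i. dder b (\<lambda>q. G q i) q) F (G q)"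
    by (simp add: dder_def J_def)
  finally show ?thesis .
qed

section \<open>Rules for partial and directional derivatives\<close>

lemma partial_const [simp]: "partial i (\<lambda>q. c) p = 0"
  by (simp add: partial_def)

lemma partial_coord: "partial j (\<lambda>q. q i) p = (if j = i then 1 else 0)"
  by (rule partialI) (auto intro!: derivative_eq_intros)

lemma partial_add:
  assumes "smooth_coord S F" "smooth_coord S G" "p \<in> S"
  shows "partial i (\<lambda>q. F q + G q) p = partial i F p + partial i G p"
  by (rule partialI, rule DERIV_add) (use assms in \<open>auto intro!: has_partial smooth_coordD(5)\<close>)

lemma partial_mult:
  assumes "smooth_coord S F" "smooth_coord S G" "p \<in> S"
  shows "partial i (\<lambda>q. F q * G q) p = partial i F p * G p + F p * partial i G p"
proof -
  have "((\<lambda>t. F (p(i := t))) has_real_derivative partial i F p) (at (p i))"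
    "((\<lambda>t. G (p(i := t))) has_real_derivative partial i G p) (at (p i))"
    using assms by (auto intro!: has_partial smooth_coordD(5))
  from DERIV_mult[OF this] show ?thesis by (intro partialI) (simp add: algebra_simps)
qed

lemma partial_sum:
  assumes "open S" "\<And>a. a \<in> A \<Longrightarrow> smooth_coord S (F a)" "p \<in> S"
  shows "partial i (\<lambda>q. \<Sum>a\<in>A. F a q) p = (\<Sum>a\<in>A. partial i (F a) p)"
  using assms(2)
proof (induction A rule: infinite_finite_induct)
  case (insert a A)
  then have "partial i (\<lambda>q. F a q + (\<Sum>a\<in>A. F a q)) p = partial i (F a) p + partial i (\<lambda>q. \<Sum>a\<in>A. F a q) p"
    using assms by (intro partial_add[where S=S] smooth_coord_sum) auto
  with insert show ?case by simp
qed auto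

text \<open>\<open>dder\<close> sums over the support of its own function; identities between
  several of them need one common index set.\<close>

lemma finite_common_support:
  assumes "finite A" "\<And>a. a \<in> A \<Longrightarrow> smooth_coord S (F a)" "p \<in> S"
  obtains J where "finite J" "\<And>a i. a \<in> A \<Longrightarrow> i \<notin> J \<Longrightarrow> partial i (F a) p = 0"
proof
  show "finite (\<Union>a\<in>A. {i. partial i (F a) p \<noteq> 0})"
    using assms by (intro finite_UN_I finite_partial_support) auto
qed auto

lemma dder_add:
  assumes "smooth_coord S F" "smooth_coord S G" "p \<in> S"
  shows "dder b (\<lambda>q. F q + G q) p = dder b F p + dder b G p"
proof -
  obtain J where J: "finite J" "\<And>a i. a \<in> {F, G} \<Longrightarrow> i \<notin> J \<Longrightarrow> partial i a p = 0"
    using finite_common_support[of "{F, G}" S "\<lambda>a. a" p] assms by auto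
  have "dder b (\<lambda>q. F q + G q) p = (\<Sum>i\<in>J. b i * partial i (\<lambda>q. F q + G q) p)"
    using J by (intro dder_eq_sum) (auto simp: partial_add[OF assms])
  moreover have "dder b F p = (\<Sum>i\<in>J. b i * partial i F p)" "dder b G p = (\<Sum>i\<in>J. b i * partial i G p)"
    using J by (auto intro!: dder_eq_sum)
  ultimately show ?thesis by (simp add: partial_add[OF assms] distrib_left sum.distrib)
qed

lemma dder_mult:
  assumes "smooth_coord S F" "smooth_coord S G" "p \<in> S"
  shows "dder b (\<lambda>q. F q * G q) p = dder b F p * G p + F p * dder b G p"
proof -
  obtain J where J: "finite J" "\<And>a i. a \<in> {F, G} \<Longrightarrow> i \<notin> J \<Longrightarrow> partial i a p = 0"
    using finite_common_support[of "{F, G}" S "\<lambda>a. a" p] assms by auto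
  have "dder b (\<lambda>q. F q * G q) p = (\<Sum>i\<in>J. b i * partial i (\<lambda>q. F q * G q) p)"
    using J by (intro dder_eq_sum) (auto simp: partial_mult[OF assms])
  moreover have "dder b F p = (\<Sum>i\<in>J. b i * partial i F p)" "dder b G p = (\<Sum>i\<in>J. b i * partial i G p)"
    using J by (auto intro!: dder_eq_sum)
  ultimately show ?thesis
    by (simp add: partial_mult[OF assms] distrib_left sum.distrib sum_distrib_left sum_distrib_right algebra_simps)
qed

lemma dder_const [simp]: "dder b (\<lambda>q. c) p = 0"
  by (simp add: dder_def)

lemma dder_coord [simp]: "dder b (\<lambda>q. q i) p = b i"
  by (subst dder_eq_sum[of "{i}"]) (auto simp: partial_coord)

lemma dder_sum:
  assumes "open S" "\<And>a. a \<in> A \<Longrightarrow> smooth_coord S (F a)" "p \<in> S"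
  shows "dder b (\<lambda>q. \<Sum>a\<in>A. F a q) p = (\<Sum>a\<in>A. dder b (F a) p)"
  using assms(2)
proof (induction A rule: infinite_finite_induct)
  case (insert a A)
  then have "dder b (\<lambda>q. F a q + (\<Sum>a\<in>A. F a q)) p = dder b (F a) p + dder b (\<lambda>q. \<Sum>a\<in>A. F a q) p"
    using assms by (intro dder_add[where S=S] smooth_coord_sum) auto
  with insert show ?case by simp
qed auto

lemma smooth_coord_dder:
  assumes F: "smooth_coord S F" and a: "\<And>i. smooth_coord S (\<lambda>q. a q i)"
  shows "smooth_coord S (\<lambda>q. dder (a q) F q)"
proof (rule smooth_coord_locally)
  fix p assume p: "p \<in> S"
  obtain V J where V: "open V" "p \<in> V" "V \<subseteq> S" "finite J" "depends_on V J F"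
    using smooth_coord_local_support[OF F p] .
  have "smooth_coord V (\<lambda>q. \<Sum>i\<in>J. a q i * partial i F q)"
    using V a smooth_coordD(4)[OF F] by (intro smooth_coord_sum smooth_coord_mult) (auto intro: smooth_coord_subset)
  then have "smooth_coord V (\<lambda>q. dder (a q) F q)"
    by (rule smooth_coord_cong) (use V partial_eq_0[OF V(1,5)] in \<open>simp add: dder_eq_sum\<close>)
  with V show "\<exists>T. p \<in> T \<and> T \<subseteq> S \<and> smooth_coord T (\<lambda>q. dder (a q) F q)" by blast
qed

text \<open>The derivative of 1/F is -(1/F)^2 times that of F, so order \<open>r\<close> of the
  reciprocal gives order \<open>r + 1\<close>.\<close>

lemma smooth_coord_inverse:
  assumes F: "smooth_coord S F" and nz: "\<And>q. q \<in> S \<Longrightarrow> F q \<noteq> 0"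
  shows "smooth_coord S (\<lambda>q. inverse (F q))"
proof -
  have o: "open S" using F smooth_coordD(1) by blast
  have "ck r S (\<lambda>q. inverse (F q))" for r
  proof (induction r)
    case 0
    have "continuous_on S (\<lambda>q. inverse (F q))"
      using smooth_coordD(2)[OF F] nz by (intro continuous_on_inverse) auto
    with locfin_binop[OF smooth_coordD(3)[OF F] smooth_coordD(3)[OF F], of "\<lambda>a b. inverse a"]
    show ?case by simp
  next
    case (Suc r)
    have d: "((\<lambda>t. inverse (F (p(i := t)))) has_real_derivative
        - (inverse (F p) * partial i F p * inverse (F p))) (at (p i))" if "p \<in> S" for p i
    proof -
      have "((\<lambda>t. F (p(i := t))) has_real_derivative partial i F p) (at (p i))"
        by (rule has_partial[OF smooth_coordD(5)[OF F that]])
      from DERIV_inverse'[OF this] nz[OF that] show ?thesis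
        by (simp only: fun_upd_triv not_False_eq_True simp_thms)
    qed
    have "ck r S (\<lambda>p. (-1) * (inverse (F p) * partial i F p * inverse (F p)))" for i
      by (intro ck_mult ck_const o Suc smooth_coordD(6)[OF smooth_coordD(4)[OF F]])
    then have "ck r S (partial i (\<lambda>q. inverse (F q)))" for i
    proof (rule ck_cong[OF o, rotated])
      show "(- 1) * (inverse (F q) * partial i F q * inverse (F q)) = partial i (\<lambda>q. inverse (F q)) q"
        if "q \<in> S" for q
        using partialI[of "\<lambda>q. inverse (F q)", OF d[OF that]] by simp
    qed
    moreover have "continuous_on S (\<lambda>q. inverse (F q))" "locfin S (\<lambda>q. inverse (F q))"
      using Suc ck_imp_continuous_on ck_imp_locfin by blast+
    moreover have "(\<lambda>t. inverse (F (p(i := t)))) differentiable (at (p i))" if "p \<in> S" for p i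
      using d[OF that] real_differentiable_def by blast
    ultimately show ?case by simp
  qed
  with o show ?thesis by (simp add: smooth_coord_iff_ck)
qed

text \<open>The bridge from coordinate functions to the Frechet derivative on
  \<open>real ^ 'n\<close>, in terms of which brackets, differentials and the transformation law of
  fields are defined.\<close>

lemma has_derivative_vec:
  fixes F :: "('n::finite \<Rightarrow> real) \<Rightarrow> real"
  assumes F: "smooth_coord S F" and y: "vec_nth y \<in> S"
  shows "((\<lambda>y. F (vec_nth y)) has_derivative (\<lambda>v. dder (vec_nth v) F (vec_nth y))) (at y)"
proof -
  define p where "p = vec_nth y"
  have lin: "(\<lambda>v::real^'n. dder (vec_nth v) F p) = (\<lambda>v. \<Sum>i\<in>UNIV. (v $ i) * partial i F p)"
    by (simp add: dder_finite)
  have bl: "bounded_linear (\<lambda>v::real^'n. dder (vec_nth v) F p)"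
    unfolding lin by (intro bounded_linear_sum bounded_linear_mult_left[THEN bounded_linear_compose] bounded_linear_vec_nth)
  have "\<exists>d>0. \<forall>z. norm (z - y) < d \<longrightarrow>
      norm (F (vec_nth z) - F (vec_nth y) - dder (vec_nth (z - y)) F p) \<le> e * norm (z - y)" if "e > 0" for e
  proof -
    \<comment> \<open>The increment is controlled by the sum of \<open>CARD('n)\<close> components,
      each at most the norm.\<close>
    define e' where "e' = e / CARD('n)"
    have "e' > 0" using that by (simp add: e'_def)
    have dep: "depends_on S UNIV F" by (auto simp: depends_on_def intro: arg_cong[of _ _ F])
    obtain V where V: "open V" "p \<in> V"
      "\<And>q. q \<in> V \<Longrightarrow> \<bar>F q - F p - (\<Sum>i\<in>UNIV. partial i F p * (q i - p i))\<bar> \<le> e' * (\<Sum>i\<in>UNIV. \<bar>q i - p i\<bar>)"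
      by (rule coordinate_increment[OF smooth_coordD(1)[OF F] _ finite dep smooth_coordD(5)[OF F]
            smooth_coordD(2)[OF smooth_coordD(4)[OF F]] \<open>e' > 0\<close>, of p]) (use y p_def in auto)
    have "open (vec_nth -` V :: (real^'n) set)"
      by (intro open_vimage V(1) continuous_on_coordinatewise_then_product) (intro continuous_intros)
    then obtain d where d: "d > 0" "ball y d \<subseteq> vec_nth -` V"
      using V(2) p_def open_contains_ball by (metis vimageI)
    show ?thesis
    proof (intro exI[of _ d] conjI allI impI d(1))
      fix z :: "real^'n" assume "norm (z - y) < d"
      then have "vec_nth z \<in> V" using d(2) by (auto simp: dist_norm norm_minus_commute)
      from V(3)[OF this]
      have "\<bar>F (vec_nth z) - F p - dder (vec_nth (z - y)) F p\<bar> \<le> e' * (\<Sum>i\<in>UNIV. \<bar>(z - y) $ i\<bar>)"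
        by (simp add: dder_finite p_def mult.commute)
      also have "\<dots> \<le> e' * (\<Sum>i\<in>(UNIV::'n set). norm (z - y))"
        using \<open>e' > 0\<close> by (intro mult_left_mono sum_mono component_le_norm_cart) auto
      also have "\<dots> = e * norm (z - y)" by (simp add: e'_def)
      finally show "norm (F (vec_nth z) - F (vec_nth y) - dder (vec_nth (z - y)) F p) \<le> e * norm (z - y)"
        by (simp add: p_def)
    qed
  qed
  with bl show ?thesis unfolding has_derivative_at_alt p_def by blast
qed

lemma continuous_vec_nth_fun: "continuous_on S (vec_nth :: real^'n \<Rightarrow> 'n \<Rightarrow> real)"
  by (intro continuous_on_coordinatewise_then_product continuous_intros)

text \<open>The mean value theorem is applied twice: to the difference in direction \<open>j\<close>
  as a function of coordinate \<open>i\<close>, then to \<open>partial i F\<close> along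
  \<open>j\<close>. The left side is symmetric in \<open>i\<close> and \<open>j\<close>, which
  \<open>partial_commute\<close> exploits.\<close>

lemma second_difference:
  fixes F :: "('i \<Rightarrow> real) \<Rightarrow> real"
  assumes F: "smooth_coord S F" and "i \<noteq> j" "h > 0"
    and S: "\<And>s t. p i \<le> s \<Longrightarrow> s \<le> p i + h \<Longrightarrow> p j \<le> t \<Longrightarrow> t \<le> p j + h \<Longrightarrow> p(i := s, j := t) \<in> S"
  shows "\<exists>s t. p i \<le> s \<and> s \<le> p i + h \<and> p j \<le> t \<and> t \<le> p j + h \<and>
    F (p(i := p i + h, j := p j + h)) - F (p(i := p i + h)) - F (p(j := p j + h)) + F p
      = h * h * partial j (partial i F) (p(i := s, j := t))"
proof -
  have d1: "((\<lambda>s. F (p(i := s, j := t))) has_real_derivative partial i F (p(i := s, j := t))) (at s)"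
    if "p i \<le> s" "s \<le> p i + h" "p j \<le> t" "t \<le> p j + h" for s t
  proof -
    have "((\<lambda>u. F ((p(j := t))(i := u))) has_real_derivative partial i F ((p(j := t))(i := s))) (at s)"
      using S[OF that] \<open>i \<noteq> j\<close>
      by (intro has_partial_at[OF smooth_coordD(5)[OF F]]) (simp_all add: fun_upd_twist)
    then show ?thesis using \<open>i \<noteq> j\<close> by (simp add: fun_upd_twist)
  qed
  have d2: "((\<lambda>t. partial i F (p(i := s, j := t))) has_real_derivative partial j (partial i F) (p(i := s, j := t))) (at t)"
    if "p i \<le> s" "s \<le> p i + h" "p j \<le> t" "t \<le> p j + h" for s t
    using S[OF that] by (intro has_partial_at[OF smooth_coordD(5)[OF smooth_coordD(4)[OF F]]])
  define g where "g s = F (p(i := s, j := p j + h)) - F (p(i := s, j := p j))" for s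
  have "\<exists>s. p i < s \<and> s < p i + h \<and> g (p i + h) - g (p i) = (p i + h - p i) *
      (partial i F (p(i := s, j := p j + h)) - partial i F (p(i := s, j := p j)))"
    unfolding g_def using \<open>h > 0\<close> by (intro MVT2 DERIV_diff d1) auto
  then obtain s where s: "p i < s" "s < p i + h" "g (p i + h) - g (p i) = h *
      (partial i F (p(i := s, j := p j + h)) - partial i F (p(i := s, j := p j)))" by auto
  have "\<exists>t. p j < t \<and> t < p j + h \<and> partial i F (p(i := s, j := p j + h)) - partial i F (p(i := s, j := p j))
      = (p j + h - p j) * partial j (partial i F) (p(i := s, j := t))"
    using \<open>h > 0\<close> s by (intro MVT2 d2) auto
  then obtain t where t: "p j < t" "t < p j + h" "partial i F (p(i := s, j := p j + h)) - partial i F (p(i := s, j := p j))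
      = h * partial j (partial i F) (p(i := s, j := t))" by auto
  have "p(i := p i, j := p j + h) = p(j := p j + h)" "p(i := p i + h, j := p j) = p(i := p i + h)"
    using \<open>i \<noteq> j\<close> by auto
  then have "g (p i + h) - g (p i) = F (p(i := p i + h, j := p j + h)) - F (p(i := p i + h)) - F (p(j := p j + h)) + F p"
    by (simp add: g_def)
  with s t show ?thesis by (intro exI[of _ s] exI[of _ t]) auto
qed

lemma partial_commute:
  fixes F :: "('i \<Rightarrow> real) \<Rightarrow> real"
  assumes F: "smooth_coord S F" "p \<in> S"
  shows "partial i (partial j F) p = partial j (partial i F) p"
proof (rule ccontr)
  assume ne: "partial i (partial j F) p \<noteq> partial j (partial i F) p"
  then have ij: "i \<noteq> j" by auto
  \<comment> \<open>Half of the gap: on \<open>V\<close> each mixed derivative stays within less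
    than \<open>e\<close> of its value at \<open>p\<close>, yet by symmetry of the second difference
    the two take a common value.\<close>
  define e where "e = \<bar>partial i (partial j F) p - partial j (partial i F) p\<bar> / 2"
  have "e > 0" using ne by (simp add: e_def)
  define V where "V = (S \<inter> partial i (partial j F) -` ball (partial i (partial j F) p) e)
    \<inter> (S \<inter> partial j (partial i F) -` ball (partial j (partial i F) p) e)"
  have "open V" unfolding V_def
    by (intro open_Int continuous_open_preimage smooth_coordD(2) smooth_coordD(4) F smooth_coordD(1)[OF F(1)] open_ball)
  moreover have "p \<in> V" using F \<open>e > 0\<close> by (simp add: V_def)
  ultimately obtain J d where J: "finite J" "d > 0" "{q. \<forall>i\<in>J. \<bar>q i - p i\<bar> < d} \<subseteq> V"
    by (rule open_contains_box)
  define h where "h = d / 2"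
  have "h > 0" using J by (simp add: h_def)
  have inV: "p(k := s, l := t) \<in> V"
    if "p k \<le> s" "s \<le> p k + h" "p l \<le> t" "t \<le> p l + h" for s t k l
    using J that by (auto simp: h_def subset_iff)
  have VS: "V \<subseteq> S" by (auto simp: V_def)
  obtain s t where st: "p i \<le> s" "s \<le> p i + h" "p j \<le> t" "t \<le> p j + h" and
    1: "F (p(i := p i + h, j := p j + h)) - F (p(i := p i + h)) - F (p(j := p j + h)) + F p
      = h * h * partial j (partial i F) (p(i := s, j := t))"
    using second_difference[OF F(1) ij \<open>h > 0\<close>, of p] inV VS by blast
  obtain s' t' where st': "p j \<le> s'" "s' \<le> p j + h" "p i \<le> t'" "t' \<le> p i + h" and
    2: "F (p(j := p j + h, i := p i + h)) - F (p(j := p j + h)) - F (p(i := p i + h)) + F p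
      = h * h * partial i (partial j F) (p(j := s', i := t'))"
    using second_difference[OF F(1) ij[symmetric] \<open>h > 0\<close>, of p] inV VS by blast
  have sw: "p(j := p j + h, i := p i + h) = p(i := p i + h, j := p j + h)" using ij by auto
  have "h * h * partial j (partial i F) (p(i := s, j := t)) = h * h * partial i (partial j F) (p(j := s', i := t'))"
    using 1 2[unfolded sw] by linarith
  with \<open>h > 0\<close> have "partial j (partial i F) (p(i := s, j := t)) = partial i (partial j F) (p(j := s', i := t'))"
    by simp
  moreover have "\<bar>partial j (partial i F) (p(i := s, j := t)) - partial j (partial i F) p\<bar> < e"
    using inV[OF st] by (auto simp: V_def dist_real_def abs_minus_commute)
  moreover have "\<bar>partial i (partial j F) (p(j := s', i := t')) - partial i (partial j F) p\<bar> < e"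
    using inV[OF st'] by (auto simp: V_def dist_real_def abs_minus_commute)
  ultimately show False unfolding e_def by (simp add: abs_if field_simps split: if_splits)
qed

section \<open>Smooth inverse functions\<close>

lemma smooth_coord_prod:
  "open S \<Longrightarrow> (\<And>a. a \<in> A \<Longrightarrow> smooth_coord S (F a)) \<Longrightarrow> smooth_coord S (\<lambda>q. \<Prod>a\<in>A. F a q)"
  by (auto simp: smooth_coord_iff_ck ck_prod)

lemma smooth_coord_det:
  fixes m :: "('i \<Rightarrow> real) \<Rightarrow> 'n::finite \<Rightarrow> 'n \<Rightarrow> real"
  assumes "open S" "\<And>r c. smooth_coord S (\<lambda>q. m q r c)"
  shows "smooth_coord S (\<lambda>q. det (\<chi> r c. m q r c))"
  unfolding det_def by (simp, intro smooth_coord_sum smooth_coord_mult smooth_coord_const smooth_coord_prod assms)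

lemma locfin_finite_index: "open S \<Longrightarrow> locfin S F" for S :: "('i::finite \<Rightarrow> real) set"
proof -
  assume "open S"
  moreover have "depends_on S UNIV F" unfolding depends_on_def by (metis UNIV_I ext)
  ultimately show ?thesis unfolding locfin_def by (intro ballI exI[of _ S] exI[of _ UNIV]) simp
qed

lemma has_derivative_vec_lambda:
  fixes f :: "'n::finite \<Rightarrow> 'a::real_normed_vector \<Rightarrow> real"
  assumes "\<And>r. (f r has_derivative f' r) (at x)"
  shows "((\<lambda>x. (\<chi> r. f r x) :: real^'n) has_derivative (\<lambda>v. \<chi> r. f' r v)) (at x)"
  unfolding has_derivative_componentwise_within[of "\<lambda>x. \<chi> r. f r x"]
  using assms by (auto simp: Basis_vec_def inner_axis)

lemma continuous_vec_lambda_comp: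
  fixes b :: "'n::finite \<Rightarrow> 'j"
  shows "continuous_on S (\<lambda>y::'j \<Rightarrow> real. \<chi> i. y (b i))"
  by (intro continuous_on_vec_lambda continuous_on_subset[OF continuous_on_product_coordinates]) auto

text \<open>Bootstrapping: the derivatives of \<open>H\<close> are a smooth function
  \<open>K\<close> of \<open>H\<close> itself, so each order of differentiability of
  \<open>H\<close> yields the next.\<close>

lemma inverse_of_smooth:
  fixes G :: "('i::finite \<Rightarrow> real) \<Rightarrow> 'j::finite \<Rightarrow> real" and H :: "('j \<Rightarrow> real) \<Rightarrow> 'i \<Rightarrow> real"
  assumes P: "open P" and cont: "\<And>i. continuous_on P (\<lambda>y. H y i)" and HN: "H ` P \<subseteq> N"
    and K: "\<And>i j. smooth_coord N (K i j)"
    and der: "\<And>i j y. y \<in> P \<Longrightarrow> ((\<lambda>t. H (y(j := t)) i) has_real_derivative K i j (H y)) (at (y j))"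
  shows "smooth_coord P (\<lambda>y. H y i)"
proof -
  have "ck r P (\<lambda>y. H y i)" for r i
  proof (induction r arbitrary: i)
    case 0
    show ?case using cont locfin_finite_index[OF P] by simp
  next
    case (Suc r)
    have "ck r P (partial j (\<lambda>y. H y i))" for j
    proof (rule ck_cong[OF P])
      show "ck r P (\<lambda>y. K i j (H y))" by (rule ck_comp[OF K P Suc HN])
      show "K i j (H y) = partial j (\<lambda>y. H y i) y" if "y \<in> P" for y
        using partialI[of "\<lambda>y. H y i", OF der[OF that]] by simp
    qed
    moreover have "(\<lambda>t. H (y(j := t)) i) differentiable (at (y j))" if "y \<in> P" for y j
      using der[OF that] real_differentiable_def by blast
    ultimately show ?case using cont locfin_finite_index[OF P] by simp
  qed
  with P show ?thesis by (simp add: smooth_coord_iff_ck)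
qed

text \<open>The inverse function theorem supplies a continuous and differentiable inverse; Cramer's
  rule writes its derivatives as quotients of determinants in the derivatives of \<open>G\<close>,
  which is the form that \<open>inverse_of_smooth\<close> needs. Domain and codomain have different
  index types, as in the application to \<open>Theta\<close>; the bijection \<open>b\<close> makes
  the Jacobian a square matrix.\<close>

lemma smooth_inverse_function:
  fixes G :: "('i::finite \<Rightarrow> real) \<Rightarrow> 'j::finite \<Rightarrow> real"
  assumes card: "CARD('i) = CARD('j)" and G: "\<And>j. smooth_coord S (\<lambda>q. G q j)" and p: "p \<in> S"
    and inj: "\<And>a. (\<And>j. dder a (\<lambda>q. G q j) p = 0) \<Longrightarrow> a = (\<lambda>_. 0)"
  obtains N H where "open N" "p \<in> N" "N \<subseteq> S" "open (G ` N)"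
    "\<And>i. smooth_coord (G ` N) (\<lambda>y. H y i)" "\<And>q. q \<in> N \<Longrightarrow> H (G q) = q"
proof -
  have oS: "open S" using G smooth_coordD(1) by blast
  obtain b :: "'i \<Rightarrow> 'j" where b: "bij b"
    using finite_same_card_bij[OF finite finite card] by blast
  define f :: "real^'i \<Rightarrow> real^'i" where "f x = (\<chi> r. G (vec_nth x) (b r))" for x
  define m where "m q r c = partial c (\<lambda>q. G q (b r)) q" for q r c
  have m: "smooth_coord S (\<lambda>q. m q r c)" for r c
    unfolding m_def by (rule smooth_coordD(4)[OF G])
  define M where "M x = (\<chi> r c. m (vec_nth x) r c)" for x :: "real^'i"
  define f' where "f' x = Blinfun (\<lambda>v. M x *v v)" for x :: "real^'i"
  have f'app: "blinfun_apply (f' x) = (\<lambda>v. M x *v v)" for x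
    unfolding f'_def by (rule bounded_linear_Blinfun_apply) (rule matrix_vector_mul_bounded_linear)
  have Mv: "M x *v v = (\<chi> r. dder (vec_nth v) (\<lambda>q. G q (b r)) (vec_nth x))" for x v
    by (simp add: matrix_vector_mult_def M_def m_def dder_finite mult.commute)
  define S' where "S' = (vec_nth -` S :: (real^'i) set)"
  have oS': "open S'" unfolding S'_def by (rule open_vimage[OF oS continuous_vec_nth_fun])
  have derf: "(f has_derivative blinfun_apply (f' x)) (at x)" if "x \<in> S'" for x
  proof -
    have "((\<lambda>x. \<chi> r. G (vec_nth x) (b r)) has_derivative (\<lambda>v. \<chi> r. dder (vec_nth v) (\<lambda>q. G q (b r)) (vec_nth x))) (at x)"
      using that by (intro has_derivative_vec_lambda has_derivative_vec[OF G]) (simp add: S'_def)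
    then show ?thesis by (simp add: f'app Mv f_def[abs_def])
  qed
  have contM: "continuous_on S' (\<lambda>x. m (vec_nth x) r c)" for r c
    by (rule continuous_on_compose2[OF smooth_coordD(2)[OF m] continuous_vec_nth_fun]) (auto simp: S'_def)
  have contf: "continuous_on S' f'"
  proof (rule continuous_on_blinfun_componentwise)
    show "continuous_on S' (\<lambda>x. blinfun_apply (f' x) v)" for v
      unfolding f'app matrix_vector_mult_def M_def
      by (simp, intro continuous_on_vec_lambda continuous_on_sum continuous_on_mult contM continuous_on_const)
  qed
  define x0 :: "real^'i" where "x0 = vec_lambda p"
  have x0: "x0 \<in> S'" "vec_nth x0 = p" using p by (simp_all add: x0_def S'_def vec_lambda_inverse)
  have "invertible (M x0)"
    unfolding invertible_left_inverse matrix_left_invertible_ker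
  proof (intro allI impI)
    fix v assume "M x0 *v v = 0"
    then have "dder (vec_nth v) (\<lambda>q. G q (b r)) p = 0" for r
      unfolding Mv x0(2) by (simp add: vec_eq_iff)
    then have "dder (vec_nth v) (\<lambda>q. G q j) p = 0" for j
      using b by (metis bij_pointE)
    from inj[OF this] show "v = 0" by (simp add: vec_eq_iff)
  qed
  then obtain B where B: "B ** M x0 = mat 1" unfolding invertible_def by blast
  have invf: "Blinfun (\<lambda>v. B *v v) o\<^sub>L f' x0 = id_blinfun"
  proof (rule blinfun_eqI)
    fix v
    have "blinfun_apply (Blinfun (\<lambda>v. B *v v)) = (\<lambda>v. B *v v)"
      by (rule bounded_linear_Blinfun_apply) (rule matrix_vector_mul_bounded_linear)
    then show "blinfun_apply (Blinfun (\<lambda>v. B *v v) o\<^sub>L f' x0) v = blinfun_apply id_blinfun v"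
      by (simp add: f'app matrix_vector_mul_assoc B)
  qed
  obtain U' V g g' where U': "open U'" "U' \<subseteq> S'" "x0 \<in> U'" and V: "open V" "f x0 \<in> V"
    and hom: "homeomorphism U' V f g"
    and g: "\<And>y. y \<in> V \<Longrightarrow> (g has_derivative g' y) (at y)"
    "\<And>y. y \<in> V \<Longrightarrow> g' y = inv (blinfun_apply (f' (g y)))"
    "\<And>y. y \<in> V \<Longrightarrow> bij (blinfun_apply (f' (g y)))"
    using inverse_function_theorem[OF oS' derf contf x0(1) invf] by metis
  define N where "N = {q. vec_lambda q \<in> U'}"
  have "N = (\<lambda>y. \<chi> i. y (id i)) -` U'" by (auto simp: N_def)
  then have oN: "open N" using open_vimage[OF U'(1) continuous_vec_lambda_comp] by metis
  define e where "e y = ((\<chi> i. y (b i)) :: real^'i)" for y :: "'j \<Rightarrow> real"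
  define P where "P = e -` V"
  have oP: "open P" unfolding P_def e_def by (rule open_vimage[OF V(1) continuous_vec_lambda_comp])
  define H where "H y = vec_nth (g (e y))" for y
  have eG: "e (G q) = f (vec_lambda q)" for q by (simp add: e_def f_def vec_lambda_inverse)
  have HG: "H (G q) = q" if "q \<in> N" for q
    using that homeomorphism_apply1[OF hom] by (simp add: H_def eG N_def vec_lambda_inverse)
  have inj_e: "y = z" if "e y = e z" for y z
  proof
    fix j obtain i where "j = b i" using b by (metis bij_pointE)
    then show "y j = z j" using that by (simp add: e_def vec_eq_iff)
  qed
  have GN: "G ` N = P"
  proof safe
    fix q assume "q \<in> N"
    then show "G q \<in> P" using homeomorphism_image1[OF hom] by (auto simp: P_def eG N_def)
  next
    fix y assume y: "y \<in> P"
    then have "e y \<in> V" by (simp add: P_def)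
    then have "g (e y) \<in> U'" "f (g (e y)) = e y"
      using homeomorphism_image2[OF hom] homeomorphism_apply2[OF hom] by auto
    then have "H y \<in> N" "e (G (H y)) = e y" by (simp_all add: N_def H_def eG vec_lambda_eta)
    then show "y \<in> G ` N" using inj_e by (metis image_eqI)
  qed
  have HN: "H ` P \<subseteq> N"
    using homeomorphism_image2[OF hom] by (auto simp: N_def H_def P_def vec_lambda_eta)
  have NS: "N \<subseteq> S" using U'(2) by (auto simp: N_def S'_def subset_iff vec_lambda_inverse)
  have detM: "det (\<chi> r c. m q r c) \<noteq> 0" if "q \<in> N" for q
  proof -
    have fV: "f (vec_lambda q) \<in> V" "g (f (vec_lambda q)) = vec_lambda q"
      using that homeomorphism_image1[OF hom] homeomorphism_apply1[OF hom] by (auto simp: N_def)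
    have "bij (\<lambda>v. M (vec_lambda q) *v v)" using g(3)[OF fV(1)] unfolding fV(2) f'app .
    then have "invertible (M (vec_lambda q))"
      by (metis invertible_eq_bij)
    then show ?thesis by (simp add: invertible_det_nz M_def vec_lambda_inverse)
  qed
  \<comment> \<open>Cramer's rule for the derivative of \<open>H\<close> in direction
    \<open>j\<close>, component \<open>i\<close>: column \<open>i\<close> of the Jacobian is
    replaced by the unit vector of the row that \<open>b\<close> maps to \<open>j\<close>.\<close>
  define K where "K i j q = det (\<chi> r c. if c = i then (if b r = j then 1 else 0) else m q r c) * inverse (det (\<chi> r c. m q r c))" for i j q
  have mN: "smooth_coord N (\<lambda>q. m q r c)" for r c by (rule smooth_coord_subset[OF m oN NS])
  have K: "smooth_coord N (K i j)" for i j
    unfolding K_def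
  proof (intro smooth_coord_mult smooth_coord_inverse smooth_coord_det oN mN detM)
    show "smooth_coord N (\<lambda>q. if c = i then (if b r = j then 1 else 0) else m q r c)" for r c
      by (cases "c = i") (auto intro: oN mN)
  qed
  have der: "((\<lambda>t. H (y(j := t)) i) has_real_derivative K i j (H y)) (at (y j))" if y: "y \<in> P" for i j y
  proof -
    have yV: "e y \<in> V" using y by (simp add: P_def)
    obtain k where k: "j = b k" using b by (metis bij_pointE)
    have ek: "e (y(j := t)) = e y + (t - y j) *\<^sub>R axis k 1" for t
      using b by (auto simp: e_def vec_eq_iff axis_def k bij_def inj_eq)
    have "((\<lambda>t. e (y(j := t))) has_derivative (\<lambda>h. h *\<^sub>R axis k 1)) (at (y j))"
      unfolding ek by (auto intro!: derivative_eq_intros)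
    moreover have "(g has_derivative g' (e y)) (at (e (y(j := y j))))" using g(1)[OF yV] by simp
    ultimately have d: "((\<lambda>t. g (e (y(j := t)))) has_derivative (\<lambda>h. g' (e y) (h *\<^sub>R axis k 1))) (at (y j))"
      by (rule has_derivative_compose)
    have lin: "linear (g' (e y))" using g(1)[OF yV] has_derivative_linear by blast
    define w where "w = g' (e y) (axis k 1)"
    have "M (g (e y)) *v w = axis k 1"
    proof -
      have "surj (blinfun_apply (f' (g (e y))))" using g(3)[OF yV] bij_is_surj by blast
      then have "blinfun_apply (f' (g (e y))) w = axis k 1"
        unfolding w_def g(2)[OF yV] by (rule surj_f_inv_f)
      then show ?thesis by (simp add: f'app)
    qed
    moreover have MH: "M (g (e y)) = (\<chi> r c. m (H y) r c)" by (simp add: M_def H_def)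
    moreover have "H y \<in> N" using HN y by auto
    ultimately have "w = (\<chi> c. det (\<chi> r c'. if c' = c then axis k 1 $ r else m (H y) r c') / det (\<chi> r c. m (H y) r c))"
      using cramer[OF detM, of "H y" w "axis k 1"] by (simp cong: if_cong)
    then have "w $ i = K i j (H y)"
      using b by (simp add: K_def axis_def k divide_inverse bij_def inj_eq eq_commute[of k] cong: if_cong)
    moreover have "((\<lambda>t. H (y(j := t)) i) has_derivative (\<lambda>h. g' (e y) (h *\<^sub>R axis k 1) $ i)) (at (y j))"
      unfolding H_def by (rule bounded_linear.has_derivative[OF bounded_linear_vec_nth d])
    ultimately show ?thesis
      unfolding has_field_derivative_def by (simp add: linear_scale[OF lin] w_def mult.commute[of _ "K i j (H y)"])
  qed
  have contH: "continuous_on P (\<lambda>y. H y i)" for i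
  proof -
    have "continuous_on V g" using hom homeomorphism_cont2 by blast
    then have "continuous_on P (\<lambda>y. g (e y))"
      by (rule continuous_on_compose2) (auto simp: P_def e_def intro: continuous_vec_lambda_comp)
    then show ?thesis unfolding H_def by (intro continuous_intros)
  qed
  show thesis
  proof (rule that[of N H])
    show "p \<in> N" using U'(3) by (simp add: N_def x0_def)
    show "smooth_coord (G ` N) (\<lambda>y. H y i)" for i
      unfolding GN by (rule inverse_of_smooth[OF oP contH HN K der])
  qed (use oN NS GN oP HG in auto)
qed

section \<open>First integrals\<close>

lemma box_as_cbox:
  fixes p :: "'i::finite \<Rightarrow> real"
  shows "vec_nth y \<in> {a. \<forall>i. \<bar>a i - p i\<bar> \<le> r} \<longleftrightarrow> y \<in> cbox (\<chi> i. p i - r) (\<chi> i. p i + r)"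
  by (auto simp: mem_box_cart abs_le_iff algebra_simps)

lemma continuous_on_cbox_vec:
  fixes F :: "('i::finite \<Rightarrow> real) \<Rightarrow> real"
  assumes "continuous_on {a. \<forall>i. \<bar>a i - p i\<bar> \<le> r} F"
  shows "continuous_on (cbox (\<chi> i. p i - r) (\<chi> i. p i + r)) (\<lambda>y. F (vec_nth y))"
  by (rule continuous_on_compose2[OF assms continuous_vec_nth_fun]) (use box_as_cbox in blast)

lemma bounded_on_box:
  fixes F :: "('i::finite \<Rightarrow> real) \<Rightarrow> real"
  assumes "continuous_on {a. \<forall>i. \<bar>a i - p i\<bar> \<le> r} F"
  obtains M where "M > 0" "\<And>a. (\<And>i. \<bar>a i - p i\<bar> \<le> r) \<Longrightarrow> \<bar>F a\<bar> \<le> M"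
proof -
  have "bounded ((\<lambda>y. F (vec_nth y)) ` cbox (\<chi> i. p i - r) (\<chi> i. p i + r))"
    by (intro compact_imp_bounded compact_continuous_image continuous_on_cbox_vec assms compact_cbox)
  then obtain M where M: "M > 0" "\<And>y. y \<in> cbox (\<chi> i. p i - r) (\<chi> i. p i + r) \<Longrightarrow> \<bar>F (vec_nth y)\<bar> \<le> M"
    unfolding bounded_pos by auto
  have "\<bar>F a\<bar> \<le> M" if "\<And>i. \<bar>a i - p i\<bar> \<le> r" for a
    using M(2)[of "vec_lambda a"] that box_as_cbox[of "vec_lambda a" p r] by (simp add: vec_lambda_inverse)
  with M(1) that show thesis by blast
qed

lemma uniformly_continuous_on_box:
  fixes F :: "('i::finite \<Rightarrow> real) \<Rightarrow> real"
  assumes "continuous_on {a. \<forall>i. \<bar>a i - p i\<bar> \<le> r} F" "e > 0"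
  obtains d where "d > 0"
    "\<And>a b. (\<And>i. \<bar>a i - p i\<bar> \<le> r) \<Longrightarrow> (\<And>i. \<bar>b i - p i\<bar> \<le> r) \<Longrightarrow> (\<And>i. \<bar>a i - b i\<bar> \<le> d) \<Longrightarrow> \<bar>F a - F b\<bar> \<le> e"
proof -
  let ?C = "cbox (\<chi> i. p i - r) (\<chi> i. p i + r)"
  have "uniformly_continuous_on ?C (\<lambda>y. F (vec_nth y))"
    by (intro compact_uniformly_continuous continuous_on_cbox_vec assms compact_cbox)
  then obtain d where d: "d > 0" "\<And>y z. y \<in> ?C \<Longrightarrow> z \<in> ?C \<Longrightarrow> dist z y < d \<Longrightarrow> dist (F (vec_nth z)) (F (vec_nth y)) < e"
    using \<open>e > 0\<close> unfolding uniformly_continuous_on_def by metis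
  \<comment> \<open>If all coordinates differ by at most \<open>d'\<close>, the Euclidean distance
    is at most the sum of these differences, hence at most \<open>d / 2\<close>.\<close>
  define d' where "d' = d / (2 * CARD('i))"
  have "\<bar>F a - F b\<bar> \<le> e"
    if ab: "\<And>i. \<bar>a i - p i\<bar> \<le> r" "\<And>i. \<bar>b i - p i\<bar> \<le> r" "\<And>i. \<bar>a i - b i\<bar> \<le> d'" for a b
  proof -
    have "dist (vec_lambda a) (vec_lambda b :: real^'i) \<le> (\<Sum>i\<in>UNIV. \<bar>a i - b i\<bar>)"
      using norm_le_l1_cart[of "vec_lambda a - vec_lambda b :: real^'i"] by (simp add: dist_norm)
    also have "\<dots> \<le> (\<Sum>i\<in>(UNIV::'i set). d')" by (rule sum_mono) (rule ab(3))
    also have "\<dots> < d" using d(1) by (simp add: d'_def)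
    finally have "dist (vec_lambda a) (vec_lambda b :: real^'i) < d" .
    moreover have "vec_lambda a \<in> ?C" "vec_lambda b \<in> ?C"
      using ab box_as_cbox[of "vec_lambda a" p r] box_as_cbox[of "vec_lambda b" p r] by (simp_all add: vec_lambda_inverse)
    ultimately show ?thesis using d(2)[of "vec_lambda b" "vec_lambda a"] by (simp add: dist_real_def vec_lambda_inverse)
  qed
  moreover have "d' > 0" using d(1) by (simp add: d'_def)
  ultimately show thesis using that by blast
qed

section \<open>Integrals depending on parameters\<close>

abbreviation jcont :: "('i \<Rightarrow> real) set \<Rightarrow> (real \<Rightarrow> ('i \<Rightarrow> real) \<Rightarrow> real) \<Rightarrow> bool" where
  "jcont N u \<equiv> continuous_on ({0..1} \<times> N) (\<lambda>(s, q). u s q)"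

text \<open>Rescaling to a fixed interval of integration lets \<open>s\<close> be treated like the other parameters.\<close>

definition pint :: "(real \<Rightarrow> ('i \<Rightarrow> real) \<Rightarrow> real) \<Rightarrow> real \<Rightarrow> ('i \<Rightarrow> real) \<Rightarrow> real" where
  "pint u s q = s * integral {0..1} (\<lambda>x. u (s * x) q)"

lemma unit_mult: "s \<in> {0..1} \<Longrightarrow> x \<in> {0..1} \<Longrightarrow> s * x \<in> {0..1::real}"
  by (auto simp: mult_le_one)

lemma jcont_section:
  assumes "jcont N u" "s \<in> {0..1}" "q \<in> N"
  shows "continuous_on {0..1} (\<lambda>x. u (s * x) q)"
proof -
  have "continuous_on {0..1} (\<lambda>x. case (s * x, q) of (s, q) \<Rightarrow> u s q)"
    by (rule continuous_on_compose2[OF assms(1)]) (use assms unit_mult in \<open>auto intro!: continuous_intros\<close>)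
  then show ?thesis by simp
qed

lemma jcont_section': "jcont N u \<Longrightarrow> q \<in> N \<Longrightarrow> continuous_on {0..1} (\<lambda>x. u x q)"
  using jcont_section[of N u 1 q] by simp

lemma pint_bound:
  assumes "jcont N u" "s \<in> {0..1}" "q \<in> N" "\<And>x. x \<in> {0..1} \<Longrightarrow> \<bar>u x q\<bar> \<le> C"
  shows "\<bar>pint u s q\<bar> \<le> C"
proof -
  have "norm (integral {0..1} (\<lambda>x. u (s * x) q)) \<le> C * (1 - 0)"
    by (rule integral_bound[OF _ jcont_section[OF assms(1-3)]]) (use assms unit_mult[OF assms(2)] in auto)
  moreover have "C \<ge> 0" using assms(4)[of 0] by force
  ultimately have "s * \<bar>integral {0..1} (\<lambda>x. u (s * x) q)\<bar> \<le> 1 * C"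
    using assms(2) by (intro mult_mono) auto
  then show ?thesis using assms(2) by (simp add: pint_def abs_mult)
qed

lemma pint_cong: "s \<in> {0..1} \<Longrightarrow> (\<And>x. x \<in> {0..1} \<Longrightarrow> u x q = v x q) \<Longrightarrow> pint u s q = pint v s q"
  unfolding pint_def using unit_mult by (metis (mono_tags, lifting) integral_cong)

lemma pint_diff:
  assumes "jcont N u" "jcont N v" "s \<in> {0..1}" "q \<in> N"
  shows "pint u s q - pint v s q = pint (\<lambda>x q. u x q - v x q) s q"
  unfolding pint_def
  by (subst integral_diff) (use assms jcont_section in \<open>auto intro!: integrable_continuous_real simp: right_diff_distrib\<close>)

lemma pint_add:
  assumes "jcont N u" "jcont N v" "s \<in> {0..1}" "q \<in> N"
  shows "pint u s q + pint v s q = pint (\<lambda>x q. u x q + v x q) s q"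
  unfolding pint_def
  by (subst integral_add) (use assms jcont_section in \<open>auto intro!: integrable_continuous_real simp: distrib_left\<close>)

lemma pint_sum:
  assumes "finite A" "\<And>a. a \<in> A \<Longrightarrow> jcont N (u a)" "s \<in> {0..1}" "q \<in> N"
  shows "(\<Sum>a\<in>A. pint (u a) s q) = pint (\<lambda>x q. \<Sum>a\<in>A. u a x q) s q"
  unfolding pint_def
  by (subst integral_sum) (use assms jcont_section[OF assms(2-4)] in \<open>auto intro!: integrable_continuous_real simp: sum_distrib_left\<close>)

lemma pint_cmult: "c q * pint u s q = pint (\<lambda>x q. c q * u x q) s q"
  unfolding pint_def by simp

lemma jcont_pint:
  assumes "jcont N u"
  shows "jcont N (pint u)"
proof -
  have "continuous_on (({0..1} \<times> N) \<times> cbox 0 1) (\<lambda>(p, x). u (fst p * x) (snd p))"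
  proof -
    have "continuous_on (({0..1} \<times> N) \<times> cbox 0 1) (\<lambda>px. case (fst (fst px) * snd px, snd (fst px)) of (s, q) \<Rightarrow> u s q)"
      by (rule continuous_on_compose2[OF assms],
          intro continuous_on_Pair continuous_on_mult continuous_on_snd continuous_on_fst continuous_on_id)
        (use unit_mult in auto)
    then show ?thesis by (simp add: split_beta)
  qed
  from integral_continuous_on_param[OF this]
  have "continuous_on ({0..1} \<times> N) (\<lambda>p. fst p * integral (cbox 0 1) (\<lambda>x. u (fst p * x) (snd p)))"
    by (intro continuous_intros)
  then show ?thesis by (simp add: pint_def split_beta)
qed

lemma pint_has_derivative:
  assumes N: "open N" and u: "jcont N u" and u': "jcont N u'" and s: "s \<in> {0..1}" and q: "q \<in> N"
    and der: "\<And>x q. x \<in> {0..1} \<Longrightarrow> q \<in> N \<Longrightarrow> ((\<lambda>t. u x (q(i := t))) has_real_derivative u' x q) (at (q i))"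
  shows "((\<lambda>t. pint u s (q(i := t))) has_real_derivative pint u' s q) (at (q i))"
proof -
  obtain d where d: "d > 0" "\<And>t. dist t (q i) < d \<Longrightarrow> q(i := t) \<in> N"
    using eventually_upd_in_open[OF N q, of i] unfolding eventually_nhds_metric by auto
  define U where "U = ball (q i) d"
  have UN: "q(i := t) \<in> N" if "t \<in> U" for t using d(2) that by (simp add: U_def dist_commute)
  have "((\<lambda>t. integral (cbox 0 1) (\<lambda>x. u (s * x) (q(i := t)))) has_real_derivative
      integral (cbox 0 1) (\<lambda>x. u' (s * x) (q(i := q i)))) (at (q i) within U)"
  proof (rule leibniz_rule_field_derivative[where fx="\<lambda>t x. u' (s * x) (q(i := t))" and f="\<lambda>t x. u (s * x) (q(i := t))"])
    fix t x :: real assume tx: "t \<in> U" "x \<in> cbox 0 1"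
    have "((\<lambda>t'. u (s * x) ((q(i := t))(i := t'))) has_real_derivative u' (s * x) (q(i := t))) (at ((q(i := t)) i))"
      by (rule der) (use tx UN unit_mult s in auto)
    then show "((\<lambda>t. u (s * x) (q(i := t))) has_real_derivative u' (s * x) (q(i := t))) (at t within U)"
      by (simp add: has_field_derivative_at_within)
  next
    show "(\<lambda>x. u (s * x) (q(i := t))) integrable_on cbox 0 1" if "t \<in> U" for t
      using jcont_section[OF u s UN[OF that]] by (auto intro!: integrable_continuous_real)
  next
    have "continuous_on (U \<times> cbox 0 1) (\<lambda>tx. case (s * snd tx, q(i := fst tx)) of (s, q) \<Rightarrow> u' s q)"
    proof (rule continuous_on_compose2[OF u'])
      have "continuous_on (U \<times> cbox 0 1) (\<lambda>tx. (q(i := fst tx)) j)" for j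
        by (cases "j = i") (auto intro!: continuous_intros)
      then show "continuous_on (U \<times> cbox 0 1) (\<lambda>tx. (s * snd tx, q(i := fst tx)))"
        by (intro continuous_on_Pair continuous_on_coordinatewise_then_product continuous_intros)
    qed (use s UN unit_mult in auto)
    then show "continuous_on (U \<times> cbox 0 1) (\<lambda>(t, x). u' (s * x) (q(i := t)))" by (simp add: split_beta)
  qed (use d in \<open>auto simp: U_def\<close>)
  then have "((\<lambda>t. integral {0..1} (\<lambda>x. u (s * x) (q(i := t)))) has_real_derivative
      integral {0..1} (\<lambda>x. u' (s * x) q)) (at (q i))"
    using d(1) by (simp add: U_def at_within_open[of "q i" "ball (q i) d"])
  from DERIV_cmult[OF this, of s] show ?thesis by (simp add: pint_def)
qed

lemma pint_eq_integral:
  assumes "jcont N u" "s \<in> {0..1}" "q \<in> N"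
  shows "pint u s q = integral {0..s} (\<lambda>x. u x q)"
proof -
  define \<Gamma> where "\<Gamma> y = integral {0..y} (\<lambda>x. u x q)" for y
  have d: "(\<Gamma> has_real_derivative u y q) (at y within {0..1})" if "y \<in> {0..1}" for y
    unfolding \<Gamma>_def by (rule integral_has_real_derivative[OF jcont_section'[OF assms(1,3)] that])
  have "((\<lambda>x. u (s * x) q * s) has_integral \<Gamma> (s * 1) - \<Gamma> (s * 0)) {0..1}"
  proof (rule fundamental_theorem_of_calculus)
    fix x :: real assume x: "x \<in> {0..1}"
    have "(\<Gamma> \<circ> (*) s has_real_derivative u (s * x) q * s) (at x within {0..1})"
    proof (rule DERIV_image_chain)
      have "(*) s ` {0..1} \<subseteq> {0..1}" using unit_mult[OF assms(2)] by blast
      then show "(\<Gamma> has_real_derivative u (s * x) q) (at (s * x) within (*) s ` {0..1})"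
        by (rule has_field_derivative_subset[OF d[OF unit_mult[OF assms(2) x]]])
      show "((*) s has_real_derivative s) (at x within {0..1})" by (auto intro!: derivative_eq_intros)
    qed
    then show "((\<lambda>x. \<Gamma> (s * x)) has_vector_derivative u (s * x) q * s) (at x within {0..1})"
      by (simp add: has_real_derivative_iff_has_vector_derivative o_def)
  qed simp
  moreover have "\<Gamma> 0 = 0" by (simp add: \<Gamma>_def)
  ultimately have "((\<lambda>x. u (s * x) q * s) has_integral \<Gamma> s) {0..1}" by simp
  from integral_unique[OF this] show ?thesis by (simp add: pint_def \<Gamma>_def mult.commute)
qed

lemma pint_has_time_derivative:
  assumes "jcont N u" "s \<in> {0..1}" "q \<in> N"
  shows "((\<lambda>s. pint u s q) has_real_derivative u s q) (at s within {0..1})"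
proof -
  have "((\<lambda>s. integral {0..s} (\<lambda>x. u x q)) has_real_derivative u s q) (at s within {0..1})"
    by (rule integral_has_real_derivative[OF jcont_section'[OF assms(1,3)] assms(2)])
  then show ?thesis
    by (rule has_field_derivative_transform_within[OF _ zero_less_one assms(2)])
      (use pint_eq_integral[OF assms(1) _ assms(3)] in simp)
qed

text \<open>The derivative is asked for in the open interval only, because there the flow equation
  is available with a two-sided derivative in time.\<close>

lemma pint_antiderivative:
  assumes "jcont N u" "s \<in> {0..1}" "q \<in> N" and cont: "continuous_on {0..1} \<Phi>"
    and der: "\<And>x. 0 < x \<Longrightarrow> x < 1 \<Longrightarrow> (\<Phi> has_real_derivative u x q) (at x)"
  shows "pint u s q = \<Phi> s - \<Phi> 0"
proof -
  have "((\<lambda>x. u x q) has_integral \<Phi> s - \<Phi> 0) {0..s}"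
  proof (rule fundamental_theorem_of_calculus_interior)
    show "continuous_on {0..s} \<Phi>" by (rule continuous_on_subset[OF cont]) (use assms(2) in auto)
    show "(\<Phi> has_vector_derivative u x q) (at x)" if "x \<in> {0<..<s}" for x
      using der[of x] that assms(2) by (simp add: has_real_derivative_iff_has_vector_derivative)
  qed (use assms in auto)
  then show ?thesis using pint_eq_integral[OF assms(1-3)] by (simp add: integral_unique)
qed

section \<open>Sequences converging uniformly together with their derivatives\<close>

definition cv0 :: "('i \<Rightarrow> real) set \<Rightarrow> (nat \<Rightarrow> real \<Rightarrow> ('i \<Rightarrow> real) \<Rightarrow> real) \<Rightarrow> bool" where
  "cv0 N u \<longleftrightarrow> (\<forall>m. jcont N (u m)) \<and> (\<exists>B. \<forall>m. \<forall>s\<in>{0..1}. \<forall>q\<in>N. \<bar>u m s q\<bar> \<le> B) \<and>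
     (\<forall>e>0. \<exists>M. \<forall>m\<ge>M. \<forall>m'\<ge>M. \<forall>s\<in>{0..1}. \<forall>q\<in>N. \<bar>u m s q - u m' s q\<bar> \<le> e)"

text \<open>Convergence in C^r with respect to \<open>q\<close>, as a Cauchy condition with common
  bounds. Over \<open>s\<close> one only integrates, so joint continuity in \<open>(s, q)\<close> is
  all that is recorded about it. The derivative sequence is an existential witness, so that a proof
  may produce it by a recursion of its own.\<close>

primrec cv :: "nat \<Rightarrow> ('i \<Rightarrow> real) set \<Rightarrow> (nat \<Rightarrow> real \<Rightarrow> ('i \<Rightarrow> real) \<Rightarrow> real) \<Rightarrow> bool" where
  "cv 0 N u \<longleftrightarrow> cv0 N u"
| "cv (Suc r) N u \<longleftrightarrow> cv0 N u \<and> (\<forall>i. \<exists>u'. cv r N u' \<and>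
     (\<forall>m. \<forall>s\<in>{0..1}. \<forall>q\<in>N. ((\<lambda>t. u m s (q(i := t))) has_real_derivative u' m s q) (at (q i))))"

lemma cv_imp_cv0: "cv r N u \<Longrightarrow> cv0 N u"
  by (cases r) auto

lemma cv_SucD:
  "cv (Suc r) N u \<Longrightarrow> \<exists>u'. cv r N u' \<and> (\<forall>m. \<forall>s\<in>{0..1}. \<forall>q\<in>N.
      ((\<lambda>t. u m s (q(i := t))) has_real_derivative u' m s q) (at (q i)))"
  by simp

lemma cv_Suc_imp: "cv (Suc r) N u \<Longrightarrow> cv r N u"
proof (induction r arbitrary: u)
  case (Suc r)
  have "\<exists>u'. cv r N u' \<and> (\<forall>m. \<forall>s\<in>{0..1}. \<forall>q\<in>N. ((\<lambda>t. u m s (q(i := t))) has_real_derivative u' m s q) (at (q i)))" for i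
  proof -
    obtain u' where u': "cv (Suc r) N u'"
      "\<forall>m. \<forall>s\<in>{0..1}. \<forall>q\<in>N. ((\<lambda>t. u m s (q(i := t))) has_real_derivative u' m s q) (at (q i))"
      using cv_SucD[OF Suc.prems, of i] by (elim exE conjE)
    with Suc.IH[OF u'(1)] show ?thesis by blast
  qed
  then show ?case using cv_imp_cv0[OF Suc.prems] by simp
qed (auto)

lemma cv0_cauchy:
  "cv0 N u \<Longrightarrow> e > 0 \<Longrightarrow> \<exists>M. \<forall>m\<ge>M. \<forall>m'\<ge>M. \<forall>s\<in>{0..1}. \<forall>q\<in>N. \<bar>u m s q - u m' s q\<bar> \<le> e"
  and cv0_jcont: "cv0 N u \<Longrightarrow> jcont N (u m)"
  by (auto simp: cv0_def)

lemma cv0_bound: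
  assumes "cv0 N u"
  shows "\<exists>B>0. \<forall>m. \<forall>s\<in>{0..1}. \<forall>q\<in>N. \<bar>u m s q\<bar> \<le> B"
proof -
  obtain B where B: "\<forall>m. \<forall>s\<in>{0..1}. \<forall>q\<in>N. \<bar>u m s q\<bar> \<le> B" using assms by (auto simp: cv0_def)
  then have "\<forall>m. \<forall>s\<in>{0..1}. \<forall>q\<in>N. \<bar>u m s q\<bar> \<le> max B 1" by (meson max.coboundedI1)
  then show ?thesis by (intro exI[of _ "max B 1"]) auto
qed

lemma cv0_const:
  assumes "continuous_on ({0..1} \<times> N) (\<lambda>(s, q). f s q)" "\<And>s q. s \<in> {0..1} \<Longrightarrow> q \<in> N \<Longrightarrow> \<bar>f s q\<bar> \<le> B"
  shows "cv0 N (\<lambda>m. f)"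
  unfolding cv0_def using assms by (auto intro!: exI[of _ B])

lemma cv_const: "cv r N (\<lambda>m s q. c)"
proof (induction r arbitrary: c)
  case 0
  show ?case by (simp, rule cv0_const[of _ _ "\<bar>c\<bar>"]) auto
next
  case (Suc r)
  have "cv0 N (\<lambda>m s q. c)" by (rule cv0_const[of _ _ "\<bar>c\<bar>"]) auto
  then show ?case using Suc[of 0] by (auto intro!: exI[of _ "\<lambda>m s q. 0"])
qed

lemma cv0_add:
  assumes u: "cv0 N u" and v: "cv0 N v"
  shows "cv0 N (\<lambda>m s q. u m s q + v m s q)"
proof -
  have "jcont N (\<lambda>s q. u m s q + v m s q)" for m
    using continuous_on_add[OF cv0_jcont[OF u, of m] cv0_jcont[OF v, of m]] by (simp add: split_beta)
  moreover obtain A where A: "\<And>m s q. s \<in> {0..1} \<Longrightarrow> q \<in> N \<Longrightarrow> \<bar>u m s q\<bar> \<le> A" using cv0_bound[OF u] by blast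
  moreover obtain B where B: "\<And>m s q. s \<in> {0..1} \<Longrightarrow> q \<in> N \<Longrightarrow> \<bar>v m s q\<bar> \<le> B" using cv0_bound[OF v] by blast
  have "\<bar>u m s q + v m s q\<bar> \<le> A + B" if "s \<in> {0..1}" "q \<in> N" for m s q
    using A[OF that, of m] B[OF that, of m] by linarith
  moreover have "\<exists>M. \<forall>m\<ge>M. \<forall>m'\<ge>M. \<forall>s\<in>{0..1}. \<forall>q\<in>N.
      \<bar>(u m s q + v m s q) - (u m' s q + v m' s q)\<bar> \<le> e" if e: "e > 0" for e
  proof -
    obtain M1 where M1: "\<forall>m\<ge>M1. \<forall>m'\<ge>M1. \<forall>s\<in>{0..1}. \<forall>q\<in>N. \<bar>u m s q - u m' s q\<bar> \<le> e / 2"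
      using cv0_cauchy[OF u half_gt_zero[OF e]] by (elim exE)
    obtain M2 where M2: "\<forall>m\<ge>M2. \<forall>m'\<ge>M2. \<forall>s\<in>{0..1}. \<forall>q\<in>N. \<bar>v m s q - v m' s q\<bar> \<le> e / 2"
      using cv0_cauchy[OF v half_gt_zero[OF e]] by (elim exE)
    have "\<bar>(u m s q + v m s q) - (u m' s q + v m' s q)\<bar> \<le> e"
      if "max M1 M2 \<le> m" "max M1 M2 \<le> m'" "s \<in> {0..1}" "q \<in> N" for m m' s q
    proof -
      have "\<bar>u m s q - u m' s q\<bar> \<le> e / 2" "\<bar>v m s q - v m' s q\<bar> \<le> e / 2" using M1 M2 that by simp_all
      then show ?thesis by linarith
    qed
    then show ?thesis by blast
  qed
  ultimately show ?thesis unfolding cv0_def by blast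
qed

text \<open>Here the uniform bounds in \<open>cv0\<close> are used: each factor multiplies a small
  difference of the other.\<close>

lemma cv0_mult:
  assumes u: "cv0 N u" and v: "cv0 N v"
  shows "cv0 N (\<lambda>m s q. u m s q * v m s q)"
proof -
  have "jcont N (\<lambda>s q. u m s q * v m s q)" for m
    using continuous_on_mult[OF cv0_jcont[OF u, of m] cv0_jcont[OF v, of m]] by (simp add: split_beta)
  moreover obtain A where A: "A > 0" "\<And>m s q. s \<in> {0..1} \<Longrightarrow> q \<in> N \<Longrightarrow> \<bar>u m s q\<bar> \<le> A" using cv0_bound[OF u] by blast
  moreover obtain B where B: "B > 0" "\<And>m s q. s \<in> {0..1} \<Longrightarrow> q \<in> N \<Longrightarrow> \<bar>v m s q\<bar> \<le> B" using cv0_bound[OF v] by blast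
  have "\<bar>u m s q * v m s q\<bar> \<le> A * B" if "s \<in> {0..1}" "q \<in> N" for m s q
    unfolding abs_mult using A(2)[OF that, of m] B(2)[OF that, of m] A(1) by (intro mult_mono) auto
  moreover have "\<exists>M. \<forall>m\<ge>M. \<forall>m'\<ge>M. \<forall>s\<in>{0..1}. \<forall>q\<in>N.
      \<bar>u m s q * v m s q - u m' s q * v m' s q\<bar> \<le> e" if e: "e > 0" for e
  proof -
    have eA: "e / (2 * A) > 0" and eB: "e / (2 * B) > 0" using e A(1) B(1) by simp_all
    obtain M1 where M1: "\<forall>m\<ge>M1. \<forall>m'\<ge>M1. \<forall>s\<in>{0..1}. \<forall>q\<in>N. \<bar>u m s q - u m' s q\<bar> \<le> e / (2 * B)"
      using cv0_cauchy[OF u eB] by (elim exE)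
    obtain M2 where M2: "\<forall>m\<ge>M2. \<forall>m'\<ge>M2. \<forall>s\<in>{0..1}. \<forall>q\<in>N. \<bar>v m s q - v m' s q\<bar> \<le> e / (2 * A)"
      using cv0_cauchy[OF v eA] by (elim exE)
    have "\<bar>u m s q * v m s q - u m' s q * v m' s q\<bar> \<le> e"
      if "max M1 M2 \<le> m" "max M1 M2 \<le> m'" and sq: "s \<in> {0..1}" "q \<in> N" for m m' s q
    proof -
      have 1: "\<bar>u m s q - u m' s q\<bar> \<le> e / (2 * B)" "\<bar>v m s q - v m' s q\<bar> \<le> e / (2 * A)"
        using M1 M2 that by simp_all
      have "\<bar>u m s q * (v m s q - v m' s q)\<bar> \<le> A * (e / (2 * A))"
        unfolding abs_mult using 1 A(2)[OF sq, of m] A(1) by (intro mult_mono) auto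
      moreover have "\<bar>(u m s q - u m' s q) * v m' s q\<bar> \<le> (e / (2 * B)) * B"
        unfolding abs_mult using 1 B(2)[OF sq, of m'] B(1) \<open>e > 0\<close> by (intro mult_mono) auto
      moreover have "A * (e / (2 * A)) = e / 2" "(e / (2 * B)) * B = e / 2" using A(1) B(1) by auto
      moreover have "u m s q * v m s q - u m' s q * v m' s q
          = u m s q * (v m s q - v m' s q) + (u m s q - u m' s q) * v m' s q" by (simp add: algebra_simps)
      ultimately show ?thesis by linarith
    qed
    then show ?thesis by blast
  qed
  ultimately show ?thesis unfolding cv0_def by blast
qed

lemma cv_add: "cv r N u \<Longrightarrow> cv r N v \<Longrightarrow> cv r N (\<lambda>m s q. u m s q + v m s q)"
proof (induction r arbitrary: u v)
  case 0
  then show ?case by (simp add: cv0_add)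
next
  case (Suc r)
  have "\<exists>w. cv r N w \<and> (\<forall>m. \<forall>s\<in>{0..1}. \<forall>q\<in>N.
      ((\<lambda>t. u m s (q(i := t)) + v m s (q(i := t))) has_real_derivative w m s q) (at (q i)))" for i
  proof -
    obtain u' where u'1: "cv r N u'" and u'2: "\<forall>m. \<forall>s\<in>{0..1}. \<forall>q\<in>N. ((\<lambda>t. u m s (q(i := t))) has_real_derivative u' m s q) (at (q i))"
      using cv_SucD[OF Suc.prems(1), of i] by (elim exE conjE)
    note u' = u'1 u'2[rule_format]
    obtain v' where v'1: "cv r N v'" and v'2: "\<forall>m. \<forall>s\<in>{0..1}. \<forall>q\<in>N. ((\<lambda>t. v m s (q(i := t))) has_real_derivative v' m s q) (at (q i))"
      using cv_SucD[OF Suc.prems(2), of i] by (elim exE conjE)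
    note v' = v'1 v'2[rule_format]
    show ?thesis
      by (intro exI[of _ "\<lambda>m s q. u' m s q + v' m s q"] conjI Suc.IH u' v' ballI allI DERIV_add)
  qed
  then show ?case using cv0_add[OF cv_imp_cv0[OF Suc.prems(1)] cv_imp_cv0[OF Suc.prems(2)]] by simp
qed

lemma cv_mult: "cv r N u \<Longrightarrow> cv r N v \<Longrightarrow> cv r N (\<lambda>m s q. u m s q * v m s q)"
proof (induction r arbitrary: u v)
  case 0
  then show ?case by (simp add: cv0_mult)
next
  case (Suc r)
  have "\<exists>w. cv r N w \<and> (\<forall>m. \<forall>s\<in>{0..1}. \<forall>q\<in>N.
      ((\<lambda>t. u m s (q(i := t)) * v m s (q(i := t))) has_real_derivative w m s q) (at (q i)))" for i
  proof -
    obtain u' where u'1: "cv r N u'" and u'2: "\<forall>m. \<forall>s\<in>{0..1}. \<forall>q\<in>N. ((\<lambda>t. u m s (q(i := t))) has_real_derivative u' m s q) (at (q i))"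
      using cv_SucD[OF Suc.prems(1), of i] by (elim exE conjE)
    note u' = u'1 u'2[rule_format]
    obtain v' where v'1: "cv r N v'" and v'2: "\<forall>m. \<forall>s\<in>{0..1}. \<forall>q\<in>N. ((\<lambda>t. v m s (q(i := t))) has_real_derivative v' m s q) (at (q i))"
      using cv_SucD[OF Suc.prems(2), of i] by (elim exE conjE)
    note v' = v'1 v'2[rule_format]
    have "cv r N (\<lambda>m s q. u' m s q * v m s q + v' m s q * u m s q)"
      by (intro cv_add Suc.IH u' v' cv_Suc_imp[OF Suc.prems(1)] cv_Suc_imp[OF Suc.prems(2)])
    moreover have "((\<lambda>t. u m s (q(i := t)) * v m s (q(i := t))) has_real_derivative
        u' m s q * v m s q + v' m s q * u m s q) (at (q i))" if "s \<in> {0..1}" "q \<in> N" for m s q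
      using DERIV_mult[OF u'(2)[OF that, of m] v'(2)[OF that, of m]] by simp
    ultimately show ?thesis by blast
  qed
  then show ?case using cv0_mult[OF cv_imp_cv0[OF Suc.prems(1)] cv_imp_cv0[OF Suc.prems(2)]] by simp
qed

lemma cv_sum: "(\<And>a. a \<in> A \<Longrightarrow> cv r N (u a)) \<Longrightarrow> cv r N (\<lambda>m s q. \<Sum>a\<in>A. u a m s q)"
  by (induction A rule: infinite_finite_induct) (auto intro!: cv_const cv_add)

text \<open>The closed box is compact, so \<open>F\<close> is uniformly continuous on it and
  preserves the Cauchy condition for sequences that stay in the box.\<close>

lemma cv0_comp:
  fixes Z :: "'j::finite \<Rightarrow> nat \<Rightarrow> real \<Rightarrow> ('i \<Rightarrow> real) \<Rightarrow> real"
  assumes F: "continuous_on {a. \<forall>i. \<bar>a i - p i\<bar> \<le> b} F" and Z: "\<And>j. cv0 N (Z j)"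
    and ZB: "\<And>j m s q. s \<in> {0..1} \<Longrightarrow> q \<in> N \<Longrightarrow> \<bar>Z j m s q - p j\<bar> \<le> b"
  shows "cv0 N (\<lambda>m s q. F (\<lambda>j. Z j m s q))"
proof -
  have "jcont N (\<lambda>s q. F (\<lambda>j. Z j m s q))" for m
  proof -
    have "continuous_on ({0..1} \<times> N) (\<lambda>x j. Z j m (fst x) (snd x))"
      using cv0_jcont[OF Z] by (intro continuous_on_coordinatewise_then_product) (simp add: split_beta)
    then have "continuous_on ({0..1} \<times> N) (\<lambda>x. F (\<lambda>j. Z j m (fst x) (snd x)))"
      by (rule continuous_on_compose2[OF F]) (use ZB in auto)
    then show ?thesis by (simp add: split_beta)
  qed
  moreover obtain A where "\<And>a. (\<And>i. \<bar>a i - p i\<bar> \<le> b) \<Longrightarrow> \<bar>F a\<bar> \<le> A" by (rule bounded_on_box[OF F]) blast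
  then have "\<bar>F (\<lambda>j. Z j m s q)\<bar> \<le> A" if "s \<in> {0..1}" "q \<in> N" for m s q
    using ZB that by simp
  moreover have "\<exists>M. \<forall>m\<ge>M. \<forall>m'\<ge>M. \<forall>s\<in>{0..1}. \<forall>q\<in>N.
      \<bar>F (\<lambda>j. Z j m s q) - F (\<lambda>j. Z j m' s q)\<bar> \<le> e" if e: "e > 0" for e
  proof -
    obtain d where d: "d > 0" "\<And>a c. (\<And>i. \<bar>a i - p i\<bar> \<le> b) \<Longrightarrow> (\<And>i. \<bar>c i - p i\<bar> \<le> b) \<Longrightarrow>
        (\<And>i. \<bar>a i - c i\<bar> \<le> d) \<Longrightarrow> \<bar>F a - F c\<bar> \<le> e"
      using uniformly_continuous_on_box[OF F \<open>e > 0\<close>] by metis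
    have "\<forall>j. \<exists>M. \<forall>m\<ge>M. \<forall>m'\<ge>M. \<forall>s\<in>{0..1}. \<forall>q\<in>N. \<bar>Z j m s q - Z j m' s q\<bar> \<le> d"
      using cv0_cauchy[OF Z d(1)] by blast
    from choice[OF this] obtain M where M: "\<And>j m m' s q. m \<ge> M j \<Longrightarrow> m' \<ge> M j \<Longrightarrow> s \<in> {0..1} \<Longrightarrow> q \<in> N \<Longrightarrow>
        \<bar>Z j m s q - Z j m' s q\<bar> \<le> d" by blast
    define M0 where "M0 = Max (range M)"
    have M0: "M j \<le> M0" for j unfolding M0_def by (intro Max_ge) auto
    have "\<bar>F (\<lambda>j. Z j m s q) - F (\<lambda>j. Z j m' s q)\<bar> \<le> e"
      if "m \<ge> M0" "m' \<ge> M0" "s \<in> {0..1}" "q \<in> N" for m m' s q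
      by (rule d(2)) (use ZB M M0 that order_trans in blast)+
    then show ?thesis by blast
  qed
  ultimately show ?thesis unfolding cv0_def by blast
qed

lemma cv_comp:
  fixes Z :: "'j::finite \<Rightarrow> nat \<Rightarrow> real \<Rightarrow> ('i \<Rightarrow> real) \<Rightarrow> real"
  assumes "smooth_coord S F" and SB: "{a. \<forall>i. \<bar>a i - p i\<bar> \<le> b} \<subseteq> S" and "\<And>j. cv r N (Z j)"
    and ZB: "\<And>j m s q. s \<in> {0..1} \<Longrightarrow> q \<in> N \<Longrightarrow> \<bar>Z j m s q - p j\<bar> \<le> b"
  shows "cv r N (\<lambda>m s q. F (\<lambda>j. Z j m s q))"
  using assms(1,3)
proof (induction r arbitrary: F)
  case 0
  then have "cv0 N (Z j)" for j by simp
  from cv0_comp[OF continuous_on_subset[OF smooth_coordD(2)[OF 0(1)] SB] this ZB] show ?case by simp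
next
  case (Suc r)
  have "cv0 N (\<lambda>m s q. F (\<lambda>j. Z j m s q))"
    by (rule cv0_comp[OF continuous_on_subset[OF smooth_coordD(2)[OF Suc.prems(1)] SB] cv_imp_cv0[OF Suc.prems(2)] ZB])
  moreover have "\<exists>w. cv r N w \<and> (\<forall>m. \<forall>s\<in>{0..1}. \<forall>q\<in>N.
      ((\<lambda>t. F (\<lambda>j. Z j m s (q(i := t)))) has_real_derivative w m s q) (at (q i)))" for i
  proof -
    have "\<forall>j. \<exists>Z'. cv r N Z' \<and> (\<forall>m. \<forall>s\<in>{0..1}. \<forall>q\<in>N. ((\<lambda>t. Z j m s (q(i := t))) has_real_derivative Z' m s q) (at (q i)))"
      using Suc.prems(2) by simp
    from choice[OF this] obtain Z' where Z'0: "\<forall>j. cv r N (Z' j) \<and>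
      (\<forall>m. \<forall>s\<in>{0..1}. \<forall>q\<in>N. ((\<lambda>t. Z j m s (q(i := t))) has_real_derivative Z' j m s q) (at (q i)))" ..
    have Z'1: "cv r N (Z' j)" for j using Z'0 by simp
    have Z'2: "((\<lambda>t. Z j m s (q(i := t))) has_real_derivative Z' j m s q) (at (q i))"
      if "s \<in> {0..1}" "q \<in> N" for j m s q using Z'0 that by simp
    note Z' = Z'1 Z'2
    have "cv r N (\<lambda>m s q. \<Sum>j\<in>UNIV. partial j F (\<lambda>j. Z j m s q) * Z' j m s q)"
      by (rule cv_sum, rule cv_mult[OF Suc.IH[OF smooth_coordD(4)[OF Suc.prems(1)] cv_Suc_imp[OF Suc.prems(2)]] Z'(1)])
    moreover have "((\<lambda>t. F (\<lambda>j. Z j m s (q(i := t)))) has_real_derivative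
        (\<Sum>j\<in>UNIV. partial j F (\<lambda>j. Z j m s q) * Z' j m s q)) (at (q i))" if sq: "s \<in> {0..1}" "q \<in> N" for m s q
    proof -
      have "((\<lambda>t. F (\<lambda>j. Z j m s (q(i := t)))) has_real_derivative
        (\<Sum>j\<in>UNIV. partial j F (\<lambda>j. Z j m s (q(i := q i))) * Z' j m s q)) (at (q i))"
      proof (rule has_derivative_along_curve[where \<gamma>="\<lambda>t j. Z j m s (q(i := t))"])
        show "open S" using smooth_coordD(1)[OF Suc.prems(1)] .
        show "(\<lambda>j. Z j m s (q(i := q i))) \<in> S" using ZB[OF sq] SB by auto
        show "depends_on S UNIV F" unfolding depends_on_def by (metis UNIV_I ext)
        show "(\<lambda>t. F (r(i := t))) differentiable at (r i)" if "r \<in> S" for i r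
          by (rule smooth_coordD(5)[OF Suc.prems(1) that])
        show "continuous_on S (partial i F)" for i by (rule smooth_coordD(2)[OF smooth_coordD(4)[OF Suc.prems(1)]])
        show "((\<lambda>t. Z j m s (q(i := t))) has_real_derivative Z' j m s q) (at (q i))" for j by (rule Z'(2)[OF sq])
      qed simp
      then show ?thesis by simp
    qed
    ultimately show ?thesis by blast
  qed
  ultimately show ?case by simp
qed

lemma cv0_pint:
  assumes u: "cv0 N u"
  shows "cv0 N (\<lambda>m. pint (u m))"
proof -
  have "jcont N (pint (u m))" for m by (rule jcont_pint[OF cv0_jcont[OF u]])
  moreover obtain A where A: "\<And>m s q. s \<in> {0..1} \<Longrightarrow> q \<in> N \<Longrightarrow> \<bar>u m s q\<bar> \<le> A" using cv0_bound[OF u] by blast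
  have "\<bar>pint (u m) s q\<bar> \<le> A" if "s \<in> {0..1}" "q \<in> N" for m s q
    by (rule pint_bound[OF cv0_jcont[OF u] that]) (use A that in blast)
  moreover have "\<exists>M. \<forall>m\<ge>M. \<forall>m'\<ge>M. \<forall>s\<in>{0..1}. \<forall>q\<in>N. \<bar>pint (u m) s q - pint (u m') s q\<bar> \<le> e" if e: "e > 0" for e
  proof -
    obtain M where M: "\<forall>m\<ge>M. \<forall>m'\<ge>M. \<forall>s\<in>{0..1}. \<forall>q\<in>N. \<bar>u m s q - u m' s q\<bar> \<le> e"
      using cv0_cauchy[OF u e] by (elim exE)
    have "\<bar>pint (u m) s q - pint (u m') s q\<bar> \<le> e" if "M \<le> m" "M \<le> m'" and sq: "s \<in> {0..1}" "q \<in> N" for m m' s q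
      unfolding pint_diff[OF cv0_jcont[OF u] cv0_jcont[OF u] sq]
    proof (rule pint_bound[OF _ sq])
      show "jcont N (\<lambda>x q. u m x q - u m' x q)"
        using continuous_on_diff[OF cv0_jcont[OF u, of m] cv0_jcont[OF u, of m']] by (simp add: split_beta)
    qed (use M that in blast)
    then show ?thesis by blast
  qed
  ultimately show ?thesis unfolding cv0_def by blast
qed

lemma cv_pint: "open N \<Longrightarrow> cv r N u \<Longrightarrow> cv r N (\<lambda>m. pint (u m))"
proof (induction r arbitrary: u)
  case 0
  then show ?case by (simp add: cv0_pint)
next
  case (Suc r)
  have "\<exists>w. cv r N w \<and> (\<forall>m. \<forall>s\<in>{0..1}. \<forall>q\<in>N.
      ((\<lambda>t. pint (u m) s (q(i := t))) has_real_derivative w m s q) (at (q i)))" for i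
  proof -
    obtain u' where u'1: "cv r N u'" and u'2: "\<forall>m. \<forall>s\<in>{0..1}. \<forall>q\<in>N. ((\<lambda>t. u m s (q(i := t))) has_real_derivative u' m s q) (at (q i))"
      using cv_SucD[OF Suc.prems(2), of i] by (elim exE conjE)
    note u' = u'1 u'2[rule_format]
    have "((\<lambda>t. pint (u m) s (q(i := t))) has_real_derivative pint (u' m) s q) (at (q i))"
      if sq: "s \<in> {0..1}" "q \<in> N" for m s q
      by (rule pint_has_derivative[OF Suc.prems(1) cv0_jcont[OF cv_imp_cv0[OF Suc.prems(2)]]
          cv0_jcont[OF cv_imp_cv0[OF u'(1)]] sq u'(2)])
    with Suc.IH[OF Suc.prems(1) u'(1)] show ?thesis by blast
  qed
  then show ?case using cv0_pint[OF cv_imp_cv0[OF Suc.prems(2)]] by simp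
qed

text \<open>Comparing the sequence with its own shifts makes a contraction by \<open>1/2\<close>, up to an error that
  tends to \<open>0\<close>, enough for the Cauchy property.\<close>

lemma cauchy_from_contraction:
  fixes U :: "'j \<Rightarrow> nat \<Rightarrow> 'x \<Rightarrow> real"
  assumes bound: "\<And>j m x. x \<in> X \<Longrightarrow> \<bar>U j m x\<bar> \<le> B"
    and contr: "\<And>\<eta>. \<eta> > 0 \<Longrightarrow> \<exists>M. \<forall>m\<ge>M. \<forall>m'\<ge>M. \<forall>d\<ge>0.
       (\<forall>j. \<forall>x\<in>X. \<bar>U j m x - U j m' x\<bar> \<le> d) \<longrightarrow> (\<forall>j. \<forall>x\<in>X. \<bar>U j (Suc m) x - U j (Suc m') x\<bar> \<le> \<eta> + d / 2)"
    and "e > 0"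
  shows "\<exists>M. \<forall>m\<ge>M. \<forall>m'\<ge>M. \<forall>j. \<forall>x\<in>X. \<bar>U j m x - U j m' x\<bar> \<le> e"
proof -
  obtain M where M: "\<And>m m' d. m \<ge> M \<Longrightarrow> m' \<ge> M \<Longrightarrow> d \<ge> 0 \<Longrightarrow>
      (\<forall>j. \<forall>x\<in>X. \<bar>U j m x - U j m' x\<bar> \<le> d) \<Longrightarrow> (\<forall>j. \<forall>x\<in>X. \<bar>U j (Suc m) x - U j (Suc m') x\<bar> \<le> e / 4 + d / 2)"
  proof -
    have "e / 4 > 0" using \<open>e > 0\<close> by simp
    from contr[OF this] obtain M where "\<forall>m\<ge>M. \<forall>m'\<ge>M. \<forall>d\<ge>0. (\<forall>j. \<forall>x\<in>X. \<bar>U j m x - U j m' x\<bar> \<le> d) \<longrightarrow>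
        (\<forall>j. \<forall>x\<in>X. \<bar>U j (Suc m) x - U j (Suc m') x\<bar> \<le> e / 4 + d / 2)" ..
    then show thesis by (intro that) blast
  qed
  define D where "D = 2 * \<bar>B\<bar>"
  \<comment> \<open>\<open>e / 2\<close> is the fixed point of the step from \<open>d\<close> to
    \<open>e / 4 + d / 2\<close>, so the errors of the single steps do not accumulate.\<close>
  have it: "\<forall>j. \<forall>x\<in>X. \<bar>U j (m + k) x - U j (m' + k) x\<bar> \<le> e / 2 + D / 2 ^ k" if "m \<ge> M" "m' \<ge> M" for m m' k
  proof (induction k)
    case 0
    have "\<bar>U j m x - U j m' x\<bar> \<le> e / 2 + D" if "x \<in> X" for j x
      using bound[OF that, of j m] bound[OF that, of j m'] \<open>e > 0\<close> by (simp add: D_def)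
    then show ?case by simp
  next
    case (Suc k)
    have "\<forall>j. \<forall>x\<in>X. \<bar>U j (Suc (m + k)) x - U j (Suc (m' + k)) x\<bar> \<le> e / 4 + (e / 2 + D / 2 ^ k) / 2"
      by (rule M) (use that Suc \<open>e > 0\<close> in \<open>auto simp: D_def\<close>)
    then show ?case by (simp add: add_divide_distrib mult.commute[of 2])
  qed
  obtain k where k: "D / 2 ^ k \<le> e / 2"
  proof -
    obtain k where "(2 * D) / e < 2 ^ k" using real_arch_pow[of 2] by auto
    then have "D / 2 ^ k \<le> e / 2" using \<open>e > 0\<close> by (simp add: field_simps)
    then show thesis by (rule that)
  qed
  have "\<forall>j. \<forall>x\<in>X. \<bar>U j m x - U j m' x\<bar> \<le> e" if "m \<ge> M + k" "m' \<ge> M + k" for m m'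
  proof (intro allI ballI)
    fix j x assume "x \<in> X"
    then have "\<bar>U j (m - k + k) x - U j (m' - k + k) x\<bar> \<le> e / 2 + D / 2 ^ k"
      using it[of "m - k" "m' - k" k] that by auto
    moreover have "m - k + k = m" "m' - k + k = m'" using that by simp_all
    ultimately have "\<bar>U j m x - U j m' x\<bar> \<le> e / 2 + D / 2 ^ k" by simp
    then show "\<bar>U j m x - U j m' x\<bar> \<le> e" using k by linarith
  qed
  then show ?thesis by blast
qed

lemma jcont_add: "jcont N u \<Longrightarrow> jcont N v \<Longrightarrow> jcont N (\<lambda>s q. u s q + v s q)"
  and jcont_diff: "jcont N u \<Longrightarrow> jcont N v \<Longrightarrow> jcont N (\<lambda>s q. u s q - v s q)"
  and jcont_mult: "jcont N u \<Longrightarrow> jcont N v \<Longrightarrow> jcont N (\<lambda>s q. u s q * v s q)"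
  unfolding split_beta by (rule continuous_on_add continuous_on_diff continuous_on_mult; assumption)+

lemma jcont_sum: "(\<And>a. a \<in> A \<Longrightarrow> jcont N (u a)) \<Longrightarrow> jcont N (\<lambda>s q. \<Sum>a\<in>A. u a s q)"
  unfolding split_beta by (rule continuous_on_sum)

lemma jcont_cong:
  "(\<And>s q. s \<in> {0..1} \<Longrightarrow> q \<in> N \<Longrightarrow> u s q = v s q) \<Longrightarrow> jcont N v \<Longrightarrow> jcont N u"
  by (rule iffD2[OF continuous_on_cong[OF refl]]) auto

lemma cv0_family_bound:
  fixes u :: "'j::finite \<Rightarrow> nat \<Rightarrow> real \<Rightarrow> ('i \<Rightarrow> real) \<Rightarrow> real"
  assumes "\<And>j. cv0 N (u j)"
  shows "\<exists>B>0. \<forall>j m. \<forall>s\<in>{0..1}. \<forall>q\<in>N. \<bar>u j m s q\<bar> \<le> B"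
proof -
  have "\<forall>j. \<exists>B. B > 0 \<and> (\<forall>m. \<forall>s\<in>{0..1}. \<forall>q\<in>N. \<bar>u j m s q\<bar> \<le> B)" using cv0_bound[OF assms] by blast
  from choice[OF this] obtain B where B: "\<forall>j. B j > 0 \<and> (\<forall>m. \<forall>s\<in>{0..1}. \<forall>q\<in>N. \<bar>u j m s q\<bar> \<le> B j)" ..
  define C where "C = Max (range B)"
  have le: "B j \<le> C" for j unfolding C_def by (intro Max_ge) auto
  show ?thesis
  proof (intro exI[of _ C] conjI allI ballI)
    show "C > 0" using B le less_le_trans by blast
    show "\<bar>u j m s q\<bar> \<le> C" if "s \<in> {0..1}" "q \<in> N" for j m s q
      using B le[of j] that order_trans by blast
  qed
qed

lemma cv0_family_cauchy:
  fixes u :: "'j::finite \<Rightarrow> nat \<Rightarrow> real \<Rightarrow> ('i \<Rightarrow> real) \<Rightarrow> real"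
  assumes "\<And>j. cv0 N (u j)" "e > 0"
  shows "\<exists>M. \<forall>j. \<forall>m\<ge>M. \<forall>m'\<ge>M. \<forall>s\<in>{0..1}. \<forall>q\<in>N. \<bar>u j m s q - u j m' s q\<bar> \<le> e"
proof -
  have "\<forall>j. \<exists>M. \<forall>m\<ge>M. \<forall>m'\<ge>M. \<forall>s\<in>{0..1}. \<forall>q\<in>N. \<bar>u j m s q - u j m' s q\<bar> \<le> e"
    using cv0_cauchy[OF assms(1,2)] by blast
  from choice[OF this] obtain M where M: "\<forall>j. \<forall>m\<ge>M j. \<forall>m'\<ge>M j. \<forall>s\<in>{0..1}. \<forall>q\<in>N. \<bar>u j m s q - u j m' s q\<bar> \<le> e" ..
  have le: "M j \<le> Max (range M)" for j by (intro Max_ge) auto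
  show ?thesis
  proof (intro exI[of _ "Max (range M)"] allI impI ballI)
    fix j m m' and s :: real and q assume "Max (range M) \<le> m" "Max (range M) \<le> m'" "s \<in> {0..1}" "q \<in> N"
    with M le[of j] show "\<bar>u j m s q - u j m' s q\<bar> \<le> e" by (meson order_trans)
  qed
qed

lemma cv0I:
  assumes "\<And>m. jcont N (u m)" "\<And>m s q. s \<in> {0..1} \<Longrightarrow> q \<in> N \<Longrightarrow> \<bar>u m s q\<bar> \<le> B"
    "\<And>e. e > 0 \<Longrightarrow> \<exists>M. \<forall>m\<ge>M. \<forall>m'\<ge>M. \<forall>s\<in>{0..1}. \<forall>q\<in>N. \<bar>u m s q - u m' s q\<bar> \<le> e"
  shows "cv0 N u"
  unfolding cv0_def using assms by blast

text \<open>The row sums of the coefficients are at most \<open>1/2\<close>, so one step of the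
  recursion halves the distance between two members of the sequence, up to the variation of
  \<open>c\<close> and \<open>B\<close>; \<open>cauchy_from_contraction\<close> does the
  rest.\<close>

lemma cv0_linear:
  fixes U :: "'j::finite \<Rightarrow> nat \<Rightarrow> real \<Rightarrow> ('i \<Rightarrow> real) \<Rightarrow> real"
  assumes rec: "\<And>j m s q. s \<in> {0..1} \<Longrightarrow> q \<in> N \<Longrightarrow>
      U j (Suc m) s q = c j m s q + pint (\<lambda>x q. \<Sum>k\<in>UNIV. B j k m x q * U k m x q) s q"
    and small: "\<And>j k m s q. s \<in> {0..1} \<Longrightarrow> q \<in> N \<Longrightarrow> \<bar>B j k m s q\<bar> \<le> \<beta>" "real CARD('j) * \<beta> \<le> 1 / 2"
    and U0: "\<And>j. cv0 N (\<lambda>m. U j 0)" and c: "\<And>j. cv0 N (c j)" and B: "\<And>j k. cv0 N (B j k)"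
  shows "cv0 N (U j)"
proof (cases "N = {}")
  case True
  then show ?thesis by (simp add: cv0_def)
next
  case False
  then have \<beta>0: "\<beta> \<ge> 0" using small(1)[of 0] by (metis abs_ge_zero all_not_in_conv atLeastAtMost_iff order_refl order_trans zero_le_one)
  define n where "n = real CARD('j)"
  have n: "n > 0" by (simp add: n_def)
  have jU: "jcont N (U j m)" for j m
  proof (induction m arbitrary: j)
    case 0
    show ?case using cv0_jcont[OF U0] .
  next
    case (Suc m)
    have "jcont N (\<lambda>s q. c j m s q + pint (\<lambda>x q. \<Sum>k\<in>UNIV. B j k m x q * U k m x q) s q)"
      by (intro jcont_add jcont_pint jcont_sum jcont_mult Suc cv0_jcont c B)
    then show ?case by (rule jcont_cong[rotated]) (rule rec)
  qed
  obtain C where C: "C > 0" "\<forall>j m. \<forall>s\<in>{0..1}. \<forall>q\<in>N. \<bar>c j m s q\<bar> \<le> C" using cv0_family_bound[of N c, OF c] by blast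
  obtain C0 where C0: "C0 > 0" "\<forall>j m. \<forall>s\<in>{0..1}. \<forall>q\<in>N. \<bar>U j 0 s q\<bar> \<le> C0" using cv0_family_bound[of N "\<lambda>j m. U j 0", OF U0] by blast
  \<comment> \<open>A bound that the recursion reproduces: the integral contributes at most
    \<open>D / 2\<close>, and \<open>c\<close> at most \<open>C\<close>, which is again at most
    \<open>D / 2\<close>.\<close>
  define D where "D = max C0 (2 * C)"
  have D: "D > 0" using C0(1) by (simp add: D_def)
  have bU: "\<bar>U j m s q\<bar> \<le> D" if "s \<in> {0..1}" "q \<in> N" for j m s q
    using that
  proof (induction m arbitrary: j s)
    case 0
    then have "\<bar>U j 0 s q\<bar> \<le> C0" using C0 by blast
    then show ?case by (simp add: D_def)
  next
    case (Suc m)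
    have "\<bar>pint (\<lambda>x q. \<Sum>k\<in>UNIV. B j k m x q * U k m x q) s q\<bar> \<le> D / 2"
    proof (rule pint_bound[OF _ Suc.prems])
      show "jcont N (\<lambda>x q. \<Sum>k\<in>UNIV. B j k m x q * U k m x q)" by (intro jcont_sum jcont_mult jU cv0_jcont B)
      fix x :: real assume x: "x \<in> {0..1}"
      have "\<bar>\<Sum>k\<in>UNIV. B j k m x q * U k m x q\<bar> \<le> (\<Sum>k\<in>(UNIV::'j set). \<beta> * D)"
        by (rule order_trans[OF sum_abs], rule sum_mono, unfold abs_mult, rule mult_mono)
          (use small(1) Suc x \<beta>0 in auto)
      also have "\<dots> = (n * \<beta>) * D" by (simp add: n_def)
      also have "\<dots> \<le> 1 / 2 * D" using small(2) D by (intro mult_right_mono) (auto simp: n_def)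
      finally show "\<bar>\<Sum>k\<in>UNIV. B j k m x q * U k m x q\<bar> \<le> D / 2" by simp
    qed
    moreover have "\<bar>c j m s q\<bar> \<le> C" using C(2) Suc.prems by blast
    moreover have "C \<le> D / 2" by (simp add: D_def)
    ultimately show ?case using rec[OF Suc.prems] by simp
  qed
  have cau: "\<exists>M. \<forall>m\<ge>M. \<forall>m'\<ge>M. \<forall>j. \<forall>x\<in>{0..1} \<times> N. \<bar>U j m (fst x) (snd x) - U j m' (fst x) (snd x)\<bar> \<le> e" if "e > 0" for e
  proof (rule cauchy_from_contraction[OF _ _ that])
    show "\<bar>U j m (fst x) (snd x)\<bar> \<le> D" if "x \<in> {0..1} \<times> N" for j m x using bU that by auto
    fix \<eta> :: real assume \<eta>: "\<eta> > 0"
    \<comment> \<open>Makes the \<open>n\<close> terms caused by the variation of the coefficients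
      add up to \<open>\<eta> / 2\<close>.\<close>
    define \<eta>' where "\<eta>' = \<eta> / (2 * n * D)"
    have \<eta>': "\<eta>' > 0" using \<eta> n D by (simp add: \<eta>'_def)
    obtain M1 where M1: "\<forall>j. \<forall>m\<ge>M1. \<forall>m'\<ge>M1. \<forall>s\<in>{0..1}. \<forall>q\<in>N. \<bar>c j m s q - c j m' s q\<bar> \<le> \<eta> / 2"
      using cv0_family_cauchy[of N c, OF c half_gt_zero[OF \<eta>]] ..
    obtain M2 where M2: "\<forall>jk. \<forall>m\<ge>M2. \<forall>m'\<ge>M2. \<forall>s\<in>{0..1}. \<forall>q\<in>N.
        \<bar>B (fst jk) (snd jk) m s q - B (fst jk) (snd jk) m' s q\<bar> \<le> \<eta>'"
      using cv0_family_cauchy[of N "\<lambda>jk. B (fst jk) (snd jk)", OF B \<eta>'] ..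
    have "\<bar>U j (Suc m) s q - U j (Suc m') s q\<bar> \<le> \<eta> + d / 2"
      if mm: "m \<ge> max M1 M2" "m' \<ge> max M1 M2" and d: "d \<ge> 0"
        and Ud: "\<forall>j. \<forall>x\<in>{0..1} \<times> N. \<bar>U j m (fst x) (snd x) - U j m' (fst x) (snd x)\<bar> \<le> d"
        and sq: "s \<in> {0..1}" "q \<in> N" for m m' d j s q
    proof -
      have jc: "jcont N (\<lambda>x q. \<Sum>k\<in>UNIV. B j k m x q * U k m x q)" for m
        by (intro jcont_sum jcont_mult jU cv0_jcont B)
      have "\<bar>pint (\<lambda>x q. \<Sum>k\<in>UNIV. B j k m x q * U k m x q) s q - pint (\<lambda>x q. \<Sum>k\<in>UNIV. B j k m' x q * U k m' x q) s q\<bar>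
          \<le> \<eta> / 2 + d / 2"
        unfolding pint_diff[OF jc jc sq]
      proof (rule pint_bound[OF jcont_diff[OF jc jc] sq])
        fix x :: real assume x: "x \<in> {0..1}"
        have t: "\<bar>B j k m x q * U k m x q - B j k m' x q * U k m' x q\<bar> \<le> \<eta>' * D + \<beta> * d" for k
        proof -
          have "\<bar>B j k m x q - B j k m' x q\<bar> \<le> \<eta>'"
            using M2[rule_format, of m m' x q "(j, k)"] mm x sq by simp
          then have "\<bar>(B j k m x q - B j k m' x q) * U k m x q\<bar> \<le> \<eta>' * D"
            unfolding abs_mult using bU[OF x sq(2), of k m] \<eta>' by (intro mult_mono) auto
          moreover have "\<bar>B j k m' x q * (U k m x q - U k m' x q)\<bar> \<le> \<beta> * d"
            unfolding abs_mult using small(1)[OF x sq(2), of j k m'] Ud x sq \<beta>0 by (intro mult_mono) auto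
          moreover have "B j k m x q * U k m x q - B j k m' x q * U k m' x q =
              (B j k m x q - B j k m' x q) * U k m x q + B j k m' x q * (U k m x q - U k m' x q)"
            by (simp add: algebra_simps)
          ultimately show ?thesis by linarith
        qed
        have "\<bar>(\<Sum>k\<in>UNIV. B j k m x q * U k m x q) - (\<Sum>k\<in>UNIV. B j k m' x q * U k m' x q)\<bar> \<le> (\<Sum>k\<in>(UNIV::'j set). \<eta>' * D + \<beta> * d)"
          unfolding sum_subtractf[symmetric] by (rule order_trans[OF sum_abs], rule sum_mono, rule t)
        also have "\<dots> = n * \<eta>' * D + (n * \<beta>) * d" by (simp add: n_def algebra_simps)
        also have "\<dots> \<le> \<eta> / 2 + 1 / 2 * d"
          using small(2) d n D by (intro add_mono mult_right_mono) (auto simp: n_def \<eta>'_def)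
        finally show "\<bar>(\<Sum>k\<in>UNIV. B j k m x q * U k m x q) - (\<Sum>k\<in>UNIV. B j k m' x q * U k m' x q)\<bar> \<le> \<eta> / 2 + d / 2" by simp
      qed
      moreover have "\<bar>c j m s q - c j m' s q\<bar> \<le> \<eta> / 2" using M1 mm sq by simp
      ultimately show ?thesis unfolding rec[OF sq] by linarith
    qed
    then show "\<exists>M. \<forall>m\<ge>M. \<forall>m'\<ge>M. \<forall>d\<ge>0.
       (\<forall>j. \<forall>x\<in>{0..1} \<times> N. \<bar>U j m (fst x) (snd x) - U j m' (fst x) (snd x)\<bar> \<le> d) \<longrightarrow>
       (\<forall>j. \<forall>x\<in>{0..1} \<times> N. \<bar>U j (Suc m) (fst x) (snd x) - U j (Suc m') (fst x) (snd x)\<bar> \<le> \<eta> + d / 2)"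
      by (intro exI[of _ "max M1 M2"]) auto
  qed
  show ?thesis
  proof (rule cv0I[OF jU bU])
    fix e :: real assume "e > 0"
    from cau[OF this] show "\<exists>M. \<forall>m\<ge>M. \<forall>m'\<ge>M. \<forall>s\<in>{0..1}. \<forall>q\<in>N. \<bar>U j m s q - U j m' s q\<bar> \<le> e" by force
  qed
qed

text \<open>An initial value enters a recursion as a constant sequence, but \<open>cv\<close>
  delivers its derivative as a sequence; one member of the latter is frozen.\<close>

lemma cv_freeze: "cv r N u \<Longrightarrow> cv r N (\<lambda>m. u k)"
proof (induction r arbitrary: u)
  case 0
  then have u: "cv0 N u" by simp
  obtain B where B: "\<forall>m. \<forall>s\<in>{0..1}. \<forall>q\<in>N. \<bar>u m s q\<bar> \<le> B" using cv0_bound[OF u] by blast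
  have "cv0 N (\<lambda>m. u k)" by (rule cv0I[of N _ B]) (use cv0_jcont[OF u] B in auto)
  then show ?case by simp
next
  case (Suc r)
  note u = cv_imp_cv0[OF Suc.prems]
  obtain B where B: "\<forall>m. \<forall>s\<in>{0..1}. \<forall>q\<in>N. \<bar>u m s q\<bar> \<le> B" using cv0_bound[OF u] by blast
  have "cv0 N (\<lambda>m. u k)" by (rule cv0I[of N _ B]) (use cv0_jcont[OF u] B in auto)
  moreover have "\<exists>w. cv r N w \<and> (\<forall>m. \<forall>s\<in>{0..1}. \<forall>q\<in>N.
      ((\<lambda>t. u k s (q(i := t))) has_real_derivative w m s q) (at (q i)))" for i
  proof -
    obtain u' where "cv r N u'" "\<forall>m. \<forall>s\<in>{0..1}. \<forall>q\<in>N. ((\<lambda>t. u m s (q(i := t))) has_real_derivative u' m s q) (at (q i))"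
      using cv_SucD[OF Suc.prems, of i] by (elim exE conjE)
    then show ?thesis by (intro exI[of _ "\<lambda>m. u' k"] conjI Suc.IH) simp_all
  qed
  ultimately show ?case by simp
qed

lemma has_real_derivative_upd_cong:
  assumes "open N" "q \<in> N" "\<And>q. q \<in> N \<Longrightarrow> f q = g q"
    "((\<lambda>t. g (q(i := t))) has_real_derivative D) (at (q i))"
  shows "((\<lambda>t. f (q(i := t))) has_real_derivative D) (at (q i))"
proof -
  have "\<forall>\<^sub>F t in nhds (q i). f (q(i := t)) = g (q(i := t))"
    using eventually_upd_in_open[OF assms(1,2)] by eventually_elim (rule assms(3))
  from iffD2[OF DERIV_cong_ev[OF refl this refl] assms(4)] show ?thesis .
qed

text \<open>Differentiating the recursion for \<open>U\<close> gives a recursion for the derivatives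
  \<open>V\<close> with the same coefficients \<open>B\<close>, hence the same contraction; its
  inhomogeneity, \<open>c'\<close> plus the integral of \<open>B'\<close> times \<open>U\<close>, no
  longer contains \<open>V\<close>. The induction hypothesis is used twice at order
  \<open>r\<close>: for \<open>U\<close>, which makes this inhomogeneity converge, and then for
  \<open>V\<close>.\<close>

lemma cv_linear:
  fixes U :: "'j::finite \<Rightarrow> nat \<Rightarrow> real \<Rightarrow> ('i \<Rightarrow> real) \<Rightarrow> real"
  assumes N: "open N"
    and small: "\<And>j k m s q. s \<in> {0..1} \<Longrightarrow> q \<in> N \<Longrightarrow> \<bar>B j k m s q\<bar> \<le> \<beta>" "real CARD('j) * \<beta> \<le> 1 / 2"
    and rec: "\<And>j m s q. s \<in> {0..1} \<Longrightarrow> q \<in> N \<Longrightarrow>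
      U j (Suc m) s q = c j m s q + pint (\<lambda>x q. \<Sum>k\<in>UNIV. B j k m x q * U k m x q) s q"
    and U0: "\<And>j. cv r N (\<lambda>m. U j 0)" and c: "\<And>j. cv r N (c j)" and B: "\<And>j k. cv r N (B j k)"
  shows "cv r N (U j)"
  using rec U0 c B
proof (induction r arbitrary: U c j)
  case 0
  show ?case unfolding cv.simps
  proof (rule cv0_linear[where U=U and c=c and B=B and \<beta>=\<beta>])
    show "U j (Suc m) s q = c j m s q + pint (\<lambda>x q. \<Sum>k\<in>UNIV. B j k m x q * U k m x q) s q"
      if "s \<in> {0..1}" "q \<in> N" for j m s q using 0(1)[OF that] .
  qed (use 0 small in simp_all)
next
  case (Suc r)
  note rec = Suc.prems(1) and U0 = Suc.prems(2) and c = Suc.prems(3) and B = Suc.prems(4)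
  have Ur: "cv r N (U j)" for j
    by (rule Suc.IH[of U c, OF rec cv_Suc_imp[OF U0] cv_Suc_imp[OF c] cv_Suc_imp[OF B]])
  have "\<exists>w. cv r N w \<and> (\<forall>m. \<forall>s\<in>{0..1}. \<forall>q\<in>N.
      ((\<lambda>t. U j m s (q(i := t))) has_real_derivative w m s q) (at (q i)))" for i
  proof -
    have "\<forall>j. \<exists>u'. cv r N u' \<and> (\<forall>m. \<forall>s\<in>{0..1}. \<forall>q\<in>N. ((\<lambda>t. c j m s (q(i := t))) has_real_derivative u' m s q) (at (q i)))"
      using cv_SucD[OF c] by blast
    from choice[OF this] obtain c' where c': "\<forall>j. cv r N (c' j) \<and>
      (\<forall>m. \<forall>s\<in>{0..1}. \<forall>q\<in>N. ((\<lambda>t. c j m s (q(i := t))) has_real_derivative c' j m s q) (at (q i)))" ..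
    have "\<forall>j. \<exists>u'. cv r N u' \<and> (\<forall>m. \<forall>s\<in>{0..1}. \<forall>q\<in>N. ((\<lambda>t. U j 0 s (q(i := t))) has_real_derivative u' m s q) (at (q i)))"
      using cv_SucD[OF U0] by blast
    from choice[OF this] obtain U0' where U0': "\<forall>j. cv r N (U0' j) \<and>
      (\<forall>m. \<forall>s\<in>{0..1}. \<forall>q\<in>N. ((\<lambda>t. U j 0 s (q(i := t))) has_real_derivative U0' j m s q) (at (q i)))" ..
    have "\<forall>jk. \<exists>u'. cv r N u' \<and> (\<forall>m. \<forall>s\<in>{0..1}. \<forall>q\<in>N.
        ((\<lambda>t. B (fst jk) (snd jk) m s (q(i := t))) has_real_derivative u' m s q) (at (q i)))"
      using cv_SucD[OF B] by blast
    from choice[OF this] obtain B0 where B0: "\<forall>jk. cv r N (B0 jk) \<and>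
      (\<forall>m. \<forall>s\<in>{0..1}. \<forall>q\<in>N. ((\<lambda>t. B (fst jk) (snd jk) m s (q(i := t))) has_real_derivative B0 jk m s q) (at (q i)))" ..
    define B' where "B' j k = B0 (j, k)" for j k
    have B'1: "cv r N (B' j k)" for j k using B0 by (simp add: B'_def)
    have B'2: "((\<lambda>t. B j k m s (q(i := t))) has_real_derivative B' j k m s q) (at (q i))" if "s \<in> {0..1}" "q \<in> N" for j k m s q
      using B0[rule_format, of "(j, k)"] that by (simp add: B'_def)
    define V where "V = rec_nat (\<lambda>j. U0' j 0) (\<lambda>m Vm j s q. c' j m s q +
        pint (\<lambda>x q. \<Sum>k\<in>UNIV. B' j k m x q * U k m x q + Vm k x q * B j k m x q) s q)"
    have V0: "V 0 j = U0' j 0" for j by (simp add: V_def)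
    have VS: "V (Suc m) j s q = c' j m s q +
        pint (\<lambda>x q. \<Sum>k\<in>UNIV. B' j k m x q * U k m x q + V m k x q * B j k m x q) s q" for m j s q
      by (simp add: V_def)
    have jU: "jcont N (U j m)" and jB: "jcont N (B j k m)" and jB': "jcont N (B' j k m)" and jc': "jcont N (c' j m)" for j k m
      using cv0_jcont[OF cv_imp_cv0[OF Ur]] cv0_jcont[OF cv_imp_cv0[OF B]] cv0_jcont[OF cv_imp_cv0[OF B'1]]
        cv0_jcont[OF cv_imp_cv0[of r N "c' j"]] c' by blast+
    have jV: "jcont N (V m j)" for m j
    proof (induction m arbitrary: j)
      case 0
      show ?case unfolding V0 using cv0_jcont[OF cv_imp_cv0[of r N "U0' j"]] U0' by blast
    next
      case (Suc m)
      have "jcont N (\<lambda>s q. c' j m s q + pint (\<lambda>x q. \<Sum>k\<in>UNIV. B' j k m x q * U k m x q + V m k x q * B j k m x q) s q)"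
        by (intro jcont_add jcont_pint jcont_sum jcont_mult Suc jU jB jB' jc')
      then show ?case by (rule jcont_cong[rotated]) (rule VS)
    qed
    have der: "((\<lambda>t. U j m s (q(i := t))) has_real_derivative V m j s q) (at (q i))" if "s \<in> {0..1}" "q \<in> N" for j m s q
      using that
    proof (induction m arbitrary: j s q)
      case 0
      then show ?case unfolding V0 using U0' by blast
    next
      case (Suc m)
      have "((\<lambda>t. c j m s (q(i := t)) + pint (\<lambda>x q. \<Sum>k\<in>UNIV. B j k m x q * U k m x q) s (q(i := t)))
          has_real_derivative V (Suc m) j s q) (at (q i))"
        unfolding VS
      proof (rule DERIV_add)
        show "((\<lambda>t. c j m s (q(i := t))) has_real_derivative c' j m s q) (at (q i))" using c' Suc.prems by blast
        show "((\<lambda>t. pint (\<lambda>x q. \<Sum>k\<in>UNIV. B j k m x q * U k m x q) s (q(i := t))) has_real_derivative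
            pint (\<lambda>x q. \<Sum>k\<in>UNIV. B' j k m x q * U k m x q + V m k x q * B j k m x q) s q) (at (q i))"
        proof (rule pint_has_derivative[OF N _ _ Suc.prems])
          show "jcont N (\<lambda>x q. \<Sum>k\<in>UNIV. B j k m x q * U k m x q)" by (intro jcont_sum jcont_mult jU jB)
          show "jcont N (\<lambda>x q. \<Sum>k\<in>UNIV. B' j k m x q * U k m x q + V m k x q * B j k m x q)"
            by (intro jcont_sum jcont_add jcont_mult jU jB jB' jV)
          show "((\<lambda>t. \<Sum>k\<in>UNIV. B j k m x (q(i := t)) * U k m x (q(i := t))) has_real_derivative
              (\<Sum>k\<in>UNIV. B' j k m x q * U k m x q + V m k x q * B j k m x q)) (at (q i))" if "x \<in> {0..1}" "q \<in> N" for x q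
          proof (rule DERIV_sum)
            fix k
            show "((\<lambda>t. B j k m x (q(i := t)) * U k m x (q(i := t))) has_real_derivative
              (B' j k m x q * U k m x q + V m k x q * B j k m x q)) (at (q i))"
              using DERIV_mult[OF B'2[OF that, of j k m] Suc.IH[OF that, of k]] by (simp only: fun_upd_triv)
          qed
        qed
      qed
      then show ?case
        by (rule has_real_derivative_upd_cong[OF N Suc.prems(2), rotated]) (rule rec[OF Suc.prems(1)])
    qed
    have "cv r N (\<lambda>m. V m j)"
    proof (rule Suc.IH[of "\<lambda>j m. V m j" "\<lambda>j m s q. c' j m s q + pint (\<lambda>x q. \<Sum>k\<in>UNIV. B' j k m x q * U k m x q) s q"])
      fix j m and s :: real and q :: "'i \<Rightarrow> real" assume sq: "s \<in> {0..1}" "q \<in> N"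
      have 1: "jcont N (\<lambda>x q. \<Sum>k\<in>UNIV. B' j k m x q * U k m x q)" by (intro jcont_sum jcont_mult jU jB')
      have 2: "jcont N (\<lambda>x q. \<Sum>k\<in>UNIV. B j k m x q * V m k x q)" by (intro jcont_sum jcont_mult jV jB)
      show "V (Suc m) j s q = c' j m s q + pint (\<lambda>x q. \<Sum>k\<in>UNIV. B' j k m x q * U k m x q) s q +
          pint (\<lambda>x q. \<Sum>k\<in>UNIV. B j k m x q * V m k x q) s q"
        unfolding VS add.assoc pint_add[OF 1 2 sq] by (simp add: sum.distrib mult.commute)
    next
      have "cv r N (U0' j)" for j using U0' by blast
      then show "cv r N (\<lambda>m. V 0 j)" for j unfolding V0 by (rule cv_freeze)
    next
      have c'1: "cv r N (c' j)" for j using c' by blast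
      have "cv r N (\<lambda>m s q. \<Sum>k\<in>UNIV. B' j k m s q * U k m s q)" for j
        by (rule cv_sum, rule cv_mult[OF B'1 Ur])
      from cv_add[OF c'1 cv_pint[OF N this]]
      show "cv r N (\<lambda>m s q. c' j m s q + pint (\<lambda>x q. \<Sum>k\<in>UNIV. B' j k m x q * U k m x q) s q)" for j .
    next
      show "cv r N (B j k)" for j k by (rule cv_Suc_imp[OF B])
    qed
    with der show ?thesis by blast
  qed
  with cv_imp_cv0[OF Ur] show ?case by simp
qed

section \<open>Smoothness of the limits\<close>

lemma cv0_tendsto:
  assumes u: "cv0 N u" "s \<in> {0..1}" "q \<in> N"
  shows "(\<lambda>m. u m s q) \<longlonglongrightarrow> lim (\<lambda>m. u m s q)"
proof -
  have "Cauchy (\<lambda>m. u m s q)"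
  proof (rule metric_CauchyI)
    fix e :: real assume "e > 0"
    then obtain M where "\<forall>m\<ge>M. \<forall>m'\<ge>M. \<forall>s\<in>{0..1}. \<forall>q\<in>N. \<bar>u m s q - u m' s q\<bar> \<le> e / 2"
      using cv0_cauchy[OF u(1) half_gt_zero] by blast
    with u \<open>e > 0\<close> show "\<exists>M. \<forall>m\<ge>M. \<forall>m'\<ge>M. dist (u m s q) (u m' s q) < e"
      by (intro exI[of _ M]) (fastforce simp: dist_real_def)
  qed
  then show ?thesis using Cauchy_convergent_iff convergent_LIMSEQ_iff by blast
qed

lemma cv0_uniform:
  assumes u: "cv0 N u" and e: "e > 0"
  shows "\<exists>M. \<forall>m\<ge>M. \<forall>s\<in>{0..1}. \<forall>q\<in>N. \<bar>u m s q - lim (\<lambda>m. u m s q)\<bar> \<le> e"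
proof -
  obtain M where M: "\<forall>m\<ge>M. \<forall>m'\<ge>M. \<forall>s\<in>{0..1}. \<forall>q\<in>N. \<bar>u m s q - u m' s q\<bar> \<le> e"
    using cv0_cauchy[OF u e] ..
  have "\<bar>u m s q - lim (\<lambda>m. u m s q)\<bar> \<le> e" if "m \<ge> M" "s \<in> {0..1}" "q \<in> N" for m s q
  proof (rule LIMSEQ_le_const2)
    show "(\<lambda>m'. \<bar>u m s q - u m' s q\<bar>) \<longlonglongrightarrow> \<bar>u m s q - lim (\<lambda>m. u m s q)\<bar>"
      by (intro tendsto_intros cv0_tendsto[OF u that(2,3)])
    show "\<exists>N. \<forall>n\<ge>N. \<bar>u m s q - u n s q\<bar> \<le> e" using M that by blast
  qed
  then show ?thesis by blast
qed

lemma jcont_lim: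
  assumes u: "cv0 N u"
  shows "jcont N (\<lambda>s q. lim (\<lambda>m. u m s q))"
proof (rule uniform_limit_theorem[where f="\<lambda>m (s, q). u m s q" and F=sequentially])
  show "\<forall>\<^sub>F m in sequentially. continuous_on ({0..1} \<times> N) (\<lambda>(s, q). u m s q)"
    using cv0_jcont[OF u] by simp
  show "uniform_limit ({0..1} \<times> N) (\<lambda>m (s, q). u m s q) (\<lambda>(s, q). lim (\<lambda>m. u m s q)) sequentially"
    unfolding uniform_limit_sequentially_iff
  proof (intro allI impI)
    fix e :: real assume "e > 0"
    then obtain M where "\<forall>m\<ge>M. \<forall>s\<in>{0..1}. \<forall>q\<in>N. \<bar>u m s q - lim (\<lambda>m. u m s q)\<bar> \<le> e / 2"
      using cv0_uniform[OF u half_gt_zero] by blast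
    with \<open>e > 0\<close> show "\<exists>M. \<forall>m\<ge>M. \<forall>x\<in>{0..1} \<times> N. dist (case x of (s, q) \<Rightarrow> u m s q) (case x of (s, q) \<Rightarrow> lim (\<lambda>m. u m s q)) < e"
      by (intro exI[of _ M]) (fastforce simp: dist_real_def)
  qed
qed simp

lemma lim_has_derivative:
  assumes N: "open N" and u: "cv0 N u" and u': "cv0 N u'" and s: "s \<in> {0..1}" and q: "q \<in> N"
    and der: "\<forall>m. \<forall>s\<in>{0..1}. \<forall>q\<in>N. ((\<lambda>t. u m s (q(i := t))) has_real_derivative u' m s q) (at (q i))"
  shows "((\<lambda>t. lim (\<lambda>m. u m s (q(i := t)))) has_real_derivative lim (\<lambda>m. u' m s q)) (at (q i))"
proof -
  obtain d where d: "d > 0" "\<And>t. dist t (q i) < d \<Longrightarrow> q(i := t) \<in> N"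
    using eventually_upd_in_open[OF N q, of i] unfolding eventually_nhds_metric by auto
  \<comment> \<open>Differentiation of a limit is applied on a convex set: an interval around
    \<open>q i\<close> on which the coordinate line stays in \<open>N\<close>.\<close>
  define X where "X = ball (q i) d"
  have XN: "q(i := t) \<in> N" if "t \<in> X" for t using d(2) that by (simp add: X_def dist_commute)
  have qX: "q i \<in> X" using d by (simp add: X_def)
  have "\<exists>g. \<forall>t\<in>X. (\<lambda>m. u m s (q(i := t))) \<longlonglongrightarrow> g t \<and>
      (g has_derivative (\<lambda>h. lim (\<lambda>m. u' m s (q(i := t))) * h)) (at t within X)"
  proof (rule has_derivative_sequence)
    show "convex X" by (simp add: X_def)
    fix m t assume t: "t \<in> X"
    have "((\<lambda>t'. u m s ((q(i := t))(i := t'))) has_real_derivative u' m s (q(i := t))) (at ((q(i := t)) i))"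
      using der s XN[OF t] by blast
    then have "((\<lambda>t. u m s (q(i := t))) has_real_derivative u' m s (q(i := t))) (at t within X)"
      by (simp add: has_field_derivative_at_within)
    then show "((\<lambda>t. u m s (q(i := t))) has_derivative (\<lambda>h. u' m s (q(i := t)) * h)) (at t within X)"
      by (simp add: has_field_derivative_def)
  next
    fix e :: real assume "e > 0"
    from cv0_uniform[OF u' this] obtain M where M: "\<forall>m\<ge>M. \<forall>s\<in>{0..1}. \<forall>q\<in>N. \<bar>u' m s q - lim (\<lambda>m. u' m s q)\<bar> \<le> e" ..
    show "\<forall>\<^sub>F m in sequentially. \<forall>t\<in>X. \<forall>h. norm (u' m s (q(i := t)) * h - lim (\<lambda>m. u' m s (q(i := t))) * h) \<le> e * norm h"
      unfolding eventually_sequentially left_diff_distrib[symmetric] norm_mult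
      by (intro exI[of _ M] allI impI ballI mult_right_mono) (use M s XN in auto)
  next
    show "q i \<in> X" by fact
    show "(\<lambda>m. u m s (q(i := q i))) \<longlonglongrightarrow> lim (\<lambda>m. u m s q)" using cv0_tendsto[OF u s q] by simp
  qed
  then obtain g where g: "\<And>t. t \<in> X \<Longrightarrow> (\<lambda>m. u m s (q(i := t))) \<longlonglongrightarrow> g t"
      "(g has_derivative (\<lambda>h. lim (\<lambda>m. u' m s (q(i := q i))) * h)) (at (q i) within X)" using qX by blast
  have "(g has_real_derivative lim (\<lambda>m. u' m s q)) (at (q i))"
    using g(2) d(1) by (simp add: has_field_derivative_def X_def at_within_open[of "q i" "ball (q i) d"])
  moreover have "\<forall>\<^sub>F t in nhds (q i). lim (\<lambda>m. u m s (q(i := t))) = g t"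
    using eventually_nhds_in_open[of X "q i"] qX g(1) by (auto simp: X_def limI elim!: eventually_mono)
  ultimately show ?thesis using iffD2[OF DERIV_cong_ev[OF refl _ refl]] by metis
qed

lemma ck_lim:
  fixes N :: "('i::finite \<Rightarrow> real) set"
  assumes N: "open N" and s: "s \<in> {0..1}"
  shows "cv r N u \<Longrightarrow> ck r N (\<lambda>q. lim (\<lambda>m. u m s q))"
proof (induction r arbitrary: u)
  have cont: "continuous_on N (\<lambda>q. lim (\<lambda>m. u m s q))" if "cv0 N u" for u
  proof -
    have "continuous_on N (\<lambda>q. case (s, q) of (s, q) \<Rightarrow> lim (\<lambda>m. u m s q))"
      by (rule continuous_on_compose2[OF jcont_lim[OF that]])
        (use s in \<open>auto intro!: continuous_on_Pair continuous_on_const continuous_on_id\<close>)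
    then show ?thesis by simp
  qed
  {
    case 0
    then show ?case using cont locfin_finite_index[OF N] by simp
  next
    case (Suc r)
    have "(\<forall>q\<in>N. (\<lambda>t. lim (\<lambda>m. u m s (q(i := t)))) differentiable (at (q i))) \<and>
        ck r N (partial i (\<lambda>q. lim (\<lambda>m. u m s q)))" for i
    proof -
      obtain u' where u'1: "cv r N u'" and u'2: "\<forall>m. \<forall>s\<in>{0..1}. \<forall>q\<in>N. ((\<lambda>t. u m s (q(i := t))) has_real_derivative u' m s q) (at (q i))"
        using cv_SucD[OF Suc.prems, of i] by (elim exE conjE)
      have d: "((\<lambda>t. lim (\<lambda>m. u m s (q(i := t)))) has_real_derivative lim (\<lambda>m. u' m s q)) (at (q i))" if "q \<in> N" for q
        by (rule lim_has_derivative[OF N cv_imp_cv0[OF Suc.prems] cv_imp_cv0[OF u'1] s that u'2])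
      have "ck r N (partial i (\<lambda>q. lim (\<lambda>m. u m s q)))"
      proof (rule ck_cong[OF N _ Suc.IH[OF u'1]])
        show "lim (\<lambda>m. u' m s q) = partial i (\<lambda>q. lim (\<lambda>m. u m s q)) q" if "q \<in> N" for q
          using partialI[of "\<lambda>q. lim (\<lambda>m. u m s q)", OF d[OF that]] by simp
      qed
      moreover have "(\<lambda>t. lim (\<lambda>m. u m s (q(i := t)))) differentiable (at (q i))" if "q \<in> N" for q
        using d[OF that] real_differentiable_def by blast
      ultimately show ?thesis by blast
    qed
    then show ?case using cont[OF cv_imp_cv0[OF Suc.prems]] locfin_finite_index[OF N] by simp
  }
qed

text \<open>Since \<open>v \<kappa> = 1\<close>, following the flow of \<open>v\<close> from \<open>q\<close> for the time \<open>p \<kappa> - q \<kappa>\<close> ends on the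
  slice \<open>{y. y \<kappa> = p \<kappa>}\<close>.  The coordinates of the end point are first integrals, as functions of
  \<open>q\<close>; \<open>Z\<close> are the Picard iterates of this flow in the time rescaled to \<open>{0..1}\<close>.\<close>

locale picard =
  fixes v :: "'i::finite \<Rightarrow> ('i \<Rightarrow> real) \<Rightarrow> real" and S :: "('i \<Rightarrow> real) set" and p :: "'i \<Rightarrow> real"
    and \<kappa> :: 'i and b \<delta> K L :: real
  assumes smooth: "\<And>j. smooth_coord S (v j)" and box: "{a. \<forall>i. \<bar>a i - p i\<bar> \<le> b} \<subseteq> S"
    and b: "b > 0" and \<delta>: "\<delta> > 0" "\<delta> + \<delta> * K \<le> b" "real CARD('i) * (\<delta> * L) \<le> 1 / 2"
    and vK: "\<And>j a. (\<And>i. \<bar>a i - p i\<bar> \<le> b) \<Longrightarrow> \<bar>v j a\<bar> \<le> K"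
    and vL: "\<And>j k a. (\<And>i. \<bar>a i - p i\<bar> \<le> b) \<Longrightarrow> \<bar>partial k (v j) a\<bar> \<le> L"
    and v1: "\<And>a. a \<in> S \<Longrightarrow> v \<kappa> a = 1"
begin

definition N :: "('i \<Rightarrow> real) set" where "N = {q. \<forall>i. \<bar>q i - p i\<bar> < \<delta>}"

definition e :: "('i \<Rightarrow> real) \<Rightarrow> real" where "e q = p \<kappa> - q \<kappa>"

primrec Z :: "nat \<Rightarrow> 'i \<Rightarrow> real \<Rightarrow> ('i \<Rightarrow> real) \<Rightarrow> real" where
  "Z 0 = (\<lambda>j s q. q j)"
| "Z (Suc m) = (\<lambda>j s q. q j + pint (\<lambda>x q. e q * v j (\<lambda>k. Z m k x q)) s q)"

lemma open_N: "open N"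
  unfolding N_def using open_box[of UNIV p \<delta>] by simp

lemma p_N: "p \<in> N" using \<delta>(1) by (simp add: N_def)

lemma K_nonneg: "K \<ge> 0"
  using order_trans[OF abs_ge_zero vK[of p]] b by simp

lemma L_nonneg: "L \<ge> 0"
  using order_trans[OF abs_ge_zero vL[of p]] b by simp

lemma N_box: "q \<in> N \<Longrightarrow> \<bar>q i - p i\<bar> \<le> b"
proof -
  assume "q \<in> N"
  then have "\<bar>q i - p i\<bar> < \<delta>" by (simp add: N_def)
  moreover have "\<delta> * K \<ge> 0" using \<delta>(1) K_nonneg by simp
  ultimately show ?thesis using \<delta>(2) by linarith
qed

lemma e_bound:
  assumes "q \<in> N" shows "\<bar>e q\<bar> \<le> \<delta>"
proof -
  have "\<bar>q \<kappa> - p \<kappa>\<bar> < \<delta>" using assms by (simp add: N_def)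
  then show ?thesis by (simp add: e_def)
qed

lemma box_S: "(\<And>i. \<bar>a i - p i\<bar> \<le> b) \<Longrightarrow> a \<in> S"
  using box by blast

lemma cont_v: "continuous_on {a. \<forall>i. \<bar>a i - p i\<bar> \<le> b} (v j)"
  by (rule continuous_on_subset[OF smooth_coordD(2)[OF smooth] box])

lemma jcont_coord: "jcont N (\<lambda>s q. q j)"
  unfolding split_beta
  by (rule continuous_on_compose2[OF continuous_on_product_coordinates continuous_on_snd[OF continuous_on_id]]) simp

lemma jcont_e: "jcont N (\<lambda>s q. e q)"
  using continuous_on_diff[OF continuous_on_const jcont_coord[of \<kappa>], of "p \<kappa>"] by (simp add: e_def split_beta)

lemma jcont_comp:
  assumes "\<And>j. jcont N (Y j)" "\<And>j s q. s \<in> {0..1} \<Longrightarrow> q \<in> N \<Longrightarrow> \<bar>Y j s q - p j\<bar> \<le> b"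
    and "continuous_on {a. \<forall>i. \<bar>a i - p i\<bar> \<le> b} F"
  shows "jcont N (\<lambda>s q. F (\<lambda>j. Y j s q))"
proof -
  have "continuous_on ({0..1} \<times> N) (\<lambda>x j. Y j (fst x) (snd x))"
    using assms(1) by (intro continuous_on_coordinatewise_then_product) (simp add: split_beta)
  then have "continuous_on ({0..1} \<times> N) (\<lambda>x. F (\<lambda>j. Y j (fst x) (snd x)))"
    by (rule continuous_on_compose2[OF assms(3)]) (use assms(2) in auto)
  then show ?thesis by (simp add: split_beta)
qed

text \<open>The iterates stay in the closed box: the starting point contributes
  \<open>\<delta>\<close> and the integral at most \<open>\<delta> * K\<close>, and
  \<open>\<delta> + \<delta> * K \<le> b\<close>.\<close>

lemma Z_jcont_box: "jcont N (Z m j) \<and> (\<forall>s\<in>{0..1}. \<forall>q\<in>N. \<bar>Z m j s q - p j\<bar> \<le> b)"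
proof (induction m arbitrary: j)
  case 0
  show ?case using jcont_coord N_box by simp
next
  case (Suc m)
  have jv: "jcont N (\<lambda>s q. e q * v j (\<lambda>k. Z m k s q))"
    by (rule jcont_mult[OF jcont_e jcont_comp]) (use Suc cont_v in auto)
  have "\<bar>Z (Suc m) j s q - p j\<bar> \<le> b" if sq: "s \<in> {0..1}" "q \<in> N" for s q
  proof -
    have "\<bar>pint (\<lambda>x q. e q * v j (\<lambda>k. Z m k x q)) s q\<bar> \<le> \<delta> * K"
    proof (rule pint_bound[OF jv sq])
      fix x :: real assume "x \<in> {0..1}"
      then have "\<bar>v j (\<lambda>k. Z m k x q)\<bar> \<le> K" using Suc sq by (intro vK) auto
      then show "\<bar>e q * v j (\<lambda>k. Z m k x q)\<bar> \<le> \<delta> * K"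
        unfolding abs_mult using e_bound[OF sq(2)] \<delta>(1) by (intro mult_mono) auto
    qed
    moreover have "\<bar>q j - p j\<bar> \<le> \<delta>" using sq(2) by (auto simp: N_def less_imp_le)
    ultimately show ?thesis using \<delta>(2) by simp
  qed
  moreover have "jcont N (Z (Suc m) j)"
    using jcont_add[OF jcont_coord jcont_pint[OF jv]] by simp
  ultimately show ?case by blast
qed

lemma Z_jcont: "jcont N (Z m j)" and Z_box: "s \<in> {0..1} \<Longrightarrow> q \<in> N \<Longrightarrow> \<bar>Z m j s q - p j\<bar> \<le> b"
  using Z_jcont_box by blast+

text \<open>Mean value estimate along the segment, which stays in the box by convexity.\<close>

lemma v_lipschitz:
  assumes a: "\<And>i. \<bar>a i - p i\<bar> \<le> b" and a': "\<And>i. \<bar>a' i - p i\<bar> \<le> b" and d: "\<And>i. \<bar>a i - a' i\<bar> \<le> d"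
  shows "\<bar>v j a - v j a'\<bar> \<le> real CARD('i) * (L * d)"
proof -
  define g where "g t = (\<lambda>i. a' i + t * (a i - a' i))" for t :: real
  have g_box: "\<bar>g t i - p i\<bar> \<le> b" if "t \<in> {0..1}" for t i
  proof -
    have "g t i - p i = (1 - t) * (a' i - p i) + t * (a i - p i)" by (simp add: g_def algebra_simps)
    also have "\<bar>\<dots>\<bar> \<le> (1 - t) * b + t * b"
      using that a[of i] a'[of i] by (intro order_trans[OF abs_triangle_ineq] add_mono) (auto simp: abs_mult mult_left_mono)
    also have "\<dots> = b" by (simp add: algebra_simps)
    finally show ?thesis .
  qed
  have gS: "g t \<in> S" if "t \<in> {0..1}" for t using g_box[OF that] by (rule box_S)
  have der: "((\<lambda>t. v j (g t)) has_real_derivative (\<Sum>i\<in>UNIV. partial i (v j) (g t) * (a i - a' i))) (at t)"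
    if "t \<in> {0..1}" for t
  proof (rule has_derivative_along_curve)
    show "open S" by (rule smooth_coordD(1)[OF smooth])
    show "g t \<in> S" by (rule gS[OF that])
    show "depends_on S UNIV (v j)" unfolding depends_on_def by (metis UNIV_I ext)
    show "(\<lambda>t. v j (r(i := t))) differentiable at (r i)" if "r \<in> S" for i r
      by (rule smooth_coordD(5)[OF smooth that])
    show "continuous_on S (partial i (v j))" for i by (rule smooth_coordD(2)[OF smooth_coordD(4)[OF smooth]])
    show "((\<lambda>t. g t i) has_real_derivative a i - a' i) (at t)" for i
      unfolding g_def by (auto intro!: derivative_eq_intros)
  qed simp
  have "norm (v j (g 1) - v j (g 0)) \<le> (real CARD('i) * (L * d)) * norm (1 - 0 :: real)"
  proof (rule field_differentiable_bound[where S="{0..1}"])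
    fix t :: real assume t: "t \<in> {0..1}"
    show "((\<lambda>t. v j (g t)) has_real_derivative (\<Sum>i\<in>UNIV. partial i (v j) (g t) * (a i - a' i))) (at t within {0..1})"
      by (rule has_field_derivative_at_within[OF der[OF t]])
    have "\<bar>\<Sum>i\<in>UNIV. partial i (v j) (g t) * (a i - a' i)\<bar> \<le> (\<Sum>i\<in>(UNIV::'i set). L * d)"
      by (rule order_trans[OF sum_abs], rule sum_mono, unfold abs_mult, rule mult_mono)
        (use vL[of "g t"] g_box[OF t] d L_nonneg in auto)
    then show "norm (\<Sum>i\<in>UNIV. partial i (v j) (g t) * (a i - a' i)) \<le> real CARD('i) * (L * d)" by simp
  qed auto
  then show ?thesis by (simp add: g_def)
qed

text \<open>The condition \<open>real CARD('i) * (\<delta> * L) \<le> 1 / 2\<close> makes the Picard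
  step a contraction; the same product reappears as the coefficient bound in
  \<open>cv_Z\<close>.\<close>

lemma cv0_Z: "cv0 N (\<lambda>m. Z m j)"
proof -
  have jv: "jcont N (\<lambda>s q. e q * v j (\<lambda>k. Z m k s q))" for m j
    by (rule jcont_mult[OF jcont_e jcont_comp]) (use Z_jcont Z_box cont_v in auto)
  define B where "B = (\<Sum>i\<in>UNIV. \<bar>p i\<bar>) + b"
  have bZ: "\<bar>Z m j s q\<bar> \<le> B" if "s \<in> {0..1}" "q \<in> N" for m j s q
  proof -
    have "\<bar>p j\<bar> \<le> (\<Sum>i\<in>UNIV. \<bar>p i\<bar>)" by (rule member_le_sum) auto
    then show ?thesis using Z_box[OF that, of m j] by (simp add: B_def)
  qed
  have cau: "\<exists>M. \<forall>m\<ge>M. \<forall>m'\<ge>M. \<forall>j. \<forall>x\<in>{0..1} \<times> N. \<bar>Z m j (fst x) (snd x) - Z m' j (fst x) (snd x)\<bar> \<le> \<epsilon>" if "\<epsilon> > 0" for \<epsilon>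
  proof (rule cauchy_from_contraction[where U="\<lambda>j m x. Z m j (fst x) (snd x)", OF _ _ that])
    show "\<bar>Z m j (fst x) (snd x)\<bar> \<le> B" if "x \<in> {0..1} \<times> N" for j m x using bZ that by auto
    fix \<eta> :: real assume \<eta>: "\<eta> > 0"
    have "\<bar>Z (Suc m) j s q - Z (Suc m') j s q\<bar> \<le> \<eta> + d / 2"
      if d: "d \<ge> 0" and Zd: "\<forall>j. \<forall>x\<in>{0..1} \<times> N. \<bar>Z m j (fst x) (snd x) - Z m' j (fst x) (snd x)\<bar> \<le> d"
        and sq: "s \<in> {0..1}" "q \<in> N" for m m' d j s q
    proof -
      have "\<bar>pint (\<lambda>x q. e q * v j (\<lambda>k. Z m k x q)) s q - pint (\<lambda>x q. e q * v j (\<lambda>k. Z m' k x q)) s q\<bar> \<le> d / 2"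
        unfolding pint_diff[OF jv jv sq]
      proof (rule pint_bound[OF jcont_diff[OF jv jv] sq])
        fix x :: real assume x: "x \<in> {0..1}"
        have "\<bar>v j (\<lambda>k. Z m k x q) - v j (\<lambda>k. Z m' k x q)\<bar> \<le> real CARD('i) * (L * d)"
          by (rule v_lipschitz) (use Z_box x sq Zd in auto)
        then have "\<bar>e q * (v j (\<lambda>k. Z m k x q) - v j (\<lambda>k. Z m' k x q))\<bar> \<le> \<delta> * (real CARD('i) * (L * d))"
          unfolding abs_mult using e_bound[OF sq(2)] \<delta>(1) by (intro mult_mono) auto
        also have "\<dots> = (real CARD('i) * (\<delta> * L)) * d" by (simp add: algebra_simps)
        also have "\<dots> \<le> 1 / 2 * d" by (rule mult_right_mono[OF \<delta>(3) d])
        finally show "\<bar>e q * v j (\<lambda>k. Z m k x q) - e q * v j (\<lambda>k. Z m' k x q)\<bar> \<le> d / 2"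
          by (simp add: right_diff_distrib)
      qed
      then show ?thesis using \<eta> by simp
    qed
    then show "\<exists>M. \<forall>m\<ge>M. \<forall>m'\<ge>M. \<forall>d\<ge>0.
       (\<forall>j. \<forall>x\<in>{0..1} \<times> N. \<bar>Z m j (fst x) (snd x) - Z m' j (fst x) (snd x)\<bar> \<le> d) \<longrightarrow>
       (\<forall>j. \<forall>x\<in>{0..1} \<times> N. \<bar>Z (Suc m) j (fst x) (snd x) - Z (Suc m') j (fst x) (snd x)\<bar> \<le> \<eta> + d / 2)"
      by (auto simp del: Z.simps)
  qed
  show ?thesis
  proof (rule cv0I[OF Z_jcont bZ])
    fix \<epsilon> :: real assume "\<epsilon> > 0"
    from cau[OF this] show "\<exists>M. \<forall>m\<ge>M. \<forall>m'\<ge>M. \<forall>s\<in>{0..1}. \<forall>q\<in>N. \<bar>Z m j s q - Z m' j s q\<bar> \<le> \<epsilon>" by force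
  qed
qed

lemma cv_coord: "cv r N (\<lambda>m s q. q j)"
proof (cases r)
  case 0
  have "cv0 N (\<lambda>m s q. q j)"
    by (rule cv0_const[OF jcont_coord, of _ "\<bar>p j\<bar> + b"]) (use N_box[of _ j] in force)
  with 0 show ?thesis by simp
next
  case (Suc r')
  have "cv0 N (\<lambda>m s q. q j)"
    by (rule cv0_const[OF jcont_coord, of _ "\<bar>p j\<bar> + b"]) (use N_box[of _ j] in force)
  moreover have "((\<lambda>t. (q(i := t)) j) has_real_derivative (if i = j then 1 else 0)) (at (q i))" for q i
    by (auto intro!: derivative_eq_intros)
  then have "\<exists>w. cv r' N w \<and> (\<forall>m::nat. \<forall>s\<in>{0..1::real}. \<forall>q\<in>N. ((\<lambda>t. (q(i := t)) j) has_real_derivative w m s q) (at (q i)))" for i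
    by (intro exI[of _ "\<lambda>m s q. if i = j then 1 else 0"] conjI cv_const) blast
  ultimately show ?thesis unfolding Suc cv.simps by blast
qed

lemma cv_e: "cv r N (\<lambda>m s q. e q)"
proof -
  have "cv r N (\<lambda>m s q. p \<kappa> + (-1) * q \<kappa>)" by (intro cv_add cv_mult cv_const cv_coord)
  then show ?thesis by (simp add: e_def)
qed

lemma e_derivative: "((\<lambda>t. e (q(i := t))) has_real_derivative (if i = \<kappa> then -1 else 0)) (at (q i))"
  unfolding e_def by (auto intro!: derivative_eq_intros)

lemma small_coefficient:
  assumes "q \<in> N" "\<And>i. \<bar>a i - p i\<bar> \<le> b"
  shows "\<bar>e q * partial k (v j) a\<bar> \<le> \<delta> * L"
  unfolding abs_mult using e_bound[OF assms(1)] vL[OF assms(2)] \<delta>(1) by (intro mult_mono) auto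

lemma integrand_derivative:
  assumes Y: "\<And>j. ((\<lambda>t. Y j x (q(i := t))) has_real_derivative Y' j x q) (at (q i))"
    and box: "\<And>j. \<bar>Y j x q - p j\<bar> \<le> b"
  shows "((\<lambda>t. e (q(i := t)) * v j (\<lambda>k. Y k x (q(i := t)))) has_real_derivative
    (if i = \<kappa> then -1 else 0) * v j (\<lambda>k. Y k x q) + (\<Sum>k\<in>UNIV. (e q * partial k (v j) (\<lambda>k. Y k x q)) * Y' k x q)) (at (q i))"
proof -
  have "((\<lambda>t. v j (\<lambda>k. Y k x (q(i := t)))) has_real_derivative
      (\<Sum>k\<in>UNIV. partial k (v j) (\<lambda>k. Y k x (q(i := q i))) * Y' k x q)) (at (q i))"
  proof (rule has_derivative_along_curve[where \<gamma>="\<lambda>t k. Y k x (q(i := t))"])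
    show "open S" by (rule smooth_coordD(1)[OF smooth])
    show "(\<lambda>k. Y k x (q(i := q i))) \<in> S" using box_S[of "\<lambda>k. Y k x q", OF box] by simp
    show "depends_on S UNIV (v j)" unfolding depends_on_def by (metis UNIV_I ext)
    show "(\<lambda>t. v j (r(i := t))) differentiable at (r i)" if "r \<in> S" for i r
      by (rule smooth_coordD(5)[OF smooth that])
    show "continuous_on S (partial i (v j))" for i by (rule smooth_coordD(2)[OF smooth_coordD(4)[OF smooth]])
    show "((\<lambda>t. Y k x (q(i := t))) has_real_derivative Y' k x q) (at (q i))" for k by (rule Y)
  qed simp
  from DERIV_mult[OF e_derivative[of q i] this] show ?thesis
    by (rule DERIV_cong) (simp add: sum_distrib_left mult_ac)
qed

text \<open>The derivatives of the iterates in \<open>q i\<close> satisfy the linearised recursion,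
  with coefficients \<open>e q * partial k (v j)\<close> taken along the iterates. By the induction
  hypothesis these converge to order \<open>r\<close>, so \<open>cv_linear\<close> gives order
  \<open>r\<close> for the derivatives, that is \<open>r + 1\<close> for the iterates.\<close>

lemma cv_Z: "cv r N (\<lambda>m. Z m j)"
proof (induction r arbitrary: j)
  case 0
  show ?case using cv0_Z by simp
next
  case (Suc r)
  note IH = Suc
  have "\<exists>w. cv r N w \<and> (\<forall>m. \<forall>s\<in>{0..1}. \<forall>q\<in>N.
      ((\<lambda>t. Z m j s (q(i := t))) has_real_derivative w m s q) (at (q i)))" for i
  proof -
    \<comment> \<open>The derivative of \<open>e\<close> in coordinate \<open>i\<close>: moving
      \<open>q\<close> also changes the time for which the flow is followed.\<close>
    define \<epsilon> :: real where "\<epsilon> = (if i = \<kappa> then -1 else 0)"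
    define V where "V = rec_nat (\<lambda>j s q. if i = j then 1 else 0) (\<lambda>m Vm j s q. (if i = j then 1 else 0) +
        pint (\<lambda>x q. \<epsilon> * v j (\<lambda>k. Z m k x q) + (\<Sum>k\<in>UNIV. (e q * partial k (v j) (\<lambda>k. Z m k x q)) * Vm k x q)) s q)"
    have V0: "V 0 = (\<lambda>j s q. if i = j then 1 else 0)" by (simp add: V_def)
    have VS: "V (Suc m) j s q = (if i = j then 1 else 0) +
        pint (\<lambda>x q. \<epsilon> * v j (\<lambda>k. Z m k x q) + (\<Sum>k\<in>UNIV. (e q * partial k (v j) (\<lambda>k. Z m k x q)) * V m k x q)) s q" for m j s q
      by (simp add: V_def)
    have cvv: "cv r N (\<lambda>m s q. v j (\<lambda>k. Z m k s q))" for j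
      by (rule cv_comp[where Z="\<lambda>k m. Z m k", OF smooth box IH Z_box])
    have cvp: "cv r N (\<lambda>m s q. e q * partial k (v j) (\<lambda>k. Z m k s q))" for j k
      by (rule cv_mult[OF cv_e cv_comp[where Z="\<lambda>k m. Z m k", OF smooth_coordD(4)[OF smooth] box IH Z_box]])
    have jv: "jcont N (\<lambda>s q. v j (\<lambda>k. Z m k s q))" for m j
      by (rule cv0_jcont[OF cv_imp_cv0[OF cvv]])
    have jp: "jcont N (\<lambda>s q. e q * partial k (v j) (\<lambda>k. Z m k s q))" for m j k
      by (rule cv0_jcont[OF cv_imp_cv0[OF cvp]])
    have jconst: "jcont N (\<lambda>s q. c)" for c by (simp add: split_beta)
    have jV: "jcont N (V m j)" for m j
    proof (induction m arbitrary: j)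
      case 0
      show ?case unfolding V0 by (rule jconst)
    next
      case (Suc m)
      have "jcont N (\<lambda>s q. (if i = j then 1 else 0) +
        pint (\<lambda>x q. \<epsilon> * v j (\<lambda>k. Z m k x q) + (\<Sum>k\<in>UNIV. (e q * partial k (v j) (\<lambda>k. Z m k x q)) * V m k x q)) s q)"
        by (intro jcont_add jcont_pint jcont_sum jcont_mult[OF jp Suc] jcont_mult[OF jconst jv] jconst)
      then show ?case by (rule jcont_cong[rotated]) (rule VS)
    qed
    have der: "((\<lambda>t. Z m j s (q(i := t))) has_real_derivative V m j s q) (at (q i))" if "s \<in> {0..1}" "q \<in> N" for j m s q
      using that
    proof (induction m arbitrary: j s q)
      case 0
      show ?case unfolding V0 by (auto intro!: derivative_eq_intros)
    next
      case (Suc m)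
      have "((\<lambda>t. (q(i := t)) j + pint (\<lambda>x q. e q * v j (\<lambda>k. Z m k x q)) s (q(i := t)))
          has_real_derivative V (Suc m) j s q) (at (q i))"
        unfolding VS
      proof (rule DERIV_add)
        show "((\<lambda>t. (q(i := t)) j) has_real_derivative (if i = j then 1 else 0)) (at (q i))"
          by (cases "i = j") (auto intro!: derivative_eq_intros)
        show "((\<lambda>t. pint (\<lambda>x q. e q * v j (\<lambda>k. Z m k x q)) s (q(i := t))) has_real_derivative
            pint (\<lambda>x q. \<epsilon> * v j (\<lambda>k. Z m k x q) + (\<Sum>k\<in>UNIV. (e q * partial k (v j) (\<lambda>k. Z m k x q)) * V m k x q)) s q) (at (q i))"
        proof (rule pint_has_derivative[OF open_N _ _ Suc.prems])
          show "jcont N (\<lambda>x q. e q * v j (\<lambda>k. Z m k x q))" by (rule jcont_mult[OF jcont_e jv])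
          show "jcont N (\<lambda>x q. \<epsilon> * v j (\<lambda>k. Z m k x q) + (\<Sum>k\<in>UNIV. (e q * partial k (v j) (\<lambda>k. Z m k x q)) * V m k x q))"
            by (intro jcont_add jcont_sum jcont_mult[OF jp jV] jcont_mult[OF jconst jv])
          show "((\<lambda>t. e (q(i := t)) * v j (\<lambda>k. Z m k x (q(i := t)))) has_real_derivative
            \<epsilon> * v j (\<lambda>k. Z m k x q) + (\<Sum>k\<in>UNIV. (e q * partial k (v j) (\<lambda>k. Z m k x q)) * V m k x q)) (at (q i))"
            if "x \<in> {0..1}" "q \<in> N" for x q
            unfolding \<epsilon>_def
            by (rule integrand_derivative[where Y="Z m" and Y'="V m", OF Suc.IH[OF that] Z_box[OF that]])
        qed
      qed
      then show ?case by (simp only: Z.simps)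
    qed
    have "cv r N (\<lambda>m. V m j)" for j
    proof (rule cv_linear[where U="\<lambda>j m. V m j" and B="\<lambda>j k m s q. e q * partial k (v j) (\<lambda>k. Z m k s q)"
          and c="\<lambda>j m s q. (if i = j then 1 else 0) + pint (\<lambda>x q. \<epsilon> * v j (\<lambda>k. Z m k x q)) s q", OF open_N _ \<delta>(3)])
      show "\<bar>e q * partial k (v j) (\<lambda>k. Z m k s q)\<bar> \<le> \<delta> * L" if "s \<in> {0..1}" "q \<in> N" for j k m s q
        by (rule small_coefficient[OF that(2) Z_box[OF that]])
      show "V (Suc m) j s q = (if i = j then 1 else 0) + pint (\<lambda>x q. \<epsilon> * v j (\<lambda>k. Z m k x q)) s q +
          pint (\<lambda>x q. \<Sum>k\<in>UNIV. (e q * partial k (v j) (\<lambda>k. Z m k x q)) * V m k x q) s q"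
        if sq: "s \<in> {0..1}" "q \<in> N" for j m s q
        unfolding VS add.assoc
        by (subst pint_add[OF jcont_mult[OF jconst jv] jcont_sum[OF jcont_mult[OF jp jV]] sq]) (rule refl)
      show "cv r N (\<lambda>m. V 0 j)" for j unfolding V0 by (rule cv_const)
      show "cv r N (\<lambda>m s q. (if i = j then 1 else 0) + pint (\<lambda>x q. \<epsilon> * v j (\<lambda>k. Z m k x q)) s q)" for j
        by (intro cv_add cv_const cv_pint[OF open_N] cv_mult cvv)
      show "cv r N (\<lambda>m s q. e q * partial k (v j) (\<lambda>k. Z m k s q))" for j k by (rule cvp)
    qed
    with der show ?thesis by blast
  qed
  with cv0_Z show ?case by simp
qed

section \<open>The flow as limit of the iterates, and its first integrals\<close>

definition Zl :: "'i \<Rightarrow> real \<Rightarrow> ('i \<Rightarrow> real) \<Rightarrow> real" where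
  "Zl j s q = lim (\<lambda>m. Z m j s q)"

lemma Zl_tendsto: "s \<in> {0..1} \<Longrightarrow> q \<in> N \<Longrightarrow> (\<lambda>m. Z m j s q) \<longlonglongrightarrow> Zl j s q"
  unfolding Zl_def by (rule cv0_tendsto[OF cv0_Z])

lemma Zl_box: "s \<in> {0..1} \<Longrightarrow> q \<in> N \<Longrightarrow> \<bar>Zl j s q - p j\<bar> \<le> b"
  by (rule LIMSEQ_le_const2[where X="\<lambda>m. \<bar>Z m j s q - p j\<bar>"])
    (auto intro!: tendsto_intros Zl_tendsto Z_box simp del: Z.simps)

lemma Zl_jcont: "jcont N (Zl j)"
  unfolding Zl_def[abs_def] by (rule jcont_lim[OF cv0_Z])

lemma Zl_smooth: "s \<in> {0..1} \<Longrightarrow> smooth_coord N (Zl j s)"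
  unfolding smooth_coord_iff_ck Zl_def[abs_def] using open_N ck_lim[OF open_N _ cv_Z] by blast

lemma jcont_vZl: "jcont N (\<lambda>s q. v j (\<lambda>k. Zl k s q))"
  by (rule jcont_comp[OF Zl_jcont Zl_box cont_v])

lemma jcont_pvZl: "jcont N (\<lambda>s q. e q * partial k (v j) (\<lambda>k. Zl k s q))"
  by (rule jcont_mult[OF jcont_e jcont_comp[OF Zl_jcont Zl_box
      continuous_on_subset[OF smooth_coordD(2)[OF smooth_coordD(4)[OF smooth]] box]]])

lemma Zl_eq:
  assumes sq: "s \<in> {0..1}" "q \<in> N"
  shows "Zl j s q = q j + pint (\<lambda>x q. e q * v j (\<lambda>k. Zl k x q)) s q"
proof (rule LIMSEQ_unique)
  show "(\<lambda>m. Z (Suc m) j s q) \<longlonglongrightarrow> Zl j s q"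
    using Zl_tendsto[OF sq] by (rule LIMSEQ_Suc)
  have cv: "cv0 N (\<lambda>m s q. e q * v j (\<lambda>k. Z m k s q))"
    using cv_mult[OF cv_e cv_comp[where Z="\<lambda>k m. Z m k", OF smooth box cv_Z Z_box], of 0] by simp
  have lim: "lim (\<lambda>m. e q * v j (\<lambda>k. Z m k x q)) = e q * v j (\<lambda>k. Zl k x q)" if "x \<in> {0..1}" for x
  proof (rule limI, rule tendsto_mult[OF tendsto_const])
    show "(\<lambda>m. v j (\<lambda>k. Z m k x q)) \<longlonglongrightarrow> v j (\<lambda>k. Zl k x q)"
    proof (rule continuous_on_tendsto_compose[OF cont_v])
      show "(\<lambda>m k. Z m k x q) \<longlonglongrightarrow> (\<lambda>k. Zl k x q)"
        by (rule topological_tendstoI, rule eventually_in_open_coordinatewise) (use Zl_tendsto[OF that sq(2)] in auto)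
    qed (use Z_box[OF that sq(2)] Zl_box[OF that sq(2)] in auto)
  qed
  have "(\<lambda>m. pint (\<lambda>x q. e q * v j (\<lambda>k. Z m k x q)) s q) \<longlonglongrightarrow> pint (\<lambda>x q. e q * v j (\<lambda>k. Zl k x q)) s q"
    unfolding LIMSEQ_def
  proof (intro allI impI)
    fix \<epsilon> :: real assume "\<epsilon> > 0"
    then obtain M where M: "\<forall>m\<ge>M. \<forall>s\<in>{0..1}. \<forall>q\<in>N.
        \<bar>e q * v j (\<lambda>k. Z m k s q) - lim (\<lambda>m. e q * v j (\<lambda>k. Z m k s q))\<bar> \<le> \<epsilon> / 2"
      using cv0_uniform[OF cv half_gt_zero] by blast
    have "\<bar>pint (\<lambda>x q. e q * v j (\<lambda>k. Z m k x q)) s q - pint (\<lambda>x q. e q * v j (\<lambda>k. Zl k x q)) s q\<bar> \<le> \<epsilon> / 2"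
      if "m \<ge> M" for m
      unfolding pint_diff[OF cv0_jcont[OF cv] jcont_mult[OF jcont_e jcont_vZl] sq]
    proof (rule pint_bound[OF jcont_diff[OF cv0_jcont[OF cv] jcont_mult[OF jcont_e jcont_vZl]] sq])
      show "\<bar>e q * v j (\<lambda>k. Z m k x q) - e q * v j (\<lambda>k. Zl k x q)\<bar> \<le> \<epsilon> / 2" if "x \<in> {0..1}" for x
        using M[rule_format, OF \<open>m \<ge> M\<close> that sq(2)] by (simp add: lim[OF that])
    qed
    with \<open>\<epsilon> > 0\<close> show "\<exists>M. \<forall>m\<ge>M. dist (pint (\<lambda>x q. e q * v j (\<lambda>k. Z m k x q)) s q) (pint (\<lambda>x q. e q * v j (\<lambda>k. Zl k x q)) s q) < \<epsilon>"
      by (intro exI[of _ M]) (fastforce simp: dist_real_def)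
  qed
  then show "(\<lambda>m. Z (Suc m) j s q) \<longlonglongrightarrow> q j + pint (\<lambda>x q. e q * v j (\<lambda>k. Zl k x q)) s q"
    unfolding Z.simps by (rule tendsto_add[OF tendsto_const])
qed

lemma Zl_0: "q \<in> N \<Longrightarrow> Zl j 0 q = q j"
  by (subst Zl_eq) (auto simp: pint_def)

lemma jcont_partial_Zl: "jcont N (\<lambda>s q. partial i (Zl j s) q)"
proof -
  have "cv (Suc 0) N (\<lambda>m. Z m j)" by (rule cv_Z)
  from cv_SucD[OF this, of i] obtain u' where u'1: "cv 0 N u'" and
    u'2: "\<forall>m. \<forall>s\<in>{0..1}. \<forall>q\<in>N. ((\<lambda>t. Z m j s (q(i := t))) has_real_derivative u' m s q) (at (q i))"
    by (elim exE conjE)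
  have u': "cv0 N u'" using u'1 by simp
  show ?thesis
  proof (rule jcont_cong[OF _ jcont_lim[OF u']])
    show "partial i (Zl j s) q = lim (\<lambda>m. u' m s q)" if "s \<in> {0..1}" "q \<in> N" for s q
      using lim_has_derivative[OF open_N cv0_Z u' that u'2]
      by (intro partialI) (simp add: Zl_def[abs_def] del: fun_upd_apply)
  qed
qed

lemma partial_Zl_eq:
  assumes sq: "s \<in> {0..1}" "q \<in> N"
  shows "partial i (Zl j s) q = (if i = j then 1 else 0) + pint (\<lambda>x q. (if i = \<kappa> then -1 else 0) * v j (\<lambda>k. Zl k x q) +
    (\<Sum>k\<in>UNIV. (e q * partial k (v j) (\<lambda>k. Zl k x q)) * partial i (Zl k x) q)) s q"
proof (rule partialI, rule has_real_derivative_upd_cong[OF open_N sq(2)])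
  show "Zl j s q = q j + pint (\<lambda>x q. e q * v j (\<lambda>k. Zl k x q)) s q" if "q \<in> N" for q by (rule Zl_eq[OF sq(1) that])
  have jconst: "jcont N (\<lambda>s q. c)" for c by (simp add: split_beta)
  show "((\<lambda>t. (q(i := t)) j + pint (\<lambda>x q. e q * v j (\<lambda>k. Zl k x q)) s (q(i := t))) has_real_derivative
      (if i = j then 1 else 0) + pint (\<lambda>x q. (if i = \<kappa> then -1 else 0) * v j (\<lambda>k. Zl k x q) +
    (\<Sum>k\<in>UNIV. (e q * partial k (v j) (\<lambda>k. Zl k x q)) * partial i (Zl k x) q)) s q) (at (q i))"
  proof (rule DERIV_add)
    show "((\<lambda>t. (q(i := t)) j) has_real_derivative (if i = j then 1 else 0)) (at (q i))"
      by (cases "i = j") (auto intro!: derivative_eq_intros)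
    show "((\<lambda>t. pint (\<lambda>x q. e q * v j (\<lambda>k. Zl k x q)) s (q(i := t))) has_real_derivative
      pint (\<lambda>x q. (if i = \<kappa> then -1 else 0) * v j (\<lambda>k. Zl k x q) +
      (\<Sum>k\<in>UNIV. (e q * partial k (v j) (\<lambda>k. Zl k x q)) * partial i (Zl k x) q)) s q) (at (q i))"
    proof (rule pint_has_derivative[OF open_N _ _ sq])
      show "jcont N (\<lambda>x q. e q * v j (\<lambda>k. Zl k x q))" by (rule jcont_mult[OF jcont_e jcont_vZl])
      show "jcont N (\<lambda>x q. (if i = \<kappa> then -1 else 0) * v j (\<lambda>k. Zl k x q) +
        (\<Sum>k\<in>UNIV. (e q * partial k (v j) (\<lambda>k. Zl k x q)) * partial i (Zl k x) q))"
        by (intro jcont_add jcont_sum jcont_mult[OF jcont_pvZl jcont_partial_Zl] jcont_mult[OF jconst jcont_vZl])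
      show "((\<lambda>t. e (q(i := t)) * v j (\<lambda>k. Zl k x (q(i := t)))) has_real_derivative
        (if i = \<kappa> then -1 else 0) * v j (\<lambda>k. Zl k x q) +
        (\<Sum>k\<in>UNIV. (e q * partial k (v j) (\<lambda>k. Zl k x q)) * partial i (Zl k x) q)) (at (q i))"
        if "x \<in> {0..1}" "q \<in> N" for x q
        by (rule integrand_derivative[where Y="Zl" and Y'="\<lambda>k x. partial i (Zl k x)",
            OF has_partial[OF smooth_coordD(5)[OF Zl_smooth[OF that(1)] that(2)]] Zl_box[OF that]])
    qed
  qed
qed

text \<open>The change of the point at parameter \<open>s\<close> when \<open>q\<close> moves along
  \<open>v\<close>. If \<open>q\<close> advances by time \<open>t\<close> on its orbit, the
  remaining time \<open>e q\<close> shrinks by \<open>t\<close>, so the point at parameter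
  \<open>s\<close> advances by \<open>(1 - s) * t\<close>. Hence \<open>D\<close> should be
  \<open>(1 - s) * v\<close> at that point; \<open>D_eq\<close> and
  \<open>transported_field_eq\<close> show that both solve one linear integral equation.\<close>

definition D :: "'i \<Rightarrow> real \<Rightarrow> ('i \<Rightarrow> real) \<Rightarrow> real" where
  "D j s q = (\<Sum>i\<in>UNIV. v i q * partial i (Zl j s) q)"

lemma jcont_v: "jcont N (\<lambda>s q. v i q)"
  by (rule jcont_comp[where Y="\<lambda>j s q. q j" and F="v i"], rule jcont_coord, erule N_box, rule cont_v)

lemma jcont_D: "jcont N (D j)"
  unfolding D_def[abs_def] by (intro jcont_sum jcont_mult[OF jcont_v jcont_partial_Zl])

lemma D_eq:
  assumes sq: "s \<in> {0..1}" "q \<in> N"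
  shows "D j s q = v j q + pint (\<lambda>x q. - v j (\<lambda>k. Zl k x q) +
    (\<Sum>k\<in>UNIV. (e q * partial k (v j) (\<lambda>k. Zl k x q)) * D k x q)) s q"
proof -
  define F where "F i x q = (if i = \<kappa> then -1 else 0) * v j (\<lambda>k. Zl k x q) +
    (\<Sum>k\<in>UNIV. (e q * partial k (v j) (\<lambda>k. Zl k x q)) * partial i (Zl k x) q)" for i x q
  have jconst: "jcont N (\<lambda>s q. c)" for c by (simp add: split_beta)
  have jF: "jcont N (F i)" for i
    unfolding F_def[abs_def]
    by (intro jcont_add jcont_sum jcont_mult[OF jcont_pvZl jcont_partial_Zl] jcont_mult[OF jconst jcont_vZl])
  have "D j s q = (\<Sum>i\<in>UNIV. v i q * (if i = j then 1 else 0)) + (\<Sum>i\<in>UNIV. v i q * pint (F i) s q)"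
    unfolding D_def partial_Zl_eq[OF sq] F_def[abs_def] distrib_left sum.distrib ..
  also have "(\<Sum>i\<in>UNIV. v i q * (if i = j then 1 else 0)) = (\<Sum>i\<in>UNIV. if i = j then v i q else 0)"
    by (rule sum.cong) auto
  also have "\<dots> = v j q" by simp
  also have "(\<Sum>i\<in>UNIV. v i q * pint (F i) s q) = pint (\<lambda>x q. \<Sum>i\<in>UNIV. v i q * F i x q) s q"
    unfolding pint_cmult by (rule pint_sum[OF finite jcont_mult[OF jcont_v jF] sq])
  also have "\<dots> = pint (\<lambda>x q. - v j (\<lambda>k. Zl k x q) + (\<Sum>k\<in>UNIV. (e q * partial k (v j) (\<lambda>k. Zl k x q)) * D k x q)) s q"
  proof (rule pint_cong[OF sq(1)])
    fix x :: real
    have "(\<Sum>i\<in>UNIV. v i q * F i x q) = (\<Sum>i\<in>UNIV. v i q * ((if i = \<kappa> then -1 else 0) * v j (\<lambda>k. Zl k x q))) +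
        (\<Sum>i\<in>UNIV. \<Sum>k\<in>UNIV. v i q * ((e q * partial k (v j) (\<lambda>k. Zl k x q)) * partial i (Zl k x) q))"
      unfolding F_def distrib_left sum.distrib sum_distrib_left ..
    also have "(\<Sum>i\<in>UNIV. v i q * ((if i = \<kappa> then -1 else 0) * v j (\<lambda>k. Zl k x q)))
        = (\<Sum>i\<in>UNIV. if i = \<kappa> then - v \<kappa> q * v j (\<lambda>k. Zl k x q) else 0)"
      by (rule sum.cong) auto
    \<comment> \<open>\<open>v \<kappa> = 1\<close> enters here: \<open>e\<close> decreases at unit
      speed along \<open>v\<close>.\<close>
    also have "\<dots> = - v j (\<lambda>k. Zl k x q)"
      using v1[OF box_S[of q]] N_box[OF sq(2)] by simp
    also have "(\<Sum>i\<in>UNIV. \<Sum>k\<in>UNIV. v i q * ((e q * partial k (v j) (\<lambda>k. Zl k x q)) * partial i (Zl k x) q))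
        = (\<Sum>k\<in>UNIV. (e q * partial k (v j) (\<lambda>k. Zl k x q)) * D k x q)"
      unfolding D_def sum_distrib_left by (subst sum.swap) (simp add: mult_ac)
    finally show "(\<Sum>i\<in>UNIV. v i q * F i x q) = - v j (\<lambda>k. Zl k x q) +
      (\<Sum>k\<in>UNIV. (e q * partial k (v j) (\<lambda>k. Zl k x q)) * D k x q)" .
  qed
  finally show ?thesis .
qed

lemma vZl_time_derivative:
  assumes s: "0 < s" "s < 1" and q: "q \<in> N"
  shows "((\<lambda>s. v j (\<lambda>k. Zl k s q)) has_real_derivative
    (\<Sum>k\<in>UNIV. partial k (v j) (\<lambda>k. Zl k s q) * (e q * v k (\<lambda>k. Zl k s q)))) (at s)"
proof (rule has_derivative_along_curve[where \<gamma>="\<lambda>s k. Zl k s q"])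
  have s01: "s \<in> {0..1}" using s by simp
  show "open S" by (rule smooth_coordD(1)[OF smooth])
  show "(\<lambda>k. Zl k s q) \<in> S" using box_S[of "\<lambda>k. Zl k s q", OF Zl_box[OF s01 q]] .
  show "depends_on S UNIV (v j)" unfolding depends_on_def by (metis UNIV_I ext)
  show "(\<lambda>t. v j (r(i := t))) differentiable at (r i)" if "r \<in> S" for i r
    by (rule smooth_coordD(5)[OF smooth that])
  show "continuous_on S (partial i (v j))" for i by (rule smooth_coordD(2)[OF smooth_coordD(4)[OF smooth]])
  show "((\<lambda>s. Zl k s q) has_real_derivative e q * v k (\<lambda>k. Zl k s q)) (at s)" for k
  proof -
    have "((\<lambda>s. pint (\<lambda>x q. e q * v k (\<lambda>k. Zl k x q)) s q) has_real_derivative e q * v k (\<lambda>k. Zl k s q)) (at s within {0..1})"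
      by (rule pint_has_time_derivative[OF jcont_mult[OF jcont_e jcont_vZl] s01 q])
    then have "((\<lambda>s. pint (\<lambda>x q. e q * v k (\<lambda>k. Zl k x q)) s q) has_real_derivative e q * v k (\<lambda>k. Zl k s q)) (at s)"
      using s by (simp add: at_within_Icc_at)
    from DERIV_add[OF DERIV_const this, of "q k"]
    have d: "((\<lambda>s. q k + pint (\<lambda>x q. e q * v k (\<lambda>k. Zl k x q)) s q) has_real_derivative e q * v k (\<lambda>k. Zl k s q)) (at s)" by simp
    have "\<forall>\<^sub>F s in nhds s. Zl k s q = q k + pint (\<lambda>x q. e q * v k (\<lambda>k. Zl k x q)) s q"
    proof (rule eventually_mono[OF eventually_nhds_in_open[of "{0<..<1}"]])
      show "Zl k s q = q k + pint (\<lambda>x q. e q * v k (\<lambda>k. Zl k x q)) s q" if "s \<in> {0<..<1}" for s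
        using that by (intro Zl_eq[OF _ q]) auto
    qed (use s in auto)
    from iffD2[OF DERIV_cong_ev[OF refl this refl] d] show ?thesis .
  qed
qed simp

lemma transported_field_eq:
  assumes sq: "s \<in> {0..1}" "q \<in> N"
  shows "(1 - s) * v j (\<lambda>k. Zl k s q) = v j q + pint (\<lambda>x q. - v j (\<lambda>k. Zl k x q) +
    (\<Sum>k\<in>UNIV. (e q * partial k (v j) (\<lambda>k. Zl k x q)) * ((1 - x) * v k (\<lambda>k. Zl k x q)))) s q"
proof -
  have js: "jcont N (\<lambda>s q. 1 - s)" unfolding split_beta by (intro continuous_intros)
  have "pint (\<lambda>x q. - v j (\<lambda>k. Zl k x q) +
    (\<Sum>k\<in>UNIV. (e q * partial k (v j) (\<lambda>k. Zl k x q)) * ((1 - x) * v k (\<lambda>k. Zl k x q)))) s q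
    = (1 - s) * v j (\<lambda>k. Zl k s q) - (1 - 0) * v j (\<lambda>k. Zl k 0 q)"
  proof (rule pint_antiderivative[OF _ sq])
    have "jcont N (\<lambda>x q. - v j (\<lambda>k. Zl k x q))"
      using continuous_on_minus[OF jcont_vZl[of j]] by (simp add: split_beta)
    then show "jcont N (\<lambda>x q. - v j (\<lambda>k. Zl k x q) +
      (\<Sum>k\<in>UNIV. (e q * partial k (v j) (\<lambda>k. Zl k x q)) * ((1 - x) * v k (\<lambda>k. Zl k x q))))"
      by (intro jcont_add jcont_sum jcont_mult[OF jcont_pvZl] jcont_mult[OF js] jcont_vZl)
    show "continuous_on {0..1} (\<lambda>x. (1 - x) * v j (\<lambda>k. Zl k x q))"
      by (rule jcont_section'[OF jcont_mult[OF js jcont_vZl] sq(2)])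
    fix x :: real assume x: "0 < x" "x < 1"
    have "((\<lambda>x. 1 - x) has_real_derivative -1) (at x)" by (auto intro!: derivative_eq_intros)
    from DERIV_mult[OF this vZl_time_derivative[OF x sq(2), of j]]
    show "((\<lambda>x. (1 - x) * v j (\<lambda>k. Zl k x q)) has_real_derivative - v j (\<lambda>k. Zl k x q) +
      (\<Sum>k\<in>UNIV. (e q * partial k (v j) (\<lambda>k. Zl k x q)) * ((1 - x) * v k (\<lambda>k. Zl k x q)))) (at x)"
      by (simp add: sum_distrib_left sum_distrib_right mult_ac)
  qed
  then show ?thesis using Zl_0[OF sq(2)] by simp
qed

text \<open>Uniqueness for the linear integral equation: the row sums of its coefficients are at
  most \<open>1/2\<close>, so inserting a bound for the difference \<open>E\<close> into the
  equation halves it, again and again. At \<open>s = 1\<close> the factor \<open>1 - s\<close>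
  vanishes, which yields the first integrals.\<close>

lemma D_eq_transported_field:
  assumes q: "q \<in> N" and s: "s \<in> {0..1}"
  shows "D j s q = (1 - s) * v j (\<lambda>k. Zl k s q)"
proof -
  define E where "E j s q = D j s q - (1 - s) * v j (\<lambda>k. Zl k s q)" for j s q
  have js: "jcont N (\<lambda>s q. 1 - s)" unfolding split_beta by (intro continuous_intros)
  have jC: "jcont N (\<lambda>s q. (1 - s) * v j (\<lambda>k. Zl k s q))" for j by (rule jcont_mult[OF js jcont_vZl])
  have jE: "jcont N (E j)" for j unfolding E_def[abs_def] by (rule jcont_diff[OF jcont_D jC])
  have jm: "jcont N (\<lambda>x q. - v j (\<lambda>k. Zl k x q))" for j
    using continuous_on_minus[OF jcont_vZl[of j]] by (simp add: split_beta)
  have E_eq: "E j s q = pint (\<lambda>x q. \<Sum>k\<in>UNIV. (e q * partial k (v j) (\<lambda>k. Zl k x q)) * E k x q) s q"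
    if s: "s \<in> {0..1}" for j s
  proof -
    have "E j s q = pint (\<lambda>x q. - v j (\<lambda>k. Zl k x q) + (\<Sum>k\<in>UNIV. (e q * partial k (v j) (\<lambda>k. Zl k x q)) * D k x q)) s q
       - pint (\<lambda>x q. - v j (\<lambda>k. Zl k x q) + (\<Sum>k\<in>UNIV. (e q * partial k (v j) (\<lambda>k. Zl k x q)) * ((1 - x) * v k (\<lambda>k. Zl k x q)))) s q"
      unfolding E_def using D_eq[OF s q, of j] transported_field_eq[OF s q, of j] by linarith
    also have "\<dots> = pint (\<lambda>x q. (- v j (\<lambda>k. Zl k x q) + (\<Sum>k\<in>UNIV. (e q * partial k (v j) (\<lambda>k. Zl k x q)) * D k x q)) -
       (- v j (\<lambda>k. Zl k x q) + (\<Sum>k\<in>UNIV. (e q * partial k (v j) (\<lambda>k. Zl k x q)) * ((1 - x) * v k (\<lambda>k. Zl k x q))))) s q"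
      by (intro pint_diff[OF _ _ s q] jcont_add jm jcont_sum jcont_mult[OF jcont_pvZl jcont_D] jcont_mult[OF jcont_pvZl jC])
    also have "\<dots> = pint (\<lambda>x q. \<Sum>k\<in>UNIV. (e q * partial k (v j) (\<lambda>k. Zl k x q)) * E k x q) s q"
      by (rule pint_cong[OF s]) (simp add: E_def right_diff_distrib sum_subtractf)
    finally show ?thesis .
  qed
  have "\<forall>j. \<exists>X. \<forall>s\<in>{0..1}. \<bar>E j s q\<bar> \<le> X"
  proof
    fix j
    have "bounded ((\<lambda>s. E j s q) ` {0..1})"
      by (intro compact_imp_bounded compact_continuous_image jcont_section'[OF jE q]) simp
    then show "\<exists>X. \<forall>s\<in>{0..1}. \<bar>E j s q\<bar> \<le> X" unfolding bounded_iff by auto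
  qed
  from choice[OF this] obtain X where X: "\<forall>j. \<forall>s\<in>{0..1}. \<bar>E j s q\<bar> \<le> X j" ..
  define Y where "Y = Max (range X)"
  have XY: "X j \<le> Y" for j unfolding Y_def by (intro Max_ge) auto
  have it: "\<bar>E j s q\<bar> \<le> Y / 2 ^ m" if "s \<in> {0..1}" for m j s
    using that
  proof (induction m arbitrary: j s)
    case 0
    then have "\<bar>E j s q\<bar> \<le> X j" using X by blast
    with XY[of j] show ?case by simp
  next
    case (Suc m)
    show ?case unfolding E_eq[OF Suc.prems]
    proof (rule pint_bound[OF _ Suc.prems q])
      show "jcont N (\<lambda>x q. \<Sum>k\<in>UNIV. (e q * partial k (v j) (\<lambda>k. Zl k x q)) * E k x q)"
        by (intro jcont_sum jcont_mult[OF jcont_pvZl jE])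
      fix x :: real assume x: "x \<in> {0..1}"
      have Y0: "Y / 2 ^ m \<ge> 0" using Suc.IH[OF x, of j] by (rule order_trans[OF abs_ge_zero])
      have "\<bar>\<Sum>k\<in>UNIV. (e q * partial k (v j) (\<lambda>k. Zl k x q)) * E k x q\<bar> \<le> (\<Sum>k\<in>(UNIV::'i set). (\<delta> * L) * (Y / 2 ^ m))"
      proof (rule order_trans[OF sum_abs], rule sum_mono)
        fix k
        show "\<bar>(e q * partial k (v j) (\<lambda>k. Zl k x q)) * E k x q\<bar> \<le> (\<delta> * L) * (Y / 2 ^ m)"
          unfolding abs_mult[of "e q * _"] using small_coefficient[OF q Zl_box[OF x q], of k j] Suc.IH[OF x, of k] \<delta>(1) L_nonneg
          by (intro mult_mono) auto
      qed
      also have "\<dots> = (real CARD('i) * (\<delta> * L)) * (Y / 2 ^ m)" by simp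
      also have "\<dots> \<le> 1 / 2 * (Y / 2 ^ m)" by (rule mult_right_mono[OF \<delta>(3) Y0])
      finally show "\<bar>\<Sum>k\<in>UNIV. (e q * partial k (v j) (\<lambda>k. Zl k x q)) * E k x q\<bar> \<le> Y / 2 ^ Suc m" by simp
    qed
  qed
  have "(\<lambda>m. Y / 2 ^ m) \<longlonglongrightarrow> 0"
    using LIMSEQ_divide_realpow_zero[of 2 Y] by simp
  then have "\<bar>E j s q\<bar> \<le> 0" using it[OF s] by (intro LIMSEQ_le_const) auto
  then show ?thesis by (simp add: E_def)
qed

lemma first_integral_Zl: "q \<in> N \<Longrightarrow> dder (\<lambda>i. v i q) (Zl j 1) q = 0"
  using D_eq_transported_field[of q 1 j] by (simp add: dder_finite D_def)

text \<open>\<open>p\<close> lies on the slice: \<open>e p = 0\<close>, and \<open>e\<close> does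
  not change in directions other than \<open>\<kappa>\<close>, so to first order nothing is
  transported.\<close>

lemma partial_Zl_at_p: "i \<noteq> \<kappa> \<Longrightarrow> partial i (Zl j 1) p = (if i = j then 1 else 0)"
proof -
  assume i: "i \<noteq> \<kappa>"
  have "pint (\<lambda>x q. (if i = \<kappa> then -1 else 0) * v j (\<lambda>k. Zl k x q) +
    (\<Sum>k\<in>UNIV. (e q * partial k (v j) (\<lambda>k. Zl k x q)) * partial i (Zl k x) q)) 1 p = pint (\<lambda>x q. 0) 1 p"
    by (rule pint_cong) (use i in \<open>auto simp: e_def\<close>)
  then show ?thesis using partial_Zl_eq[of 1 p i j] p_N by (simp add: pint_def)
qed

end

text \<open>Dividing \<open>v\<close> by its component \<open>\<kappa>\<close> makes this coordinate
  serve as time and does not change the first integrals. At \<open>p\<close> their derivatives in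
  the other directions are those of the coordinates; \<open>N'\<close> is a neighbourhood where this
  persists up to \<open>1 / (2 * n)\<close>, the tolerance of
  \<open>near_identity_injective\<close>.\<close>

lemma first_integrals_exist:
  fixes v :: "'i::finite \<Rightarrow> ('i \<Rightarrow> real) \<Rightarrow> real"
  assumes v: "\<And>j. smooth_coord S (v j)" and p: "p \<in> S" and v\<kappa>: "v \<kappa> p \<noteq> 0"
  shows "\<exists>N h. open N \<and> p \<in> N \<and> N \<subseteq> S \<and> (\<forall>q\<in>N. v \<kappa> q \<noteq> 0) \<and> (\<forall>j. smooth_coord N (h j)) \<and>
    (\<forall>j. \<forall>q\<in>N. dder (\<lambda>i. v i q) (h j) q = 0) \<and>
    (\<forall>i j. \<forall>q\<in>N. i \<noteq> \<kappa> \<longrightarrow> \<bar>partial i (h j) q - (if i = j then 1 else 0)\<bar> \<le> 1 / (2 * real CARD('i)))"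
proof -
  define S' where "S' = {q \<in> S. v \<kappa> q \<in> - {0}}"
  have "S' = S \<inter> v \<kappa> -` (- {0})" by (auto simp: S'_def)
  then have oS': "open S'"
    using continuous_open_preimage[OF smooth_coordD(2)[OF v[of \<kappa>]] smooth_coordD(1)[OF v[of \<kappa>]], of "- {0}"] by (simp add: open_Compl)
  have S'S: "S' \<subseteq> S" by (auto simp: S'_def)
  have vS': "smooth_coord S' (v j)" for j by (rule smooth_coord_subset[OF v oS' S'S])
  define w where "w j q = v j q * inverse (v \<kappa> q)" for j q
  have w: "smooth_coord S' (w j)" for j
    unfolding w_def[abs_def] by (intro smooth_coord_mult vS' smooth_coord_inverse) (auto simp: S'_def)
  have "p \<in> S'" using p v\<kappa> by (simp add: S'_def)
  with oS' obtain J d where "finite J" and d: "d > 0" "{q. \<forall>i\<in>J. \<bar>q i - p i\<bar> < d} \<subseteq> S'"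
    by (rule open_contains_box)
  define b where "b = d / 2"
  have b: "b > 0" "{a. \<forall>i. \<bar>a i - p i\<bar> \<le> b} \<subseteq> S'"
  proof -
    show "b > 0" using d by (simp add: b_def)
    have "\<bar>a i - p i\<bar> < d" if "\<bar>a i - p i\<bar> \<le> b" for a i using that d(1) by (simp add: b_def)
    then have "{a. \<forall>i. \<bar>a i - p i\<bar> \<le> b} \<subseteq> {q. \<forall>i\<in>J. \<bar>q i - p i\<bar> < d}" by blast
    then show "{a. \<forall>i. \<bar>a i - p i\<bar> \<le> b} \<subseteq> S'" using d(2) by blast
  qed
  have bnd: "\<exists>M. \<forall>a. (\<forall>i. \<bar>a i - p i\<bar> \<le> b) \<longrightarrow> \<bar>F a\<bar> \<le> M" if "smooth_coord S' F" for F
    by (rule bounded_on_box[OF continuous_on_subset[OF smooth_coordD(2)[OF that] b(2)]]) blast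
  have "\<forall>j. \<exists>M. \<forall>a. (\<forall>i. \<bar>a i - p i\<bar> \<le> b) \<longrightarrow> \<bar>w j a\<bar> \<le> M" using bnd[OF w] by blast
  from choice[OF this] obtain K0 where K0: "\<forall>j a. (\<forall>i. \<bar>a i - p i\<bar> \<le> b) \<longrightarrow> \<bar>w j a\<bar> \<le> K0 j" ..
  have "\<forall>jk. \<exists>M. \<forall>a. (\<forall>i. \<bar>a i - p i\<bar> \<le> b) \<longrightarrow> \<bar>partial (snd jk) (w (fst jk)) a\<bar> \<le> M"
    using bnd[OF smooth_coordD(4)[OF w]] by blast
  from choice[OF this] obtain L0 where L0: "\<forall>jk a. (\<forall>i. \<bar>a i - p i\<bar> \<le> b) \<longrightarrow> \<bar>partial (snd jk) (w (fst jk)) a\<bar> \<le> L0 jk" ..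
  define K where "K = Max (insert 0 (range K0))"
  define L where "L = Max (insert 0 (range L0))"
  have K: "K0 j \<le> K" "K \<ge> 0" and L: "L0 jk \<le> L" "L \<ge> 0" for j jk
    unfolding K_def L_def by (intro Max_ge; simp)+
  define n where "n = real CARD('i)"
  have n: "n > 0" by (simp add: n_def)
  \<comment> \<open>The first bound keeps the iterates in the box of radius \<open>b\<close>, the
    second gives the contraction; adding \<open>1\<close> to \<open>K\<close> and \<open>L\<close>
    avoids division by zero.\<close>
  define \<delta> where "\<delta> = min (b / (1 + K)) (1 / (2 * n * (L + 1)))"
  have \<delta>: "\<delta> > 0" using b(1) K(2) L(2) n by (simp add: \<delta>_def)
  have "\<delta> * (1 + K) \<le> (b / (1 + K)) * (1 + K)" using K(2) by (intro mult_right_mono) (auto simp: \<delta>_def)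
  also have "\<dots> = b" using K(2) by simp
  finally have \<delta>1: "\<delta> + \<delta> * K \<le> b" by (simp only: distrib_left mult_1_right)
  have "n * (\<delta> * L) \<le> n * ((1 / (2 * n * (L + 1))) * (L + 1))"
    using L(2) n \<delta> by (intro mult_left_mono mult_mono) (auto simp: \<delta>_def)
  then have \<delta>2: "n * (\<delta> * L) \<le> 1 / 2" using n L(2) by simp
  interpret P: picard w S' p \<kappa> b \<delta> K L
  proof
    show "\<bar>w j a\<bar> \<le> K" if "\<And>i. \<bar>a i - p i\<bar> \<le> b" for j a
      using K0 K(1)[of j] that by (meson order_trans)
    show "\<bar>partial k (w j) a\<bar> \<le> L" if "\<And>i. \<bar>a i - p i\<bar> \<le> b" for j k a
      using L0[rule_format, of a "(j, k)"] L(1)[of "(j, k)"] that by simp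
    show "w \<kappa> a = 1" if "a \<in> S'" for a using that by (simp add: w_def S'_def)
  qed (use w b \<delta> \<delta>1 \<delta>2 in \<open>auto simp: n_def\<close>)
  define h where "h j = P.Zl j 1" for j
  have h: "smooth_coord P.N (h j)" for j unfolding h_def by (rule P.Zl_smooth) simp
  define T where "T i j = {q \<in> P.N. \<bar>partial i (h j) q - (if i = j then 1 else 0)\<bar> < 1 / (2 * n)}" for i j
  have oT: "open (T i j)" for i j
  proof -
    have "T i j = P.N \<inter> partial i (h j) -` ball (if i = j then 1 else 0) (1 / (2 * n))"
      by (auto simp: T_def dist_real_def abs_minus_commute)
    then show ?thesis
      using continuous_open_preimage[OF smooth_coordD(2)[OF smooth_coordD(4)[OF h]] P.open_N open_ball] by simp
  qed
  define N' where "N' = P.N \<inter> (\<Inter>ij\<in>{ij. fst ij \<noteq> \<kappa>}. T (fst ij) (snd ij))"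
  have oN': "open N'" unfolding N'_def using oT P.open_N by (intro open_Int open_INT) auto
  have N'N: "N' \<subseteq> P.N" by (auto simp: N'_def)
  have NS: "P.N \<subseteq> S'" using P.N_box P.box_S by blast
  show ?thesis
  proof (intro exI[of _ N'] exI[of _ h] conjI allI ballI impI)
    show "p \<in> N'" using P.p_N P.partial_Zl_at_p n by (auto simp: N'_def T_def h_def)
    show "N' \<subseteq> S" using N'N NS S'S by blast
    show "v \<kappa> q \<noteq> 0" if "q \<in> N'" for q using that N'N NS by (auto simp: S'_def)
    show "smooth_coord N' (h j)" for j by (rule smooth_coord_subset[OF h oN' N'N])
    show "dder (\<lambda>i. v i q) (h j) q = 0" if "q \<in> N'" for j q
    proof -
      have "q \<in> P.N" "q \<in> S'" using that N'N NS by auto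
      then have "dder (\<lambda>i. w i q) (h j) q = 0" unfolding h_def by (intro P.first_integral_Zl)
      then have "inverse (v \<kappa> q) * dder (\<lambda>i. v i q) (h j) q = 0"
        by (simp add: dder_finite w_def sum_distrib_left mult_ac)
      then show ?thesis using \<open>q \<in> S'\<close> by (simp add: S'_def)
    qed
    show "\<bar>partial i (h j) q - (if i = j then 1 else 0)\<bar> \<le> 1 / (2 * real CARD('i))" if "q \<in> N'" "i \<noteq> \<kappa>" for i j q
      using that by (auto simp: N'_def T_def n_def less_imp_le)
  qed (rule oN')
qed

section \<open>Coordinates on the manifold and on the jet space\<close>

text \<open>\<open>inv_into S \<kappa>\<close> changes with \<open>S\<close>. Replacing it by a left
  inverse \<open>\<iota>\<close> that does not makes smoothness on different sets a statement about
  the same function, so that restriction and gluing apply.\<close>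

lemma smooth_in_iff:
  assumes "\<And>x. x \<in> S \<Longrightarrow> \<iota> (\<kappa> x) = x"
  shows "smooth_in \<kappa> S F \<longleftrightarrow> smooth_coord (\<kappa> ` S) (\<lambda>y. F (\<iota> y))"
proof -
  have "inj_on \<kappa> S" using assms by (metis inj_on_def)
  then have eq: "(F \<circ> inv_into S \<kappa>) y = F (\<iota> y)" if "y \<in> \<kappa> ` S" for y
    using that assms by (auto simp: inv_into_f_f)
  show ?thesis unfolding smooth_in_def
    using smooth_coord_cong[of "\<kappa> ` S" "F \<circ> inv_into S \<kappa>" "\<lambda>y. F (\<iota> y)"]
      smooth_coord_cong[of "\<kappa> ` S" "\<lambda>y. F (\<iota> y)" "F \<circ> inv_into S \<kappa>"] eq by metis
qed

text \<open>Coordinates as functions on the index type instead of vectors in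
  \<open>real ^ 'n\<close>: this is the format of \<open>smooth_coord\<close>, and it serves the
  infinite index type of the jets as well.\<close>

definition cc :: "('x, 'n::finite) chart \<Rightarrow> 'x \<Rightarrow> 'n \<Rightarrow> real" where
  "cc c x = vec_nth (snd c x)"

definition ci :: "('x, 'n::finite) chart \<Rightarrow> ('n \<Rightarrow> real) \<Rightarrow> 'x" where
  "ci c y = chart_inv c (vec_lambda y)"

definition ei :: "('x, 'n::finite) chart \<Rightarrow> ('n + nat \<times> 'm::finite \<Rightarrow> real) \<Rightarrow> 'x \<times> 'm jet" where
  "ei c q = (ci c (\<lambda>i. q (Inl i)), \<lambda>j. \<chi> i. q (Inr (j, i)))"

definition ji :: "(nat \<times> 'm::finite \<Rightarrow> real) \<Rightarrow> 'm jet" where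
  "ji q = (\<lambda>j. \<chi> i. q (j, i))"

definition tr :: "('x, 'n::finite) chart \<Rightarrow> ('x, 'n) chart \<Rightarrow> ('n \<Rightarrow> real) \<Rightarrow> 'n \<Rightarrow> real" where
  "tr c d y = cc d (ci c y)"

lemma ji_jet_coords [simp]: "ji (jet_coords w) = w"
  by (auto simp: ji_def jet_coords_def vec_eq_iff)

lemma jet_coords_ji [simp]: "jet_coords (ji q) = q"
  by (auto simp: ji_def jet_coords_def)

lemma inv_jet_coords: "inv jet_coords = ji"
  by (rule ext) (metis inv_f_f jet_coords_ji inj_on_inverseI ji_jet_coords)

lemma continuous_ji: "continuous_on S ji"
  unfolding ji_def
  by (intro continuous_on_coordinatewise_then_product continuous_on_vec_lambda continuous_on_subset[OF continuous_on_product_coordinates]) auto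

lemma jet_image: "jet_coords ` V = ji -` V"
  by (auto simp: image_iff) (metis jet_coords_ji)

lemma open_jet_image: "open V \<Longrightarrow> open (jet_coords ` V)"
  unfolding jet_image by (rule open_vimage[OF _ continuous_ji])

lemma continuous_jet_coords: "continuous_on S (\<lambda>w. jet_coords w a)"
  unfolding jet_coords_def split_beta
  by (intro continuous_on_component continuous_on_subset[OF continuous_on_product_coordinates]) auto

lemma smooth_in_jet_iff: "smooth_in jet_coords V F \<longleftrightarrow> smooth_coord (jet_coords ` V) (\<lambda>q. F (ji q))"
  by (rule smooth_in_iff) simp

text \<open>The components of the trivial Cartan field, so that \<open>dder (shift_coords q)\<close>
  is this derivation at \<open>q\<close>.\<close>

definition shift_coords :: "(nat \<times> 'm \<Rightarrow> real) \<Rightarrow> nat \<times> 'm \<Rightarrow> real" where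
  "shift_coords q = (\<lambda>(j, i). q (Suc j, i))"

text \<open>Only finitely many partial derivatives are nonzero at the point, so the series is a
  finite sum over the orders that occur.\<close>

lemma suminf_dder:
  fixes F :: "('a + nat \<times> 'm::finite \<Rightarrow> real) \<Rightarrow> real"
  assumes fin: "finite {a. partial (f a) F q \<noteq> 0}"
  shows "(\<Sum>j. \<Sum>i\<in>UNIV. b (j, i) * partial (f (j, i :: 'm)) F q) =
    (\<Sum>a | partial (f a) F q \<noteq> 0. b a * partial (f a) F q)"
proof -
  define K where "K = {a. partial (f a) F q \<noteq> 0}"
  have fK: "finite (fst ` K)" using fin by (simp add: K_def)
  have "(\<Sum>j. \<Sum>i\<in>UNIV. b (j, i) * partial (f (j, i)) F q) = (\<Sum>j\<in>fst ` K. \<Sum>i\<in>UNIV. b (j, i) * partial (f (j, i)) F q)"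
  proof (rule suminf_finite[OF fK])
    fix j assume "j \<notin> fst ` K"
    then have "partial (f (j, i)) F q = 0" for i by (force simp: K_def)
    then show "(\<Sum>i\<in>UNIV. b (j, i) * partial (f (j, i)) F q) = 0" by simp
  qed
  also have "\<dots> = (\<Sum>a\<in>fst ` K \<times> UNIV. b a * partial (f a) F q)"
    by (simp add: sum.cartesian_product split_beta)
  also have "\<dots> = (\<Sum>a\<in>K. b a * partial (f a) F q)"
    by (rule sum.mono_neutral_right) (use fK in \<open>force simp: K_def\<close>)+
  finally show ?thesis by (simp add: K_def)
qed

lemma suminf_dder':
  fixes F :: "(nat \<times> 'm::finite \<Rightarrow> real) \<Rightarrow> real"
  assumes fin: "finite {a. partial a F q \<noteq> 0}"
  shows "(\<Sum>j. \<Sum>i\<in>UNIV. b (j, i) * partial (j, i) F q) = dder b F q"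
proof -
  define K where "K = {a. partial a F q \<noteq> 0}"
  have fK: "finite (fst ` K)" using fin by (simp add: K_def)
  have "(\<Sum>j. \<Sum>i\<in>UNIV. b (j, i) * partial (j, i) F q) = (\<Sum>j\<in>fst ` K. \<Sum>i\<in>UNIV. b (j, i) * partial (j, i) F q)"
  proof (rule suminf_finite[OF fK])
    fix j assume "j \<notin> fst ` K"
    then have "partial (j, i) F q = 0" for i by (force simp: K_def)
    then show "(\<Sum>i\<in>UNIV. b (j, i) * partial (j, i) F q) = 0" by simp
  qed
  also have "\<dots> = (\<Sum>a\<in>fst ` K \<times> UNIV. b a * partial a F q)"
    by (simp add: sum.cartesian_product split_beta)
  also have "\<dots> = dder b F q"
    by (rule dder_eq_sum[symmetric]) (use fK in \<open>force simp: K_def\<close>)+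
  finally show ?thesis .
qed

lemma trivial_cartan_eq_dder:
  assumes "smooth_coord S (\<lambda>q. F (ji q))" "jet_coords w \<in> S"
  shows "trivial_cartan F w = dder (shift_coords (jet_coords w)) (\<lambda>q. F (ji q)) (jet_coords w)"
proof -
  have "trivial_cartan F w = (\<Sum>j. \<Sum>i\<in>UNIV. shift_coords (jet_coords w) (j, i) * partial (j, i) (\<lambda>q. F (ji q)) (jet_coords w))"
    unfolding trivial_cartan_def inv_jet_coords o_def by (simp add: shift_coords_def jet_coords_def)
  then show ?thesis using suminf_dder'[OF finite_partial_support[OF assms]] by simp
qed

lemma dder_Plus:
  fixes F :: "('n::finite + nat \<times> 'm::finite \<Rightarrow> real) \<Rightarrow> real"
  assumes "finite {a. partial a F q \<noteq> 0}"
  shows "dder b F q = (\<Sum>i\<in>UNIV. b (Inl i) * partial (Inl i) F q) +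
    (\<Sum>j. \<Sum>i\<in>UNIV. b (Inr (j, i)) * partial (Inr (j, i)) F q)"
proof -
  define K where "K = {a. partial (Inr a) F q \<noteq> 0}"
  have fK: "finite K" unfolding K_def
    using finite_vimageI[OF assms, of Inr] by (simp add: vimage_def)
  have "dder b F q = (\<Sum>a\<in>range Inl \<union> Inr ` K. b a * partial a F q)"
  proof (rule dder_eq_sum)
    show "partial a F q = 0" if "a \<notin> range Inl \<union> Inr ` K" for a
      using that by (cases a) (auto simp: K_def)
  qed (use fK in auto)
  also have "\<dots> = (\<Sum>a\<in>range Inl. b a * partial a F q) + (\<Sum>a\<in>Inr ` K. b a * partial a F q)"
    using fK by (intro sum.union_disjoint) auto
  also have "(\<Sum>a\<in>range Inl. b a * partial a F q) = (\<Sum>i\<in>UNIV. b (Inl i) * partial (Inl i) F q)"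
    by (simp add: sum.reindex)
  also have "(\<Sum>a\<in>Inr ` K. b a * partial a F q) = (\<Sum>a\<in>K. b (Inr a) * partial (Inr a) F q)"
    by (simp add: sum.reindex)
  also have "\<dots> = (\<Sum>j. \<Sum>i\<in>UNIV. b (Inr (j, i)) * partial (Inr (j, i)) F q)"
    using suminf_dder[of Inr F q "\<lambda>a. b (Inr a)"] fK by (simp add: K_def)
  finally show ?thesis .
qed

text \<open>The second order terms cancel because partial derivatives commute. What remains is the
  Lie bracket as commutator of derivations, with the sign convention of
  \<open>lie_bracket\<close>.\<close>

lemma dder_commutator:
  fixes a b :: "('n::finite \<Rightarrow> real) \<Rightarrow> 'n \<Rightarrow> real"
  assumes a: "\<And>i. smooth_coord S (\<lambda>q. a q i)" and b: "\<And>i. smooth_coord S (\<lambda>q. b q i)"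
    and F: "smooth_coord S F" and q: "q \<in> S"
  shows "dder (a q) (\<lambda>q. dder (b q) F q) q - dder (b q) (\<lambda>q. dder (a q) F q) q =
    dder (\<lambda>i. dder (a q) (\<lambda>q. b q i) q - dder (b q) (\<lambda>q. a q i) q) F q"
proof -
  have o: "open S" by (rule smooth_coordD(1)[OF F])
  have 1: "dder (u q) (\<lambda>q. dder (v q) F q) q =
      (\<Sum>i\<in>UNIV. dder (u q) (\<lambda>q. v q i) q * partial i F q) + (\<Sum>i\<in>UNIV. v q i * dder (u q) (partial i F) q)"
    if v: "\<And>i. smooth_coord S (\<lambda>q. v q i)" for u v :: "('n \<Rightarrow> real) \<Rightarrow> 'n \<Rightarrow> real"
  proof -
    have "dder (u q) (\<lambda>q. dder (v q) F q) q = (\<Sum>i\<in>UNIV. dder (u q) (\<lambda>q. v q i * partial i F q) q)"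
      unfolding dder_finite[of "v _"]
      by (rule dder_sum[OF o smooth_coord_mult[OF v smooth_coordD(4)[OF F]] q])
    also have "\<dots> = (\<Sum>i\<in>UNIV. dder (u q) (\<lambda>q. v q i) q * partial i F q + v q i * dder (u q) (partial i F) q)"
      by (intro sum.cong refl dder_mult[OF v smooth_coordD(4)[OF F] q])
    finally show ?thesis by (simp add: sum.distrib)
  qed
  have "(\<Sum>i\<in>UNIV. b q i * dder (a q) (partial i F) q) = (\<Sum>i\<in>UNIV. \<Sum>k\<in>UNIV. b q i * (a q k * partial k (partial i F) q))"
    unfolding dder_finite sum_distrib_left ..
  also have "\<dots> = (\<Sum>k\<in>UNIV. \<Sum>i\<in>UNIV. b q i * (a q k * partial k (partial i F) q))" by (rule sum.swap)
  also have "\<dots> = (\<Sum>k\<in>UNIV. \<Sum>i\<in>UNIV. a q k * (b q i * partial i (partial k F) q))"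
    by (simp add: mult_ac partial_commute[OF F q])
  also have "\<dots> = (\<Sum>k\<in>UNIV. a q k * dder (b q) (partial k F) q)"
    unfolding dder_finite sum_distrib_left ..
  finally have sw: "(\<Sum>i\<in>UNIV. b q i * dder (a q) (partial i F) q) = (\<Sum>i\<in>UNIV. a q i * dder (b q) (partial i F) q)" .
  show ?thesis unfolding 1[OF b, where u=a] 1[OF a, where u=b] sw dder_finite[of "\<lambda>i. _ i - _ i"]
    by (simp add: left_diff_distrib sum_subtractf)
qed

locale control_system =
  fixes A :: "('x::{t2_space,second_countable_topology}, 'n::finite) chart set"
    and f0 :: "('x, 'n) vfield" and f :: "'m::finite \<Rightarrow> ('x, 'n) vfield"
  assumes manifold: "smooth_manifold A" and f0: "smooth_vfield A f0" and f: "\<And>j. smooth_vfield A (f j)"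
begin

lemma chart_at: "chart_at A x \<in> A" "x \<in> fst (chart_at A x)"
proof -
  have "\<exists>c. c \<in> A \<and> x \<in> fst c" using manifold unfolding smooth_manifold_def by blast
  from someI_ex[OF this] show "chart_at A x \<in> A" "x \<in> fst (chart_at A x)" by (auto simp: chart_at_def)
qed

lemma chart:
  assumes "c \<in> A"
  shows "open (fst c)" "open (snd c ` fst c)" "homeomorphism (fst c) (snd c ` fst c) (snd c) (chart_inv c)"
  using manifold assms unfolding smooth_manifold_def by blast+

lemma ci_cc: "c \<in> A \<Longrightarrow> x \<in> fst c \<Longrightarrow> ci c (cc c x) = x"
  using homeomorphism_apply1[OF chart(3)] by (simp add: ci_def cc_def vec_lambda_eta)

lemma ei_ext_coords: "c \<in> A \<Longrightarrow> p \<in> fst c \<times> UNIV \<Longrightarrow> ei c (ext_coords c p) = p" for p :: "'x \<times> 'm jet"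
  using ci_cc[of c "fst p"] by (auto simp: ei_def ext_coords_def jet_coords_def cc_def vec_eq_iff fun_eq_iff prod_eq_iff)

lemma continuous_ci:
  assumes "c \<in> A" shows "continuous_on (cc c ` fst c) (ci c)"
proof -
  have "continuous_on (cc c ` fst c) (\<lambda>y::'n\<Rightarrow>real. \<chi> i. y (id i))"
    by (rule continuous_vec_lambda_comp)
  then have "continuous_on (cc c ` fst c) (\<lambda>y. chart_inv c (\<chi> i. y (id i)))"
    by (rule continuous_on_compose2[OF homeomorphism_cont2[OF chart(3)[OF assms]]])
      (auto simp: cc_def vec_lambda_eta)
  then show ?thesis by (simp add: ci_def)
qed

lemma open_cc_image:
  assumes c: "c \<in> A" and U: "open U" "U \<subseteq> fst c"
  shows "open (cc c ` U)"
proof -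
  have "open (snd c ` U)"
    using homeomorphism_imp_open_map[OF chart(3)[OF c], of U] U chart(2)[OF c]
    by (metis inf.absorb_iff2 openin_open openin_open_eq)
  then have "open ((\<lambda>y::'n\<Rightarrow>real. \<chi> i. y (id i)) -` (snd c ` U))"
    by (rule open_vimage) (rule continuous_vec_lambda_comp)
  moreover have "(\<lambda>y::'n\<Rightarrow>real. \<chi> i. y (id i)) -` (snd c ` U) = cc c ` U"
    by (auto simp: cc_def image_iff vec_lambda_eta) (metis vec_lambda_inverse UNIV_I)+
  ultimately show ?thesis by simp
qed

text \<open>Written as a preimage under \<open>ei c\<close>, the image of an open set is seen to be
  open. The condition on the \<open>Inl\<close> part keeps to the chart range, outside of which
  \<open>chart_inv\<close> is arbitrary.\<close>

lemma ext_image: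
  fixes W :: "('x \<times> 'm jet) set"
  assumes c: "c \<in> A" and W: "W \<subseteq> fst c \<times> UNIV"
  shows "ext_coords c ` W = {q. (\<lambda>i. q (Inl i)) \<in> cc c ` fst c \<and> ei c q \<in> W}"
proof safe
  fix x w assume "(x, w) \<in> W"
  with W show "(\<lambda>i. ext_coords c (x, w) (Inl i)) \<in> cc c ` fst c" "ei c (ext_coords c (x, w)) \<in> W"
    using ei_ext_coords[OF c, of "(x, w)"] by (auto simp: ext_coords_def[of _ "(x, w)", THEN fun_cong] cc_def)
next
  fix q x assume q: "ei c q \<in> W" "(\<lambda>i. q (Inl i)) = cc c x" "x \<in> fst c"
  have "ext_coords c (ei c q) a = q a" for a
  proof (cases a)
    case (Inl i)
    have "ext_coords c (ei c q) a = cc c (ci c (cc c x)) i" by (simp add: Inl ext_coords_def ei_def cc_def[of c "ci _ _"] q(2))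
    also have "\<dots> = q a" using ci_cc[OF c q(3)] fun_cong[OF q(2), of i] by (simp add: Inl)
    finally show ?thesis .
  next
    case (Inr b)
    then show ?thesis by (cases b) (simp add: ext_coords_def ei_def jet_coords_def)
  qed
  then have "q = ext_coords c (ei c q)" by auto
  then show "q \<in> ext_coords c ` W" using q(1) by blast
qed

lemma continuous_ei:
  assumes c: "c \<in> A"
  shows "continuous_on {q. (\<lambda>i. q (Inl i)) \<in> cc c ` fst c} (ei c)"
proof -
  have "continuous_on {q. (\<lambda>i. q (Inl i)) \<in> cc c ` fst c} (\<lambda>q. ci c (\<lambda>i. q (Inl i)))"
    by (rule continuous_on_compose2[OF continuous_ci[OF c] continuous_on_coordinatewise_then_product])
      (auto intro: continuous_on_subset[OF continuous_on_product_coordinates])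
  then show ?thesis unfolding ei_def
    by (intro continuous_on_Pair continuous_on_coordinatewise_then_product[where f="\<lambda>q j. \<chi> i. q (Inr (j, i))"] continuous_on_vec_lambda
        continuous_on_subset[OF continuous_on_product_coordinates]) auto
qed

lemma open_ext_image:
  fixes W :: "('x \<times> 'm jet) set"
  assumes c: "c \<in> A" and W: "open W" "W \<subseteq> fst c \<times> UNIV"
  shows "open (ext_coords c ` W)"
proof -
  define T where "T = {q :: 'n + nat \<times> 'm \<Rightarrow> real. (\<lambda>i. q (Inl i)) \<in> cc c ` fst c}"
  have "T = {q \<in> UNIV. (\<lambda>i. q (Inl i)) \<in> cc c ` fst c}" by (simp add: T_def)
  then have "open T"
    using open_preimage_coordinatewise[OF open_UNIV open_cc_image[OF c chart(1)[OF c] order_refl], of "\<lambda>q i. q (Inl i)"]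
      continuous_on_product_coordinates by simp
  with continuous_open_preimage[OF continuous_ei[OF c] _ W(1)] have "open (T \<inter> ei c -` W)" unfolding T_def by blast
  moreover have "T \<inter> ei c -` W = ext_coords c ` W" unfolding ext_image[OF c W(2)] T_def by auto
  ultimately show ?thesis by simp
qed

abbreviation smX :: "('x, 'n) chart \<Rightarrow> ('x \<times> 'm jet) set \<Rightarrow> ('x \<times> 'm jet \<Rightarrow> real) \<Rightarrow> bool" where
  "smX c W F \<equiv> smooth_coord (ext_coords c ` W) (\<lambda>q. F (ei c q))"

abbreviation smx :: "('x, 'n) chart \<Rightarrow> 'x set \<Rightarrow> ('x \<Rightarrow> real) \<Rightarrow> bool" where
  "smx c U h \<equiv> smooth_coord (cc c ` U) (\<lambda>y. h (ci c y))"

lemma smooth_ext_iff: "smooth_ext A W F \<longleftrightarrow> (\<forall>c\<in>A. smX c (W \<inter> fst c \<times> UNIV) F)"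
  unfolding smooth_ext_def
  by (rule ball_cong[OF refl], rule smooth_in_iff) (use ei_ext_coords in auto)

lemma smooth_fun_iff: "smooth_fun A U h \<longleftrightarrow> (\<forall>c\<in>A. smx c (U \<inter> fst c) h)"
  unfolding smooth_fun_def cc_def[symmetric]
  by (rule ball_cong[OF refl], rule smooth_in_iff) (use ci_cc in auto)

lemma cc_vec: "cc c ` U = vec_nth ` snd c ` U"
  by (auto simp: cc_def image_iff)

lemma smooth_tr:
  assumes "c \<in> A" "d \<in> A"
  shows "smooth_coord (cc c ` (fst c \<inter> fst d)) (\<lambda>y. tr c d y i)"
proof -
  have "smooth_in vec_nth (snd c ` (fst c \<inter> fst d)) (\<lambda>y. snd d (chart_inv c y) $ i)"
    using manifold assms unfolding smooth_manifold_def by blast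
  then have "smooth_coord (vec_nth ` snd c ` (fst c \<inter> fst d)) (\<lambda>y. snd d (chart_inv c (vec_lambda y)) $ i)"
    by (subst (asm) smooth_in_iff[of _ vec_lambda]) (simp_all add: vec_lambda_eta)
  then show ?thesis unfolding cc_vec by (simp add: tr_def ci_def cc_def)
qed

lemma tr_cc: "c \<in> A \<Longrightarrow> x \<in> fst c \<Longrightarrow> tr c d (cc c x) = cc d x"
  by (simp add: tr_def ci_cc)

definition etr :: "('x, 'n) chart \<Rightarrow> ('x, 'n) chart \<Rightarrow> ('n + nat \<times> 'm \<Rightarrow> real) \<Rightarrow> 'n + nat \<times> 'm \<Rightarrow> real" where
  "etr c d q = case_sum (tr c d (\<lambda>i. q (Inl i))) (\<lambda>b. q (Inr b))"

lemma etr_ext_coords: "c \<in> A \<Longrightarrow> p \<in> fst c \<times> UNIV \<Longrightarrow> etr c d (ext_coords c p) = ext_coords d p"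
  using tr_cc[of c "fst p" d] by (auto simp: etr_def ext_coords_def cc_def fun_eq_iff split: sum.split)

lemma smooth_etr:
  assumes c: "c \<in> A" and d: "d \<in> A" and W: "open W" "W \<subseteq> (fst c \<inter> fst d) \<times> UNIV"
  shows "smooth_coord (ext_coords c ` W) (\<lambda>q. etr c d q a)"
proof -
  have o: "open (ext_coords c ` W)" using open_ext_image[OF c W(1)] W(2) by blast
  show ?thesis
  proof (cases a)
    case (Inl i)
    have "smooth_coord (ext_coords c ` W) (\<lambda>q. tr c d (\<lambda>i. q (Inl i)) i)"
      by (rule smooth_coord_comp[OF smooth_tr[OF c d] o smooth_coord_coord[OF o]])
        (use W(2) in \<open>force simp: ext_coords_def cc_def\<close>)
    then show ?thesis by (simp add: etr_def Inl)
  next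
    case (Inr b)
    then show ?thesis using smooth_coord_coord[OF o] by (simp add: etr_def)
  qed
qed

text \<open>A chart of the manifold acts on the state coordinates only, so the change of coordinates
  \<open>etr\<close> on the jet space is the transition map together with the identity on the
  controls.\<close>

lemma smX_chart_change:
  assumes c: "c \<in> A" and d: "d \<in> A" and W: "open W" "W \<subseteq> (fst c \<inter> fst d) \<times> UNIV" and F: "smX d W F"
  shows "smX c W F"
proof -
  have o: "open (ext_coords c ` W)" using open_ext_image[OF c W(1)] W(2) by blast
  have "etr c d ` ext_coords c ` W = ext_coords d ` W"
    unfolding image_image by (rule image_cong[OF refl], rule etr_ext_coords[OF c]) (use W(2) in auto)
  then have "smooth_coord (ext_coords c ` W) (\<lambda>q. F (ei d (etr c d q)))"
    by (intro smooth_coord_comp[OF F o smooth_etr[OF c d W]]) simp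
  then show ?thesis
  proof (rule smooth_coord_cong)
    fix q assume "q \<in> ext_coords c ` W"
    then obtain p where p: "p \<in> W" "q = ext_coords c p" by blast
    then have "p \<in> fst c \<times> UNIV" "p \<in> fst d \<times> UNIV" using W(2) by auto
    then show "F (ei d (etr c d q)) = F (ei c q)"
      by (simp only: p(2) etr_ext_coords[OF c] ei_ext_coords[OF c] ei_ext_coords[OF d])
  qed
qed

lemma smX_subset:
  "c \<in> A \<Longrightarrow> smX c W F \<Longrightarrow> open W' \<Longrightarrow> W' \<subseteq> W \<Longrightarrow> W' \<subseteq> fst c \<times> UNIV \<Longrightarrow> smX c W' F"
  by (rule smooth_coord_subset[OF _ open_ext_image]) auto

lemma smooth_extI:
  assumes c: "c \<in> A" and W: "open W" "W \<subseteq> fst c \<times> UNIV" and F: "smX c W F"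
  shows "smooth_ext A W F"
  unfolding smooth_ext_iff
proof
  fix d assume d: "d \<in> A"
  have o: "open (W \<inter> fst d \<times> UNIV)" by (intro open_Int W(1) open_Times chart(1)[OF d] open_UNIV)
  show "smX d (W \<inter> fst d \<times> UNIV) F"
    by (rule smX_chart_change[OF d c o _ smX_subset[OF c F o]]) (use W(2) in auto)
qed

lemma smooth_funI:
  assumes c: "c \<in> A" and U: "open U" "U \<subseteq> fst c" and h: "smx c U h"
  shows "smooth_fun A U h"
  unfolding smooth_fun_iff
proof
  fix d assume d: "d \<in> A"
  have oU: "open (U \<inter> fst d)" by (intro open_Int U(1) chart(1)[OF d])
  have o: "open (cc d ` (U \<inter> fst d))" by (rule open_cc_image[OF d oU]) simp
  have "smooth_coord (cc d ` (U \<inter> fst d)) (\<lambda>y. h (ci c (tr d c y)))"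
  proof (rule smooth_coord_comp[OF h o])
    show "smooth_coord (cc d ` (U \<inter> fst d)) (\<lambda>y. tr d c y i)" for i
      by (rule smooth_coord_subset[OF smooth_tr[OF d c] o]) (use U(2) in auto)
    show "tr d c ` cc d ` (U \<inter> fst d) \<subseteq> cc c ` U" by (auto simp: tr_cc[OF d])
  qed
  then show "smx d (U \<inter> fst d) h"
    by (rule smooth_coord_cong) (use U(2) in \<open>auto simp: tr_cc[OF d] ci_cc[OF c] ci_cc[OF d] subset_iff\<close>)
qed

section \<open>Vector fields and brackets in coordinates\<close>

definition vc :: "('x, 'n) vfield \<Rightarrow> ('x, 'n) chart \<Rightarrow> ('n \<Rightarrow> real) \<Rightarrow> 'n \<Rightarrow> real" where
  "vc v c y = vec_nth (v c (vec_lambda y))"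

text \<open>Unlike \<open>smooth_vfield\<close> this says nothing about changes of charts. The
  members of the involutive closures enter the argument through their expressions in one fixed chart
  only.\<close>

definition smooth_on_chart :: "('x, 'n) chart \<Rightarrow> ('x, 'n) vfield \<Rightarrow> bool" where
  "smooth_on_chart c v \<longleftrightarrow> (\<forall>i. smooth_coord (cc c ` fst c) (\<lambda>y. vc v c y i))"

lemma vc_cc: "vc v c (cc c x) = vec_nth (v c (snd c x))"
  by (simp add: vc_def cc_def vec_lambda_eta)

lemma smooth_vfield_chart:
  assumes "smooth_vfield A v" "c \<in> A" shows "smooth_on_chart c v"
proof -
  have "smooth_in vec_nth (snd c ` fst c) (\<lambda>y. v c y $ i)" for i using assms unfolding smooth_vfield_def by blast
  then have "smooth_coord (vec_nth ` snd c ` fst c) (\<lambda>y. v c (vec_lambda y) $ i)" for i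
    by (subst (asm) smooth_in_iff[of _ vec_lambda]) (simp_all add: vec_lambda_eta)
  then show ?thesis by (simp add: smooth_on_chart_def cc_vec vc_def)
qed

lemma frechet_tr:
  assumes c: "c \<in> A" and d: "d \<in> A" and x: "x \<in> fst c \<inter> fst d"
  shows "(snd d \<circ> chart_inv c has_derivative (\<lambda>\<xi>. \<chi> i. dder (vec_nth \<xi>) (\<lambda>y. tr c d y i) (cc c x))) (at (snd c x))"
proof -
  have "((\<lambda>y. \<chi> i. tr c d (vec_nth y) i) has_derivative (\<lambda>\<xi>. \<chi> i. dder (vec_nth \<xi>) (\<lambda>y. tr c d y i) (vec_nth (snd c x)))) (at (snd c x))"
    by (rule has_derivative_vec_lambda, rule has_derivative_vec[OF smooth_tr[OF c d]]) (use x in \<open>auto simp: cc_def\<close>)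
  moreover have "(\<lambda>y. \<chi> i. tr c d (vec_nth y) i) = snd d \<circ> chart_inv c"
    by (auto simp: tr_def cc_def ci_def vec_lambda_eta fun_eq_iff)
  ultimately show ?thesis by (simp add: cc_def)
qed

lemma vfield_tr:
  assumes v: "smooth_vfield A v" and c: "c \<in> A" and d: "d \<in> A" and x: "x \<in> fst c \<inter> fst d"
  shows "dder (vc v c (cc c x)) (\<lambda>y. tr c d y i) (cc c x) = vc v d (cc d x) i"
proof -
  have "v d (snd d x) = frechet_derivative (snd d \<circ> chart_inv c) (at (snd c x)) (v c (snd c x))"
    using v c d x unfolding smooth_vfield_def by blast
  also have "\<dots> = (\<chi> i. dder (vec_nth (v c (snd c x))) (\<lambda>y. tr c d y i) (cc c x))"
    by (simp flip: frechet_derivative_at[OF frechet_tr[OF c d x]])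
  finally show ?thesis by (simp add: vc_cc)
qed

lemma smooth_affine_field: "smooth_vfield A (affine_field f0 f u)"
  unfolding smooth_vfield_def
proof (intro conjI ballI allI)
  fix c i assume c: "c \<in> A"
  have "smooth_coord (cc c ` fst c) (\<lambda>y. vc f0 c y i + (\<Sum>j\<in>UNIV. u $ j * vc (f j) c y i))"
    using smooth_vfield_chart[OF f0 c] smooth_vfield_chart[OF f c]
    by (intro smooth_coord_add smooth_coord_sum smooth_coord_mult smooth_coord_const open_cc_image[OF c chart(1)[OF c] order_refl])
      (auto simp: smooth_on_chart_def)
  then show "smooth_in vec_nth (snd c ` fst c) (\<lambda>y. affine_field f0 f u c y $ i)"
    by (subst smooth_in_iff[of _ vec_lambda]) (simp_all add: vec_lambda_eta affine_field_def vc_def cc_vec)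
next
  fix c d x assume c: "c \<in> A" and d: "d \<in> A" and x: "x \<in> fst c \<inter> fst d"
  define L where "L = frechet_derivative (snd d \<circ> chart_inv c) (at (snd c x))"
  have "linear L" unfolding L_def
    using frechet_derivative_at[OF frechet_tr[OF c d x]] has_derivative_linear[OF frechet_tr[OF c d x]] by simp
  moreover have "f0 d (snd d x) = L (f0 c (snd c x))" "f j d (snd d x) = L (f j c (snd c x))" for j
    using f0 f[of j] c d x unfolding smooth_vfield_def L_def by blast+
  ultimately show "affine_field f0 f u d (snd d x) = L (affine_field f0 f u c (snd c x))"
    by (simp add: affine_field_def linear_add linear_sum linear_scale)
qed

lemma lie_bracket_coords:
  assumes c: "c \<in> A" and v: "smooth_on_chart c v" and w: "smooth_on_chart c w" and y: "y \<in> cc c ` fst c"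
  shows "vc (lie_bracket v w) c y i = dder (vc v c y) (\<lambda>y. vc w c y i) y - dder (vc w c y) (\<lambda>y. vc v c y i) y"
proof -
  have fd: "frechet_derivative (u c) (at (vec_lambda y)) \<xi> $ i = dder (vec_nth \<xi>) (\<lambda>y. vc u c y i) y"
    if u: "smooth_on_chart c u" for u :: "('x, 'n) vfield" and \<xi>
  proof -
    have "((\<lambda>z. \<chi> i. vc u c (vec_nth z) i) has_derivative (\<lambda>\<xi>. \<chi> i. dder (vec_nth \<xi>) (\<lambda>y. vc u c y i) (vec_nth (vec_lambda y :: real^'n)))) (at (vec_lambda y))"
      by (rule has_derivative_vec_lambda, rule has_derivative_vec[where S="cc c ` fst c"])
        (use u y in \<open>auto simp: smooth_on_chart_def vec_lambda_inverse\<close>)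
    moreover have "(\<lambda>z. \<chi> i. vc u c (vec_nth z) i) = u c" by (auto simp: vc_def vec_lambda_eta fun_eq_iff)
    ultimately have "(u c has_derivative (\<lambda>\<xi>. \<chi> i. dder (vec_nth \<xi>) (\<lambda>y. vc u c y i) y)) (at (vec_lambda y))"
      by (simp add: vec_lambda_inverse)
    then show ?thesis by (simp flip: frechet_derivative_at)
  qed
  show ?thesis unfolding vc_def[of "lie_bracket v w"] lie_bracket_def vector_minus_component fd[OF v] fd[OF w]
    by (simp add: vc_def)
qed

lemma smooth_lie_bracket:
  assumes c: "c \<in> A" and v: "smooth_on_chart c v" and w: "smooth_on_chart c w"
  shows "smooth_on_chart c (lie_bracket v w)"
  unfolding smooth_on_chart_def
proof
  fix i
  have "smooth_coord (cc c ` fst c) (\<lambda>y. dder (vc v c y) (\<lambda>y. vc w c y i) y - dder (vc w c y) (\<lambda>y. vc v c y i) y)"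
    using v w unfolding smooth_on_chart_def by (intro smooth_coord_diff smooth_coord_dder) auto
  then show "smooth_coord (cc c ` fst c) (\<lambda>y. vc (lie_bracket v w) c y i)"
    by (rule smooth_coord_cong) (use lie_bracket_coords[OF c v w] in simp)
qed

text \<open>Naturality of the bracket. Both fields are applied, as derivations, to a component of
  the transition map; \<open>key\<close> computes such an iterated derivative in the other chart,
  and the commutator is the bracket by \<open>dder_commutator\<close>.\<close>

lemma lie_bracket_tr:
  assumes v: "smooth_vfield A v" and w: "smooth_vfield A w" and c: "c \<in> A" and d: "d \<in> A" and x: "x \<in> fst c \<inter> fst d"
  shows "dder (vc (lie_bracket v w) c (cc c x)) (\<lambda>y. tr c d y i) (cc c x) = vc (lie_bracket v w) d (cc d x) i"
proof -
  define S where "S = cc c ` (fst c \<inter> fst d)"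
  have oS: "open S" unfolding S_def
    by (rule open_cc_image[OF c open_Int[OF chart(1)[OF c] chart(1)[OF d]]]) simp
  have SS: "S \<subseteq> cc c ` fst c" by (auto simp: S_def)
  have sm: "smooth_coord S (\<lambda>y. vc u c y i)" if "smooth_vfield A u" for u i
    using smooth_coord_subset[OF _ oS SS] smooth_vfield_chart[OF that c] by (simp add: smooth_on_chart_def)
  have t: "smooth_coord S (\<lambda>y. tr c d y i)" for i unfolding S_def by (rule smooth_tr[OF c d])
  have xS: "cc c x \<in> S" using x by (auto simp: S_def)
  have tx: "tr c d (cc c x) = cc d x" using tr_cc[OF c] x by simp
  have key: "dder (vc a c (cc c x)) (\<lambda>y. dder (vc b c y) (\<lambda>y. tr c d y i) y) (cc c x)
      = dder (vc a d (cc d x)) (\<lambda>y. vc b d y i) (cc d x)" if a: "smooth_vfield A a" and b: "smooth_vfield A b" for a b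
  proof -
    have "dder (vc a c (cc c x)) (\<lambda>y. dder (vc b c y) (\<lambda>y. tr c d y i) y) (cc c x)
        = dder (vc a c (cc c x)) (\<lambda>y. vc b d (tr c d y) i) (cc c x)"
    proof (rule dder_cong[OF oS xS])
      fix y assume "y \<in> S"
      then obtain x' where x': "x' \<in> fst c \<inter> fst d" "y = cc c x'" by (auto simp: S_def)
      then show "dder (vc b c y) (\<lambda>y. tr c d y i) y = vc b d (tr c d y) i"
        using vfield_tr[OF b c d x'(1)] tr_cc[OF c] by simp
    qed
    also have "\<dots> = dder (\<lambda>k. dder (vc a c (cc c x)) (\<lambda>y. tr c d y k) (cc c x)) (\<lambda>y. vc b d y i) (tr c d (cc c x))"
      by (rule chain_dder[where S="cc d ` fst d", OF _ _ t xS])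
        (use smooth_vfield_chart[OF b d] x tx in \<open>auto simp: smooth_on_chart_def\<close>)
    also have "\<dots> = dder (vc a d (cc d x)) (\<lambda>y. vc b d y i) (cc d x)"
      unfolding vfield_tr[OF a c d x] tx ..
    finally show ?thesis .
  qed
  have xc: "cc c x \<in> cc c ` fst c" and xd: "cc d x \<in> cc d ` fst d" using x by auto
  have "dder (vc (lie_bracket v w) c (cc c x)) (\<lambda>y. tr c d y i) (cc c x) =
      dder (\<lambda>k. dder (vc v c (cc c x)) (\<lambda>y. vc w c y k) (cc c x) - dder (vc w c (cc c x)) (\<lambda>y. vc v c y k) (cc c x)) (\<lambda>y. tr c d y i) (cc c x)"
    unfolding lie_bracket_coords[OF c smooth_vfield_chart[OF v c] smooth_vfield_chart[OF w c] xc, abs_def] ..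
  also have "\<dots> = dder (vc v d (cc d x)) (\<lambda>y. vc w d y i) (cc d x) - dder (vc w d (cc d x)) (\<lambda>y. vc v d y i) (cc d x)"
    unfolding key[OF v w, symmetric] key[OF w v, symmetric]
    by (rule dder_commutator[symmetric, OF sm[OF v] sm[OF w] t xS])
  also have "\<dots> = vc (lie_bracket v w) d (cc d x) i"
    by (rule lie_bracket_coords[symmetric, OF d smooth_vfield_chart[OF v d] smooth_vfield_chart[OF w d] xd])
  finally show ?thesis .
qed

text \<open>The Cartan field of the system at \<open>p\<close>, as a vector in the coordinates
  \<open>ext_coords c\<close>.\<close>

definition cvec :: "('x, 'n) chart \<Rightarrow> 'x \<times> 'm jet \<Rightarrow> 'n + nat \<times> 'm \<Rightarrow> real" where
  "cvec c p = case_sum (vc (affine_field f0 f (snd p 0)) c (cc c (fst p))) (shift_coords (jet_coords (snd p)))"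

text \<open>The components of the Cartan field transform by the Jacobian of \<open>etr\<close>: on
  the state part this is the transformation law of \<open>affine_field\<close> with the control held
  fixed, on the jet part it is the identity.\<close>

lemma dder_chart_change:
  assumes c: "c \<in> A" and d: "d \<in> A" and W: "open W" "p \<in> W" "W \<subseteq> (fst c \<inter> fst d) \<times> UNIV" and F: "smX d W F"
  shows "dder (cvec c p) (\<lambda>q. F (ei c q)) (ext_coords c p) = dder (cvec d p) (\<lambda>q. F (ei d q)) (ext_coords d p)"
proof -
  have o: "open (ext_coords c ` W)" using open_ext_image[OF c W(1)] W(3) by blast
  have pc: "ext_coords c p \<in> ext_coords c ` W" using W(2) by simp
  have pf: "p \<in> fst c \<times> UNIV" "p \<in> fst d \<times> UNIV" "fst p \<in> fst c \<inter> fst d" using W(2,3) by auto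
  have "dder (cvec c p) (\<lambda>q. F (ei c q)) (ext_coords c p) = dder (cvec c p) (\<lambda>q. F (ei d (etr c d q))) (ext_coords c p)"
  proof (rule dder_cong[OF o pc])
    fix q assume "q \<in> ext_coords c ` W"
    then obtain r where r: "r \<in> W" "q = ext_coords c r" by blast
    then have "r \<in> fst c \<times> UNIV" "r \<in> fst d \<times> UNIV" using W(3) by auto
    then show "F (ei c q) = F (ei d (etr c d q))"
      by (simp only: r(2) etr_ext_coords[OF c] ei_ext_coords[OF c] ei_ext_coords[OF d])
  qed
  also have "\<dots> = dder (\<lambda>a. dder (cvec c p) (\<lambda>q. etr c d q a) (ext_coords c p)) (\<lambda>q. F (ei d q)) (etr c d (ext_coords c p))"
    by (rule chain_dder[OF F _ smooth_etr[OF c d W(1,3)] pc]) (simp only: etr_ext_coords[OF c pf(1)] imageI[OF W(2)])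
  also have "(\<lambda>a. dder (cvec c p) (\<lambda>q. etr c d q a) (ext_coords c p)) = cvec d p"
  proof
    fix a
    show "dder (cvec c p) (\<lambda>q. etr c d q a) (ext_coords c p) = cvec d p a"
    proof (cases a)
      case (Inl i)
      have "dder (cvec c p) (\<lambda>q. tr c d (\<lambda>k. q (Inl k)) i) (ext_coords c p) =
          dder (\<lambda>k. dder (cvec c p) (\<lambda>q. q (Inl k)) (ext_coords c p)) (\<lambda>y. tr c d y i) (\<lambda>k. ext_coords c p (Inl k))"
        by (rule chain_dder[OF smooth_tr[OF c d] _ smooth_coord_coord[OF o] pc])
          (use pf(3) in \<open>auto simp: ext_coords_def cc_def\<close>)
      also have "\<dots> = dder (vc (affine_field f0 f (snd p 0)) c (cc c (fst p))) (\<lambda>y. tr c d y i) (cc c (fst p))"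
        by (simp add: cvec_def ext_coords_def cc_def)
      also have "\<dots> = vc (affine_field f0 f (snd p 0)) d (cc d (fst p)) i"
        by (rule vfield_tr[OF smooth_affine_field c d pf(3)])
      finally show ?thesis by (simp add: Inl etr_def cvec_def)
    next
      case (Inr b)
      then show ?thesis by (simp add: etr_def cvec_def)
    qed
  qed
  also have "etr c d (ext_coords c p) = ext_coords d p" by (rule etr_ext_coords[OF c pf(1)])
  finally show ?thesis .
qed

text \<open>\<open>cartan\<close> works at each point in the chart \<open>chart_at\<close>, a choice
  that may jump from point to point. To apply it again to its own result, as \<open>prolong\<close>
  does, one chart has to serve a whole neighbourhood.\<close>

lemma cartan_eq_dder:
  assumes c: "c \<in> A" and W: "open W" "p \<in> W" "W \<subseteq> fst c \<times> UNIV" and F: "smX c W F"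
  shows "cartan A f0 f F p = dder (cvec c p) (\<lambda>q. F (ei c q)) (ext_coords c p)"
proof -
  define d where "d = chart_at A (fst p)"
  have d: "d \<in> A" "fst p \<in> fst d" using chart_at by (auto simp: d_def)
  define W' where "W' = W \<inter> fst d \<times> UNIV"
  have W': "open W'" "p \<in> W'" "W' \<subseteq> (fst c \<inter> fst d) \<times> UNIV" "W' \<subseteq> fst d \<times> UNIV" "W' \<subseteq> W"
    using W d by (auto simp: W'_def intro!: open_Int open_Times chart(1) mem_Times_iff[THEN iffD2])
  have Fc: "smX c W' F" by (rule smX_subset[OF c F W'(1,5)]) (use W(3) W'(5) in auto)
  have Fd: "smX d W' F" by (rule smX_chart_change[OF d(1) c W'(1) _ Fc]) (use W'(3) in auto)
  define G where "G = F \<circ> inv_into (fst d \<times> UNIV) (ext_coords d)"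
  have o: "open (ext_coords d ` W')" and pd: "ext_coords d p \<in> ext_coords d ` W'"
    using open_ext_image[OF d(1) W'(1,4)] W'(2) by auto
  have inj: "inj_on (ext_coords d :: 'x \<times> 'm jet \<Rightarrow> _) (fst d \<times> UNIV)"
    by (rule inj_on_inverseI[of _ "ei d"]) (rule ei_ext_coords[OF d(1)])
  have Geq: "F (ei d q) = G q" if q: "q \<in> ext_coords d ` W'" for q
  proof -
    obtain r where r: "r \<in> W'" "q = ext_coords d r" using q by blast
    then have "r \<in> fst d \<times> UNIV" using W'(4) by blast
    then show ?thesis by (simp only: G_def o_def r(2) inv_into_f_f[OF inj] ei_ext_coords[OF d(1)])
  qed
  have Gs: "smooth_coord (ext_coords d ` W') G" by (rule smooth_coord_cong[OF Fd Geq])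
  have "cartan A f0 f F p = (\<Sum>i\<in>UNIV. cvec d p (Inl i) * partial (Inl i) G (ext_coords d p)) +
    (\<Sum>j. \<Sum>i\<in>UNIV. cvec d p (Inr (j, i)) * partial (Inr (j, i)) G (ext_coords d p))"
    unfolding cartan_def Let_def d_def[symmetric] G_def[symmetric]
    by (simp add: cvec_def vc_cc shift_coords_def jet_coords_def)
  also have "\<dots> = dder (cvec d p) G (ext_coords d p)"
    by (rule dder_Plus[symmetric, OF finite_partial_support[OF Gs pd]])
  also have "\<dots> = dder (cvec d p) (\<lambda>q. F (ei d q)) (ext_coords d p)"
    by (rule dder_cong[OF o pd]) (simp add: Geq)
  also have "\<dots> = dder (cvec c p) (\<lambda>q. F (ei c q)) (ext_coords c p)"
    by (rule dder_chart_change[symmetric, OF c d(1) W'(1-3) Fd])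
  finally show ?thesis .
qed

end

section \<open>Flatness implies strong accessibility\<close>

definition bracket :: "(('n \<Rightarrow> real) \<Rightarrow> 'n \<Rightarrow> real) \<Rightarrow> (('n \<Rightarrow> real) \<Rightarrow> 'n \<Rightarrow> real) \<Rightarrow> ('n \<Rightarrow> real) \<Rightarrow> 'n \<Rightarrow> real" where
  "bracket a b y i = dder (a y) (\<lambda>y. b y i) y - dder (b y) (\<lambda>y. a y i) y"


text \<open>Sections, along the map \<open>X\<close>, of the distribution generated by
  \<open>K\<close>: the coefficients are functions of \<open>q\<close> and not of the point
  \<open>X q\<close>. Rule \<open>cong\<close> identifies families that agree on \<open>S\<close>,
  where alone the equation of the trajectory holds.\<close>

inductive fields_along :: "(('n \<Rightarrow> real) \<Rightarrow> 'n \<Rightarrow> real) set \<Rightarrow> ('n \<Rightarrow> ('k \<Rightarrow> real) \<Rightarrow> real) \<Rightarrow> ('k \<Rightarrow> real) set \<Rightarrow>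
    ('n \<Rightarrow> ('k \<Rightarrow> real) \<Rightarrow> real) \<Rightarrow> bool"
  for K X S where
  zero: "fields_along K X S (\<lambda>i q. 0)"
| gen: "v \<in> K \<Longrightarrow> smooth_coord S a \<Longrightarrow> fields_along K X S (\<lambda>i q. a q * v (\<lambda>k. X k q) i)"
| add: "fields_along K X S Y \<Longrightarrow> fields_along K X S Y' \<Longrightarrow> fields_along K X S (\<lambda>i q. Y i q + Y' i q)"
| cong: "fields_along K X S Y \<Longrightarrow> (\<And>i q. q \<in> S \<Longrightarrow> Y i q = Y' i q) \<Longrightarrow> fields_along K X S Y'"

lemma fields_along_mono: "fields_along K X S Y \<Longrightarrow> K \<subseteq> K' \<Longrightarrow> fields_along K' X S Y"
  by (induction rule: fields_along.induct) (auto intro: fields_along.intros)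

lemma fields_along_sum:
  "(\<And>a. a \<in> A \<Longrightarrow> fields_along K X S (Y a)) \<Longrightarrow> fields_along K X S (\<lambda>i q. \<Sum>a\<in>A. Y a i q)"
  by (induction A rule: infinite_finite_induct) (auto intro: fields_along.zero fields_along.add)

lemma fields_along_minus:
  assumes "open S" "fields_along K X S Y" shows "fields_along K X S (\<lambda>i q. - Y i q)"
  using assms(2)
proof (induction rule: fields_along.induct)
  case (gen v a)
  have "smooth_coord S (\<lambda>q. (-1) * a q)" by (intro smooth_coord_mult smooth_coord_const assms(1) gen)
  from fields_along.gen[OF gen(1) this, of X] show ?case by simp
next
  case (add Y Y')
  from fields_along.add[OF add.IH] show ?case by simp
next
  case (cong Y Y')
  show ?case by (rule fields_along.cong[OF cong.IH]) (simp add: cong(2))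
qed (simp add: fields_along.zero)

lemma fields_along_smooth:
  assumes "open S" "\<And>k. smooth_coord S (X k)" "(\<lambda>q k. X k q) ` S \<subseteq> R"
    and K: "\<And>v i. v \<in> K \<Longrightarrow> smooth_coord R (\<lambda>y. v y i)" and "fields_along K X S Y"
  shows "smooth_coord S (Y i)"
  using assms(5)
proof (induction arbitrary: i rule: fields_along.induct)
  case (gen v a)
  show ?case by (rule smooth_coord_mult[OF gen(2) smooth_coord_comp[OF K[OF gen(1)] assms(1,2,3)]])
next
  case (cong Y Y')
  show ?case by (rule smooth_coord_cong[OF cong.IH]) (simp add: cong(2))
qed (auto intro: assms(1))

lemma fields_along_span:
  fixes Y :: "'n::finite \<Rightarrow> ('k \<Rightarrow> real) \<Rightarrow> real"
  assumes "fields_along K X S Y" "q \<in> S"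
  shows "(\<chi> i. Y i q) \<in> span ((\<lambda>v. \<chi> i. v (\<lambda>k. X k q) i) ` K)"
  using assms
proof (induction rule: fields_along.induct)
  case zero
  have "((\<chi> i. 0) :: real^'n) = 0" by (simp add: vec_eq_iff)
  then show ?case by (simp add: span_zero)
next
  case (gen v a)
  have "(\<chi> i. a q * v (\<lambda>k. X k q) i) = a q *\<^sub>R (\<chi> i. v (\<lambda>k. X k q) i)" by (simp add: vec_eq_iff)
  then show ?case using gen(1) by (auto intro: span_scale span_base)
next
  case (add Y Y')
  have "(\<chi> i. Y i q + Y' i q) = (\<chi> i. Y i q) + (\<chi> i. Y' i q)" by (simp add: vec_eq_iff)
  then show ?case using add by (simp add: span_add)
qed auto

text \<open>The commutator of d/dz^(j+1) with the trivial Cartan field is d/dz^(j), because the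
  coordinate \<open>(Suc j, l)\<close> occurs in this field only as the coefficient belonging to
  \<open>(j, l)\<close>. This is the mechanism that lowers the order.\<close>

lemma partial_shift:
  fixes F :: "(nat \<times> 'm \<Rightarrow> real) \<Rightarrow> real"
  assumes F: "smooth_coord S F" and q: "q \<in> S" and J: "finite J" "depends_on S J F"
  shows "partial (Suc j, l) (\<lambda>q. dder (shift_coords q) F q) q =
    dder (shift_coords q) (partial (Suc j, l) F) q + partial (j, l) F q"
proof -
  define b where "b = (Suc j, l)"
  have o: "open S" by (rule smooth_coordD(1)[OF F])
  have z: "partial a F q = 0" if "a \<notin> J" "q \<in> S" for a q by (rule partial_eq_0[OF o J(2) that])
  have z2: "partial a (partial b F) q = 0" if "a \<notin> J" for a
    by (rule partial_eq_0[OF o depends_on_partial[OF o J(2)] that q])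
  have sh: "smooth_coord S (\<lambda>q. shift_coords q a)" for a
    unfolding shift_coords_def split_beta by (rule smooth_coord_coord[OF o])
  have psh: "partial b (\<lambda>q. shift_coords q a) q = (if a = (j, l) then 1 else 0)" for a
    unfolding shift_coords_def split_beta partial_coord by (cases a) (auto simp: b_def)
  have "partial b (\<lambda>q. dder (shift_coords q) F q) q = partial b (\<lambda>q. \<Sum>a\<in>J. shift_coords q a * partial a F q) q"
    by (rule partial_cong[OF o q], rule dder_eq_sum[OF J(1)]) (rule z)
  also have "\<dots> = (\<Sum>a\<in>J. partial b (\<lambda>q. shift_coords q a * partial a F q) q)"
    by (rule partial_sum[OF o smooth_coord_mult[OF sh smooth_coordD(4)[OF F]] q])
  also have "\<dots> = (\<Sum>a\<in>J. (if a = (j, l) then partial a F q else 0) + shift_coords q a * partial a (partial b F) q)"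
    by (rule sum.cong[OF refl], subst partial_mult[OF sh smooth_coordD(4)[OF F] q])
      (simp add: psh partial_commute[OF F q, of b])
  also have "\<dots> = (\<Sum>a\<in>J. if a = (j, l) then partial a F q else 0) + (\<Sum>a\<in>J. shift_coords q a * partial a (partial b F) q)"
    by (rule sum.distrib)
  also have "(\<Sum>a\<in>J. if a = (j, l) then partial a F q else 0) = partial (j, l) F q"
    using J(1) z[OF _ q, of "(j, l)"] by (auto simp: sum.delta)
  also have "(\<Sum>a\<in>J. shift_coords q a * partial a (partial b F) q) = dder (shift_coords q) (partial b F) q"
    by (rule dder_eq_sum[symmetric, OF J(1) z2])
  finally show ?thesis by (simp add: b_def)
qed

text \<open>Differentiating \<open>\<tau>X = g0(X) + \<Sum> U\<^sub>j g\<^sub>j(X)\<close> with respect to \<open>(Suc j, l)\<close> gives the partial derivative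
  of \<open>X\<close> with respect to \<open>(j, l)\<close> in terms of the one with respect to \<open>(Suc j, l)\<close>.  As \<open>X\<close> depends on
  finitely many coordinates, all its partial derivatives are obtained from \<open>0\<close> in this way.\<close>

locale trajectory =
  fixes X :: "'n::finite \<Rightarrow> (nat \<times> 'm::finite \<Rightarrow> real) \<Rightarrow> real" and U :: "'m \<Rightarrow> (nat \<times> 'm \<Rightarrow> real) \<Rightarrow> real"
    and g0 :: "('n \<Rightarrow> real) \<Rightarrow> 'n \<Rightarrow> real" and g :: "'m \<Rightarrow> ('n \<Rightarrow> real) \<Rightarrow> 'n \<Rightarrow> real"
    and R S and K :: "nat \<Rightarrow> (('n \<Rightarrow> real) \<Rightarrow> 'n \<Rightarrow> real) set"
  assumes g0: "\<And>i. smooth_coord R (\<lambda>y. g0 y i)" and g: "\<And>j i. smooth_coord R (\<lambda>y. g j y i)"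
    and X: "\<And>i. smooth_coord S (X i)" and U: "\<And>j. smooth_coord S (U j)" and XR: "(\<lambda>q k. X k q) ` S \<subseteq> R"
    and tau: "\<And>q i. q \<in> S \<Longrightarrow> dder (shift_coords q) (X i) q = g0 (\<lambda>k. X k q) i + (\<Sum>j\<in>UNIV. U j q * g j (\<lambda>k. X k q) i)"
    and K: "\<And>k v i. v \<in> K k \<Longrightarrow> smooth_coord R (\<lambda>y. v y i)" and K_mono: "\<And>k. K k \<subseteq> K (Suc k)"
    and K_g: "\<And>j. g j \<in> K 0"
    and K_bracket: "\<And>k v. v \<in> K k \<Longrightarrow> bracket g0 v \<in> K (Suc k)" "\<And>j k v. v \<in> K k \<Longrightarrow> bracket (g j) v \<in> K (Suc k)"
begin

abbreviation Xq :: "(nat \<times> 'm \<Rightarrow> real) \<Rightarrow> 'n \<Rightarrow> real" where "Xq q \<equiv> \<lambda>k. X k q"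

text \<open>The Jacobian of the right hand side of the system in the state, along the trajectory,
  with the controls held fixed.\<close>

definition G :: "'n \<Rightarrow> 'n \<Rightarrow> (nat \<times> 'm \<Rightarrow> real) \<Rightarrow> real" where
  "G r i q = partial r (\<lambda>y. g0 y i) (Xq q) + (\<Sum>j\<in>UNIV. U j q * partial r (\<lambda>y. g j y i) (Xq q))"

lemma open_S: "open S" using X smooth_coordD(1) by blast

lemma comp_smooth: "smooth_coord R F \<Longrightarrow> smooth_coord S (\<lambda>q. F (Xq q))"
  by (rule smooth_coord_comp[OF _ open_S X XR])

lemma Xq_R: "q \<in> S \<Longrightarrow> Xq q \<in> R" using XR by blast

lemma K_mono': "k \<le> l \<Longrightarrow> K k \<subseteq> K l"
  by (rule lift_Suc_mono_le[of K]) (rule K_mono)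

text \<open>Let w = g0 + sum U_j g_j be the velocity of X and Y = a v(X). Then tau Y = (tau a) v + a
  (Dv w), and subtracting G Y = a (Dw v) leaves (tau a) v + a [g0, v] + sum a U_j [g_j, v]. In Dw as
  in \<open>G\<close> the U_j are not differentiated.\<close>

lemma fields_along_tau:
  assumes "fields_along (K k) X S Y"
  shows "fields_along (K (Suc k)) X S (\<lambda>i q. dder (shift_coords q) (Y i) q - (\<Sum>r\<in>UNIV. G r i q * Y r q))"
  using assms
proof (induction rule: fields_along.induct)
  case zero
  show ?case by (simp add: fields_along.zero)
next
  case (add Y Y')
  have sm: "smooth_coord S (Y i)" "smooth_coord S (Y' i)" for i
    by (rule fields_along_smooth[where X=X and R=R and K="K k", OF open_S X XR _ add(1)], erule K)
      (rule fields_along_smooth[where X=X and R=R and K="K k", OF open_S X XR _ add(2)], erule K)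
  show ?case
    by (rule fields_along.cong[OF fields_along.add[OF add.IH]])
      (simp add: dder_add[OF sm] distrib_left sum.distrib)
next
  case (cong Y Y')
  show ?case
    by (rule fields_along.cong[OF cong.IH]) (simp add: cong(2) dder_cong[OF open_S _ cong(2)])
next
  case (gen v a)
  have v: "smooth_coord R (\<lambda>y. v y i)" for i by (rule K[OF gen(1)])
  have sh: "smooth_coord S (\<lambda>q. shift_coords q b)" for b
    unfolding shift_coords_def split_beta by (rule smooth_coord_coord[OF open_S])
  have 1: "fields_along (K (Suc k)) X S (\<lambda>i q. dder (shift_coords q) a q * v (Xq q) i)"
    by (rule fields_along.gen[OF _ smooth_coord_dder[OF gen(2) sh]]) (use gen(1) K_mono in blast)
  have 2: "fields_along (K (Suc k)) X S (\<lambda>i q. a q * bracket g0 v (Xq q) i)"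
    by (rule fields_along.gen[OF K_bracket(1)[OF gen(1)] gen(2)])
  have 3: "fields_along (K (Suc k)) X S (\<lambda>i q. \<Sum>j\<in>UNIV. (a q * U j q) * bracket (g j) v (Xq q) i)"
    by (rule fields_along_sum, rule fields_along.gen[OF K_bracket(2)[OF gen(1)] smooth_coord_mult[OF gen(2) U]])
  show ?case
  proof (rule fields_along.cong[OF fields_along.add[OF fields_along.add[OF 1 2] 3]])
    fix i q assume q: "q \<in> S"
    have "dder (shift_coords q) (\<lambda>q. a q * v (Xq q) i) q =
        dder (shift_coords q) a q * v (Xq q) i + a q * dder (shift_coords q) (\<lambda>q. v (Xq q) i) q"
      by (rule dder_mult[OF gen(2) comp_smooth[OF v] q])
    also have "dder (shift_coords q) (\<lambda>q. v (Xq q) i) q = dder (\<lambda>k. dder (shift_coords q) (X k) q) (\<lambda>y. v y i) (Xq q)"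
      by (rule chain_dder[OF v Xq_R[OF q] X q])
    also have "\<dots> = dder (g0 (Xq q)) (\<lambda>y. v y i) (Xq q) + (\<Sum>j\<in>UNIV. U j q * dder (g j (Xq q)) (\<lambda>y. v y i) (Xq q))"
    proof -
      have "(\<Sum>k\<in>UNIV. (\<Sum>j\<in>UNIV. U j q * g j (Xq q) k) * partial k (\<lambda>y. v y i) (Xq q)) =
          (\<Sum>j\<in>UNIV. U j q * (\<Sum>k\<in>UNIV. g j (Xq q) k * partial k (\<lambda>y. v y i) (Xq q)))"
        unfolding sum_distrib_left sum_distrib_right by (subst sum.swap) (simp add: mult_ac)
      then show ?thesis unfolding dder_finite tau[OF q] distrib_right sum.distrib by simp
    qed
    finally have L: "dder (shift_coords q) (\<lambda>q. a q * v (Xq q) i) q = dder (shift_coords q) a q * v (Xq q) i +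
        a q * (dder (g0 (Xq q)) (\<lambda>y. v y i) (Xq q) + (\<Sum>j\<in>UNIV. U j q * dder (g j (Xq q)) (\<lambda>y. v y i) (Xq q)))" .
    have "(\<Sum>r\<in>UNIV. G r i q * (a q * v (Xq q) r)) =
        (\<Sum>r\<in>UNIV. a q * (v (Xq q) r * partial r (\<lambda>y. g0 y i) (Xq q))) +
        (\<Sum>r\<in>UNIV. \<Sum>j\<in>UNIV. a q * (U j q * (v (Xq q) r * partial r (\<lambda>y. g j y i) (Xq q))))"
      unfolding G_def distrib_right sum.distrib sum_distrib_right by (simp add: mult_ac)
    also have "(\<Sum>r\<in>UNIV. \<Sum>j\<in>UNIV. a q * (U j q * (v (Xq q) r * partial r (\<lambda>y. g j y i) (Xq q)))) =
        (\<Sum>j\<in>UNIV. \<Sum>r\<in>UNIV. a q * (U j q * (v (Xq q) r * partial r (\<lambda>y. g j y i) (Xq q))))" by (rule sum.swap)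
    finally have "(\<Sum>r\<in>UNIV. G r i q * (a q * v (Xq q) r)) = a q * (dder (v (Xq q)) (\<lambda>y. g0 y i) (Xq q) +
        (\<Sum>j\<in>UNIV. U j q * dder (v (Xq q)) (\<lambda>y. g j y i) (Xq q)))"
      unfolding dder_finite by (simp add: sum_distrib_left distrib_left)
    with L show "dder (shift_coords q) a q * v (Xq q) i + a q * bracket g0 v (Xq q) i + (\<Sum>j\<in>UNIV. (a q * U j q) * bracket (g j) v (Xq q) i)
      = dder (shift_coords q) (\<lambda>q. a q * v (Xq q) i) q - (\<Sum>r\<in>UNIV. G r i q * (a q * v (Xq q) r))"
      by (simp add: bracket_def sum_subtractf right_diff_distrib distrib_left sum_distrib_left mult.assoc)
  qed
qed

text \<open>Let \<open>b = (Suc j, l)\<close> and write a subscript for a partial derivative.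
  \<open>partial_shift\<close> and the equation of the system give tau X_b + X_(j,l) = sum (U_s)_b
  g_s + G X_b. So X_(j,l) is a combination of the g_s minus tau X_b - G X_b, which
  \<open>fields_along_tau\<close> handles.\<close>

lemma fields_along_step:
  assumes J: "finite J" "\<And>i. depends_on S J (X i)" and H: "fields_along (K k) X S (\<lambda>i. partial (Suc j, l) (X i))"
  shows "fields_along (K (Suc k)) X S (\<lambda>i. partial (j, l) (X i))"
proof -
  define b where "b = (Suc j, l)"
  have 1: "fields_along (K (Suc k)) X S (\<lambda>i q. \<Sum>s\<in>UNIV. partial b (U s) q * g s (Xq q) i)"
    by (rule fields_along_sum, rule fields_along.gen[OF _ smooth_coordD(4)[OF U]]) (use K_g K_mono'[of 0 "Suc k"] in auto)
  note 2 = fields_along_minus[OF open_S fields_along_tau[OF H, folded b_def]]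
  show ?thesis
  proof (rule fields_along.cong[OF fields_along.add[OF 1 2]])
    fix i q assume q: "q \<in> S"
    have cg: "partial b (\<lambda>q. F (Xq q)) q = (\<Sum>r\<in>UNIV. partial b (X r) q * partial r F (Xq q))" if F: "smooth_coord R F" for F
    proof -
      have "partial b (\<lambda>q. F (Xq q)) q = dder (\<lambda>r. partial b (X r) q) F (Xq q)"
        by (rule chain_partial[OF F Xq_R[OF q] smooth_coordD(5)[OF X q]])
      then show ?thesis by (simp add: dder_finite)
    qed
    have "dder (shift_coords q) (partial b (X i)) q + partial (j, l) (X i) q = partial b (\<lambda>q. dder (shift_coords q) (X i) q) q"
      unfolding b_def by (rule partial_shift[symmetric, OF X q J(1) J(2)])
    also have "\<dots> = partial b (\<lambda>q. g0 (Xq q) i + (\<Sum>s\<in>UNIV. U s q * g s (Xq q) i)) q"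
      by (rule partial_cong[OF open_S q tau])
    also have "\<dots> = partial b (\<lambda>q. g0 (Xq q) i) q + (\<Sum>s\<in>UNIV. partial b (\<lambda>q. U s q * g s (Xq q) i) q)"
      by (subst partial_add[OF comp_smooth[OF g0] smooth_coord_sum[OF open_S smooth_coord_mult[OF U comp_smooth[OF g]]] q],
          subst partial_sum[OF open_S smooth_coord_mult[OF U comp_smooth[OF g]] q]) (rule refl)
    also have "(\<Sum>s\<in>UNIV. partial b (\<lambda>q. U s q * g s (Xq q) i) q) =
        (\<Sum>s\<in>UNIV. partial b (U s) q * g s (Xq q) i) + (\<Sum>s\<in>UNIV. U s q * partial b (\<lambda>q. g s (Xq q) i) q)"
      by (subst partial_mult[OF U comp_smooth[OF g] q]) (rule sum.distrib)
    also have "(\<Sum>s\<in>UNIV. U s q * partial b (\<lambda>q. g s (Xq q) i) q) =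
        (\<Sum>r\<in>UNIV. \<Sum>s\<in>UNIV. U s q * (partial b (X r) q * partial r (\<lambda>y. g s y i) (Xq q)))"
      unfolding cg[OF g] sum_distrib_left by (rule sum.swap)
    finally have "dder (shift_coords q) (partial b (X i)) q + partial (j, l) (X i) q =
       (\<Sum>s\<in>UNIV. partial b (U s) q * g s (Xq q) i) + (\<Sum>r\<in>UNIV. G r i q * partial b (X r) q)"
      unfolding cg[OF g0] G_def distrib_right sum.distrib sum_distrib_right by (simp add: mult_ac)
    then show "(\<Sum>s\<in>UNIV. partial b (U s) q * g s (Xq q) i) + - (dder (shift_coords q) (partial b (X i)) q - (\<Sum>r\<in>UNIV. G r i q * partial b (X r) q))
      = partial (j, l) (X i) q" by linarith
  qed
qed

lemma all_partials:
  assumes J: "finite J" "\<And>i. depends_on S J (X i)" and N: "\<And>a. a \<in> J \<Longrightarrow> fst a < N"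
  shows "fields_along (K N) X S (\<lambda>i. partial a (X i))"
proof -
  have z: "fields_along (K k) X S (\<lambda>i. partial (j, l) (X i))" if "j \<ge> N" for k j l
  proof (rule fields_along.cong[OF fields_along.zero])
    fix i q assume "q \<in> S"
    with that N[of "(j, l)"] show "0 = partial (j, l) (X i) q"
      using partial_eq_0[OF open_S J(2)] by fastforce
  qed
  \<comment> \<open>Descent in the order of the jet coordinate at the price of one stage per step:
    order \<open>N - d\<close> is reached with \<open>K d\<close>.\<close>
  have d: "d \<le> N \<Longrightarrow> fields_along (K d) X S (\<lambda>i. partial (N - d, l) (X i))" for d l
  proof (induction d)
    case 0
    then show ?case using z by simp
  next
    case (Suc d)
    then have "N - d = Suc (N - Suc d)" "fields_along (K d) X S (\<lambda>i. partial (N - d, l) (X i))" by auto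
    then show ?case using fields_along_step[OF J] by simp
  qed
  obtain j l where a: "a = (j, l)" by (cases a)
  show ?thesis
  proof (cases "j \<ge> N")
    case True
    then show ?thesis using z by (simp add: a)
  next
    case False
    then have "fields_along (K (N - j)) X S (\<lambda>i. partial a (X i))" using d[of "N - j" l] by (simp add: a)
    then show ?thesis by (rule fields_along_mono) (rule K_mono', simp)
  qed
qed

end

text \<open>\<open>X\<close> depends near \<open>q0\<close> on finitely many coordinates, so
  \<open>all_partials\<close> applies on a smaller set. The hypothesis \<open>sub\<close> says that
  the differential of \<open>X\<close> is onto: each unit vector is a combination of partial
  derivatives of \<open>X\<close>, and these lie in the span of the fields in
  \<open>K N\<close>.\<close>

lemma trajectory_span:
  fixes X :: "'n::finite \<Rightarrow> (nat \<times> 'm::finite \<Rightarrow> real) \<Rightarrow> real"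
  assumes T: "trajectory X U g0 g R S K" and q0: "q0 \<in> S"
    and sub: "\<And>i'. \<exists>b. \<forall>i. dder b (X i) q0 = (if i = i' then 1 else 0)"
  shows "\<exists>k. span ((\<lambda>v. \<chi> i. v (\<lambda>k. X k q0) i) ` K k) = UNIV"
proof -
  interpret T: trajectory X U g0 g R S K by (rule T)
  have "\<forall>i. \<exists>V J. open V \<and> q0 \<in> V \<and> V \<subseteq> S \<and> finite J \<and> depends_on V J (X i)"
    using smooth_coordD(3)[OF T.X] q0 unfolding locfin_def by blast
  from choice[OF this] obtain V where "\<forall>i. \<exists>J. open (V i) \<and> q0 \<in> V i \<and> V i \<subseteq> S \<and> finite J \<and> depends_on (V i) J (X i)" ..
  from choice[OF this] obtain J where V: "\<forall>i. open (V i) \<and> q0 \<in> V i \<and> V i \<subseteq> S \<and> finite (J i) \<and> depends_on (V i) (J i) (X i)" ..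
  define S' where "S' = (\<Inter>i\<in>UNIV. V i)"
  define J' where "J' = (\<Union>i\<in>UNIV. J i)"
  have oS': "open S'" unfolding S'_def using V by (intro open_INT ballI) auto
  have S': "q0 \<in> S'" "S' \<subseteq> S" using V by (auto simp: S'_def)
  have J': "finite J'" using V by (auto simp: J'_def)
  have dep: "depends_on S' J' (X i)" for i
    using V[rule_format, of i] unfolding depends_on_def S'_def J'_def by blast
  \<comment> \<open>\<open>insert 0\<close> covers an empty \<open>J'\<close>; \<open>Suc\<close>
    makes the bound strict, since the descent starts at an order where all derivatives
    vanish.\<close>
  define N where "N = Suc (Max (insert 0 (fst ` J')))"
  have N: "fst a < N" if "a \<in> J'" for a
    unfolding N_def less_Suc_eq_le using J' that by (intro Max_ge) auto
  interpret T': trajectory X U g0 g R S' K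
    using T.g0 T.g T.K T.K_mono T.K_g T.K_bracket T.tau T.XR S'(2) smooth_coord_subset[OF T.X oS' S'(2)] smooth_coord_subset[OF T.U oS' S'(2)]
    by unfold_locales (auto simp: subset_iff)
  define B where "B = (\<lambda>v. \<chi> i. v (\<lambda>k. X k q0) i) ` K N"
  have pB: "(\<chi> i. partial a (X i) q0) \<in> span B" for a
    unfolding B_def by (rule fields_along_span[OF T'.all_partials[OF J' dep N] S'(1)])
  have z: "partial a (X i) q0 = 0" if "a \<notin> J'" for a i by (rule partial_eq_0[OF oS' dep that S'(1)])
  have "axis i' 1 \<in> span B" for i'
  proof -
    obtain b where b: "\<forall>i. dder b (X i) q0 = (if i = i' then 1 else 0)" using sub by blast
    have "axis i' 1 = (\<Sum>a\<in>J'. b a *\<^sub>R (\<chi> i. partial a (X i) q0))"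
      using b dder_eq_sum[OF J', of "X _" q0 b, OF z] by (auto simp: vec_eq_iff axis_def)
    then show ?thesis by (simp only:) (intro span_sum span_scale pB)
  qed
  then have "Basis \<subseteq> span B" by (auto simp: Basis_vec_def)
  then have "span B = UNIV" by (metis span_Basis span_mono span_span top.extremum_uniqueI)
  then show ?thesis unfolding B_def by blast
qed

context control_system
begin

section \<open>Flat outputs and the two Cartan fields\<close>

lemma open_chart_part: "c \<in> A \<Longrightarrow> open W \<Longrightarrow> open (W \<inter> fst c \<times> UNIV)"
  by (intro open_Int open_Times chart open_UNIV)

lemma smooth_ext_chart: "smooth_ext A W F \<Longrightarrow> c \<in> A \<Longrightarrow> smX c (W \<inter> fst c \<times> UNIV) F"
  unfolding smooth_ext_iff by blast

lemma prolong_Suc: "cartan A f0 f (\<lambda>p. prolong A f0 f z p j $ i) p = prolong A f0 f z p (Suc j) $ i"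
  by (simp add: prolong_def)

text \<open>If the Cartan derivative of each component of \<open>\<psi>\<close> is the component of
  the next order, the chain rule turns the direction \<open>cvec\<close> into
  \<open>shift_coords\<close> at the image: \<open>\<psi>\<close> carries one Cartan field to the
  other.\<close>

lemma cartan_comp:
  fixes \<psi> :: "'x \<times> 'm jet \<Rightarrow> 'm jet" and G :: "'m jet \<Rightarrow> real"
  assumes c: "c \<in> A" and W: "open W" "p \<in> W" "W \<subseteq> fst c \<times> UNIV"
    and \<psi>: "\<And>j i. smX c W (\<lambda>p. \<psi> p j $ i)" and G: "smooth_coord S (\<lambda>q. G (ji q))"
    and WS: "\<And>p. p \<in> W \<Longrightarrow> jet_coords (\<psi> p) \<in> S"
    and car: "\<And>j i. cartan A f0 f (\<lambda>p. \<psi> p j $ i) p = \<psi> p (Suc j) $ i"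
  shows "smX c W (\<lambda>p. G (\<psi> p))" and "cartan A f0 f (\<lambda>p. G (\<psi> p)) p = trivial_cartan G (\<psi> p)"
proof -
  have o: "open (ext_coords c ` W)" by (rule open_ext_image[OF c W(1,3)])
  have pW: "ext_coords c p \<in> ext_coords c ` W" using W(2) by simp
  have ep: "ei c (ext_coords c p) = p" using ei_ext_coords[OF c] W by blast
  have sm: "smooth_coord (ext_coords c ` W) (\<lambda>q. jet_coords (\<psi> (ei c q)) a)" for a
    using \<psi>[of "fst a" "snd a"] by (simp add: jet_coords_def split_beta)
  have im: "(\<lambda>q. jet_coords (\<psi> (ei c q))) ` ext_coords c ` W \<subseteq> S"
  proof
    fix y assume "y \<in> (\<lambda>q. jet_coords (\<psi> (ei c q))) ` ext_coords c ` W"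
    then obtain r where r: "r \<in> W" "y = jet_coords (\<psi> (ei c (ext_coords c r)))" by blast
    then show "y \<in> S" using WS[OF r(1)] ei_ext_coords[OF c, of r] W(3) by auto
  qed
  have "smooth_coord (ext_coords c ` W) (\<lambda>q. G (ji (jet_coords (\<psi> (ei c q)))))"
    by (rule smooth_coord_comp[OF G o sm im])
  then show G1: "smX c W (\<lambda>p. G (\<psi> p))" by simp
  have "cartan A f0 f (\<lambda>p. G (\<psi> p)) p = dder (cvec c p) (\<lambda>q. G (ji (jet_coords (\<psi> (ei c q))))) (ext_coords c p)"
    using cartan_eq_dder[OF c W G1] by simp
  also have "\<dots> = dder (\<lambda>a. dder (cvec c p) (\<lambda>q. jet_coords (\<psi> (ei c q)) a) (ext_coords c p)) (\<lambda>q. G (ji q)) (jet_coords (\<psi> (ei c (ext_coords c p))))"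
    by (rule chain_dder[OF G _ sm pW]) (simp add: ep WS[OF W(2)])
  also have "(\<lambda>a. dder (cvec c p) (\<lambda>q. jet_coords (\<psi> (ei c q)) a) (ext_coords c p)) = shift_coords (jet_coords (\<psi> p))"
  proof
    fix a :: "nat \<times> 'm"
    obtain j i where a: "a = (j, i)" by (cases a)
    show "dder (cvec c p) (\<lambda>q. jet_coords (\<psi> (ei c q)) a) (ext_coords c p) = shift_coords (jet_coords (\<psi> p)) a"
      using cartan_eq_dder[OF c W \<psi>, of j i] car[of j i] by (simp add: a jet_coords_def shift_coords_def)
  qed
  also have "dder (shift_coords (jet_coords (\<psi> p))) (\<lambda>q. G (ji q)) (jet_coords (\<psi> (ei c (ext_coords c p)))) = trivial_cartan G (\<psi> p)"
    using trivial_cartan_eq_dder[OF G WS[OF W(2)]] by (simp add: ep)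
  finally show "cartan A f0 f (\<lambda>p. G (\<psi> p)) p = trivial_cartan G (\<psi> p)" .
qed

lemma cartan_cong:
  assumes c: "c \<in> A" and W: "open W" "p \<in> W" "W \<subseteq> fst c \<times> UNIV" and F: "smX c W F"
    and eq: "\<And>p. p \<in> W \<Longrightarrow> F p = F' p"
  shows "cartan A f0 f F p = cartan A f0 f F' p"
proof -
  have eq': "F (ei c q) = F' (ei c q)" if q: "q \<in> ext_coords c ` W" for q
  proof -
    obtain r where r: "r \<in> W" "q = ext_coords c r" using q by blast
    then show ?thesis using eq[OF r(1)] ei_ext_coords[OF c, of r] W(3) by auto
  qed
  have F': "smX c W F'" by (rule smooth_coord_cong[OF F eq'])
  show ?thesis unfolding cartan_eq_dder[OF c W F] cartan_eq_dder[OF c W F']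
    by (rule dder_cong[OF open_ext_image[OF c W(1,3)] imageI[OF W(2)] eq'])
qed

lemma smooth_into_ext_comp:
  fixes \<phi> :: "'m jet \<Rightarrow> 'x \<times> 'm jet"
  assumes V: "open V" and \<phi>: "smooth_into_ext A V \<phi>" and W: "open W" and F: "smooth_ext A W F"
  shows "open {w \<in> V. \<phi> w \<in> W}" and "smooth_coord (jet_coords ` {w \<in> V. \<phi> w \<in> W}) (\<lambda>q. F (\<phi> (ji q)))"
proof -
  have cont: "continuous_on V \<phi>" using \<phi> by (simp add: smooth_into_ext_def)
  have op: "open {w \<in> V. \<phi> w \<in> B}" if "open B" for B
    using continuous_open_preimage[OF cont V that] by (simp add: vimage_def Int_def)
  show "open {w \<in> V. \<phi> w \<in> W}" by (rule op[OF W])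
  show "smooth_coord (jet_coords ` {w \<in> V. \<phi> w \<in> W}) (\<lambda>q. F (\<phi> (ji q)))"
  proof (rule smooth_coord_locally)
    fix q assume "q \<in> jet_coords ` {w \<in> V. \<phi> w \<in> W}"
    then obtain w where w: "w \<in> V" "\<phi> w \<in> W" "q = jet_coords w" by blast
    define c where "c = chart_at A (fst (\<phi> w))"
    have c: "c \<in> A" "fst (\<phi> w) \<in> fst c" using chart_at by (auto simp: c_def)
    define T where "T = {w \<in> V. \<phi> w \<in> W \<inter> fst c \<times> UNIV}"
    have oT: "open (jet_coords ` T)" unfolding T_def by (rule open_jet_image[OF op[OF open_chart_part[OF c(1) W]]])
    have "smooth_in jet_coords (V \<inter> \<phi> -` (fst c \<times> UNIV)) (\<lambda>w. ext_coords c (\<phi> w) a)" for a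
      using \<phi> c(1) by (simp add: smooth_into_ext_def)
    then have "smooth_coord (jet_coords ` (V \<inter> \<phi> -` (fst c \<times> UNIV))) (\<lambda>q. ext_coords c (\<phi> (ji q)) a)" for a
      by (simp add: smooth_in_jet_iff)
    then have sm: "smooth_coord (jet_coords ` T) (\<lambda>q. ext_coords c (\<phi> (ji q)) a)" for a
      by (rule smooth_coord_subset[OF _ oT]) (auto simp: T_def)
    have "smooth_coord (jet_coords ` T) (\<lambda>q. F (ei c (ext_coords c (\<phi> (ji q)))))"
      by (rule smooth_coord_comp[OF smooth_ext_chart[OF F c(1)] oT sm]) (auto simp: T_def)
    then have "smooth_coord (jet_coords ` T) (\<lambda>q. F (\<phi> (ji q)))"
    proof (rule smooth_coord_cong)
      fix q assume "q \<in> jet_coords ` T"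
      then have "\<phi> (ji q) \<in> fst c \<times> UNIV" by (auto simp: T_def)
      then show "F (ei c (ext_coords c (\<phi> (ji q)))) = F (\<phi> (ji q))" by (simp only: ei_ext_coords[OF c(1)])
    qed
    moreover have "q \<in> jet_coords ` T" using w c by (auto simp: T_def mem_Times_iff)
    ultimately show "\<exists>T. q \<in> T \<and> T \<subseteq> jet_coords ` {w \<in> V. \<phi> w \<in> W} \<and> smooth_coord T (\<lambda>q. F (\<phi> (ji q)))"
      by (intro exI[of _ "jet_coords ` T"]) (auto simp: T_def)
  qed
qed

lemma flat_outputD:
  assumes "flat_output A f0 f W z"
  shows "open W" "open (prolong A f0 f z ` W)" "inj_on (prolong A f0 f z) W"
    "smooth_ext A W (\<lambda>p. prolong A f0 f z p j $ i)"
    "smooth_into_ext A (prolong A f0 f z ` W) (inv_into W (prolong A f0 f z))"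
  using assms unfolding flat_output_def Let_def by blast+

lemma cartan_flat_comp:
  assumes fl: "flat_output A f0 f W z" and W': "open W'" "W' \<subseteq> W" "p \<in> W'"
    and G: "smooth_coord S (\<lambda>q. G (ji q))" and WS: "\<And>p. p \<in> W' \<Longrightarrow> jet_coords (prolong A f0 f z p) \<in> S"
    and F: "smooth_ext A W' F" and eq: "\<And>p. p \<in> W' \<Longrightarrow> F p = G (prolong A f0 f z p)"
  shows "cartan A f0 f F p = trivial_cartan G (prolong A f0 f z p)"
proof -
  define c where "c = chart_at A (fst p)"
  have c: "c \<in> A" "fst p \<in> fst c" using chart_at by (auto simp: c_def)
  define T where "T = W' \<inter> fst c \<times> UNIV"
  have T: "open T" "p \<in> T" "T \<subseteq> fst c \<times> UNIV" "T \<subseteq> W'" "T \<subseteq> W"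
    using open_chart_part[OF c(1) W'(1)] W' c by (auto simp: T_def mem_Times_iff)
  have Fc: "smX c T F" unfolding T_def by (rule smooth_ext_chart[OF F c(1)])
  have \<psi>: "smX c T (\<lambda>p. prolong A f0 f z p j $ i)" for j i
    by (rule smX_subset[OF c(1) smooth_ext_chart[OF flat_outputD(4)[OF fl] c(1)] T(1) _ T(3)]) (use T(3,5) in auto)
  have "cartan A f0 f F p = cartan A f0 f (\<lambda>p. G (prolong A f0 f z p)) p"
    by (rule cartan_cong[OF c(1) T(1-3) Fc]) (use eq T(4) in blast)
  also have "\<dots> = trivial_cartan G (prolong A f0 f z p)"
    by (rule cartan_comp(2)[where \<psi>="prolong A f0 f z" and G=G, OF c(1) T(1-3) \<psi> G _ prolong_Suc])
      (use WS T(4) in blast)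
  finally show ?thesis .
qed

text \<open>Both prolongations carry the Cartan field of the system to the trivial one. So the
  trivial field applied to a component of the transition map, pulled back by \<open>\<psi>2\<close>,
  is the Cartan derivative of that component of \<open>\<psi>1\<close>, which is the component of
  the next order.\<close>

lemma flat_outputs_lb_map:
  assumes fl1: "flat_output A f0 f W1 z1" and fl2: "flat_output A f0 f W2 z2"
  shows "open (prolong A f0 f z2 ` (W1 \<inter> W2))"
    and "lb_map (prolong A f0 f z2 ` (W1 \<inter> W2)) (prolong A f0 f z1 \<circ> inv_into W2 (prolong A f0 f z2))"
proof -
  define \<psi>1 where "\<psi>1 = prolong A f0 f z1"
  define \<psi>2 where "\<psi>2 = prolong A f0 f z2"
  define \<phi>2 where "\<phi>2 = inv_into W2 \<psi>2"
  note D1 = flat_outputD[OF fl1, folded \<psi>1_def] and D2 = flat_outputD[OF fl2, folded \<psi>2_def, folded \<phi>2_def]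
  have \<phi>\<psi>: "\<phi>2 (\<psi>2 p) = p" if "p \<in> W2" for p unfolding \<phi>2_def by (rule inv_into_f_f[OF D2(3) that])
  define D where "D = W1 \<inter> W2"
  have oD: "open D" unfolding D_def using D1(1) D2(1) by blast
  have V: "\<psi>2 ` D = {w \<in> \<psi>2 ` W2. \<phi>2 w \<in> W1}" using \<phi>\<psi> by (auto simp: D_def)
  have sm: "open (\<psi>2 ` D)" "smooth_coord (jet_coords ` \<psi>2 ` D) (\<lambda>q. \<psi>1 (\<phi>2 (ji q)) j $ i)" for j i
    unfolding V by (rule smooth_into_ext_comp[OF D2(2,5) D1(1) D1(4)])+
  show "open (prolong A f0 f z2 ` (W1 \<inter> W2))" using sm(1) by (simp add: \<psi>2_def D_def)
  have "trivial_cartan (\<lambda>w. \<psi>1 (\<phi>2 w) j $ i) w = \<psi>1 (\<phi>2 w) (Suc j) $ i" if w: "w \<in> \<psi>2 ` D" for j i w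
  proof -
    obtain p where p: "p \<in> D" "w = \<psi>2 p" using w by blast
    have "cartan A f0 f (\<lambda>p. \<psi>1 p j $ i) p = trivial_cartan (\<lambda>w. \<psi>1 (\<phi>2 w) j $ i) (\<psi>2 p)"
      unfolding \<psi>2_def
    proof (rule cartan_flat_comp[OF fl2 oD _ p(1) sm(2)])
      have "smX c (D \<inter> fst c \<times> UNIV) (\<lambda>p. \<psi>1 p j $ i)" if "c \<in> A" for c
        by (rule smX_subset[OF that smooth_ext_chart[OF D1(4) that] open_chart_part[OF that oD]]) (auto simp: D_def)
      then show "smooth_ext A D (\<lambda>p. \<psi>1 p j $ i)" by (simp add: smooth_ext_iff)
    qed (use \<phi>\<psi> in \<open>auto simp: D_def \<psi>2_def[symmetric]\<close>)
    moreover have "cartan A f0 f (\<lambda>p. \<psi>1 p j $ i) p = \<psi>1 p (Suc j) $ i" unfolding \<psi>1_def by (rule prolong_Suc)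
    ultimately show ?thesis using p \<phi>\<psi>[of p] by (simp add: D_def)
  qed
  with sm(2) show "lb_map (prolong A f0 f z2 ` (W1 \<inter> W2)) (prolong A f0 f z1 \<circ> inv_into W2 (prolong A f0 f z2))"
    unfolding lb_map_def \<psi>1_def[symmetric] \<psi>2_def[symmetric] \<phi>2_def[symmetric] D_def[symmetric]
    by (simp add: smooth_in_jet_iff)
qed

lemma flat_outputs_compatible:
  assumes fl1: "flat_output A f0 f W1 z1" and fl2: "flat_output A f0 f W2 z2"
  shows "lb_compatible (W1, prolong A f0 f z1) (W2, prolong A f0 f z2)"
proof -
  have i1: "inv_into W1 (prolong A f0 f z1) (prolong A f0 f z1 p) = p" if "p \<in> W1" for p
    by (rule inv_into_f_f[OF flat_outputD(3)[OF fl1] that])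
  have i2: "inv_into W2 (prolong A f0 f z2) (prolong A f0 f z2 p) = p" if "p \<in> W2" for p
    by (rule inv_into_f_f[OF flat_outputD(3)[OF fl2] that])
  show ?thesis
    unfolding lb_compatible_def prod.case lb_isomorphism_def
  proof (intro impI conjI)
    show "open (prolong A f0 f z2 ` (W1 \<inter> W2))" "lb_map (prolong A f0 f z2 ` (W1 \<inter> W2)) (prolong A f0 f z1 \<circ> inv_into W2 (prolong A f0 f z2))"
      by (rule flat_outputs_lb_map[OF fl1 fl2])+
    show "open (prolong A f0 f z1 ` (W1 \<inter> W2))" "lb_map (prolong A f0 f z1 ` (W1 \<inter> W2)) (prolong A f0 f z2 \<circ> inv_into W1 (prolong A f0 f z1))"
      using flat_outputs_lb_map[OF fl2 fl1] by (simp_all add: Int_commute)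
  qed (auto simp: i1 i2 image_image)
qed

section \<open>The distributions and their involutive closures\<close>

lemma smooth_fun_const: "smooth_fun A UNIV (\<lambda>_. a)"
  unfolding smooth_fun_iff by (auto intro!: smooth_coord_const open_cc_image chart)

lemma open_range: "c \<in> A \<Longrightarrow> open (cc c ` fst c)"
  by (rule open_cc_image[OF _ chart(1)]) auto

lemma smooth_on_chart_add:
  "smooth_on_chart c v \<Longrightarrow> smooth_on_chart c w \<Longrightarrow> smooth_on_chart c (\<lambda>c y. v c y + w c y)"
  unfolding smooth_on_chart_def vc_def by (simp add: smooth_coord_add)

lemma smooth_on_chart_scale:
  assumes "smooth_fun A UNIV a" "c \<in> A" "smooth_on_chart c v"
  shows "smooth_on_chart c (\<lambda>c y. a (chart_inv c y) *\<^sub>R v c y)"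
  using assms smooth_coord_mult[of "cc c ` fst c" "\<lambda>y. a (ci c y)" "\<lambda>y. vc v c y i" for i]
  unfolding smooth_on_chart_def vc_def smooth_fun_iff ci_def by simp

lemma involutive_closure_smooth:
  assumes c: "c \<in> A" and D: "\<And>v. v \<in> D \<Longrightarrow> smooth_on_chart c v" and "v \<in> involutive_closure A D"
  shows "smooth_on_chart c v"
  using assms(3)
  by induction (auto intro: D smooth_on_chart_add smooth_on_chart_scale[OF _ c] smooth_lie_bracket[OF c])

lemma distr_smooth:
  assumes c: "c \<in> A"
  shows "v \<in> distr A f0 f k \<Longrightarrow> smooth_on_chart c v"
proof (induction k arbitrary: v)
  case 0
  then obtain a where a: "v = (\<lambda>c y. \<Sum>j\<in>UNIV. a j (chart_inv c y) *\<^sub>R f j c y)" "\<forall>j. smooth_fun A UNIV (a j)" by auto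
  have "smooth_coord (cc c ` fst c) (\<lambda>y. \<Sum>j\<in>UNIV. a j (ci c y) * vc (f j) c y i)" for i
    using a(2) smooth_vfield_chart[OF f c] c unfolding smooth_fun_iff smooth_on_chart_def
    by (intro smooth_coord_sum smooth_coord_mult open_range[OF c]) auto
  then show ?case by (simp add: smooth_on_chart_def vc_def a(1) ci_def)
next
  case (Suc k)
  then obtain u w where v: "v = (\<lambda>c y. u c y + lie_bracket f0 w c y)"
    "u \<in> involutive_closure A (distr A f0 f k)" "w \<in> involutive_closure A (distr A f0 f k)" by auto
  have "smooth_on_chart c u" "smooth_on_chart c w"
    using involutive_closure_smooth[OF c Suc.IH] v by blast+
  then show ?case unfolding v(1)
    by (intro smooth_on_chart_add smooth_lie_bracket[OF c] smooth_vfield_chart[OF f0 c])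
qed

definition cl :: "nat \<Rightarrow> ('x, 'n) vfield set" where "cl k = involutive_closure A (distr A f0 f k)"

lemma cl_smooth: "c \<in> A \<Longrightarrow> v \<in> cl k \<Longrightarrow> smooth_on_chart c v"
  unfolding cl_def by (rule involutive_closure_smooth[OF _ distr_smooth])

lemma f_in_cl: "f j \<in> cl 0"
proof -
  have "(\<lambda>c y. \<Sum>i\<in>UNIV. (if i = j then 1 else 0) *\<^sub>R f i c y) = f j"
    by (auto simp: fun_eq_iff if_distrib[of "\<lambda>a. a *\<^sub>R _"] cong: if_cong)
  then have "f j \<in> distr A f0 f 0"
    by (simp, intro exI[of _ "\<lambda>i _. if i = j then 1 else 0"]) (simp add: smooth_fun_const)
  then show ?thesis unfolding cl_def by (rule involutive_closure.base)
qed

lemma distr_SucI: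
  assumes "u \<in> cl k" "w \<in> cl k"
  shows "(\<lambda>c y. u c y + lie_bracket f0 w c y) \<in> distr A f0 f (Suc k)"
  using assms unfolding cl_def by (simp only: distr.simps) blast

text \<open>Members of \<open>distr\<close> at a successor are sums v + [f0, w]; the zero field in
  place of \<open>v\<close> or \<open>w\<close> isolates one summand.\<close>

lemma zero_in_cl: "(\<lambda>c y. 0) \<in> cl k"
proof (induction k)
  case 0
  from involutive_closure.scale[OF smooth_fun_const[of 0] f_in_cl[of undefined, unfolded cl_def]] show ?case by (simp add: cl_def)
next
  case (Suc k)
  from involutive_closure.scale[OF smooth_fun_const[of 0] involutive_closure.base[OF distr_SucI[OF this this]]]
  show ?case by (simp add: cl_def)
qed

lemma lie_bracket_zero:
  assumes c: "c \<in> A" and y: "y \<in> cc c ` fst c"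
  shows "vc (lie_bracket f0 (\<lambda>c y. 0)) c y i = 0"
proof -
  have z: "smooth_on_chart c (\<lambda>c y. 0)" by (rule cl_smooth[OF c zero_in_cl])
  show ?thesis unfolding lie_bracket_coords[OF c smooth_vfield_chart[OF f0 c] z y]
    by (simp add: vc_def dder_def)
qed

text \<open>Equality is claimed on the chart range only: outside of it \<open>f0\<close> need not be
  differentiable, and its bracket with the zero field is then an unspecified value.\<close>

lemma cl_in_distr:
  assumes c: "c \<in> A" and v: "v \<in> cl k"
  shows "\<exists>v'\<in>distr A f0 f (Suc k). \<forall>y\<in>cc c ` fst c. vc v' c y = vc v c y"
proof
  show "(\<lambda>c y. v c y + lie_bracket f0 (\<lambda>c y. 0) c y) \<in> distr A f0 f (Suc k)"
    by (rule distr_SucI[OF v zero_in_cl])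
  show "\<forall>y\<in>cc c ` fst c. vc (\<lambda>c y. v c y + lie_bracket f0 (\<lambda>c y. 0) c y) c y = vc v c y"
    using lie_bracket_zero[OF c] by (auto simp: vc_def fun_eq_iff)
qed

text \<open>The inverse \<open>\<phi>\<close> of the prolongation writes state and control as
  functions \<open>X\<close> and \<open>U\<close> of the jet of \<open>z\<close>, for which the
  equation of the system becomes an identity with the trivial Cartan field: a
  \<open>trajectory\<close>. The control \<open>u\<close> is arbitrary because the distributions
  depend on the state alone.\<close>

lemma flat_point_in_Omega:
  assumes fl: "flat_output A f0 f W z" and p0: "p0 \<in> W"
  shows "(fst p0, u) \<in> Omega A f0 f"
proof -
  define x0 where "x0 = fst p0"
  define c where "c = chart_at A x0"
  have c: "c \<in> A" "x0 \<in> fst c" using chart_at by (auto simp: c_def)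
  define \<psi> where "\<psi> = prolong A f0 f z"
  define \<phi> where "\<phi> = inv_into W \<psi>"
  note D = flat_outputD[OF fl, folded \<psi>_def, folded \<phi>_def]
  have \<phi>\<psi>: "\<phi> (\<psi> p) = p" if "p \<in> W" for p unfolding \<phi>_def by (rule inv_into_f_f[OF D(3) that])
  define T where "T = W \<inter> fst c \<times> UNIV"
  have T: "open T" "p0 \<in> T" "T \<subseteq> fst c \<times> UNIV" "T \<subseteq> W"
    using open_chart_part[OF c(1) D(1)] p0 c(2) by (auto simp: T_def mem_Times_iff x0_def)
  have oT: "open (ext_coords c ` T)" by (rule open_ext_image[OF c(1) T(1,3)])
  define R where "R = cc c ` fst c"
  have oR: "open R" unfolding R_def by (rule open_range[OF c(1)])
  define S where "S = jet_coords ` \<psi> ` T"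
  have coord: "smooth_ext A T (\<lambda>p. ext_coords c p a)" for a
  proof (rule smooth_extI[OF c(1) T(1,3)], rule smooth_coord_cong[OF smooth_coord_coord[OF oT]])
    fix q assume "q \<in> ext_coords c ` T"
    then obtain r where r: "r \<in> T" "q = ext_coords c r" by blast
    then show "q a = ext_coords c (ei c q) a" using ei_ext_coords[OF c(1), of r] T(3) by auto
  qed
  have V: "\<psi> ` T = {w \<in> \<psi> ` W. \<phi> w \<in> T}" using \<phi>\<psi> T(4) by auto
  have XU: "smooth_coord S (\<lambda>q. ext_coords c (\<phi> (ji q)) a)" for a
    unfolding S_def V by (rule smooth_into_ext_comp(2)[OF D(2,5) T(1) coord])
  define X where "X i q = ext_coords c (\<phi> (ji q)) (Inl i)" for i q
  define U where "U j q = ext_coords c (\<phi> (ji q)) (Inr (0, j))" for j q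
  have Xcc: "(\<lambda>k. X k (jet_coords (\<psi> p))) = cc c (fst p)" if "p \<in> W" for p
    using \<phi>\<psi>[OF that] by (auto simp: X_def ext_coords_def cc_def)
  have SW: "jet_coords (\<psi> p) \<in> S" if "p \<in> T" for p using that by (simp add: S_def)
  have tauX: "dder (shift_coords q) (X i) q = vc f0 c (\<lambda>k. X k q) i + (\<Sum>j\<in>UNIV. U j q * vc (f j) c (\<lambda>k. X k q) i)"
    if q: "q \<in> S" for q i
  proof -
    obtain p where p: "p \<in> T" "q = jet_coords (\<psi> p)" using q by (auto simp: S_def)
    have pW: "p \<in> W" using p T(4) by blast
    have "dder (shift_coords q) (X i) q = trivial_cartan (\<lambda>w. ext_coords c (\<phi> w) (Inl i)) (\<psi> p)"
      using trivial_cartan_eq_dder[OF XU SW[OF p(1)], of "Inl i"] by (simp add: p(2) X_def[abs_def])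
    also have "\<dots> = cartan A f0 f (\<lambda>p. ext_coords c p (Inl i)) p"
      unfolding \<psi>_def
      by (rule cartan_flat_comp[symmetric, OF fl T(1,4) p(1) XU _ coord])
        (use SW \<phi>\<psi> T(4) in \<open>auto simp: \<psi>_def[symmetric] subset_iff\<close>)
    also have "\<dots> = dder (cvec c p) (\<lambda>q. ext_coords c (ei c q) (Inl i)) (ext_coords c p)"
      by (rule cartan_eq_dder[OF c(1) T(1) p(1) T(3)]) (use smooth_ext_chart[OF coord c(1), of "Inl i"] T(3) in \<open>simp add: Int_absorb2\<close>)
    also have "\<dots> = dder (cvec c p) (\<lambda>q. q (Inl i)) (ext_coords c p)"
    proof (rule dder_cong[OF oT imageI[OF p(1)]])
      fix q assume "q \<in> ext_coords c ` T"
      then obtain r where r: "r \<in> T" "q = ext_coords c r" by blast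
      then show "ext_coords c (ei c q) (Inl i) = q (Inl i)" using ei_ext_coords[OF c(1), of r] T(3) by auto
    qed
    also have "\<dots> = vc f0 c (cc c (fst p)) i + (\<Sum>j\<in>UNIV. snd p 0 $ j * vc (f j) c (cc c (fst p)) i)"
      by (simp add: cvec_def vc_def affine_field_def)
    finally have L: "dder (shift_coords q) (X i) q = vc f0 c (cc c (fst p)) i + (\<Sum>j\<in>UNIV. snd p 0 $ j * vc (f j) c (cc c (fst p)) i)" .
    have Uq: "snd p 0 $ j = U j q" for j
      unfolding U_def p(2) ji_jet_coords \<phi>\<psi>[OF pW] by (simp add: ext_coords_def jet_coords_def)
    show ?thesis using L[unfolded Uq] unfolding p(2) Xcc[OF pW] .
  qed
  \<comment> \<open>Fields are compared on the chart range only, as in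
    \<open>cl_in_distr\<close>.\<close>
  define K where "K k = {v. \<exists>w\<in>cl k. \<forall>y\<in>R. vc w c y = v y}" for k
  have Ksm: "smooth_coord R (\<lambda>y. v y i)" if "v \<in> K k" for k v i
  proof -
    obtain w where w: "w \<in> cl k" "\<forall>y\<in>R. vc w c y = v y" using \<open>v \<in> K k\<close> by (auto simp: K_def)
    have "smooth_coord R (\<lambda>y. vc w c y i)" using cl_smooth[OF c(1) w(1)] by (simp add: smooth_on_chart_def R_def)
    then show ?thesis by (rule smooth_coord_cong) (simp add: w(2))
  qed
  have Kd: "\<exists>w\<in>distr A f0 f (Suc k). \<forall>y\<in>R. vc w c y = v y" if "v \<in> K k" for k v
    using that cl_in_distr[OF c(1)] unfolding K_def R_def by fastforce
  have Kmono: "K k \<subseteq> K (Suc k)" for k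
  proof
    fix v assume "v \<in> K k"
    from Kd[OF this] show "v \<in> K (Suc k)" unfolding K_def cl_def by (blast intro: involutive_closure.base)
  qed
  have br: "vc (lie_bracket a b) c y i = bracket (vc a c) (vc b c) y i" if "smooth_on_chart c a" "smooth_on_chart c b" "y \<in> R" for a b y i
    using lie_bracket_coords[OF c(1) that(1,2)] that(3) by (simp add: bracket_def R_def)
  have bcong: "bracket a v y = bracket a v' y" if "\<forall>y\<in>R. v y = v' y" "y \<in> R" for a v v' y
  proof
    show "bracket a v y i = bracket a v' y i" for i
      unfolding bracket_def using dder_cong[OF oR that(2), of "\<lambda>y. v y i" "\<lambda>y. v' y i"] that by simp
  qed
  have KI: "bracket (vc a c) v \<in> K l"
    if a: "smooth_on_chart c a" and w: "w \<in> cl k" "\<forall>y\<in>R. vc w c y = v y" and ab: "lie_bracket a w \<in> cl l" for a v w k l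
    unfolding K_def mem_Collect_eq
  proof (rule bexI[OF _ ab], rule ballI)
    fix y assume y: "y \<in> R"
    have "vc (lie_bracket a w) c y = bracket (vc a c) (vc w c) y" using br[OF a cl_smooth[OF c(1) w(1)] y] by (rule ext)
    also have "\<dots> = bracket (vc a c) v y" by (rule bcong[OF w(2) y])
    finally show "vc (lie_bracket a w) c y = bracket (vc a c) v y" .
  qed
  have traj: "trajectory X U (vc f0 c) (\<lambda>j. vc (f j) c) R S K"
  proof
    show "smooth_coord R (\<lambda>y. vc f0 c y i)" "smooth_coord R (\<lambda>y. vc (f j) c y i)" for i j
      using smooth_vfield_chart[OF f0 c(1)] smooth_vfield_chart[OF f c(1), of j] by (auto simp: smooth_on_chart_def R_def)
    show "smooth_coord S (X i)" "smooth_coord S (U j)" for i j using XU by (simp_all add: X_def[abs_def] U_def[abs_def])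
    show "(\<lambda>q k. X k q) ` S \<subseteq> R"
    proof
      fix y assume "y \<in> (\<lambda>q k. X k q) ` S"
      then obtain p where p: "p \<in> T" "y = (\<lambda>k. X k (jet_coords (\<psi> p)))" by (auto simp: S_def)
      then have "y = cc c (fst p)" "fst p \<in> fst c" using Xcc[of p] T(3,4) by auto
      then show "y \<in> R" by (simp add: R_def)
    qed
    show "dder (shift_coords q) (X i) q = vc f0 c (\<lambda>k. X k q) i + (\<Sum>j\<in>UNIV. U j q * vc (f j) c (\<lambda>k. X k q) i)"
      if "q \<in> S" for q i by (rule tauX[OF that])
    show "smooth_coord R (\<lambda>y. v y i)" if "v \<in> K k" for k v i by (rule Ksm[OF that])
    show "K k \<subseteq> K (Suc k)" for k by (rule Kmono)
    show K0: "vc (f j) c \<in> K 0" for j unfolding K_def using f_in_cl by blast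
    fix k v assume v: "v \<in> K k"
    then obtain w where w: "w \<in> cl k" "\<forall>y\<in>R. vc w c y = v y" by (auto simp: K_def)
    have "lie_bracket f0 w \<in> cl (Suc k)"
      using involutive_closure.base[OF distr_SucI[OF zero_in_cl w(1)]] by (simp add: cl_def)
    then show "bracket (vc f0 c) v \<in> K (Suc k)" by (rule KI[OF smooth_vfield_chart[OF f0 c(1)] w])
    fix j
    \<comment> \<open>The bracket with \<open>f j\<close> is formed inside one involutive closure,
      so both factors are first moved to stage \<open>Suc k\<close>.\<close>
    have "K 0 \<subseteq> K (Suc k)" by (rule lift_Suc_mono_le[of K]) (auto intro: Kmono[THEN subsetD])
    then obtain a where a: "a \<in> cl (Suc k)" "\<forall>y\<in>R. vc a c y = vc (f j) c y" using K0[of j] by (auto simp: K_def)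
    obtain b where b: "b \<in> cl (Suc k)" "\<forall>y\<in>R. vc b c y = v y" using v Kmono[of k] by (auto simp: K_def)
    have "lie_bracket a b \<in> cl (Suc k)" using a(1) b(1) unfolding cl_def by (rule involutive_closure.bracket)
    from KI[OF cl_smooth[OF c(1) a(1)] b this] obtain e where e: "e \<in> cl (Suc k)" "\<forall>y\<in>R. vc e c y = bracket (vc a c) v y"
      by (auto simp: K_def)
    have "bracket (vc a c) v y = bracket (vc (f j) c) v y" if y: "y \<in> R" for y
    proof
      show "bracket (vc a c) v y i = bracket (vc (f j) c) v y i" for i
        unfolding bracket_def using dder_cong[OF oR y, of "\<lambda>y. vc a c y i" "\<lambda>y. vc (f j) c y i"] a(2) y by simp
    qed
    with e show "bracket (vc (f j) c) v \<in> K (Suc k)" unfolding K_def by (intro CollectI bexI[of _ e]) auto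
  qed
  define q0 where "q0 = jet_coords (\<psi> p0)"
  have q0: "q0 \<in> S" unfolding q0_def by (rule SW[OF T(2)])
  \<comment> \<open>The direction is the image of the unit vector \<open>i'\<close> of the state
    under the differential of \<open>\<psi>\<close>; as \<open>X\<close> after \<open>\<psi>\<close>
    is the state, \<open>X\<close> maps it back.\<close>
  have sub: "\<exists>b. \<forall>i. dder b (X i) q0 = (if i = i' then 1 else 0)" for i'
  proof (intro exI allI)
    fix i
    define \<xi> where "\<xi> = (\<lambda>a. if a = (Inl i' :: 'n + nat \<times> 'm) then 1 else 0 :: real)"
    have \<psi>sm: "smooth_coord (ext_coords c ` T) (\<lambda>q. jet_coords (\<psi> (ei c q)) a)" for a
      using smooth_ext_chart[OF D(4) c(1), folded T_def, of "fst a" "snd a"] by (simp add: jet_coords_def split_beta)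
    have pT: "ext_coords c p0 \<in> ext_coords c ` T" using T(2) by simp
    have e0: "ei c (ext_coords c p0) = p0" using ei_ext_coords[OF c(1), of p0] T(2,3) by auto
    have "dder (\<lambda>a. dder \<xi> (\<lambda>q. jet_coords (\<psi> (ei c q)) a) (ext_coords c p0)) (X i) (jet_coords (\<psi> (ei c (ext_coords c p0)))) =
        dder \<xi> (\<lambda>q. X i (jet_coords (\<psi> (ei c q)))) (ext_coords c p0)"
      by (rule chain_dder[symmetric, OF _ _ \<psi>sm pT, where S=S]) (use XU q0 e0 in \<open>auto simp: X_def[abs_def] q0_def\<close>)
    also have "\<dots> = dder \<xi> (\<lambda>q. q (Inl i)) (ext_coords c p0)"
    proof (rule dder_cong[OF oT pT])
      fix q assume "q \<in> ext_coords c ` T"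
      then obtain r where r: "r \<in> T" "q = ext_coords c r" by blast
      then have "ei c q = r" "\<phi> (\<psi> r) = r" using ei_ext_coords[OF c(1), of r] T(3,4) \<phi>\<psi> by auto
      then show "X i (jet_coords (\<psi> (ei c q))) = q (Inl i)" by (simp add: X_def r(2))
    qed
    also have "\<dots> = (if i = i' then 1 else 0)" by (simp add: \<xi>_def)
    finally show "dder (\<lambda>a. dder \<xi> (\<lambda>q. jet_coords (\<psi> (ei c q)) a) (ext_coords c p0)) (X i) q0 = (if i = i' then 1 else 0)"
      unfolding e0 q0_def .
  qed
  obtain k where k: "span ((\<lambda>v. \<chi> i. v (\<lambda>k. X k q0) i) ` K k) = UNIV"
    using trajectory_span[OF traj q0 sub] by blast
  have Xq0: "(\<lambda>k. X k q0) = cc c x0" unfolding q0_def x0_def by (rule Xcc[OF p0])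
  have x0R: "cc c x0 \<in> R" using c(2) by (simp add: R_def)
  \<comment> \<open>The rank in \<open>Omega\<close> is that of a distribution and not of its
    closure; the closure of stage \<open>k\<close> is found again in stage
    \<open>Suc k\<close>.\<close>
  have "(\<lambda>v. \<chi> i. v (\<lambda>k. X k q0) i) ` K k \<subseteq> (\<lambda>v. vf_at A v x0) ` distr A f0 f (Suc k)"
  proof
    fix y assume "y \<in> (\<lambda>v. \<chi> i. v (\<lambda>k. X k q0) i) ` K k"
    then obtain v where v: "v \<in> K k" "y = (\<chi> i. v (cc c x0) i)" unfolding Xq0 by blast
    obtain w where w: "w \<in> distr A f0 f (Suc k)" "\<forall>y\<in>R. vc w c y = v y" using Kd[OF v(1)] by blast
    have "y = vf_at A w x0" unfolding vf_at_def Let_def c_def[symmetric] v(2)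
      using w(2) x0R vc_cc[of w c x0] by (simp add: vec_eq_iff)
    then show "y \<in> (\<lambda>v. vf_at A v x0) ` distr A f0 f (Suc k)" using w(1) by blast
  qed
  from span_mono[OF this] k have "span ((\<lambda>v. vf_at A v x0) ` distr A f0 f (Suc k)) = UNIV" by blast
  then have "dim ((\<lambda>v. vf_at A v x0) ` distr A f0 f (Suc k)) = CARD('n)"
    by (metis dim_span dim_UNIV DIM_cart DIM_real mult.right_neutral)
  then show ?thesis unfolding Omega_def rank_at_def x0_def by blast
qed

end

section \<open>Construction of flat outputs\<close>

text \<open>Diagonal dominance: each \<open>a i\<close> is at most \<open>s / (2 * n)\<close> in
  absolute value, where \<open>s\<close> is the sum of all these absolute values; hence
  \<open>s \<le> s / 2\<close>.\<close>

lemma near_identity_injective: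
  fixes a :: "'m::finite \<Rightarrow> real"
  assumes Q: "\<And>i j. \<bar>Q i j - (if i = j then 1 else 0)\<bar> \<le> 1 / (2 * n)" and n: "real CARD('m) \<le> n"
    and z: "\<And>i. (\<Sum>j\<in>UNIV. Q i j * a j) = 0"
  shows "a i = 0"
proof -
  have n0: "n > 0" using n by (meson less_le_trans of_nat_0_less_iff zero_less_card_finite)
  define s where "s = (\<Sum>j\<in>UNIV. \<bar>a j\<bar>)"
  have s0: "s \<ge> 0" by (simp add: s_def sum_nonneg)
  have ai: "\<bar>a i\<bar> \<le> s / (2 * n)" for i
  proof -
    have "(\<Sum>j\<in>UNIV. (if i = j then 1 else 0) * a j) = (\<Sum>j\<in>UNIV. if i = j then a j else 0)"
      by (rule sum.cong) auto
    also have "\<dots> = a i" by simp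
    finally have "a i = (\<Sum>j\<in>UNIV. ((if i = j then 1 else 0) - Q i j) * a j)"
      using z[of i] by (simp add: left_diff_distrib sum_subtractf)
    also have "\<bar>\<dots>\<bar> \<le> (\<Sum>j\<in>UNIV. 1 / (2 * n) * \<bar>a j\<bar>)"
    proof (rule order_trans[OF sum_abs], rule sum_mono)
      fix j
      show "\<bar>((if i = j then 1 else 0) - Q i j) * a j\<bar> \<le> 1 / (2 * n) * \<bar>a j\<bar>"
        unfolding abs_mult using Q[of i j] by (intro mult_right_mono) (simp_all add: abs_minus_commute)
    qed
    finally show ?thesis by (simp add: s_def sum_divide_distrib)
  qed
  have "s \<le> (\<Sum>j\<in>(UNIV::'m set). s / (2 * n))" unfolding s_def by (rule sum_mono) (use ai s_def in simp)
  also have "\<dots> = real CARD('m) * (s / (2 * n))" by simp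
  also have "\<dots> \<le> n * (s / (2 * n))" using n s0 n0 by (intro mult_right_mono) auto
  also have "\<dots> = s / 2" using n0 by simp
  finally have "s = 0" using s0 by simp
  then have "\<bar>a i\<bar> \<le> 0" using ai[of i] by simp
  then show ?thesis by simp
qed

locale coord_system =
  fixes F0 :: "('n::finite \<Rightarrow> real) \<Rightarrow> 'n \<Rightarrow> real" and F :: "'m::finite \<Rightarrow> ('n \<Rightarrow> real) \<Rightarrow> 'n \<Rightarrow> real"
    and R :: "('n \<Rightarrow> real) set" and k :: 'm
  assumes F0: "\<And>i. smooth_coord R (\<lambda>y. F0 y i)" and F: "\<And>s i. smooth_coord R (\<lambda>y. F s y i)"
    and card: "CARD('n) = Suc CARD('m)"
begin

text \<open>The bracket [g, f_k] with the control as a constant parameter;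
  \<open>lie_bracket_affine\<close> makes the identification.\<close>

definition B :: "('m \<Rightarrow> real) \<Rightarrow> ('n \<Rightarrow> real) \<Rightarrow> 'n \<Rightarrow> real" where
  "B u y i = bracket F0 (F k) y i + (\<Sum>s\<in>UNIV. u s * bracket (F s) (F k) y i)"

definition good :: "('m \<Rightarrow> real) \<Rightarrow> ('n \<Rightarrow> real) \<Rightarrow> bool" where
  "good u y \<longleftrightarrow> span (insert (\<chi> i. B u y i) (range (\<lambda>s. \<chi> i. F s y i))) = UNIV"

text \<open>The time derivative of \<open>h j\<close> along the system. For first integrals of
  \<open>F k\<close> the summand \<open>s = k\<close> is zero.\<close>

definition H1 :: "('m \<Rightarrow> ('n \<Rightarrow> real) \<Rightarrow> real) \<Rightarrow> 'm \<Rightarrow> ('n + 'm \<Rightarrow> real) \<Rightarrow> real" where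
  "H1 h j q = dder (F0 (\<lambda>i. q (Inl i))) (h j) (\<lambda>i. q (Inl i)) +
    (\<Sum>s\<in>UNIV. q (Inr s) * dder (F s (\<lambda>i. q (Inl i))) (h j) (\<lambda>i. q (Inl i)))"

text \<open>The component \<open>Inr None\<close> makes the map square: neither \<open>h\<close> nor \<open>H1 h\<close> depends on \<open>u\<^sub>k\<close>.\<close>

definition Theta :: "('m \<Rightarrow> ('n \<Rightarrow> real) \<Rightarrow> real) \<Rightarrow> ('n + 'm \<Rightarrow> real) \<Rightarrow> 'm + 'm option \<Rightarrow> real" where
  "Theta h q = case_sum (\<lambda>j. h j (\<lambda>i. q (Inl i))) (\<lambda>b. case b of None \<Rightarrow> q (Inr k) | Some j \<Rightarrow> H1 h j q)"

lemma B_upd: "B (u(k := t)) y = B u y"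
proof
  fix i
  have "bracket (F k) (F k) y i = 0" by (simp add: bracket_def)
  then have "(u(k := t)) s * bracket (F s) (F k) y i = u s * bracket (F s) (F k) y i" for s by simp
  then show "B (u(k := t)) y i = B u y i" unfolding B_def by (simp only:)
qed

text \<open>Once \<open>\<tau>\<close> numbers the fields and the bracket by the state indices,
  spanning becomes a nonzero determinant. This makes it an open condition and equivalent to
  independence of the rows.\<close>

definition M :: "('n \<Rightarrow> 'm option) \<Rightarrow> ('m \<Rightarrow> real) \<Rightarrow> ('n \<Rightarrow> real) \<Rightarrow> real^'n^'n" where
  "M \<tau> u y = (\<chi> r i. case \<tau> r of None \<Rightarrow> B u y i | Some s \<Rightarrow> F s y i)"

lemma ex_bij: "\<exists>\<tau>::'n \<Rightarrow> 'm option. bij \<tau>"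
proof -
  have "CARD('n) = CARD('m option)" using card by simp
  from finite_same_card_bij[OF finite finite this] show ?thesis by blast
qed

lemma rows_M: "bij \<tau> \<Longrightarrow> rows (M \<tau> u y) = insert (\<chi> i. B u y i) (range (\<lambda>s. \<chi> i. F s y i))"
proof -
  assume \<tau>: "bij \<tau>"
  have row: "row r (M \<tau> u y) = (case \<tau> r of None \<Rightarrow> \<chi> i. B u y i | Some s \<Rightarrow> \<chi> i. F s y i)" for r
    by (auto simp: row_def M_def vec_eq_iff split: option.split)
  have "rows (M \<tau> u y) = (\<lambda>b. case b of None \<Rightarrow> \<chi> i. B u y i | Some s \<Rightarrow> \<chi> i. F s y i) ` range \<tau>"
    unfolding rows_def row by auto
  also have "range \<tau> = insert None (range Some)" using bij_is_surj[OF \<tau>] UNIV_option_conv by metis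
  finally show ?thesis by (simp add: image_image)
qed

lemma good_iff_det: "bij \<tau> \<Longrightarrow> good u y \<longleftrightarrow> det (M \<tau> u y) \<noteq> 0"
  unfolding good_def rows_M[symmetric] matrix_left_invertible_span_rows[symmetric]
  by (simp add: invertible_det_nz[symmetric] invertible_left_inverse)

lemma good_independent:
  assumes "good u y" and eq: "\<And>i. b * B u y i + (\<Sum>s\<in>UNIV. a s * F s y i) = 0"
  shows "b = 0" "a s = 0"
proof -
  obtain \<tau> :: "'n \<Rightarrow> 'm option" where \<tau>: "bij \<tau>" using ex_bij by blast
  have "invertible (M \<tau> u y)" using assms(1) good_iff_det[OF \<tau>] invertible_det_nz by blast
  then have "\<exists>C. M \<tau> u y ** C = mat 1" by (simp add: invertible_right_inverse)
  then have ind: "\<And>e. (\<Sum>r\<in>UNIV. e r *s row r (M \<tau> u y)) = 0 \<Longrightarrow> \<forall>r. e r = 0"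
    unfolding matrix_right_invertible_independent_rows by blast
  define e where "e b' = (case b' of None \<Rightarrow> b | Some s \<Rightarrow> a s)" for b'
  have "(\<Sum>r\<in>UNIV. e (\<tau> r) *s row r (M \<tau> u y)) $ i = 0" for i
  proof -
    have "(\<Sum>r\<in>UNIV. e (\<tau> r) *s row r (M \<tau> u y)) $ i =
        (\<Sum>r\<in>UNIV. e (\<tau> r) * (case \<tau> r of None \<Rightarrow> B u y i | Some s \<Rightarrow> F s y i))"
      by (simp add: row_def M_def)
    also have "\<dots> = (\<Sum>b'\<in>UNIV. e b' * (case b' of None \<Rightarrow> B u y i | Some s \<Rightarrow> F s y i))"
      by (rule sum.reindex_bij_betw[OF \<tau>])
    also have "\<dots> = b * B u y i + (\<Sum>s\<in>UNIV. a s * F s y i)"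
      by (simp add: UNIV_option_conv e_def sum.reindex)
    finally show ?thesis using eq by simp
  qed
  then have "\<forall>r. e (\<tau> r) = 0" by (intro ind) (simp add: vec_eq_iff)
  then have "e b' = 0" for b' using bij_pointE[OF \<tau>, of b'] by metis
  from this[of None] this[of "Some s"] show "b = 0" "a s = 0" by (simp_all add: e_def)
qed

lemma open_R: "open R" by (rule smooth_coordD(1)[OF F])

lemma smooth_bracket: "(\<And>i. smooth_coord S (\<lambda>y. a y i)) \<Longrightarrow> (\<And>i. smooth_coord S (\<lambda>y. b y i)) \<Longrightarrow> smooth_coord S (\<lambda>y. bracket a b y i)"
  unfolding bracket_def by (intro smooth_coord_diff smooth_coord_dder)

text \<open>The commutator of derivations applied to \<open>h\<close>; one of its two terms drops
  out since the derivative of \<open>h\<close> along \<open>F k\<close> vanishes on all of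
  \<open>Nh\<close> and not just at \<open>y\<close>.\<close>

lemma dder_F_dder:
  assumes Nh: "open Nh" "Nh \<subseteq> R" "y \<in> Nh" and h: "smooth_coord Nh h" and hk: "\<And>y. y \<in> Nh \<Longrightarrow> dder (F k y) h y = 0"
    and a: "\<And>i. smooth_coord R (\<lambda>y. a y i)"
  shows "dder (F k y) (\<lambda>y. dder (a y) h y) y = - dder (bracket a (F k) y) h y"
proof -
  have sm: "smooth_coord Nh (\<lambda>y. F k y i)" "smooth_coord Nh (\<lambda>y. a y i)" for i
    using smooth_coord_subset[OF F Nh(1,2)] smooth_coord_subset[OF a Nh(1,2)] by auto
  have z: "dder (a y) (\<lambda>y. dder (F k y) h y) y = dder (a y) (\<lambda>y. 0) y"
    by (rule dder_cong[OF Nh(1,3) hk])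
  have "dder (F k y) (\<lambda>y. dder (a y) h y) y = - (dder (a y) (\<lambda>y. dder (F k y) h y) y - dder (F k y) (\<lambda>y. dder (a y) h y) y)"
    using z by simp
  also have "dder (a y) (\<lambda>y. dder (F k y) h y) y - dder (F k y) (\<lambda>y. dder (a y) h y) y = dder (bracket a (F k) y) h y"
    unfolding dder_commutator[OF sm(2,1) h Nh(3)] bracket_def[abs_def] ..
  finally show ?thesis .
qed

lemma smooth_Theta:
  assumes Nh: "open Nh" "Nh \<subseteq> R" and h: "\<And>j. smooth_coord Nh (h j)" and S: "open S" "\<And>q. q \<in> S \<Longrightarrow> (\<lambda>i. q (Inl i)) \<in> Nh"
  shows "smooth_coord S (\<lambda>q. Theta h q b)"
proof -
  have cmp: "smooth_coord S (\<lambda>q. G (\<lambda>i. q (Inl i)))" if "smooth_coord Nh G" for G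
    by (rule smooth_coord_comp[OF that S(1) smooth_coord_coord[OF S(1)]]) (use S(2) in auto)
  have d: "smooth_coord Nh (\<lambda>y. dder (a y) (h j) y)" if "\<And>i. smooth_coord R (\<lambda>y. a y i)" for a j
    by (rule smooth_coord_dder[OF h smooth_coord_subset[OF that Nh]])
  have "smooth_coord S (\<lambda>q. H1 h j q)" for j
    unfolding H1_def
    by (intro smooth_coord_add smooth_coord_sum smooth_coord_mult S(1) cmp[OF d[OF F0]] cmp[OF d[OF F]] smooth_coord_coord)
  note H = this
  show ?thesis
  proof (cases b)
    case (Inl j)
    then show ?thesis using cmp[OF h, of j] by (simp add: Theta_def)
  next
    case (Inr b')
    then show ?thesis using H smooth_coord_coord[OF S(1)] by (cases b') (simp_all add: Theta_def)
  qed
qed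

text \<open>Let \<open>a\<close> be in the kernel, with state part \<open>\<xi>\<close> and control
  part \<open>\<eta>\<close>. The \<open>h\<close> rows give \<xi> = l F_k, the row
  \<open>None\<close> gives \<open>\<eta> k = 0\<close>, and by \<open>dder_F_dder\<close> the
  \<open>H1\<close> rows say that - l B + sum \<eta>_s F_s is killed by all differentials of
  \<open>h\<close>, hence equals some m F_k. Independence of the bracket and the fields then leaves
  only zero.\<close>

lemma Theta_jacobian:
  assumes Nh: "open Nh" "Nh \<subseteq> R" and h: "\<And>j. smooth_coord Nh (h j)" and hk: "\<And>j y. y \<in> Nh \<Longrightarrow> dder (F k y) (h j) y = 0"
    and ker: "\<And>y \<xi>. y \<in> Nh \<Longrightarrow> (\<And>j. dder \<xi> (h j) y = 0) \<Longrightarrow> \<exists>l. \<xi> = (\<lambda>i. l * F k y i)"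
    and q: "(\<lambda>i. q (Inl i)) \<in> Nh" and gd: "good (\<lambda>s. q (Inr s)) (\<lambda>i. q (Inl i))"
    and a: "\<And>b. dder a (\<lambda>q. Theta h q b) q = 0"
  shows "a = (\<lambda>_. 0)"
proof -
  define y where "y = (\<lambda>i. q (Inl i))"
  define u where "u = (\<lambda>s. q (Inr s))"
  define S where "S = {q \<in> UNIV. (\<lambda>i. q (Inl i) :: real) \<in> Nh} \<inter> (UNIV :: ('n + 'm \<Rightarrow> real) set)"
  have oS: "open S" unfolding S_def
    using open_preimage_coordinatewise[OF open_UNIV Nh(1), of "\<lambda>q i. q (Inl i)"] continuous_on_product_coordinates by auto
  have qS: "q \<in> S" using q by (simp add: S_def)
  define \<xi> where "\<xi> = (\<lambda>i. a (Inl i))"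
  define \<eta> where "\<eta> = (\<lambda>s. a (Inr s))"
  have ch: "dder a (\<lambda>q. G (\<lambda>i. q (Inl i))) q = dder \<xi> G y" if "smooth_coord Nh G" for G
  proof -
    have "dder a (\<lambda>q. G (\<lambda>i. q (Inl i))) q = dder (\<lambda>i. dder a (\<lambda>q. q (Inl i)) q) G (\<lambda>i. q (Inl i))"
      by (rule chain_dder[OF that q smooth_coord_coord[OF oS] qS])
    then show ?thesis by (simp add: \<xi>_def y_def)
  qed
  have cmp: "smooth_coord S (\<lambda>q. G (\<lambda>i. q (Inl i)))" if "smooth_coord Nh G" for G
    by (rule smooth_coord_comp[OF that oS smooth_coord_coord[OF oS]]) (auto simp: S_def)
  have yN: "y \<in> Nh" using q by (simp add: y_def)
  have "dder \<xi> (h j) y = 0" for j using a[of "Inl j"] ch[OF h[of j]] by (simp add: Theta_def)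
  from ker[OF yN this] obtain l where l: "\<xi> = (\<lambda>i. l * F k y i)" by blast
  have \<eta>k: "\<eta> k = 0" using a[of "Inr None"] by (simp add: Theta_def \<eta>_def)
  have scl: "dder \<xi> G y = l * dder (F k y) G y" for G
    by (simp add: l dder_finite sum_distrib_left mult_ac)
  have d: "smooth_coord Nh (\<lambda>y. dder (a y) (h j) y)" if "\<And>i. smooth_coord R (\<lambda>y. a y i)" for a j
    by (rule smooth_coord_dder[OF h smooth_coord_subset[OF that Nh]])
  have z: "dder (\<lambda>i. - l * B u y i + (\<Sum>s\<in>UNIV. \<eta> s * F s y i)) (h j) y = 0" for j
  proof -
    have "0 = dder a (\<lambda>q. H1 h j q) q" using a[of "Inr (Some j)"] by (simp add: Theta_def)
    also have "\<dots> = dder a (\<lambda>q. dder (F0 (\<lambda>i. q (Inl i))) (h j) (\<lambda>i. q (Inl i))) q +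
        (\<Sum>s\<in>UNIV. dder a (\<lambda>q. q (Inr s) * dder (F s (\<lambda>i. q (Inl i))) (h j) (\<lambda>i. q (Inl i))) q)"
      unfolding H1_def
      by (subst dder_add[OF cmp[OF d[OF F0]] smooth_coord_sum[OF oS smooth_coord_mult[OF smooth_coord_coord[OF oS] cmp[OF d[OF F]]]] qS],
          subst dder_sum[OF oS smooth_coord_mult[OF smooth_coord_coord[OF oS] cmp[OF d[OF F]]] qS]) (rule refl)
    also have "\<dots> = dder \<xi> (\<lambda>y. dder (F0 y) (h j) y) y +
        (\<Sum>s\<in>UNIV. \<eta> s * dder (F s y) (h j) y + u s * dder \<xi> (\<lambda>y. dder (F s y) (h j) y) y)"
      by (subst dder_mult[OF smooth_coord_coord[OF oS] cmp[OF d[OF F]] qS])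
        (simp add: ch[OF d[OF F0]] ch[OF d[OF F]] \<eta>_def u_def y_def)
    also have "\<dots> = - l * dder (bracket F0 (F k) y) (h j) y + (\<Sum>s\<in>UNIV. \<eta> s * dder (F s y) (h j) y + u s * (- l * dder (bracket (F s) (F k) y) (h j) y))"
    proof -
      have e: "dder (F k y) (\<lambda>y. dder (b y) (h j) y) y = - dder (bracket b (F k) y) (h j) y"
        if b: "\<And>i. smooth_coord R (\<lambda>y. b y i)" for b
        by (rule dder_F_dder[OF Nh yN h[of j] hk[of _ j] b])
      show ?thesis unfolding scl e[OF F0] e[OF F] by simp
    qed
    also have "\<dots> = dder (\<lambda>i. - l * B u y i + (\<Sum>s\<in>UNIV. \<eta> s * F s y i)) (h j) y"
    proof -
      have sw: "(\<Sum>i\<in>UNIV. (\<Sum>s\<in>UNIV. e s * X s i) * partial i (h j) y) = (\<Sum>s\<in>UNIV. e s * (\<Sum>i\<in>UNIV. X s i * partial i (h j) y))"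
        for e :: "'m \<Rightarrow> real" and X
        unfolding sum_distrib_left sum_distrib_right by (subst sum.swap) (simp add: mult_ac)
      show ?thesis
        unfolding dder_finite B_def distrib_left distrib_right sum.distrib mult.assoc sum_distrib_left[symmetric] sw
        by (simp add: sum_distrib_left sum_negf algebra_simps)
    qed
    finally show ?thesis by simp
  qed
  from ker[OF yN z] obtain m where m: "(\<lambda>i. - l * B u y i + (\<Sum>s\<in>UNIV. \<eta> s * F s y i)) = (\<lambda>i. m * F k y i)" by blast
  have lin: "- l * B u y i + (\<Sum>s\<in>UNIV. (\<eta> s - (if s = k then m else 0)) * F s y i) = 0" for i
  proof -
    have "(\<Sum>s\<in>UNIV. (if s = k then m else 0) * F s y i) = (\<Sum>s\<in>UNIV. if s = k then m * F s y i else 0)"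
      by (rule sum.cong) auto
    also have "\<dots> = m * F k y i" by simp
    finally show ?thesis using fun_cong[OF m, of i] by (simp add: left_diff_distrib sum_subtractf)
  qed
  have g': "good u y" using gd by (simp add: u_def y_def)
  have "- l = 0" by (rule good_independent(1)[OF g' lin])
  \<comment> \<open>At \<open>s = k\<close> independence yields only \<open>\<eta> k = m\<close>;
    there the row \<open>None\<close> is used.\<close>
  moreover have "\<eta> s = 0" for s
    using good_independent(2)[OF g' lin, of s] \<eta>k by (cases "s = k") simp_all
  ultimately have "a b = 0" for b
    using fun_cong[OF l] by (cases b) (auto simp: \<xi>_def \<eta>_def fun_eq_iff)
  then show ?thesis by auto
qed

lemma open_good: "open {q :: 'n + 'm \<Rightarrow> real. (\<lambda>i. q (Inl i)) \<in> R \<and> good (\<lambda>s. q (Inr s)) (\<lambda>i. q (Inl i))}"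
proof -
  obtain \<tau> :: "'n \<Rightarrow> 'm option" where \<tau>: "bij \<tau>" using ex_bij by blast
  define S where "S = {q \<in> UNIV. (\<lambda>i. (q :: 'n + 'm \<Rightarrow> real) (Inl i)) \<in> R}"
  have oS: "open S" unfolding S_def
    using open_preimage_coordinatewise[OF open_UNIV open_R, of "\<lambda>q i. q (Inl i)"] continuous_on_product_coordinates by auto
  have cmp: "smooth_coord S (\<lambda>q. G (\<lambda>i. q (Inl i)))" if "smooth_coord R G" for G
    by (rule smooth_coord_comp[OF that oS smooth_coord_coord[OF oS]]) (auto simp: S_def)
  have "smooth_coord S (\<lambda>q. B (\<lambda>s. q (Inr s)) (\<lambda>i. q (Inl i)) i)" for i
    unfolding B_def
    by (intro smooth_coord_add smooth_coord_sum smooth_coord_mult oS cmp[OF smooth_bracket[OF F0 F]] cmp[OF smooth_bracket[OF F F]] smooth_coord_coord)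
  then have "smooth_coord S (\<lambda>q. case \<tau> r of None \<Rightarrow> B (\<lambda>s. q (Inr s)) (\<lambda>i. q (Inl i)) i | Some s \<Rightarrow> F s (\<lambda>i. q (Inl i)) i)" for r i
    using cmp[OF F] by (cases "\<tau> r") auto
  from smooth_coordD(2)[OF smooth_coord_det[OF oS this]]
  have "continuous_on S (\<lambda>q. det (M \<tau> (\<lambda>s. q (Inr s)) (\<lambda>i. q (Inl i))))" by (simp add: M_def)
  from continuous_open_preimage[OF this oS, of "- {0}"]
  have "open (S \<inter> (\<lambda>q. det (M \<tau> (\<lambda>s. q (Inr s)) (\<lambda>i. q (Inl i)))) -` (- {0}))" by (simp add: open_Compl)
  moreover have "S \<inter> (\<lambda>q. det (M \<tau> (\<lambda>s. q (Inr s)) (\<lambda>i. q (Inl i)))) -` (- {0}) =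
      {q. (\<lambda>i. q (Inl i)) \<in> R \<and> good (\<lambda>s. q (Inr s)) (\<lambda>i. q (Inl i))}"
    by (auto simp: S_def good_iff_det[OF \<tau>])
  ultimately show ?thesis by simp
qed

lemma good_F_nonzero:
  assumes "good u y" obtains \<kappa> where "F k y \<kappa> \<noteq> 0"
proof (rule ccontr)
  assume "\<not> thesis"
  then have "F k y i = 0" for i using that by blast
  then have "0 * B u y i + (\<Sum>s\<in>UNIV. (if s = k then 1 else 0) * F s y i) = 0" for i
    by (auto intro: sum.neutral)
  from good_independent(2)[OF assms this, of k] show False by simp
qed

end

text \<open>One predicate for everything that the local construction uses, so that data obtained
  from an existence statement can be handed to the locale \<open>local_chart\<close>.
  \<open>\<Lambda>\<close> is the smooth local inverse of \<open>Theta\<close>.\<close>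

definition chart_data where
  "chart_data F0 F R (k :: 'm::finite) (\<kappa> :: 'n::finite) Nh h N \<Lambda> \<longleftrightarrow>
    open Nh \<and> Nh \<subseteq> R \<and> (\<forall>y\<in>Nh. F k y \<kappa> \<noteq> 0) \<and> (\<forall>j. smooth_coord Nh (h j)) \<and>
    (\<forall>j. \<forall>y\<in>Nh. dder (F k y) (h j) y = 0) \<and>
    (\<forall>y\<in>Nh. \<forall>\<xi>. (\<forall>j. dder \<xi> (h j) y = 0) \<longrightarrow> (\<exists>l. \<xi> = (\<lambda>i. l * F k y i))) \<and>
    (\<forall>y\<in>Nh. \<forall>a :: 'm \<Rightarrow> real. (\<forall>\<xi>. (\<Sum>j\<in>UNIV. a j * dder \<xi> (h j) y) = 0) \<longrightarrow> (\<forall>j. a j = 0)) \<and>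
    open N \<and> (\<forall>q\<in>N. (\<lambda>i. q (Inl i)) \<in> Nh \<and> coord_system.good F0 F k (\<lambda>s. q (Inr s)) (\<lambda>i. q (Inl i))) \<and>
    open (coord_system.Theta F0 F k h ` N) \<and>
    (\<forall>b. smooth_coord (coord_system.Theta F0 F k h ` N) (\<lambda>t. \<Lambda> t b)) \<and>
    (\<forall>q\<in>N. \<Lambda> (coord_system.Theta F0 F k h q) = q)"

context coord_system
begin

lemma ex_chart_data:
  assumes y0: "y0 \<in> R" and g: "good u0 y0"
  shows "\<exists>\<kappa> Nh h N \<Lambda>. chart_data F0 F R k \<kappa> Nh h N \<Lambda> \<and> case_sum y0 u0 \<in> N"
proof -
  obtain \<kappa> where \<kappa>: "F k y0 \<kappa> \<noteq> 0" using good_F_nonzero[OF g] .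
  obtain Nh h0 where Nh: "open Nh" "y0 \<in> Nh" "Nh \<subseteq> R" "\<forall>y\<in>Nh. F k y \<kappa> \<noteq> 0" and
    h0: "\<forall>i. smooth_coord Nh (h0 i)" "\<forall>i. \<forall>y\<in>Nh. dder (\<lambda>j. F k y j) (h0 i) y = 0" and
    ni: "\<forall>i j. \<forall>y\<in>Nh. i \<noteq> \<kappa> \<longrightarrow> \<bar>partial i (h0 j) y - (if i = j then 1 else 0)\<bar> \<le> 1 / (2 * real CARD('n))"
    using first_integrals_exist[where v="\<lambda>j y. F k y j" and \<kappa>=\<kappa>, OF F y0 \<kappa>] by (elim exE conjE)
  \<comment> \<open>\<open>\<sigma>\<close> enumerates the coordinates other than
    \<open>\<kappa>\<close>; in these directions the integrals with the same indices have
    derivatives close to those of the coordinates.\<close>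
  have "card (UNIV - {\<kappa>}) = CARD('m)" using card by (simp add: card_Diff_singleton)
  then obtain \<sigma> where \<sigma>: "bij_betw \<sigma> (UNIV :: 'm set) (UNIV - {\<kappa>})"
    using finite_same_card_bij[of "UNIV :: 'm set" "UNIV - {\<kappa>}"] by auto
  have \<sigma>1: "\<sigma> j \<noteq> \<kappa>" for j using \<sigma> by (auto simp: bij_betw_def)
  have \<sigma>2: "\<sigma> i = \<sigma> j \<longleftrightarrow> i = j" for i j using \<sigma> by (auto simp: bij_betw_def inj_eq)
  define h where "h j = h0 (\<sigma> j)" for j
  have h: "smooth_coord Nh (h j)" for j using h0 by (simp add: h_def)
  have hk: "dder (F k y) (h j) y = 0" if "y \<in> Nh" for j y using h0 that by (simp add: h_def)
  have cardle: "real CARD('m) \<le> real CARD('n)" using card by simp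
  have Q: "\<bar>partial (\<sigma> i) (h j) y - (if i = j then 1 else 0)\<bar> \<le> 1 / (2 * real CARD('n))" if "y \<in> Nh" for i j y
    using ni[rule_format, of y "\<sigma> i" "\<sigma> j"] that \<sigma>1 \<sigma>2 by (simp add: h_def)
  have ker: "\<exists>l. \<xi> = (\<lambda>i. l * F k y i)" if y: "y \<in> Nh" and z: "\<And>j. dder \<xi> (h j) y = 0" for y \<xi>
  proof -
    \<comment> \<open>Chosen to remove component \<open>\<kappa>\<close>; what remains lies in the
      directions in which the Jacobian of \<open>h\<close> is near the identity.\<close>
    define l where "l = \<xi> \<kappa> / F k y \<kappa>"
    define \<zeta> where "\<zeta> i = \<xi> i - l * F k y i" for i
    have \<zeta>\<kappa>: "\<zeta> \<kappa> = 0" using Nh(4) y by (simp add: \<zeta>_def l_def)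
    have "\<zeta> (\<sigma> i) = 0" for i
    proof (rule near_identity_injective[where Q="\<lambda>j i. partial (\<sigma> i) (h j) y" and a="\<lambda>i. \<zeta> (\<sigma> i)", OF _ cardle])
      show "\<bar>partial (\<sigma> i) (h j) y - (if j = i then 1 else 0)\<bar> \<le> 1 / (2 * real CARD('n))" for i j
        using Q[OF y, of i j] by (cases "i = j") simp_all
      fix j
      have "dder \<zeta> (h j) y = dder \<xi> (h j) y - l * dder (F k y) (h j) y"
        unfolding dder_finite \<zeta>_def left_diff_distrib sum_subtractf by (simp add: sum_distrib_left mult.assoc)
      then have "0 = (\<Sum>i\<in>UNIV. \<zeta> i * partial i (h j) y)" using z hk[OF y] by (simp add: dder_finite)
      also have "\<dots> = (\<Sum>i\<in>UNIV - {\<kappa>}. \<zeta> i * partial i (h j) y)"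
        by (rule sum.mono_neutral_right) (auto simp: \<zeta>\<kappa>)
      also have "\<dots> = (\<Sum>i\<in>UNIV. \<zeta> (\<sigma> i) * partial (\<sigma> i) (h j) y)"
        by (rule sum.reindex_bij_betw[symmetric, OF \<sigma>])
      finally show "(\<Sum>i\<in>UNIV. partial (\<sigma> i) (h j) y * \<zeta> (\<sigma> i)) = 0" by (simp add: mult.commute)
    qed
    moreover have "i = \<kappa> \<or> i \<in> range \<sigma>" for i using \<sigma> by (auto simp: bij_betw_def)
    ultimately have "\<zeta> i = 0" for i using \<zeta>\<kappa> by (metis imageE)
    then have "\<xi> = (\<lambda>i. l * F k y i)" by (auto simp: \<zeta>_def)
    then show ?thesis by blast
  qed
  have ind: "a j = 0" if y: "y \<in> Nh" and z: "\<forall>\<xi>. (\<Sum>j\<in>UNIV. a j * dder \<xi> (h j) y) = 0" for y a j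
  proof (rule near_identity_injective[where Q="\<lambda>i j. partial (\<sigma> i) (h j) y", OF Q[OF y] cardle])
    fix i
    have "dder (\<lambda>i'. if i' = \<sigma> i then 1 else 0) (h j) y = partial (\<sigma> i) (h j) y" for j
      unfolding dder_finite by (simp add: if_distrib[of "\<lambda>a. a * _"] cong: if_cong)
    then show "(\<Sum>j\<in>UNIV. partial (\<sigma> i) (h j) y * a j) = 0"
      using z[rule_format, of "\<lambda>i'. if i' = \<sigma> i then 1 else 0"] by (simp add: mult.commute)
  qed
  define S where "S = {q :: 'n + 'm \<Rightarrow> real. (\<lambda>i. q (Inl i)) \<in> R \<and> good (\<lambda>s. q (Inr s)) (\<lambda>i. q (Inl i))} \<inter> {q \<in> UNIV. (\<lambda>i. q (Inl i)) \<in> Nh}"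
  have oS: "open S" unfolding S_def
    using open_preimage_coordinatewise[OF open_UNIV Nh(1), of "\<lambda>q i. q (Inl i)"] continuous_on_product_coordinates open_good by auto
  define q0 where "q0 = case_sum y0 u0"
  have q0S: "q0 \<in> S" using Nh(2) y0 g by (simp add: S_def q0_def)
  have cardeq: "CARD('n + 'm) = CARD('m + 'm option)" using card by simp
  have sm: "smooth_coord S (\<lambda>q. Theta h q b)" for b
    by (rule smooth_Theta[OF Nh(1,3) h oS]) (simp add: S_def)
  obtain N \<Lambda> where N: "open N" "q0 \<in> N" "N \<subseteq> S" "open (Theta h ` N)"
    "\<And>b. smooth_coord (Theta h ` N) (\<lambda>t. \<Lambda> t b)" "\<And>q. q \<in> N \<Longrightarrow> \<Lambda> (Theta h q) = q"
  proof (rule smooth_inverse_function[OF cardeq sm q0S])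
    show "a = (\<lambda>_. 0)" if "\<And>b. dder a (\<lambda>q. Theta h q b) q0 = 0" for a
      by (rule Theta_jacobian[OF Nh(1,3) h hk ker _ _ that]) (use q0S in \<open>auto simp: S_def\<close>)
  qed blast
  have "chart_data F0 F R k \<kappa> Nh h N \<Lambda>"
    unfolding chart_data_def using Nh h hk ker ind N by (auto simp: S_def subset_iff)
  with N(2) show ?thesis unfolding q0_def by blast
qed

end

context control_system
begin

section \<open>Cartan derivatives in one chart\<close>

lemma cartan_coord:
  assumes c: "c \<in> A" and W: "open W" "p \<in> W" "W \<subseteq> fst c \<times> UNIV"
  shows "smX c W (\<lambda>p. ext_coords c p a)" "cartan A f0 f (\<lambda>p. ext_coords c p a) p = cvec c p a"
proof -
  have o: "open (ext_coords c ` W)" by (rule open_ext_image[OF c W(1,3)])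
  have eq: "ext_coords c (ei c q) a = q a" if q: "q \<in> ext_coords c ` W" for q
  proof -
    obtain r where r: "r \<in> W" "q = ext_coords c r" using q by blast
    then show ?thesis using ei_ext_coords[OF c, of r] W(3) by auto
  qed
  show sm: "smX c W (\<lambda>p. ext_coords c p a)"
    by (rule smooth_coord_cong[OF smooth_coord_coord[OF o]]) (simp add: eq)
  show "cartan A f0 f (\<lambda>p. ext_coords c p a) p = cvec c p a"
  proof -
    have "dder (cvec c p) (\<lambda>q. ext_coords c (ei c q) a) (ext_coords c p) = dder (cvec c p) (\<lambda>q. q a) (ext_coords c p)"
      by (rule dder_cong[OF o imageI[OF W(2)] eq])
    then show ?thesis unfolding cartan_eq_dder[OF c W sm] by simp
  qed
qed

lemma cvec_ei:
  fixes q :: "'n + nat \<times> 'm \<Rightarrow> real"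
  assumes c: "c \<in> A" and q: "(\<lambda>i. q (Inl i)) \<in> cc c ` fst c"
  shows "cvec c (ei c q) = case_sum (\<lambda>i. vc f0 c (\<lambda>i. q (Inl i)) i + (\<Sum>s\<in>UNIV. q (Inr (0, s)) * vc (f s) c (\<lambda>i. q (Inl i)) i))
    (\<lambda>b. q (Inr (Suc (fst b), snd b)))"
proof -
  have y: "cc c (fst (ei c q)) = (\<lambda>i. q (Inl i))" using q ci_cc[OF c] by (auto simp: ei_def)
  show ?thesis
    unfolding cvec_def y
    by (auto simp: fun_eq_iff ei_def shift_coords_def jet_coords_def vc_def affine_field_def split: sum.split)
qed

text \<open>Makes the iteration in \<open>prolong\<close> possible: in one chart the components of
  the Cartan field are smooth functions of the point.\<close>

lemma smX_cartan:
  assumes c: "c \<in> A" and W: "open W" "W \<subseteq> fst c \<times> UNIV" and F: "smX c W F"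
  shows "smX c W (cartan A f0 f F)"
proof -
  have o: "open (ext_coords c ` W)" by (rule open_ext_image[OF c W])
  have R: "(\<lambda>i. q (Inl i)) \<in> cc c ` fst c" if "q \<in> ext_coords c ` W" for q
    using that unfolding ext_image[OF c W(2)] by simp
  have cmp: "smooth_coord (ext_coords c ` W) (\<lambda>q. G (\<lambda>i. q (Inl i)))" if "smooth_coord (cc c ` fst c) G" for G
    by (rule smooth_coord_comp[OF that o smooth_coord_coord[OF o]]) (use R in blast)
  have v: "smooth_coord (cc c ` fst c) (\<lambda>y. vc f0 c y i)" "smooth_coord (cc c ` fst c) (\<lambda>y. vc (f s) c y i)" for s i
    using smooth_vfield_chart[OF f0 c] smooth_vfield_chart[OF f c] by (simp_all add: smooth_on_chart_def)
  have "smooth_coord (ext_coords c ` W) (\<lambda>q. cvec c (ei c q) a)" for a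
  proof (cases a)
    case (Inl i)
    have "smooth_coord (ext_coords c ` W) (\<lambda>q. vc f0 c (\<lambda>i. q (Inl i)) i + (\<Sum>s\<in>UNIV. q (Inr (0, s)) * vc (f s) c (\<lambda>i. q (Inl i)) i))"
      by (intro smooth_coord_add smooth_coord_sum smooth_coord_mult smooth_coord_coord o cmp v)
    then show ?thesis by (rule smooth_coord_cong) (simp add: cvec_ei[OF c R] Inl)
  next
    case (Inr b)
    show ?thesis by (rule smooth_coord_cong[OF smooth_coord_coord[OF o]]) (simp add: cvec_ei[OF c R] Inr)
  qed
  from smooth_coord_dder[OF F this]
  show ?thesis
  proof (rule smooth_coord_cong)
    fix q assume "q \<in> ext_coords c ` W"
    then obtain r where r: "r \<in> W" "q = ext_coords c r" by blast
    then have "ei c q = r" using ei_ext_coords[OF c, of r] W(2) by auto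
    then show "dder (cvec c (ei c q)) (\<lambda>q. F (ei c q)) q = cartan A f0 f F (ei c q)"
      using cartan_eq_dder[OF c W(1) r(1) W(2) F] r(2) by simp
  qed
qed

lemma ext_coords_ei: "c \<in> A \<Longrightarrow> (\<lambda>i. q (Inl i)) \<in> cc c ` fst c \<Longrightarrow> ext_coords c (ei c q) = q"
  for q :: "'n + nat \<times> 'm \<Rightarrow> real"
proof -
  assume c: "c \<in> A" and q: "(\<lambda>i. q (Inl i)) \<in> cc c ` fst c"
  then have "ei c q \<in> fst c \<times> UNIV" using ci_cc[OF c] by (auto simp: ei_def)
  with q have "q \<in> ext_coords c ` (fst c \<times> UNIV)" unfolding ext_image[OF c order_refl] by blast
  then obtain r where "r \<in> fst c \<times> UNIV" "q = ext_coords c r" by blast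
  then show "ext_coords c (ei c q) = q" using ei_ext_coords[OF c, of r] by simp
qed

end

text \<open>\<open>u0k\<close> is a reference value for the control u_k. The inverse
  \<open>\<Lambda>\<close> expects the value of u_k as an input, while \<open>h\<close> and its
  first derivative do not determine it; filling the slot with \<open>u0k\<close> allows
  \<open>\<Lambda>\<close> to be applied, and the true u_k is restored afterwards.\<close>

locale local_chart = control_system A f0 f
  for A :: "('x::{t2_space,second_countable_topology}, 'n::finite) chart set"
    and f0 :: "('x, 'n) vfield" and f :: "'m::finite \<Rightarrow> ('x, 'n) vfield" +
  fixes c :: "('x, 'n) chart" and k :: 'm and \<kappa> :: 'n and Nh :: "('n \<Rightarrow> real) set" and h :: "'m \<Rightarrow> ('n \<Rightarrow> real) \<Rightarrow> real"
    and N :: "('n + 'm \<Rightarrow> real) set" and \<Lambda> :: "('m + 'm option \<Rightarrow> real) \<Rightarrow> 'n + 'm \<Rightarrow> real" and u0k :: real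
  assumes c: "c \<in> A" and card: "CARD('n) = Suc CARD('m)"
    and data: "chart_data (vc f0 c) (\<lambda>s. vc (f s) c) (cc c ` fst c) k \<kappa> Nh h N \<Lambda>"
begin

abbreviation "F0 \<equiv> vc f0 c"
abbreviation "F \<equiv> \<lambda>s. vc (f s) c"
abbreviation "R \<equiv> cc c ` fst c"

sublocale C: coord_system F0 F R k
  using smooth_vfield_chart[OF f0 c] smooth_vfield_chart[OF f c] card
  by unfold_locales (simp_all add: smooth_on_chart_def)

abbreviation "\<Theta> \<equiv> C.Theta h"

lemma Nh: "open Nh" "Nh \<subseteq> R" "\<And>y. y \<in> Nh \<Longrightarrow> F k y \<kappa> \<noteq> 0"
  and h: "\<And>j. smooth_coord Nh (h j)" and hk: "\<And>j y. y \<in> Nh \<Longrightarrow> dder (F k y) (h j) y = 0"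
  and ker: "\<And>y \<xi>. y \<in> Nh \<Longrightarrow> (\<And>j. dder \<xi> (h j) y = 0) \<Longrightarrow> \<exists>l. \<xi> = (\<lambda>i. l * F k y i)"
  and ind: "\<And>y a j. y \<in> Nh \<Longrightarrow> (\<And>\<xi>. (\<Sum>j\<in>UNIV. a j * dder \<xi> (h j) y) = 0) \<Longrightarrow> a j = 0"
  and N: "open N" "\<And>q. q \<in> N \<Longrightarrow> (\<lambda>i. q (Inl i)) \<in> Nh" "\<And>q. q \<in> N \<Longrightarrow> C.good (\<lambda>s. q (Inr s)) (\<lambda>i. q (Inl i))"
  and \<Theta>: "open (\<Theta> ` N)" "\<And>b. smooth_coord (\<Theta> ` N) (\<lambda>t. \<Lambda> t b)" "\<And>q. q \<in> N \<Longrightarrow> \<Lambda> (\<Theta> q) = q"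
  using data unfolding chart_data_def by blast+

text \<open>With \<open>u0k\<close> in place of u_k the set \<open>U\<close> imposes no condition on
  u_k, nor on the derivatives of the control.\<close>

definition red :: "('n + nat \<times> 'm \<Rightarrow> real) \<Rightarrow> 'n + 'm \<Rightarrow> real" where
  "red q = case_sum (\<lambda>i. q (Inl i)) (\<lambda>s. if s = k then u0k else q (Inr (0, s)))"

definition U :: "('x \<times> 'm jet) set" where
  "U = {p. fst p \<in> fst c \<and> red (ext_coords c p) \<in> N}"

definition hX :: "'m \<Rightarrow> 'x \<Rightarrow> real" where "hX j x = h j (cc c x)"

definition z :: "'x \<times> 'm jet \<Rightarrow> real^'m" where "z p = (\<chi> j. hX j (fst p))"

abbreviation "\<psi> \<equiv> prolong A f0 f z"

lemma ext_Inl: "(\<lambda>i. ext_coords c p (Inl i)) = cc c (fst p)"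
  by (simp add: ext_coords_def cc_def)

lemma UD: "p \<in> U \<Longrightarrow> cc c (fst p) \<in> Nh" "p \<in> U \<Longrightarrow> fst p \<in> fst c" "U \<subseteq> fst c \<times> UNIV"
  using N(2) unfolding U_def by (fastforce simp: red_def ext_coords_def cc_def)+

lemma open_U: "open U"
proof -
  have "continuous_on (fst c \<times> UNIV) (\<lambda>p :: 'x \<times> 'm jet. red (ext_coords c p) b)" for b
  proof (cases b)
    case (Inl i)
    have "continuous_on (fst c \<times> UNIV) (\<lambda>p :: 'x \<times> 'm jet. snd c (fst p) $ i)"
      by (intro continuous_on_component continuous_on_compose2[OF homeomorphism_cont1[OF chart(3)[OF c]]] continuous_on_fst continuous_on_id) auto
    then show ?thesis by (simp add: red_def Inl ext_coords_def)
  next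
    case (Inr s)
    have "continuous_on (fst c \<times> UNIV) (\<lambda>p :: 'x \<times> 'm jet. snd p 0 $ s)"
      by (rule continuous_on_component, rule continuous_on_compose2[OF continuous_on_product_coordinates[of 0] continuous_on_snd[OF continuous_on_id]]) simp
    then show ?thesis by (cases "s = k") (simp_all add: red_def Inr ext_coords_def jet_coords_def)
  qed
  from open_preimage_coordinatewise[OF open_Times[OF chart(1)[OF c] open_UNIV] N(1) this]
  show ?thesis by (simp add: U_def mem_Times_iff)
qed

lemma smX_h: "smX c U (\<lambda>p. z p $ j)"
proof -
  have o: "open (ext_coords c ` U)" by (rule open_ext_image[OF c open_U UD(3)])
  have im: "(\<lambda>i. q (Inl i)) \<in> Nh \<and> cc c (fst (ei c q)) = (\<lambda>i. q (Inl i))" if q: "q \<in> ext_coords c ` U" for q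
  proof -
    obtain p where p: "p \<in> U" "q = ext_coords c p" using q by blast
    then have "ei c q = p" using ei_ext_coords[OF c, of p] UD(3) by auto
    with p UD(1) show ?thesis by (simp add: ext_Inl)
  qed
  have "smooth_coord (ext_coords c ` U) (\<lambda>q. h j (\<lambda>i. q (Inl i)))"
    by (rule smooth_coord_comp[OF h o smooth_coord_coord[OF o]]) (use im in blast)
  then show ?thesis by (rule smooth_coord_cong) (simp add: z_def hX_def im)
qed

lemma smX_\<psi>: "smX c U (\<lambda>p. \<psi> p j $ i)"
proof (induction j)
  case 0
  show ?case using smX_h[of i] by (simp add: prolong_def)
next
  case (Suc j)
  have "(\<lambda>q. \<psi> (ei c q) (Suc j) $ i) = (\<lambda>q. cartan A f0 f (\<lambda>p. \<psi> p j $ i) (ei c q))" by (simp add: prolong_Suc)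
  then show ?case using smX_cartan[OF c open_U UD(3) Suc] by simp
qed

lemma \<psi>_0: "\<psi> p 0 $ j = h j (cc c (fst p))"
  by (simp add: prolong_def z_def hX_def)

text \<open>u_k may be replaced by \<open>u0k\<close> because \<open>h j\<close> is a first integral
  of \<open>F k\<close>.\<close>

lemma \<psi>_1:
  assumes p: "p \<in> U" shows "\<psi> p (Suc 0) $ j = C.H1 h j (red (ext_coords c p))"
proof -
  define y where "y = cc c (fst p)"
  have yN: "y \<in> Nh" using UD(1)[OF p] by (simp add: y_def)
  have o: "open (ext_coords c ` U)" and pU: "ext_coords c p \<in> ext_coords c ` U"
    using open_ext_image[OF c open_U UD(3)] p by auto
  have "\<psi> p (Suc 0) $ j = cartan A f0 f (\<lambda>p. z p $ j) p" by (simp add: prolong_def)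
  also have "\<dots> = dder (cvec c p) (\<lambda>q. z (ei c q) $ j) (ext_coords c p)"
    by (rule cartan_eq_dder[OF c open_U p UD(3) smX_h])
  also have "\<dots> = dder (cvec c p) (\<lambda>q. h j (\<lambda>i. q (Inl i))) (ext_coords c p)"
  proof (rule dder_cong[OF o pU])
    fix q assume "q \<in> ext_coords c ` U"
    then obtain r where r: "r \<in> U" "q = ext_coords c r" by blast
    then have "ei c q = r" using ei_ext_coords[OF c, of r] UD(3) by auto
    then show "z (ei c q) $ j = h j (\<lambda>i. q (Inl i))" by (simp add: z_def hX_def r(2) ext_Inl)
  qed
  also have "\<dots> = dder (\<lambda>i. dder (cvec c p) (\<lambda>q. q (Inl i)) (ext_coords c p)) (h j) (\<lambda>i. ext_coords c p (Inl i))"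
    by (rule chain_dder[OF h _ smooth_coord_coord[OF o] pU]) (simp add: ext_Inl yN[unfolded y_def])
  also have "\<dots> = dder (\<lambda>i. F0 y i + (\<Sum>s\<in>UNIV. snd p 0 $ s * F s y i)) (h j) y"
    by (simp add: cvec_def ext_Inl y_def vc_def affine_field_def)
  also have "\<dots> = dder (F0 y) (h j) y + (\<Sum>s\<in>UNIV. snd p 0 $ s * dder (F s y) (h j) y)"
  proof -
    have "(\<Sum>i\<in>UNIV. (\<Sum>s\<in>UNIV. snd p 0 $ s * F s y i) * partial i (h j) y) = (\<Sum>s\<in>UNIV. snd p 0 $ s * (\<Sum>i\<in>UNIV. F s y i * partial i (h j) y))"
      unfolding sum_distrib_left sum_distrib_right by (subst sum.swap) (simp add: mult_ac)
    then show ?thesis unfolding dder_finite distrib_right sum.distrib by simp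
  qed
  also have "(\<Sum>s\<in>UNIV. snd p 0 $ s * dder (F s y) (h j) y) =
      (\<Sum>s\<in>UNIV. red (ext_coords c p) (Inr s) * dder (F s y) (h j) y)"
    by (rule sum.cong) (auto simp: red_def ext_coords_def jet_coords_def hk[OF yN])
  finally show ?thesis by (simp add: C.H1_def red_def ext_Inl[symmetric] y_def)
qed

section \<open>The inverse of the prolongation\<close>

definition comp :: "(nat \<times> 'm \<Rightarrow> real) \<Rightarrow> 'm + 'm option \<Rightarrow> real" where
  "comp r = case_sum (\<lambda>j. r (0, j)) (\<lambda>b. case b of None \<Rightarrow> u0k | Some j \<Rightarrow> r (1, j))"

lemma comp_\<psi>: "p \<in> U \<Longrightarrow> comp (jet_coords (\<psi> p)) = \<Theta> (red (ext_coords c p))"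
  using \<psi>_1[of p] by (auto simp: comp_def C.Theta_def jet_coords_def \<psi>_0 red_def ext_Inl fun_eq_iff split: sum.split option.split)

definition Vc :: "(nat \<times> 'm \<Rightarrow> real) set" where "Vc = {r. comp r \<in> \<Theta> ` N}"

definition L :: "(nat \<times> 'm \<Rightarrow> real) \<Rightarrow> 'n + 'm \<Rightarrow> real" where "L r = \<Lambda> (comp r)"

lemma smooth_comp_UNIV: "smooth_coord UNIV (\<lambda>r. comp r b)"
proof (cases b)
  case (Inr b')
  then show ?thesis using smooth_coord_coord[OF open_UNIV] smooth_coord_const[OF open_UNIV] by (cases b') (simp_all add: comp_def)
qed (simp add: comp_def smooth_coord_coord)

lemma open_Vc: "open Vc"
  using open_preimage_coordinatewise[OF open_UNIV \<Theta>(1) smooth_coordD(2)[OF smooth_comp_UNIV]] by (simp add: Vc_def)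

lemma L: "r \<in> Vc \<Longrightarrow> L r \<in> N" "r \<in> Vc \<Longrightarrow> \<Theta> (L r) = comp r"
  using \<Theta>(3) by (auto simp: Vc_def L_def)

lemma smooth_L: "smooth_coord Vc (\<lambda>r. L r b)"
  unfolding L_def
  by (rule smooth_coord_comp[OF \<Theta>(2) open_Vc smooth_coord_subset[OF smooth_comp_UNIV open_Vc]]) (auto simp: Vc_def)

lemma L_k: "r \<in> Vc \<Longrightarrow> L r (Inr k) = u0k"
  using fun_cong[OF L(2), of r "Inr None"] by (simp add: C.Theta_def comp_def)

abbreviation "X r \<equiv> \<lambda>i. L r (Inl i)"

abbreviation "\<tau> G \<equiv> \<lambda>r. dder (shift_coords r) G r"

definition aff :: "('m \<Rightarrow> real) \<Rightarrow> ('n \<Rightarrow> real) \<Rightarrow> 'n \<Rightarrow> real" where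
  "aff u y i = F0 y i + (\<Sum>s\<in>UNIV. u s * F s y i)"

text \<open>The correction that turns \<open>u0k\<close> into u_k. The velocity of the reconstructed
  state differs from the right hand side with control \<open>u0k\<close> by a multiple of
  \<open>F k\<close>; the factor is read off in component \<open>\<kappa>\<close>, where
  \<open>F k\<close> does not vanish. As \<open>X\<close> uses first derivatives of
  \<open>z\<close>, this uses second ones.\<close>

definition lam :: "(nat \<times> 'm \<Rightarrow> real) \<Rightarrow> real" where
  "lam r = (\<tau> (\<lambda>r. X r \<kappa>) r - aff (\<lambda>s. L r (Inr s)) (X r) \<kappa>) * inverse (F k (X r) \<kappa>)"

definition Uc :: "'m \<Rightarrow> (nat \<times> 'm \<Rightarrow> real) \<Rightarrow> real" where
  "Uc s r = L r (Inr s) + (if s = k then lam r else 0)"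

lemma X_Nh: "r \<in> Vc \<Longrightarrow> X r \<in> Nh" by (rule N(2)[OF L(1)])

lemma smooth_shift: "open S \<Longrightarrow> smooth_coord S (\<lambda>q. shift_coords q a)"
  unfolding shift_coords_def split_beta by (rule smooth_coord_coord)

lemma aff_add: "aff (\<lambda>s. u s + (if s = k then l else 0)) y i = aff u y i + l * F k y i"
proof -
  have "(\<Sum>s\<in>UNIV. (if s = k then l else 0) * F s y i) = (\<Sum>s\<in>UNIV. if s = k then l * F s y i else 0)"
    by (rule sum.cong) auto
  also have "\<dots> = l * F k y i" by simp
  finally show ?thesis by (simp add: aff_def distrib_right sum.distrib)
qed

text \<open>The velocity of \<open>X\<close> and the right hand side with the reference control give
  the same derivative of every \<open>h j\<close>: along \<open>X\<close> the function
  \<open>h j\<close> is the coordinate \<open>(0, j)\<close>, whose derivative \<open>(1, j)\<close>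
  is the \<open>H1\<close> component of \<open>Theta\<close> at \<open>L r\<close>. The difference
  lies in the kernel of all differentials of \<open>h\<close>, so it is a multiple of
  \<open>F k\<close>, and \<open>lam\<close> is the factor.\<close>

lemma tau_X:
  assumes r: "r \<in> Vc" shows "\<tau> (\<lambda>r. X r i) r = aff (\<lambda>s. Uc s r) (X r) i"
proof -
  define \<xi> where "\<xi> = (\<lambda>i. \<tau> (\<lambda>r. X r i) r)"
  define \<zeta> where "\<zeta> i = \<xi> i - aff (\<lambda>s. L r (Inr s)) (X r) i" for i
  have "dder \<zeta> (h j) (X r) = 0" for j
  proof -
    have "\<tau> (\<lambda>r. h j (X r)) r = \<tau> (\<lambda>r. r (0, j)) r"
    proof (rule dder_cong[OF open_Vc r])
      show "h j (X q) = q (0, j)" if "q \<in> Vc" for q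
        using fun_cong[OF L(2)[OF that], of "Inl j"] by (simp add: C.Theta_def comp_def)
    qed
    also have "\<dots> = r (1, j)" by (simp add: shift_coords_def)
    also have "\<dots> = C.H1 h j (L r)"
      using fun_cong[OF L(2)[OF r], of "Inr (Some j)"] by (simp add: C.Theta_def comp_def)
    also have "\<dots> = dder (aff (\<lambda>s. L r (Inr s)) (X r)) (h j) (X r)"
    proof -
      have "(\<Sum>i\<in>UNIV. (\<Sum>s\<in>UNIV. L r (Inr s) * F s (X r) i) * partial i (h j) (X r)) = (\<Sum>s\<in>UNIV. L r (Inr s) * (\<Sum>i\<in>UNIV. F s (X r) i * partial i (h j) (X r)))"
        unfolding sum_distrib_left sum_distrib_right by (subst sum.swap) (simp add: mult_ac)
      then show ?thesis unfolding C.H1_def dder_finite aff_def distrib_right sum.distrib by simp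
    qed
    finally have "dder \<xi> (h j) (X r) = dder (aff (\<lambda>s. L r (Inr s)) (X r)) (h j) (X r)"
      using chain_dder[OF h[of j] X_Nh[OF r] smooth_L r, of "shift_coords r"] by (simp add: \<xi>_def)
    then show ?thesis unfolding dder_finite \<zeta>_def left_diff_distrib sum_subtractf by simp
  qed
  from ker[OF X_Nh[OF r] this] obtain l where l: "\<zeta> = (\<lambda>i. l * F k (X r) i)" by blast
  have "lam r = \<zeta> \<kappa> * inverse (F k (X r) \<kappa>)" by (simp add: lam_def \<zeta>_def \<xi>_def)
  then have "lam r = l" using Nh(3)[OF X_Nh[OF r]] l by simp
  then show ?thesis
    unfolding Uc_def aff_add using fun_cong[OF l, of i] by (simp add: \<zeta>_def \<xi>_def)
qed

lemma smooth_X_comp: "smooth_coord Nh G \<Longrightarrow> smooth_coord Vc (\<lambda>r. G (X r))"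
  by (rule smooth_coord_comp[OF _ open_Vc smooth_L]) (use X_Nh in auto)

lemma smooth_Uc: "smooth_coord Vc (Uc s)"
proof -
  have v: "smooth_coord Nh (\<lambda>y. F0 y i)" "smooth_coord Nh (\<lambda>y. F s y i)" for s i
    using smooth_coord_subset[OF C.F0 Nh(1,2)] smooth_coord_subset[OF C.F Nh(1,2)] by auto
  have "smooth_coord Vc (\<lambda>r. aff (\<lambda>s. L r (Inr s)) (X r) \<kappa>)"
    unfolding aff_def by (intro smooth_coord_add smooth_coord_sum smooth_coord_mult smooth_L open_Vc smooth_X_comp v)
  moreover have "smooth_coord Vc (\<lambda>r. inverse (F k (X r) \<kappa>))"
    by (intro smooth_coord_inverse smooth_X_comp v) (use Nh(3) X_Nh in blast)
  ultimately have "smooth_coord Vc lam"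
    unfolding lam_def[abs_def] by (intro smooth_coord_mult smooth_coord_diff smooth_coord_dder smooth_L smooth_shift open_Vc)
  then show ?thesis using smooth_coord_add[OF smooth_L] smooth_L by (cases "s = k") (simp_all add: Uc_def[abs_def])
qed

text \<open>Taking iterated derivatives of \<open>Uc\<close> for the higher controls is forced if
  the trivial Cartan field is to be carried to that of the system.\<close>

definition \<Phi> :: "(nat \<times> 'm \<Rightarrow> real) \<Rightarrow> 'n + nat \<times> 'm \<Rightarrow> real" where
  "\<Phi> r = case_sum (X r) (\<lambda>(j, s). ((\<lambda>G. \<tau> G) ^^ j) (Uc s) r)"

lemma \<Phi>_Suc: "\<Phi> r (Inr (Suc j, s)) = \<tau> (\<lambda>r. \<Phi> r (Inr (j, s))) r"
  by (simp add: \<Phi>_def)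

lemma smooth_\<Phi>: "smooth_coord Vc (\<lambda>r. \<Phi> r a)"
proof (cases a)
  case (Inl i)
  then show ?thesis using smooth_L by (simp add: \<Phi>_def)
next
  case (Inr b)
  have "smooth_coord Vc (\<lambda>r. \<Phi> r (Inr (j, s)))" for j s
  proof (induction j)
    case 0
    show ?case using smooth_Uc by (simp add: \<Phi>_def)
  next
    case (Suc j)
    show ?case unfolding \<Phi>_Suc by (rule smooth_coord_dder[OF Suc smooth_shift[OF open_Vc]])
  qed
  then show ?thesis by (cases b) (simp add: Inr)
qed

lemma \<Phi>_R: "r \<in> Vc \<Longrightarrow> (\<lambda>i. \<Phi> r (Inl i)) \<in> R"
  using X_Nh Nh(2) by (auto simp: \<Phi>_def)

lemma tau_\<Phi>: "r \<in> Vc \<Longrightarrow> \<tau> (\<lambda>r. \<Phi> r a) r = cvec c (ei c (\<Phi> r)) a"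
proof (cases a)
  case (Inl i)
  assume r: "r \<in> Vc"
  show ?thesis unfolding cvec_ei[OF c \<Phi>_R[OF r]] Inl
    using tau_X[OF r, of i] by (simp add: \<Phi>_def aff_def)
next
  case (Inr b)
  assume r: "r \<in> Vc"
  show ?thesis unfolding cvec_ei[OF c \<Phi>_R[OF r]] Inr by (cases b) (simp add: \<Phi>_Suc)
qed

definition \<phi> :: "'m jet \<Rightarrow> 'x \<times> 'm jet" where "\<phi> w = ei c (\<Phi> (jet_coords w))"

definition V :: "'m jet set" where "V = {w. jet_coords w \<in> Vc}"

lemma open_V: "open V"
  using open_preimage_coordinatewise[OF open_UNIV open_Vc continuous_jet_coords] by (simp add: V_def)

lemma ext_\<phi>: "w \<in> V \<Longrightarrow> ext_coords c (\<phi> w) = \<Phi> (jet_coords w)"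
  unfolding \<phi>_def by (rule ext_coords_ei[OF c \<Phi>_R]) (simp add: V_def)

lemma \<phi>_U: "w \<in> V \<Longrightarrow> \<phi> w \<in> U"
proof -
  assume w: "w \<in> V"
  then have r: "jet_coords w \<in> Vc" by (simp add: V_def)
  have "red (\<Phi> (jet_coords w)) = L (jet_coords w)"
    using L_k[OF r] by (auto simp: red_def \<Phi>_def Uc_def fun_eq_iff split: sum.split)
  moreover have "fst (\<phi> w) \<in> fst c"
    using \<Phi>_R[OF r] ci_cc[OF c] by (auto simp: \<phi>_def ei_def)
  ultimately show ?thesis using L(1)[OF r] ext_\<phi>[OF w] by (simp add: U_def)
qed

text \<open>By \<open>tau_\<Phi>\<close> the map \<open>\<Phi>\<close> carries the trivial Cartan
  field to that of the system. So order \<open>Suc j\<close> of \<open>\<psi> (\<phi> w)\<close> is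
  the trivial derivative of order \<open>j\<close>, which by induction is a coordinate. The
  hypothesis is differentiated, hence it must hold for all \<open>r\<close> in
  \<open>Vc\<close>.\<close>

lemma \<psi>_\<phi>: "w \<in> V \<Longrightarrow> \<psi> (\<phi> w) = w"
proof -
  have "\<psi> (\<phi> (ji r)) j $ i = r (j, i)" if "r \<in> Vc" for r j i
    using that
  proof (induction j arbitrary: r)
    case 0
    have "ji r \<in> V" using 0 by (simp add: V_def)
    then have "cc c (fst (\<phi> (ji r))) = X r" unfolding ext_Inl[symmetric] ext_\<phi>[OF \<open>ji r \<in> V\<close>] by (simp add: \<Phi>_def)
    then show ?case
      using fun_cong[OF L(2)[OF 0], of "Inl i"] by (simp add: \<psi>_0 C.Theta_def comp_def)
  next
    case (Suc j)
    have w: "ji r \<in> V" using Suc.prems by (simp add: V_def)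
    have eU: "\<Phi> r \<in> ext_coords c ` U"
      using ext_\<phi>[OF w] \<phi>_U[OF w] by (metis imageI jet_coords_ji)
    have \<phi>r: "\<phi> (ji r) = ei c (\<Phi> r)" by (simp add: \<phi>_def)
    have "\<psi> (\<phi> (ji r)) (Suc j) $ i = cartan A f0 f (\<lambda>p. \<psi> p j $ i) (\<phi> (ji r))" by (simp add: prolong_Suc)
    also have "\<dots> = dder (cvec c (\<phi> (ji r))) (\<lambda>q. \<psi> (ei c q) j $ i) (ext_coords c (\<phi> (ji r)))"
      by (rule cartan_eq_dder[OF c open_U \<phi>_U[OF w] UD(3) smX_\<psi>])
    also have "\<dots> = dder (\<lambda>a. \<tau> (\<lambda>r. \<Phi> r a) r) (\<lambda>q. \<psi> (ei c q) j $ i) (\<Phi> r)"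
      by (simp only: ext_\<phi>[OF w] jet_coords_ji tau_\<Phi>[OF Suc.prems]) (simp only: \<phi>r)
    also have "\<dots> = \<tau> (\<lambda>r. \<psi> (ei c (\<Phi> r)) j $ i) r"
      by (rule chain_dder[symmetric, OF smX_\<psi> eU smooth_\<Phi> Suc.prems])
    also have "\<dots> = \<tau> (\<lambda>r. r (j, i)) r"
      by (rule dder_cong[OF open_Vc Suc.prems]) (use Suc.IH in \<open>simp add: \<phi>_def\<close>)
    also have "\<dots> = r (Suc j, i)" by (simp add: shift_coords_def)
    finally show ?case .
  qed
  note * = this
  assume "w \<in> V"
  then have "\<psi> (\<phi> w) j $ i = jet_coords w (j, i)" for j i using *[of "jet_coords w" j i] by (simp add: V_def)
  then show "\<psi> (\<phi> w) = w" by (simp add: vec_eq_iff fun_eq_iff jet_coords_def)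
qed

lemma \<psi>_V: "p \<in> U \<Longrightarrow> \<psi> p \<in> V"
  using comp_\<psi>[of p] by (simp add: V_def Vc_def U_def)

text \<open>\<open>it\<close> passes from one order to the next: if a function \<open>G\<close> of
  the jet of \<open>z\<close> reproduces coordinate \<open>a\<close> on \<open>U\<close>, its
  trivial Cartan derivative reproduces the Cartan derivative of that coordinate. Applied to the
  state component \<open>\<kappa>\<close> this recovers u_k, applied to the controls their next
  derivatives.\<close>

lemma \<phi>_\<psi>:
  assumes p: "p \<in> U" shows "\<phi> (\<psi> p) = p"
proof -
  have r: "jet_coords (\<psi> p) \<in> Vc" if "p \<in> U" for p using \<psi>_V[OF that] by (simp add: V_def)
  have Lr: "L (jet_coords (\<psi> p)) = red (ext_coords c p)" if "p \<in> U" for p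
    using comp_\<psi>[OF that] \<Theta>(3) that by (simp add: L_def U_def)
  have Xr: "X (jet_coords (\<psi> p)) = cc c (fst p)" if "p \<in> U" for p
    unfolding Lr[OF that] by (simp add: red_def ext_Inl)
  have it: "\<tau> G (jet_coords (\<psi> p)) = cvec c p a"
    if p: "p \<in> U" and G: "smooth_coord Vc G" and eq: "\<And>p. p \<in> U \<Longrightarrow> G (jet_coords (\<psi> p)) = ext_coords c p a" for G a p
  proof -
    have G': "smooth_coord Vc (\<lambda>q. (\<lambda>w. G (jet_coords w)) (ji q))" using G by simp
    have "\<tau> G (jet_coords (\<psi> p)) = trivial_cartan (\<lambda>w. G (jet_coords w)) (\<psi> p)"
      using trivial_cartan_eq_dder[OF G' r[OF p]] by simp
    also have "\<dots> = cartan A f0 f (\<lambda>p. G (jet_coords (\<psi> p))) p"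
      by (rule cartan_comp(2)[where \<psi>=\<psi> and G="\<lambda>w. G (jet_coords w)", symmetric, OF c open_U p UD(3) smX_\<psi> G' r prolong_Suc])
    also have "\<dots> = cartan A f0 f (\<lambda>p. ext_coords c p a) p"
      by (rule cartan_cong[symmetric, OF c open_U p UD(3) cartan_coord(1)[OF c open_U p UD(3)]]) (simp add: eq)
    also have "\<dots> = cvec c p a" by (rule cartan_coord(2)[OF c open_U p UD(3)])
    finally show ?thesis .
  qed
  have "\<Phi> (jet_coords (\<psi> p)) (Inr (j, s)) = ext_coords c p (Inr (j, s))" if "p \<in> U" for p j s
    using that
  proof (induction j arbitrary: p)
    case 0
    let ?r = "jet_coords (\<psi> p)"
    let ?y = "cc c (fst p)"
    have y: "F k ?y \<kappa> \<noteq> 0" by (rule Nh(3)[OF UD(1)[OF 0]])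
    have "\<tau> (\<lambda>r. X r \<kappa>) ?r = cvec c p (Inl \<kappa>)"
      by (rule it[OF 0 smooth_L]) (use Xr in \<open>simp add: ext_Inl[symmetric, THEN fun_cong] fun_eq_iff\<close>)
    also have "\<dots> = aff (\<lambda>s. snd p 0 $ s) ?y \<kappa>" by (simp add: cvec_def aff_def vc_def affine_field_def)
    \<comment> \<open>The actual control is the reference one plus a correction in slot
      \<open>k\<close>, the form in which \<open>aff_add\<close> isolates the factor of
      \<open>F k\<close>.\<close>
    also have "(\<lambda>s. snd p 0 $ s) = (\<lambda>s. L ?r (Inr s) + (if s = k then snd p 0 $ k - u0k else 0))"
      unfolding Lr[OF 0] by (auto simp: red_def ext_coords_def jet_coords_def)
    finally have "\<tau> (\<lambda>r. X r \<kappa>) ?r = aff (\<lambda>s. L ?r (Inr s)) ?y \<kappa> + (snd p 0 $ k - u0k) * F k ?y \<kappa>"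
      unfolding aff_add .
    then have l: "lam ?r = snd p 0 $ k - u0k" using y unfolding lam_def Xr[OF 0] by simp
    have "\<Phi> ?r (Inr (0, s)) = red (ext_coords c p) (Inr s) + (if s = k then snd p 0 $ k - u0k else 0)"
      unfolding \<Phi>_def Lr[OF 0, symmetric] l[symmetric] by (simp add: Uc_def)
    then show ?case by (simp add: red_def ext_coords_def jet_coords_def[of "snd p"])
  next
    case (Suc j)
    have "\<tau> (\<lambda>r. \<Phi> r (Inr (j, s))) (jet_coords (\<psi> p)) = cvec c p (Inr (j, s))"
      by (rule it[OF Suc.prems smooth_\<Phi> Suc.IH])
    then show ?case unfolding \<Phi>_Suc
      by (simp add: cvec_def ext_coords_def shift_coords_def jet_coords_def[of "snd p"])
  qed
  moreover have "\<Phi> (jet_coords (\<psi> p)) (Inl i) = ext_coords c p (Inl i)" for i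
    using fun_cong[OF Xr[OF p], of i] by (simp add: \<Phi>_def ext_coords_def cc_def)
  ultimately have "\<Phi> (jet_coords (\<psi> p)) a = ext_coords c p a" for a
    using p by (metis sum.exhaust surj_pair)
  then have "\<Phi> (jet_coords (\<psi> p)) = ext_coords c p" by auto
  then show ?thesis using ei_ext_coords[OF c, of p] UD(3) p by (auto simp: \<phi>_def)
qed

lemma image_\<psi>: "\<psi> ` U = V"
  using \<psi>_V \<psi>_\<phi> \<phi>_U by (auto simp: image_iff) metis

lemma continuous_\<phi>: "continuous_on V \<phi>"
proof -
  have "continuous_on V (\<lambda>w. \<Phi> (jet_coords w))"
  proof (rule continuous_on_coordinatewise_then_product)
    fix a
    have "continuous_on V jet_coords" by (rule continuous_on_coordinatewise_then_product[OF continuous_jet_coords])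
    then show "continuous_on V (\<lambda>w. \<Phi> (jet_coords w) a)"
      by (rule continuous_on_compose2[OF smooth_coordD(2)[OF smooth_\<Phi>]]) (auto simp: V_def)
  qed
  then show ?thesis unfolding \<phi>_def
    by (rule continuous_on_compose2[OF continuous_ei[OF c]]) (use \<Phi>_R in \<open>auto simp: V_def\<close>)
qed

text \<open>Smoothness into the jet space is asked for in every chart \<open>d\<close>, while
  \<open>\<Phi>\<close> is written in the chart \<open>c\<close>; it is therefore followed by
  \<open>etr c d\<close>.\<close>

lemma smooth_into_\<phi>: "smooth_into_ext A V \<phi>"
  unfolding smooth_into_ext_def
proof (intro conjI ballI allI continuous_\<phi>)
  fix d a assume d: "d \<in> A"
  define T where "T = V \<inter> \<phi> -` (fst d \<times> UNIV)"
  have oT: "open T" unfolding T_def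
    by (rule continuous_open_preimage[OF continuous_\<phi> open_V open_Times[OF chart(1)[OF d] open_UNIV]])
  have oJ: "open (jet_coords ` T)" by (rule open_jet_image[OF oT])
  define W where "W = U \<inter> fst d \<times> UNIV"
  have W: "open W" "W \<subseteq> (fst c \<inter> fst d) \<times> UNIV"
    using open_chart_part[OF d open_U] UD(3) by (auto simp: W_def)
  have sub: "jet_coords ` T \<subseteq> Vc" by (auto simp: T_def V_def)
  have im: "\<Phi> q = ext_coords c (\<phi> (ji q)) \<and> \<phi> (ji q) \<in> W" if q: "q \<in> jet_coords ` T" for q
  proof -
    have "ji q \<in> V" "\<phi> (ji q) \<in> fst d \<times> UNIV" using q by (auto simp: T_def)
    then show ?thesis using ext_\<phi>[of "ji q"] \<phi>_U[of "ji q"] by (simp add: W_def)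
  qed
  have "smooth_coord (jet_coords ` T) (\<lambda>q. etr c d (\<Phi> q) a)"
    by (rule smooth_coord_comp[OF smooth_etr[OF c d W] oJ smooth_coord_subset[OF smooth_\<Phi> oJ sub]]) (use im in blast)
  then have "smooth_coord (jet_coords ` T) (\<lambda>q. ext_coords d (\<phi> (ji q)) a)"
  proof (rule smooth_coord_cong)
    fix q assume "q \<in> jet_coords ` T"
    from im[OF this] have "\<Phi> q = ext_coords c (\<phi> (ji q))" "\<phi> (ji q) \<in> fst c \<times> UNIV" using W(2) by auto
    then show "etr c d (\<Phi> q) a = ext_coords d (\<phi> (ji q)) a" by (simp only: etr_ext_coords[OF c])
  qed
  then show "smooth_in jet_coords (V \<inter> \<phi> -` (fst d \<times> UNIV)) (\<lambda>w. ext_coords d (\<phi> w) a)"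
    unfolding smooth_in_jet_iff T_def .
qed

lemma flat: "flat_output A f0 f U z"
  unfolding flat_output_def Let_def image_\<psi>
proof (intro conjI allI)
  show "open U" "open V" by (rule open_U open_V)+
  show "smooth_ext A U (\<lambda>p. z p $ i)" for i by (rule smooth_extI[OF c open_U UD(3) smX_h])
  show "smooth_ext A U (\<lambda>p. \<psi> p j $ i)" for i j by (rule smooth_extI[OF c open_U UD(3) smX_\<psi>])
  show inj: "inj_on \<psi> U" by (rule inj_on_inverseI[of _ \<phi>]) (rule \<phi>_\<psi>)
  have eq: "inv_into U \<psi> w = \<phi> w" if "w \<in> V" for w
    using inv_into_f_f[OF inj \<phi>_U[OF that]] \<psi>_\<phi>[OF that] by simp
  have "continuous_on V (inv_into U \<psi>)"
    by (rule iffD2[OF continuous_on_cong[OF refl eq] continuous_\<phi>])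
  moreover have "smooth_in jet_coords (V \<inter> inv_into U \<psi> -` (fst d \<times> UNIV)) (\<lambda>w. ext_coords d (inv_into U \<psi> w) a)" if d: "d \<in> A" for d a
  proof -
    have s: "V \<inter> inv_into U \<psi> -` (fst d \<times> UNIV) = V \<inter> \<phi> -` (fst d \<times> UNIV)" using eq by auto
    have "smooth_coord (jet_coords ` (V \<inter> \<phi> -` (fst d \<times> UNIV))) (\<lambda>q. ext_coords d (\<phi> (ji q)) a)"
      using smooth_into_\<phi> d unfolding smooth_into_ext_def smooth_in_jet_iff by blast
    then show ?thesis unfolding s smooth_in_jet_iff by (rule smooth_coord_cong) (auto simp: eq)
  qed
  ultimately show "smooth_into_ext A V (inv_into U \<psi>)" by (simp add: smooth_into_ext_def)
qed

end

context control_system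
begin

section \<open>The spanning condition and differentials in different charts\<close>

definition spans :: "('x, 'n) chart \<Rightarrow> 'x \<Rightarrow> real^'m \<Rightarrow> 'm \<Rightarrow> bool" where
  "spans c x u k \<longleftrightarrow> span (insert (lie_bracket (affine_field f0 f u) (f k) c (snd c x)) (range (\<lambda>j. f j c (snd c x)))) = UNIV"

lemma vec_vc: "(\<chi> i. vc v c (cc c x) i) = v c (snd c x)"
  by (simp add: vc_cc vec_lambda_eta)

text \<open>Changing the chart acts on tangent vectors by a linear map, which is surjective since the change
  back is a right inverse.\<close>

lemma spans_chart_change:
  assumes c: "c \<in> A" and d: "d \<in> A" and x: "x \<in> fst c \<inter> fst d" and sp: "spans c x u k"
  shows "spans d x u k"
proof -
  define T where "T = (\<lambda>\<xi>. \<chi> i. dder (vec_nth \<xi>) (\<lambda>y. tr c d y i) (cc c x))"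
  have lin: "linear T" unfolding T_def by (rule has_derivative_linear[OF frechet_tr[OF c d x]])
  have "surj T"
  proof (rule surjI)
    fix \<eta> :: "real^'n"
    define S where "S = cc d ` (fst d \<inter> fst c)"
    have oS: "open S" unfolding S_def by (rule open_cc_image[OF d open_Int[OF chart(1)[OF d] chart(1)[OF c]]]) simp
    have xS: "cc d x \<in> S" using x by (auto simp: S_def)
    have "dder (\<lambda>k. dder (vec_nth \<eta>) (\<lambda>y. tr d c y k) (cc d x)) (\<lambda>y. tr c d y i) (cc c x) = \<eta> $ i" for i
    proof -
      have "tr d c (cc d x) = cc c x" using tr_cc[OF d] x by simp
      moreover have "cc c x \<in> cc c ` (fst c \<inter> fst d)" using x by blast
      ultimately have "dder (\<lambda>k. dder (vec_nth \<eta>) (\<lambda>y. tr d c y k) (cc d x)) (\<lambda>y. tr c d y i) (cc c x) =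
          dder (vec_nth \<eta>) (\<lambda>y. tr c d (tr d c y) i) (cc d x)"
        using chain_dder[OF smooth_tr[OF c d] _ smooth_tr[OF d c] xS[unfolded S_def], where b="vec_nth \<eta>"] by simp
      also have "\<dots> = dder (vec_nth \<eta>) (\<lambda>y. y i) (cc d x)"
      proof (rule dder_cong[OF oS xS])
        show "tr c d (tr d c y) i = y i" if "y \<in> S" for y
          using that by (auto simp: S_def tr_cc[OF c] tr_cc[OF d])
      qed
      finally show ?thesis by simp
    qed
    then show "T (\<chi> k. dder (vec_nth \<eta>) (\<lambda>y. tr d c y k) (cc d x)) = \<eta>"
      by (simp add: T_def vec_eq_iff vec_lambda_inverse)
  qed
  have Tv: "T (v c (snd c x)) = v d (snd d x)" if "\<And>i. dder (vc v c (cc c x)) (\<lambda>y. tr c d y i) (cc c x) = vc v d (cc d x) i" for v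
    using that by (simp add: T_def vc_cc vec_eq_iff)
  have "T ` insert (lie_bracket (affine_field f0 f u) (f k) c (snd c x)) (range (\<lambda>j. f j c (snd c x))) =
      insert (lie_bracket (affine_field f0 f u) (f k) d (snd d x)) (range (\<lambda>j. f j d (snd d x)))"
    using Tv[OF lie_bracket_tr[OF smooth_affine_field f c d x]] Tv[OF vfield_tr[OF f c d x]]
    by (simp add: image_image)
  then show ?thesis
    using span_linear_image[OF lin, of "insert (lie_bracket (affine_field f0 f u) (f k) c (snd c x)) (range (\<lambda>j. f j c (snd c x)))"]
      sp \<open>surj T\<close> by (simp add: spans_def)
qed

lemma differential_eq:
  assumes S: "open S" "x \<in> S" and g: "smooth_fun A S g"
  shows "differential A g x \<xi> = dder (vec_nth \<xi>) (\<lambda>y. g (ci (chart_at A x) y)) (cc (chart_at A x) x)"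
proof -
  define d where "d = chart_at A x"
  have d: "d \<in> A" "x \<in> fst d" using chart_at by (auto simp: d_def)
  have "((\<lambda>y. g (ci d (vec_nth y))) has_derivative (\<lambda>\<xi>. dder (vec_nth \<xi>) (\<lambda>y. g (ci d y)) (vec_nth (snd d x)))) (at (snd d x))"
    by (rule has_derivative_vec[where S="cc d ` (S \<inter> fst d)"]) (use g d S in \<open>auto simp: smooth_fun_iff cc_def\<close>)
  moreover have "(\<lambda>y. g (ci d (vec_nth y))) = g \<circ> chart_inv d" by (auto simp: ci_def vec_lambda_eta)
  ultimately have "(g \<circ> chart_inv d has_derivative (\<lambda>\<xi>. dder (vec_nth \<xi>) (\<lambda>y. g (ci d y)) (cc d x))) (at (snd d x))"
    by (simp add: cc_def)
  then show ?thesis unfolding differential_def Let_def d_def[symmetric] by (simp flip: frechet_derivative_at)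
qed

lemma dder_fun_chart_change:
  assumes c: "c \<in> A" and d: "d \<in> A" and S: "open S" "x \<in> S" "x \<in> fst c" "x \<in> fst d" and g: "smooth_fun A S g"
  shows "dder \<eta> (\<lambda>y. g (ci c y)) (cc c x) = dder (\<lambda>i. dder \<eta> (\<lambda>y. tr c d y i) (cc c x)) (\<lambda>y. g (ci d y)) (cc d x)"
proof -
  define T where "T = S \<inter> (fst c \<inter> fst d)"
  have oT: "open T" unfolding T_def by (intro open_Int S(1) chart(1)[OF c] chart(1)[OF d])
  have oC: "open (cc c ` T)" by (rule open_cc_image[OF c oT]) (auto simp: T_def)
  have xT: "cc c x \<in> cc c ` T" using S by (auto simp: T_def)
  have gd: "smooth_coord (cc d ` (S \<inter> fst d)) (\<lambda>y. g (ci d y))" using g d by (simp add: smooth_fun_iff)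
  have t: "smooth_coord (cc c ` T) (\<lambda>y. tr c d y i)" for i
    by (rule smooth_coord_subset[OF smooth_tr[OF c d] oC]) (auto simp: T_def)
  have "dder \<eta> (\<lambda>y. g (ci c y)) (cc c x) = dder \<eta> (\<lambda>y. g (ci d (tr c d y))) (cc c x)"
  proof (rule dder_cong[OF oC xT])
    show "g (ci c y) = g (ci d (tr c d y))" if "y \<in> cc c ` T" for y
      using that by (auto simp: T_def tr_cc[OF c] ci_cc[OF c] ci_cc[OF d])
  qed
  also have "\<dots> = dder (\<lambda>i. dder \<eta> (\<lambda>y. tr c d y i) (cc c x)) (\<lambda>y. g (ci d y)) (tr c d (cc c x))"
    by (rule chain_dder[OF gd _ t xT]) (use S tr_cc[OF c S(3)] in auto)
  finally show ?thesis using tr_cc[OF c S(3)] by simp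
qed

end

locale sized_system = control_system A f0 f
  for A :: "('x::{t2_space,second_countable_topology}, 'n::finite) chart set"
    and f0 :: "('x, 'n) vfield" and f :: "'m::finite \<Rightarrow> ('x, 'n) vfield" +
  assumes size: "CARD('n) = Suc CARD('m)"
begin

lemma coord_sys: "c \<in> A \<Longrightarrow> coord_system (vc f0 c) (\<lambda>s. vc (f s) c) (cc c ` fst c)"
  using smooth_vfield_chart[OF f0] smooth_vfield_chart[OF f] size
  by unfold_locales (simp_all add: smooth_on_chart_def)

text \<open>Linearity of the bracket over constants: the components of \<open>u\<close> are not
  differentiated.\<close>

lemma lie_bracket_affine:
  assumes c: "c \<in> A" and x: "x \<in> fst c"
  shows "lie_bracket (affine_field f0 f u) (f k) c (snd c x) =
    (\<chi> i. coord_system.B (vc f0 c) (\<lambda>s. vc (f s) c) k (vec_nth u) (cc c x) i)"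
proof -
  interpret C: coord_system "vc f0 c" "\<lambda>s. vc (f s) c" "cc c ` fst c" k by (rule coord_sys[OF c])
  define y where "y = cc c x"
  have y: "y \<in> cc c ` fst c" using x by (simp add: y_def)
  have va: "vc (affine_field f0 f u) c y = (\<lambda>i. vc f0 c y i + (\<Sum>s\<in>UNIV. u $ s * vc (f s) c y i))" for y
    by (auto simp: vc_def affine_field_def)
  have "vc (lie_bracket (affine_field f0 f u) (f k)) c y i = C.B (vec_nth u) y i" for i
  proof -
    have sw: "(\<Sum>i\<in>UNIV. (\<Sum>s\<in>UNIV. u $ s * X s i) * Y i) = (\<Sum>s\<in>UNIV. u $ s * (\<Sum>i\<in>UNIV. X s i * Y i))" for X and Y :: "'n \<Rightarrow> real"
      unfolding sum_distrib_left sum_distrib_right by (subst sum.swap) (simp add: mult_ac)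
    have 1: "dder (vc (affine_field f0 f u) c y) G y = dder (vc f0 c y) G y + (\<Sum>s\<in>UNIV. u $ s * dder (vc (f s) c y) G y)" for G
      unfolding va dder_finite distrib_right sum.distrib sw ..
    have 2: "dder b (\<lambda>y. vc f0 c y i + (\<Sum>s\<in>UNIV. u $ s * vc (f s) c y i)) y =
        dder b (\<lambda>y. vc f0 c y i) y + (\<Sum>s\<in>UNIV. u $ s * dder b (\<lambda>y. vc (f s) c y i) y)" for b
    proof -
      have m: "smooth_coord (cc c ` fst c) (\<lambda>y. u $ s * vc (f s) c y i)" for s
        by (intro smooth_coord_mult smooth_coord_const C.F C.open_R)
      show ?thesis
        by (subst dder_add[OF C.F0 smooth_coord_sum[OF C.open_R m] y], subst dder_sum[OF C.open_R m y],
            subst dder_mult[OF smooth_coord_const[OF C.open_R] C.F y]) simp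
    qed
    show ?thesis
      unfolding lie_bracket_coords[OF c smooth_vfield_chart[OF smooth_affine_field c] smooth_vfield_chart[OF f c] y]
        1 unfolding va 2 C.B_def bracket_def
      by (simp add: right_diff_distrib sum_subtractf)
  qed
  then show ?thesis using vec_vc[of "lie_bracket (affine_field f0 f u) (f k)" c x] by (simp add: y_def)
qed

lemma spans_iff_good:
  assumes c: "c \<in> A" and x: "x \<in> fst c"
  shows "spans c x u k \<longleftrightarrow> coord_system.good (vc f0 c) (\<lambda>s. vc (f s) c) k (vec_nth u) (cc c x)"
  unfolding spans_def coord_system.good_def[OF coord_sys[OF c]] lie_bracket_affine[OF c x] vec_vc ..

text \<open>Omitting the summand \<open>i = k\<close> does not change the bracket because [f_k, f_k]
  = 0; in terms of \<open>B\<close> the component \<open>k\<close> of the control is set to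
  zero.\<close>

lemma Omega0_iff: "(x, u) \<in> Omega0 A f0 f \<longleftrightarrow> (\<exists>k. spans (chart_at A x) x u k)"
proof -
  define c where "c = chart_at A x"
  have c: "c \<in> A" "x \<in> fst c" using chart_at by (auto simp: c_def)
  have br: "lie_bracket (\<lambda>c y. f0 c y + (\<Sum>i\<in>UNIV - {k}. (u $ i) *\<^sub>R f i c y)) (f k) c (snd c x) =
      lie_bracket (affine_field f0 f u) (f k) c (snd c x)" for k
  proof -
    have "(\<Sum>i\<in>UNIV - {k}. (u $ i) *\<^sub>R f i c y) = (\<Sum>i\<in>UNIV. (if i = k then 0 else u $ i) *\<^sub>R f i c y)" for c y
      by (rule sum.mono_neutral_cong_left) auto
    then have "(\<lambda>c y. f0 c y + (\<Sum>i\<in>UNIV - {k}. (u $ i) *\<^sub>R f i c y)) = affine_field f0 f (\<chi> i. if i = k then 0 else u $ i)"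
      by (auto simp: affine_field_def fun_eq_iff)
    moreover have "vec_nth (\<chi> i. if i = k then 0 else u $ i) = (vec_nth u)(k := 0)" by auto
    ultimately show ?thesis
      by (simp add: lie_bracket_affine[OF c] coord_system.B_upd[OF coord_sys[OF c(1)]])
  qed
  show ?thesis unfolding Omega0_def Let_def mem_Collect_eq prod.case spans_def vf_at_def c_def[symmetric] br ..
qed

end

section \<open>Properties of the local flat output demanded by the theorem\<close>

context local_chart
begin

sublocale sized_system A f0 f by unfold_locales (rule card)

text \<open>\<open>N\<close> gives the condition for the control with \<open>u0k\<close> in slot
  \<open>k\<close>; by \<open>B_upd\<close> it persists for the actual value of u_k.\<close>

lemma spans_on_U:
  assumes p: "p \<in> U"
  shows "spans (chart_at A (fst p)) (fst p) (snd p 0) k"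
proof -
  have x: "fst p \<in> fst c" by (rule UD(2)[OF p])
  have rI: "(\<lambda>s. red (ext_coords c p) (Inr s)) = (vec_nth (snd p 0))(k := u0k)"
    by (auto simp: red_def ext_coords_def jet_coords_def)
  have rX: "(\<lambda>i. red (ext_coords c p) (Inl i)) = cc c (fst p)" by (simp add: red_def ext_Inl)
  have "C.good ((vec_nth (snd p 0))(k := u0k)) (cc c (fst p))"
    using N(3)[of "red (ext_coords c p)"] p unfolding rI rX by (simp add: U_def)
  then have "C.good (vec_nth (snd p 0)) (cc c (fst p))" unfolding C.good_def C.B_upd .
  then have sp: "spans c (fst p) (snd p 0) k" using spans_iff_good[OF c x] by simp
  show ?thesis by (rule spans_chart_change[OF c chart_at(1) _ sp]) (use x chart_at(2) in auto)
qed

lemma U_Omega0: "U \<subseteq> lift_set (Omega0 A f0 f)"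
proof
  fix p assume p: "p \<in> U"
  have "(fst p, snd p 0) \<in> Omega0 A f0 f" unfolding Omega0_iff using spans_on_U[OF p] by blast
  then show "p \<in> lift_set (Omega0 A f0 f)" by (simp add: lift_set_def split_beta)
qed

lemma open_fst_U: "open (fst ` U)"
  by (rule open_image_fst[OF open_U])

lemma fst_U: "x \<in> fst ` U \<Longrightarrow> x \<in> fst c" "x \<in> fst ` U \<Longrightarrow> cc c x \<in> Nh"
  using UD by auto

lemma open_cc_U: "open (cc c ` fst ` U)"
  by (rule open_cc_image[OF c open_fst_U]) (use fst_U in auto)

lemma hX_cc:
  assumes "y \<in> cc c ` fst ` U"
  shows "hX j (ci c y) = h j y"
proof -
  obtain x where x: "x \<in> fst ` U" "y = cc c x" using assms by blast
  then show ?thesis using ci_cc[OF c fst_U(1)[OF x(1)]] by (simp add: hX_def)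
qed

lemma smooth_hX: "smooth_fun A (fst ` U) (hX j)"
proof (rule smooth_funI[OF c open_fst_U])
  show "fst ` U \<subseteq> fst c" using fst_U by blast
  have "smooth_coord (cc c ` fst ` U) (h j)"
    by (rule smooth_coord_subset[OF h open_cc_U]) (use fst_U in blast)
  then show "smx c (fst ` U) (hX j)" by (rule smooth_coord_cong) (simp add: hX_cc)
qed

text \<open>\<open>differential\<close> is taken in the chart \<open>chart_at A x\<close>, which
  varies with \<open>x\<close>, whereas \<open>h\<close> is known in the chart \<open>c\<close>;
  tangent vectors are moved by the transition map.\<close>

lemma differential_hX:
  assumes x: "x \<in> fst ` U"
  shows "differential A (hX j) x (\<chi> i. dder \<eta> (\<lambda>y. tr c (chart_at A x) y i) (cc c x)) = dder \<eta> (h j) (cc c x)"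
proof -
  have "dder \<eta> (h j) (cc c x) = dder \<eta> (\<lambda>y. hX j (ci c y)) (cc c x)"
    by (rule dder_cong[OF open_cc_U imageI[OF x]]) (simp add: hX_cc)
  then show ?thesis
    unfolding differential_eq[OF open_fst_U x smooth_hX]
    using dder_fun_chart_change[OF c chart_at(1) open_fst_U x fst_U(1)[OF x] chart_at(2) smooth_hX, of \<eta> j]
    by (simp add: vec_lambda_inverse)
qed

lemma first_integral_hX: "first_integral A (fst ` U) (f k) (hX j)"
  unfolding first_integral_def
proof (intro conjI ballI open_fst_U smooth_hX)
  fix x assume x: "x \<in> fst ` U"
  have "vf_at A (f k) x = (\<chi> i. dder (F k (cc c x)) (\<lambda>y. tr c (chart_at A x) y i) (cc c x))"
    unfolding vf_at_def Let_def
    using vfield_tr[OF f c chart_at(1), of x x k] x fst_U(1)[OF x] chart_at(2)[of x] by (simp add: vec_vc)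
  then show "differential A (hX j) x (vf_at A (f k) x) = 0"
    using differential_hX[OF x] hk[OF fst_U(2)[OF x]] by simp
qed

lemma indep_hX: "indep_differentials A (fst ` U) hX"
  unfolding indep_differentials_def
proof (intro ballI allI impI)
  fix x and a :: "'m \<Rightarrow> real" and j
  assume x: "x \<in> fst ` U" and z: "\<forall>v. (\<Sum>i\<in>UNIV. a i * differential A (hX i) x v) = 0"
  show "a j = 0"
  proof (rule ind[OF fst_U(2)[OF x]])
    show "(\<Sum>j\<in>UNIV. a j * dder \<xi> (h j) (cc c x)) = 0" for \<xi>
      using z unfolding differential_hX[OF x, symmetric] by blast
  qed
qed

end

context sized_system
begin

text \<open>Indexed by a pair of state and control instead of a jet: one open set contains every jet
  over the pair, whatever the higher derivatives of the control.\<close>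

definition flat_chart :: "'x \<times> (real^'m) \<Rightarrow> ('x \<times> 'm jet) set \<Rightarrow> 'm \<Rightarrow> ('m \<Rightarrow> 'x \<Rightarrow> real) \<Rightarrow> bool" where
  "flat_chart b W k h \<longleftrightarrow> open W \<and> (\<forall>w. w 0 = snd b \<longrightarrow> (fst b, w) \<in> W) \<and> W \<subseteq> lift_set (Omega0 A f0 f) \<and>
    flat_output A f0 f W (\<lambda>p. \<chi> i. h i (fst p)) \<and> (\<forall>p\<in>W. spans (chart_at A (fst p)) (fst p) (snd p 0) k) \<and>
    (\<forall>i. first_integral A (fst ` W) (f k) (h i)) \<and> indep_differentials A (fst ` W) h"

lemma ex_flat_chart:
  assumes b: "b \<in> Omega0 A f0 f"
  shows "\<exists>W k h. flat_chart b W k h"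
proof -
  obtain x0 u0 where xu: "b = (x0, u0)" by (cases b)
  define c where "c = chart_at A x0"
  have c: "c \<in> A" "x0 \<in> fst c" using chart_at by (auto simp: c_def)
  obtain k where "spans c x0 u0 k" using b Omega0_iff[of x0 u0] by (auto simp: xu c_def)
  then have g: "coord_system.good (vc f0 c) (\<lambda>s. vc (f s) c) k (vec_nth u0) (cc c x0)" using spans_iff_good[OF c] by simp
  interpret C: coord_system "vc f0 c" "\<lambda>s. vc (f s) c" "cc c ` fst c" k by (rule coord_sys[OF c(1)])
  obtain \<kappa> Nh h N \<Lambda> where data: "chart_data (vc f0 c) (\<lambda>s. vc (f s) c) (cc c ` fst c) k \<kappa> Nh h N \<Lambda>"
    and q0: "case_sum (cc c x0) (vec_nth u0) \<in> N"
    using C.ex_chart_data[OF imageI[OF c(2)] g] by blast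
  interpret L: local_chart A f0 f c k \<kappa> Nh h N \<Lambda> "u0 $ k"
    using c(1) size data by unfold_locales
  have "(x0, w) \<in> L.U" if w: "w 0 = u0" for w
  proof -
    have "L.red (ext_coords c (x0, w)) = case_sum (cc c x0) (vec_nth u0)"
      using w by (auto simp: L.red_def ext_coords_def cc_def jet_coords_def fun_eq_iff split: sum.split)
    with q0 c(2) show ?thesis by (simp add: L.U_def)
  qed
  moreover have "flat_output A f0 f L.U (\<lambda>p. \<chi> i. L.hX i (fst p))" using L.flat unfolding L.z_def[abs_def] .
  ultimately have "flat_chart b L.U k L.hX"
    unfolding flat_chart_def xu using L.open_U L.U_Omega0 L.spans_on_U L.first_integral_hX L.indep_hX by simp
  then show ?thesis by blast
qed

end

theorem theorem4:
  fixes A :: "('x::{t2_space,second_countable_topology}, 'n::finite) chart set"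
    and f0 :: "('x, 'n) vfield"
    and f :: "'m::finite \<Rightarrow> ('x, 'n) vfield"
  assumes "CARD('n) \<ge> 2" and "CARD('m) = CARD('n) - 1"
    and "smooth_manifold A"
    and "smooth_vfield A f0" and "\<And>j. smooth_vfield A (f j)"
    and "\<exists>S. open S \<and> closure S = UNIV \<and> (\<forall>x\<in>S. indep_fields_at A f x)"
  shows "(\<exists>(U :: 'x \<times> (real ^ 'm) \<Rightarrow> ('x \<times> 'm jet) set)
            (\<Phi> :: 'x \<times> (real ^ 'm) \<Rightarrow> 'x \<Rightarrow> real ^ 'm \<Rightarrow> real ^ 'm \<Rightarrow> real ^ 'm)
            (z :: 'x \<times> (real ^ 'm) \<Rightarrow> 'x \<times> 'm jet \<Rightarrow> real ^ 'm).
          (\<forall>b x w. z b (x, w) = \<Phi> b x (w 0) (w 1)) \<and>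
          (\<forall>(x0, w0) \<in> lift_set (Omega0 A f0 f).
             let b = (x0, w0 0) in
               open (U b) \<and> (x0, w0) \<in> U b \<and> U b \<subseteq> lift_set (Omega0 A f0 f) \<and>
               flat_output A f0 f (U b) (z b) \<and>
               (\<exists>k h.
                  (\<forall>(x, w) \<in> U b.
                     dim (span (insert (vf_at A (lie_bracket (affine_field f0 f (w 0)) (f k)) x)
                                  (range (\<lambda>j. vf_at A (f j) x)))) = CARD('n)) \<and>
                  (\<forall>i. first_integral A (fst ` U b) (f k) (h i)) \<and>
                  indep_differentials A (fst ` U b) h \<and>
                  (\<forall>(x, w) \<in> U b. \<forall>i. z b (x, w) $ i = h i x)) \<and>
               lb_chart A f0 f (U b, prolong A f0 f (z b))) \<and>
          lb_atlas A f0 f {(U b, prolong A f0 f (z b)) | b. b \<in> Omega0 A f0 f})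
       \<and> intrinsic_singularities A f0 f \<subseteq> UNIV - lift_set (Omega0 A f0 f)
       \<and> UNIV - lift_set (Omega A f0 f) \<subseteq> intrinsic_singularities A f0 f"
  proof -
  interpret sized_system A f0 f
    using assms(1-5) by unfold_locales simp_all
  \<comment> \<open>The statement asks for the charts as functions of the base point, hence a choice
    for every point of \<open>Omega0\<close>.\<close>
  have "\<forall>b. \<exists>W k h. b \<in> Omega0 A f0 f \<longrightarrow> flat_chart b W k h" using ex_flat_chart by blast
  then obtain W K H where ch: "\<And>b. b \<in> Omega0 A f0 f \<Longrightarrow> flat_chart b (W b) (K b) (H b)"
    unfolding choice_iff by blast
  define Z where "Z b p = (\<chi> i. H b i (fst p))" for b and p :: "'x \<times> 'm jet"
  have fl: "flat_output A f0 f (W b) (Z b)" if "b \<in> Omega0 A f0 f" for b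
    using ch[OF that] by (simp add: flat_chart_def Z_def[abs_def])
  have lb: "lb_chart A f0 f (W b, prolong A f0 f (Z b))" if "b \<in> Omega0 A f0 f" for b
    using fl[OF that] by (auto simp: lb_chart_def)
  define At where "At = {(W b, prolong A f0 f (Z b)) | b. b \<in> Omega0 A f0 f}"
  \<comment> \<open>Compatibility holds for any two flat outputs, from whichever of the fields their
    first integrals come.\<close>
  have atlas: "lb_atlas A f0 f At"
    using lb flat_outputs_compatible[OF fl fl] by (auto simp: lb_atlas_def At_def)
  have mem: "(x0, w0) \<in> W (x0, w0 0)" if "(x0, w0 0) \<in> Omega0 A f0 f" for x0 w0
    using ch[OF that] by (simp add: flat_chart_def)
  have charts: "let b = (x0, w0 0) in
       open (W b) \<and> (x0, w0) \<in> W b \<and> W b \<subseteq> lift_set (Omega0 A f0 f) \<and> flat_output A f0 f (W b) (Z b) \<and>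
       (\<exists>k h. (\<forall>(x, w) \<in> W b.
            dim (span (insert (vf_at A (lie_bracket (affine_field f0 f (w 0)) (f k)) x)
                         (range (\<lambda>j. vf_at A (f j) x)))) = CARD('n)) \<and>
          (\<forall>i. first_integral A (fst ` W b) (f k) (h i)) \<and> indep_differentials A (fst ` W b) h \<and>
          (\<forall>(x, w) \<in> W b. \<forall>i. Z b (x, w) $ i = h i x)) \<and>
       lb_chart A f0 f (W b, prolong A f0 f (Z b))" if "(x0, w0) \<in> lift_set (Omega0 A f0 f)" for x0 w0
  proof -
    define b where "b = (x0, w0 0)"
    have b: "b \<in> Omega0 A f0 f" using that by (simp add: lift_set_def b_def)
    note c = ch[OF b, unfolded flat_chart_def]
    have d: "dim (span (insert (vf_at A (lie_bracket (affine_field f0 f (w 0)) (f (K b))) x)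
        (range (\<lambda>j. vf_at A (f j) x)))) = CARD('n)" if "(x, w) \<in> W b" for x w
    proof -
      have "spans (chart_at A x) x (w 0) (K b)" using c that by force
      then show ?thesis by (simp add: spans_def vf_at_def Let_def del: dim_span)
    qed
    show ?thesis unfolding Let_def b_def[symmetric]
    proof (intro conjI exI[of _ "K b"] exI[of _ "H b"])
      show "(x0, w0) \<in> W b" using mem b by (simp add: b_def)
      show "\<forall>(x, w) \<in> W b. dim (span (insert (vf_at A (lie_bracket (affine_field f0 f (w 0)) (f (K b))) x)
          (range (\<lambda>j. vf_at A (f j) x)))) = CARD('n)" using d by blast
      show "\<forall>(x, w) \<in> W b. \<forall>i. Z b (x, w) $ i = H b i x" by (simp add: Z_def)
    qed (use c fl[OF b] lb[OF b] in blast)+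
  qed
  have "\<exists>U \<Phi> z. (\<forall>b x w. z b (x, w) = \<Phi> b x (w 0) (w 1)) \<and> (\<forall>(x0, w0) \<in> lift_set (Omega0 A f0 f). let b = (x0, w0 0) in
       open (U b) \<and> (x0, w0) \<in> U b \<and> U b \<subseteq> lift_set (Omega0 A f0 f) \<and> flat_output A f0 f (U b) (z b) \<and>
       (\<exists>k h. (\<forall>(x, w) \<in> U b.
            dim (span (insert (vf_at A (lie_bracket (affine_field f0 f (w 0)) (f k)) x)
                         (range (\<lambda>j. vf_at A (f j) x)))) = CARD('n)) \<and>
          (\<forall>i. first_integral A (fst ` U b) (f k) (h i)) \<and> indep_differentials A (fst ` U b) h \<and>
          (\<forall>(x, w) \<in> U b. \<forall>i. z b (x, w) $ i = h i x)) \<and>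
       lb_chart A f0 f (U b, prolong A f0 f (z b))) \<and>
     lb_atlas A f0 f {(U b, prolong A f0 f (z b)) | b. b \<in> Omega0 A f0 f}"
  proof (intro exI conjI allI)
    show "Z b (x, w) = (\<lambda>b x u ud. \<chi> i. H b i x) b x (w 0) (w 1)" for b x w by (simp add: Z_def)
    show "lb_atlas A f0 f {(W b, prolong A f0 f (Z b)) | b. b \<in> Omega0 A f0 f}" using atlas by (simp add: At_def)
  qed (use charts in blast)
  moreover have "intrinsic_singularities A f0 f \<subseteq> UNIV - lift_set (Omega0 A f0 f)"
  proof
    fix p assume p: "p \<in> intrinsic_singularities A f0 f"
    have "p \<notin> lift_set (Omega0 A f0 f)"
    proof
      assume "p \<in> lift_set (Omega0 A f0 f)"
      then have b: "(fst p, snd p 0) \<in> Omega0 A f0 f" by (simp add: lift_set_def split_beta)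
      have "(W (fst p, snd p 0), prolong A f0 f (Z (fst p, snd p 0))) \<in> At" using b by (auto simp: At_def)
      then have "p \<notin> W (fst p, snd p 0)" using p atlas by (force simp: intrinsic_singularities_def)
      then show False using mem[of "fst p" "snd p"] b by simp
    qed
    then show "p \<in> UNIV - lift_set (Omega0 A f0 f)" by simp
  qed
  \<comment> \<open>Every point in the domain of a chart lies over \<open>Omega\<close>, by
    \<open>flat_point_in_Omega\<close>; so no atlas reaches the points outside.\<close>
  moreover have "UNIV - lift_set (Omega A f0 f) \<subseteq> intrinsic_singularities A f0 f"
  proof
    fix p assume p: "p \<in> UNIV - lift_set (Omega A f0 f)"
    have "p \<notin> fst C" if at: "lb_atlas A f0 f \<C>" "C \<in> \<C>" for \<C> C
    proof
      assume pC: "p \<in> fst C"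
      have "lb_chart A f0 f C" using at by (simp add: lb_atlas_def)
      then obtain z where "flat_output A f0 f (fst C) z" by (auto simp: lb_chart_def split_beta)
      from flat_point_in_Omega[OF this pC] p show False by (simp add: lift_set_def split_beta)
    qed
    then show "p \<in> intrinsic_singularities A f0 f" by (auto simp: intrinsic_singularities_def)
  qed
  ultimately show ?thesis by blast
qed

end
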